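(* Let $\mathcal{A}^{\flat}_X=\{A\in\mathcal{A}_X\mid F_A=0\}$ be the space of flat connections and put $$\mathcal{D}^{\flat}_X=\coprod_{A\in\mathcal{A}^{\flat}_X}\bigl\{\,a\oplus\gamma^1_A(a)\;\bigm|\;a\in T_A\mathcal{A}^{\flat}_X\,\bigr\},\qquad \gamma^1_A(a)=A^2\wedge a+a\wedge A^2,$$ where $A^2=A\wedge A$. Then $\mathcal{D}^{\flat}_X$ is a Dirac structure over $\mathcal{A}^{\flat}_X\subset\mathcal{A}_X$.
   Context: $X$ is a compact, connected, oriented Riemannian four-manifold with boundary $M=\partial X$ (possibly empty), $G=SU(n)$ with $n\ge2$, $\mathfrak g=\mathfrak{su}(n)$. $\mathcal{A}_X$ is the space of irreducible connections on the trivial bundle $X\times G$, regarded as $\mathfrak g$-valued 1-forms. $\Omega^r_{s}(X,\mathfrak g)$ denotes the $\mathfrak g$-valued $r$-forms on $X$ of Sobolev class $L^2_{s}$. The tangent space $T_A\mathcal{A}_X$ is identified with $\Omega^1_{s-\frac12}(X,\mathfrak g)$ and the cotangent space $T^*_A\mathcal{A}_X$ with $\Omega^3_{s-\frac12}(X,\mathfrak g)$, the pairing being $\langle\alpha\mid a\rangle_X=\frac{1}{8\pi^3}\int_X\mathrm{tr}(\alpha\wedge a)$; the same pairing is used over $\mathcal{A}^\flat_X$. Products of matrix-valued forms are wedge products combined with matrix multiplication; $F_A=\mathrm dA+A\wedge A$ is the curvature and $\mathrm d_A$ the covariant exterior derivative. The tangent space of $\mathcal{A}^\flat_X$ is $T_A\mathcal{A}^{\flat}_X=\{a\in\Omega^1_{s-\frac12}(X,\mathfrak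 g)\mid\mathrm d_Aa=0\}$. The standard Courant algebroid over $\mathcal{A}^\flat_X$ is $T\mathcal{A}^\flat_X\oplus T^*\mathcal{A}^\flat_X$ with symmetric bilinear form $\langle a\oplus\alpha,b\oplus\beta\rangle_+=\frac12\{\langle\alpha\mid b\rangle_X+\langle\beta\mid a\rangle_X\}$, anchor $\rho(a\oplus\alpha)=a$, and bracket of sections $[\![a\oplus\alpha,b\oplus\beta]\!]=[a,b]\oplus(\mathcal{L}_a\beta-i_b\tilde{\mathrm d}\alpha)$, where $[\cdot,\cdot]$, $\mathcal{L}$, $\tilde{\mathrm d}$, $i$ are the Lie bracket of vector fields, Lie derivative, exterior derivative and contraction. A Dirac structure is a maximal isotropic subbundle (for $\langle\cdot,\cdot\rangle_+$) whose sections are closed under $[\![\cdot,\cdot]\!]$.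
   Formalization: As γ^1_A(a) is not su(n)-valued, T* is taken as the functionals on T_A given by 3-forms with arbitrary complex matrix values, with complex pairing; A^♭ is assumed to be a smooth submanifold with tangent spaces {d_A a=0}, and s>5/2 so that γ^1_A(a) is of class L^2_{s-1/2}. *)

theory Defs
  imports "HOL-Analysis.Analysis" "HOL-Library.Function_Algebras"
begin

section \<open>Calculus on normed spaces given by a carrier and a norm\<close>

text \<open>
  The Sobolev spaces below depend on a manifold, an atlas and a real exponent, hence are not types.
  A normed space is therefore a pair of a linear subspace of a real vector space and a norm on it;
  the ambient vector spaces are spaces of functions with pointwise operations.
\<close>

instantiation "fun" :: (type, real_vector) real_vector
begin

definition scaleR_fun_def: "scaleR r f = (\<lambda>x. r *\<^sub>R f x)"

instance
  by standard (auto simp: scaleR_fun_def fun_eq_iff scaleR_add_right scaleR_add_left)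

end

type_synonym 'v nsp = "'v set \<times> ('v \<Rightarrow> real)"

abbreviation pts :: "'v nsp \<Rightarrow> 'v set" where "pts \<equiv> fst"

abbreviation nrm :: "'v nsp \<Rightarrow> 'v \<Rightarrow> real" where "nrm \<equiv> snd"

definition euclid :: "'v::real_normed_vector nsp" where
  "euclid = (UNIV, norm)"

definition prod_nsp :: "'v nsp \<Rightarrow> 'w nsp \<Rightarrow> ('v \<times> 'w) nsp" where
  "prod_nsp E F = (pts E \<times> pts F, \<lambda>(x, y). nrm E x + nrm F y)"

definition nopen :: "'v::real_vector nsp \<Rightarrow> 'v set \<Rightarrow> bool" where
  "nopen E U \<longleftrightarrow> U \<subseteq> pts E \<and>
     (\<forall>x\<in>U. \<exists>r>0. \<forall>y\<in>pts E. nrm E (y - x) < r \<longrightarrow> y \<in> U)"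

definition closed_subspace :: "'v::real_vector nsp \<Rightarrow> 'v set \<Rightarrow> bool" where
  "closed_subspace E K \<longleftrightarrow> K \<subseteq> pts E \<and> subspace K \<and> nopen E (pts E - K)"

text \<open>
  Smoothness (class $C^\infty$ in the sense of Frechet) on an open set \<open>U\<close>: \<open>D hs x\<close> is the
  \<open>k\<close>-th derivative at \<open>x\<close> evaluated on the list \<open>hs\<close> of \<open>k\<close> directions.  It is bounded, and
  the \<open>(k+1)\<close>-st derivative is the Frechet derivative of the \<open>k\<close>-th one with respect to the
  norm of bounded \<open>k\<close>-linear maps.
\<close>

definition smooth_on :: "'v::real_vector nsp \<Rightarrow> 'w::real_vector nsp \<Rightarrow> 'v set \<Rightarrow> ('v \<Rightarrow> 'w) \<Rightarrow> bool" where
  "smooth_on E F U f \<longleftrightarrow> (\<exists>D :: 'v list \<Rightarrow> 'v \<Rightarrow> 'w.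
     (\<forall>x\<in>U. D [] x = f x) \<and>
     (\<forall>x\<in>U. \<forall>hs\<in>lists (pts E). D hs x \<in> pts F) \<and>
     (\<forall>x\<in>U. \<forall>hs\<in>lists (pts E). \<forall>h\<in>pts E. \<forall>h'\<in>pts E. \<forall>r.
        D ((r *\<^sub>R h + h') # hs) x = r *\<^sub>R D (h # hs) x + D (h' # hs) x) \<and>
     (\<forall>x\<in>U. \<forall>k. \<exists>C. \<forall>hs\<in>lists (pts E). length hs = k \<longrightarrow>
        nrm F (D hs x) \<le> C * prod_list (map (nrm E) hs)) \<and>
     (\<forall>x\<in>U. \<forall>k. \<forall>\<epsilon>>0. \<exists>\<delta>>0. \<forall>h\<in>pts E. nrm E h < \<delta> \<longrightarrow> x + h \<in> U \<longrightarrow>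
        (\<forall>hs\<in>lists (pts E). length hs = k \<longrightarrow>
           nrm F (D hs (x + h) - D hs x - D (h # hs) x)
             \<le> \<epsilon> * nrm E h * prod_list (map (nrm E) hs))))"

text \<open>Smoothness along an arbitrary subset: locally the restriction of a smooth map.\<close>

definition smooth_along :: "'v::real_vector nsp \<Rightarrow> 'w::real_vector nsp \<Rightarrow> 'v set \<Rightarrow> ('v \<Rightarrow> 'w) \<Rightarrow> bool" where
  "smooth_along E F S f \<longleftrightarrow>
     (\<forall>x\<in>S. \<exists>W g. nopen E W \<and> x \<in> W \<and> smooth_on E F W g \<and> (\<forall>y\<in>S \<inter> W. g y = f y))"

definition submanifold :: "'v::real_vector nsp \<Rightarrow> 'v set \<Rightarrow> bool" where
  "submanifold E Z \<longleftrightarrow> Z \<subseteq> pts E \<and>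
     (\<forall>A\<in>Z. \<exists>U W \<Psi> \<Psi>' K. nopen E U \<and> A \<in> U \<and> nopen E W \<and>
        smooth_on E E U \<Psi> \<and> smooth_on E E W \<Psi>' \<and> \<Psi> ` U = W \<and> (\<forall>x\<in>U. \<Psi>' (\<Psi> x) = x) \<and>
        closed_subspace E K \<and> \<Psi> ` (Z \<inter> U) = W \<inter> K)"

definition has_velocity :: "'v::real_vector nsp \<Rightarrow> (real \<Rightarrow> 'v) \<Rightarrow> 'v \<Rightarrow> bool" where
  "has_velocity E c v \<longleftrightarrow> v \<in> pts E \<and>
     ((\<lambda>t. nrm E ((1 / t) *\<^sub>R (c t - c 0) - v)) \<longlongrightarrow> 0) (at 0)"

definition curve_through :: "'v::real_vector nsp \<Rightarrow> 'v set \<Rightarrow> 'v \<Rightarrow> 'v \<Rightarrow> (real \<Rightarrow> 'v) \<Rightarrow> bool" where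
  "curve_through E Z A v c \<longleftrightarrow> smooth_on euclid E {-1<..<1} c \<and> c ` {-1<..<1} \<subseteq> Z \<and>
     c 0 = A \<and> has_velocity E c v"

definition tangent_space :: "'v::real_vector nsp \<Rightarrow> 'v set \<Rightarrow> 'v \<Rightarrow> 'v set" where
  "tangent_space E Z A = {v. \<exists>c. curve_through E Z A v c}"

text \<open>The derivative at \<open>A\<close>, in the tangent direction \<open>v\<close>, of a map defined on \<open>Z\<close> near \<open>A\<close>.\<close>

definition deriv_along ::
    "'v::real_vector nsp \<Rightarrow> 'w::real_vector nsp \<Rightarrow> 'v set \<Rightarrow> ('v \<Rightarrow> 'w) \<Rightarrow> 'v \<Rightarrow> 'v \<Rightarrow> 'w" where
  "deriv_along E F Z f A v =
     (THE w. \<exists>c. curve_through E Z A v c \<and> has_velocity F (\<lambda>t. f (c t)) w)"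


section \<open>The standard Courant algebroid and Dirac structures\<close>

text \<open>
  Throughout, \<open>Z\<close> is a submanifold of the normed space \<open>E\<close>, and \<open>Q :: 'w \<Rightarrow> 'v \<Rightarrow> complex\<close> pairs a
  second normed space \<open>F\<close> with \<open>E\<close>.  A cotangent vector of \<open>Z\<close> at \<open>A\<close> is the functional on the
  tangent space of \<open>Z\<close> at \<open>A\<close> induced by some \<open>\<alpha>\<close> in \<open>F\<close>, extended by zero to the ambient
  type.  So two elements of \<open>F\<close> that agree on the tangent space of \<open>Z\<close> are the same covector.
  Sections over an open part \<open>S\<close> of \<open>Z\<close> are functions of which only the values on \<open>S\<close> matter.
\<close>

definition covec ::
    "'v::real_vector nsp \<Rightarrow> ('w \<Rightarrow> 'v \<Rightarrow> complex) \<Rightarrow> 'v set \<Rightarrow> 'v \<Rightarrow> 'w \<Rightarrow> ('v \<Rightarrow> complex)" where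
  "covec E Q Z A \<alpha> = (\<lambda>b. if b \<in> tangent_space E Z A then Q \<alpha> b else 0)"

definition cotangent_space ::
    "'v::real_vector nsp \<Rightarrow> 'w nsp \<Rightarrow> ('w \<Rightarrow> 'v \<Rightarrow> complex) \<Rightarrow> 'v set \<Rightarrow> 'v \<Rightarrow> ('v \<Rightarrow> complex) set" where
  "cotangent_space E F Q Z A = covec E Q Z A ` pts F"

definition cotangent_norm ::
    "'v::real_vector nsp \<Rightarrow> 'w nsp \<Rightarrow> ('w \<Rightarrow> 'v \<Rightarrow> complex) \<Rightarrow> 'v set \<Rightarrow> 'v \<Rightarrow> ('v \<Rightarrow> complex) \<Rightarrow> real" where
  "cotangent_norm E F Q Z A \<xi> = Inf (nrm F ` {\<alpha> \<in> pts F. covec E Q Z A \<alpha> = \<xi>})"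

definition courant_fibre ::
    "'v::real_vector nsp \<Rightarrow> 'w nsp \<Rightarrow> ('w \<Rightarrow> 'v \<Rightarrow> complex) \<Rightarrow> 'v set \<Rightarrow> 'v \<Rightarrow> ('v \<times> ('v \<Rightarrow> complex)) set" where
  "courant_fibre E F Q Z A = tangent_space E Z A \<times> cotangent_space E F Q Z A"

definition plus_form :: "'v \<times> ('v \<Rightarrow> complex) \<Rightarrow> 'v \<times> ('v \<Rightarrow> complex) \<Rightarrow> complex" where
  "plus_form x y = (snd x (fst y) + snd y (fst x)) / 2"

definition isotropic :: "('v \<times> ('v \<Rightarrow> complex)) set \<Rightarrow> bool" where
  "isotropic L \<longleftrightarrow> (\<forall>x\<in>L. \<forall>y\<in>L. plus_form x y = 0)"

definition maximal_isotropic ::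
    "('v::real_vector \<times> ('v \<Rightarrow> complex)) set \<Rightarrow> ('v \<times> ('v \<Rightarrow> complex)) set \<Rightarrow> bool" where
  "maximal_isotropic V L \<longleftrightarrow> subspace L \<and> L \<subseteq> V \<and> isotropic L \<and>
     (\<forall>L'. subspace L' \<and> L' \<subseteq> V \<and> isotropic L' \<and> L \<subseteq> L' \<longrightarrow> L' = L)"

definition vector_fields :: "'v::real_vector nsp \<Rightarrow> 'v set \<Rightarrow> 'v set \<Rightarrow> ('v \<Rightarrow> 'v) set" where
  "vector_fields E Z S = {a. smooth_along E E S a \<and> (\<forall>A\<in>S. a A \<in> tangent_space E Z A)}"

definition one_forms ::
    "'v::real_vector nsp \<Rightarrow> 'w::real_vector nsp \<Rightarrow> ('w \<Rightarrow> 'v \<Rightarrow> complex) \<Rightarrow> 'v set \<Rightarrow> 'v set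
      \<Rightarrow> ('v \<Rightarrow> 'v \<Rightarrow> complex) set" where
  "one_forms E F Q Z S = {\<xi>. \<forall>A\<in>S. \<exists>W \<alpha>. nopen E W \<and> A \<in> W \<and> smooth_on E F W \<alpha> \<and>
     (\<forall>B\<in>S \<inter> W. \<xi> B = covec E Q Z B (\<alpha> B))}"

definition lie_bracket ::
    "'v::real_vector nsp \<Rightarrow> 'v set \<Rightarrow> ('v \<Rightarrow> 'v) \<Rightarrow> ('v \<Rightarrow> 'v) \<Rightarrow> 'v \<Rightarrow> 'v" where
  "lie_bracket E Z a b A = deriv_along E E Z b A (a A) - deriv_along E E Z a A (b A)"

text \<open>The usual global formulas for the Lie derivative and the exterior derivative of a one-form,
  evaluated on vector fields.\<close>

definition lie_derivative ::
    "'v::real_vector nsp \<Rightarrow> 'v set \<Rightarrow> ('v \<Rightarrow> 'v) \<Rightarrow> ('v \<Rightarrow> 'v \<Rightarrow> complex) \<Rightarrow> ('v \<Rightarrow> 'v) \<Rightarrow> 'v \<Rightarrow> complex" where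
  "lie_derivative E Z a \<beta> c A =
     deriv_along E euclid Z (\<lambda>B. \<beta> B (c B)) A (a A) - \<beta> A (lie_bracket E Z a c A)"

definition exterior_derivative ::
    "'v::real_vector nsp \<Rightarrow> 'v set \<Rightarrow> ('v \<Rightarrow> 'v \<Rightarrow> complex) \<Rightarrow> ('v \<Rightarrow> 'v) \<Rightarrow> ('v \<Rightarrow> 'v) \<Rightarrow> 'v \<Rightarrow> complex" where
  "exterior_derivative E Z \<alpha> b c A =
     deriv_along E euclid Z (\<lambda>B. \<alpha> B (c B)) A (b A)
     - deriv_along E euclid Z (\<lambda>B. \<alpha> B (b B)) A (c A)
     - \<alpha> A (lie_bracket E Z b c A)"

text \<open>The section \<open>e\<close> is the bracket of \<open>e1\<close> and \<open>e2\<close> over \<open>S\<close>.  The equality of the one-form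
  parts is tested on all local vector fields \<open>c\<close>.\<close>

definition is_courant_bracket ::
    "'v::real_vector nsp \<Rightarrow> 'v set \<Rightarrow> 'v set
      \<Rightarrow> ('v \<Rightarrow> 'v) \<times> ('v \<Rightarrow> 'v \<Rightarrow> complex) \<Rightarrow> ('v \<Rightarrow> 'v) \<times> ('v \<Rightarrow> 'v \<Rightarrow> complex)
      \<Rightarrow> ('v \<Rightarrow> 'v) \<times> ('v \<Rightarrow> 'v \<Rightarrow> complex) \<Rightarrow> bool" where
  "is_courant_bracket E Z S e1 e2 e \<longleftrightarrow>
     (\<forall>A\<in>S. fst e A = lie_bracket E Z (fst e1) (fst e2) A) \<and>
     (\<forall>W c. nopen E W \<longrightarrow> c \<in> vector_fields E Z (S \<inter> W) \<longrightarrow>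
        (\<forall>A\<in>S \<inter> W. snd e A (c A) =
           lie_derivative E Z (fst e1) (snd e2) c A
           - exterior_derivative E Z (snd e1) (fst e2) c A))"

definition sections ::
    "'v::real_vector nsp \<Rightarrow> 'w::real_vector nsp \<Rightarrow> ('w \<Rightarrow> 'v \<Rightarrow> complex) \<Rightarrow> 'v set
      \<Rightarrow> ('v \<times> 'v \<times> ('v \<Rightarrow> complex)) set \<Rightarrow> 'v set
      \<Rightarrow> (('v \<Rightarrow> 'v) \<times> ('v \<Rightarrow> 'v \<Rightarrow> complex)) set" where
  "sections E F Q Z D S =
     {(a, \<xi>). a \<in> vector_fields E Z S \<and> \<xi> \<in> one_forms E F Q Z S \<and>
        (\<forall>A\<in>S. (A, a A, \<xi> A) \<in> D)}"

text \<open>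
  Smooth subbundles of the Courant algebroid.  Locally the fibres are the isomorphic images of a
  fixed closed subspace \<open>K\<close> of \<open>E \<times> F\<close> under maps \<open>\<tau> A\<close> that depend smoothly on \<open>A\<close>
  (through the lifts \<open>p\<close>, \<open>q\<close>) and have locally uniformly bounded inverses.
\<close>

definition subbundle ::
    "'v::real_vector nsp \<Rightarrow> 'w::real_vector nsp \<Rightarrow> ('w \<Rightarrow> 'v \<Rightarrow> complex) \<Rightarrow> 'v set
      \<Rightarrow> ('v \<times> 'v \<times> ('v \<Rightarrow> complex)) set \<Rightarrow> bool" where
  "subbundle E F Q Z D \<longleftrightarrow>
     D \<subseteq> Sigma Z (courant_fibre E F Q Z) \<and>
     (\<forall>A\<in>Z. subspace (D `` {A})) \<and>
     (\<forall>A\<^sub>0\<in>Z. \<exists>W K p q C. nopen E W \<and> A\<^sub>0 \<in> W \<and> closed_subspace (prod_nsp E F) K \<and>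
        smooth_along (prod_nsp E (prod_nsp E F)) E ((Z \<inter> W) \<times> K) p \<and>
        smooth_along (prod_nsp E (prod_nsp E F)) F ((Z \<inter> W) \<times> K) q \<and>
        (\<forall>A\<in>Z \<inter> W. let \<tau> = (\<lambda>k. (p (A, k), covec E Q Z A (q (A, k)))) in
           bij_betw \<tau> K (D `` {A}) \<and>
           (\<forall>k\<in>K. \<forall>l\<in>K. \<forall>r. \<tau> (r *\<^sub>R k + l) = r *\<^sub>R \<tau> k + \<tau> l) \<and>
           (\<forall>k\<in>K. nrm (prod_nsp E F) k
              \<le> C * (nrm E (fst (\<tau> k)) + cotangent_norm E F Q Z A (snd (\<tau> k))))))"

definition dirac_structure ::
    "'v::real_vector nsp \<Rightarrow> 'w::real_vector nsp \<Rightarrow> ('w \<Rightarrow> 'v \<Rightarrow> complex) \<Rightarrow> 'v set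
      \<Rightarrow> ('v \<times> 'v \<times> ('v \<Rightarrow> complex)) set \<Rightarrow> bool" where
  "dirac_structure E F Q Z D \<longleftrightarrow>
     subbundle E F Q Z D \<and>
     (\<forall>A\<in>Z. maximal_isotropic (courant_fibre E F Q Z A) (D `` {A})) \<and>
     (\<forall>W. nopen E W \<longrightarrow>
        (\<forall>e1\<in>sections E F Q Z D (Z \<inter> W). \<forall>e2\<in>sections E F Q Z D (Z \<inter> W).
           \<exists>e\<in>sections E F Q Z D (Z \<inter> W). is_courant_bracket E Z (Z \<inter> W) e1 e2 e))"


section \<open>Oriented Riemannian four-manifolds with boundary\<close>

definition half_space :: "(real^4) set" where
  "half_space = {x. 0 \<le> x $ 1}"

datatype 'x chart = Chart (cdom: "'x set") (cmap: "'x \<Rightarrow> real^4")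

definition cimg :: "'x chart \<Rightarrow> (real^4) set" where
  "cimg c = cmap c ` cdom c"

definition cinv :: "'x chart \<Rightarrow> real^4 \<Rightarrow> 'x" where
  "cinv c = inv_into (cdom c) (cmap c)"

definition overlap :: "'x chart \<Rightarrow> 'x chart \<Rightarrow> (real^4) set" where
  "overlap c d = cmap c ` (cdom c \<inter> cdom d)"

definition transition :: "'x chart \<Rightarrow> 'x chart \<Rightarrow> real^4 \<Rightarrow> real^4" where
  "transition c d = (\<lambda>x. cmap d (cinv c x))"

definition transition_deriv :: "'x chart \<Rightarrow> 'x chart \<Rightarrow> real^4 \<Rightarrow> real^4 \<Rightarrow> real^4" where
  "transition_deriv c d x = frechet_derivative (transition c d) (at x within overlap c d)"

definition oriented_manifold4 :: "'x topology \<Rightarrow> 'x chart set \<Rightarrow> bool" where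
  "oriented_manifold4 X \<A> \<longleftrightarrow> Hausdorff_space X \<and> (\<Union>c\<in>\<A>. cdom c) = topspace X \<and>
     (\<forall>c\<in>\<A>. openin X (cdom c) \<and> openin (top_of_set half_space) (cimg c) \<and>
        homeomorphic_map (subtopology X (cdom c)) (top_of_set (cimg c)) (cmap c)) \<and>
     (\<forall>c\<in>\<A>. \<forall>d\<in>\<A>. smooth_along euclid euclid (overlap c d) (transition c d) \<and>
        (\<forall>x\<in>overlap c d. det (matrix (transition_deriv c d x)) > 0))"

text \<open>\<open>g c x v w\<close> is the metric in the chart \<open>c\<close>, at the point with coordinates \<open>x\<close>.\<close>

definition riemannian_metric ::
    "'x chart set \<Rightarrow> ('x chart \<Rightarrow> real^4 \<Rightarrow> real^4 \<Rightarrow> real^4 \<Rightarrow> real) \<Rightarrow> bool" where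
  "riemannian_metric \<A> g \<longleftrightarrow>
     (\<forall>c\<in>\<A>. (\<forall>v w. smooth_along euclid euclid (cimg c) (\<lambda>x. g c x v w)) \<and>
        (\<forall>x\<in>cimg c. bilinear (g c x) \<and> (\<forall>v w. g c x v w = g c x w v) \<and>
           (\<forall>v. v \<noteq> 0 \<longrightarrow> g c x v v > 0))) \<and>
     (\<forall>c\<in>\<A>. \<forall>d\<in>\<A>. \<forall>x\<in>overlap c d. \<forall>v w.
        g c x v w = g d (transition c d x) (transition_deriv c d x v) (transition_deriv c d x w))"

text \<open>A finite smooth partition of unity, each member paired with a chart that contains its support.
  It enters the definition of the Sobolev norms, where another choice gives an equivalent norm, and
  of the integral over \<open>X\<close>, which does not depend on it.\<close>

definition partition_of_unity ::
    "'x topology \<Rightarrow> 'x chart set \<Rightarrow> ('x chart \<times> ('x \<Rightarrow> real)) set \<Rightarrow> bool" where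
  "partition_of_unity X \<A> P \<longleftrightarrow> finite P \<and>
     (\<forall>(c, \<rho>)\<in>P. c \<in> \<A> \<and> (\<forall>p\<in>topspace X. 0 \<le> \<rho> p) \<and>
        X closure_of {p \<in> topspace X. \<rho> p \<noteq> 0} \<subseteq> cdom c \<and>
        (\<forall>d\<in>\<A>. smooth_along euclid euclid (cimg d) (\<lambda>x. \<rho> (cinv d x)))) \<and>
     (\<forall>p\<in>topspace X. (\<Sum>(c, \<rho>)\<in>P. \<rho> p) = 1)"


section \<open>Matrix-valued differential forms\<close>

text \<open>
  An alternating \<open>r\<close>-form on \<open>\<real>\<^sup>4\<close> is a function of lists of vectors that vanishes on lists of
  length other than \<open>r\<close>.  A form on the manifold is the family \<open>\<omega> c x\<close> of its coordinate
  representatives in the charts \<open>c\<close>, at the points \<open>x\<close> of the chart images.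
\<close>

type_synonym 'n mat = "complex^'n^'n"

type_synonym ('x, 'b) form = "'x chart \<Rightarrow> real^4 \<Rightarrow> (real^4) list \<Rightarrow> 'b"

definition alt_form :: "nat \<Rightarrow> ((real^4) list \<Rightarrow> 'b::real_vector) \<Rightarrow> bool" where
  "alt_form r \<eta> \<longleftrightarrow> (\<forall>vs. length vs \<noteq> r \<longrightarrow> \<eta> vs = 0) \<and>
     (\<forall>us vs. linear (\<lambda>v. \<eta> (us @ v # vs))) \<and> (\<forall>vs. \<not> distinct vs \<longrightarrow> \<eta> vs = 0)"

definition forms :: "'x chart set \<Rightarrow> nat \<Rightarrow> 'b set \<Rightarrow> ('x, 'b::real_vector) form set" where
  "forms \<A> r S = {\<omega>.
     (\<forall>c x. c \<notin> \<A> \<or> x \<notin> cimg c \<longrightarrow> \<omega> c x = 0) \<and>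
     (\<forall>c\<in>\<A>. \<forall>x\<in>cimg c. alt_form r (\<omega> c x) \<and> (\<forall>vs. length vs = r \<longrightarrow> \<omega> c x vs \<in> S)) \<and>
     (\<forall>c\<in>\<A>. \<forall>d\<in>\<A>. \<forall>x\<in>overlap c d. \<forall>vs.
        \<omega> c x vs = \<omega> d (transition c d x) (map (transition_deriv c d x) vs))}"

text \<open>The wedge product combined with matrix multiplication, as a sum over shuffles: \<open>I\<close> is the
  set of positions of the arguments of the left factor.\<close>

definition wedge :: "('x, 'n::finite mat) form \<Rightarrow> ('x, 'n mat) form \<Rightarrow> ('x, 'n mat) form"
    (infixl "\<and>\<^sub>w" 70) where
  "\<alpha> \<and>\<^sub>w \<beta> = (\<lambda>c x vs. \<Sum>I\<in>Pow {..<length vs}.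
     (-1) ^ card {(i, j). i \<in> I \<and> j \<in> {..<length vs} - I \<and> j < i} *\<^sub>R
       (\<alpha> c x (nths vs I) ** \<beta> c x (nths vs (- I))))"

definition form_trace :: "('x, 'n::finite mat) form \<Rightarrow> ('x, complex) form" where
  "form_trace \<omega> = (\<lambda>c x vs. trace (\<omega> c x vs))"

definition form_integral ::
    "('x chart \<times> ('x \<Rightarrow> real)) set \<Rightarrow> ('x, complex) form \<Rightarrow> complex" where
  "form_integral P \<mu> = (\<Sum>(c, \<rho>)\<in>P.
     LINT x:cimg c|lborel. \<rho> (cinv c x) *\<^sub>R \<mu> c x [axis 1 1, axis 2 1, axis 3 1, axis 4 1])"

text \<open>\<open>d\<eta> = \<theta>\<close> in the sense of distributions on the interior of \<open>X\<close>, for an \<open>r\<close>-form \<open>\<eta>\<close>.\<close>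

definition has_ext_deriv ::
    "'x chart set \<Rightarrow> nat \<Rightarrow> ('x, 'b::euclidean_space) form \<Rightarrow> ('x, 'b) form \<Rightarrow> bool" where
  "has_ext_deriv \<A> r \<eta> \<theta> \<longleftrightarrow>
     (\<forall>c\<in>\<A>. \<forall>\<phi> :: real^4 \<Rightarrow> real. \<forall>T. smooth_on euclid euclid UNIV \<phi> \<longrightarrow>
        compact T \<longrightarrow> T \<subseteq> interior (cimg c) \<longrightarrow> (\<forall>x. x \<notin> T \<longrightarrow> \<phi> x = 0) \<longrightarrow>
        (\<forall>vs. length vs = Suc r \<longrightarrow>
           (LINT x|lborel. \<phi> x *\<^sub>R \<theta> c x vs) =
           - (\<Sum>k<Suc r. (-1) ^ k *\<^sub>R
               (LINT x|lborel. frechet_derivative \<phi> (at x) (vs ! k) *\<^sub>R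
                  \<eta> c x (take k vs @ drop (Suc k) vs)))))"


section \<open>Sobolev spaces\<close>

text \<open>
  $L^2_\sigma(\mathbb R^4)$ for \<open>\<sigma> > 2\<close>: functions whose Fourier transform is square
  integrable with weight $(1+|\xi|^2)^\sigma$.  For \<open>\<sigma> > 2\<close> such a transform is
  integrable, so that the functions are continuous and given pointwise by Fourier inversion; the
  definitions are only meant for this range.  On a relatively open subset of the half-space, the
  space consists of the restrictions and carries the quotient norm.
\<close>

definition sobolev_symbol :: "real \<Rightarrow> (real^4 \<Rightarrow> complex) set" where
  "sobolev_symbol \<sigma> = {h \<in> borel_measurable lborel.
     integrable lborel (\<lambda>\<xi>. (1 + (norm \<xi>)\<^sup>2) powr \<sigma> * (norm (h \<xi>))\<^sup>2)}"

definition fourier :: "(real^4 \<Rightarrow> complex) \<Rightarrow> real^4 \<Rightarrow> complex" where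
  "fourier h x = (LINT \<xi>|lborel. cis (x \<bullet> \<xi>) * h \<xi>)"

definition sobolev_fun :: "real \<Rightarrow> (real^4) set \<Rightarrow> (real^4 \<Rightarrow> complex) set" where
  "sobolev_fun \<sigma> V = {f. \<exists>h\<in>sobolev_symbol \<sigma>. \<forall>x\<in>V. f x = fourier h x}"

definition sobolev_fun_norm :: "real \<Rightarrow> (real^4) set \<Rightarrow> (real^4 \<Rightarrow> complex) \<Rightarrow> real" where
  "sobolev_fun_norm \<sigma> V f =
     Inf {sqrt (LINT \<xi>|lborel. (1 + (norm \<xi>)\<^sup>2) powr \<sigma> * (norm (h \<xi>))\<^sup>2) | h.
       h \<in> sobolev_symbol \<sigma> \<and> (\<forall>x\<in>V. f x = fourier h x)}"

text \<open>Since the sets where the members of the partition of unity do not vanish cover \<open>X\<close>, a form is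
  of class $L^2_\sigma$ iff its components, restricted to each of these sets, are.\<close>

definition patch :: "'x chart \<Rightarrow> ('x \<Rightarrow> real) \<Rightarrow> (real^4) set" where
  "patch c \<rho> = cmap c ` {p \<in> cdom c. \<rho> p \<noteq> 0}"

definition frames :: "nat \<Rightarrow> (real^4) list set" where
  "frames r = {vs. set vs \<subseteq> Basis \<and> length vs = r}"

definition sobolev_forms ::
    "'x chart set \<Rightarrow> ('x chart \<times> ('x \<Rightarrow> real)) set \<Rightarrow> real \<Rightarrow> nat \<Rightarrow> 'n::finite mat set
      \<Rightarrow> ('x, 'n mat) form set" where
  "sobolev_forms \<A> P \<sigma> r S = {\<omega> \<in> forms \<A> r S.
     \<forall>(c, \<rho>)\<in>P. \<forall>vs\<in>frames r. \<forall>i j. (\<lambda>x. \<omega> c x vs $ i $ j) \<in> sobolev_fun \<sigma> (patch c \<rho>)}"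

definition sobolev_norm ::
    "('x chart \<times> ('x \<Rightarrow> real)) set \<Rightarrow> real \<Rightarrow> nat \<Rightarrow> ('x, 'n::finite mat) form \<Rightarrow> real" where
  "sobolev_norm P \<sigma> r \<omega> = sqrt (\<Sum>(c, \<rho>)\<in>P. \<Sum>vs\<in>frames r. \<Sum>i\<in>UNIV. \<Sum>j\<in>UNIV.
     (sobolev_fun_norm \<sigma> (patch c \<rho>) (\<lambda>x. \<omega> c x vs $ i $ j))\<^sup>2)"

definition sobolev_space ::
    "'x chart set \<Rightarrow> ('x chart \<times> ('x \<Rightarrow> real)) set \<Rightarrow> real \<Rightarrow> nat \<Rightarrow> 'n::finite mat set
      \<Rightarrow> ('x, 'n mat) form nsp" where
  "sobolev_space \<A> P \<sigma> r S = (sobolev_forms \<A> P \<sigma> r S, sobolev_norm P \<sigma> r)"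


section \<open>Connections\<close>

definition adjoint_mat :: "'n::finite mat \<Rightarrow> 'n mat" where
  "adjoint_mat M = (\<chi> i j. cnj (M $ j $ i))"

definition SU :: "'n::finite mat set" where
  "SU = {U. U ** adjoint_mat U = mat 1 \<and> det U = 1}"

definition su :: "'n::finite mat set" where
  "su = {M. adjoint_mat M = - M \<and> trace M = 0}"

definition SU_center :: "'n::finite mat set" where
  "SU_center = {z \<in> SU. \<forall>U\<in>SU. z ** U = U ** z}"

text \<open>\<open>F\<close> is the curvature \<open>dA + A \<and> A\<close>, and \<open>b\<close> is \<open>d\<^sub>A a\<close> for an \<open>r\<close>-form \<open>a\<close>.\<close>

definition has_curvature ::
    "'x chart set \<Rightarrow> ('x, 'n::finite mat) form \<Rightarrow> ('x, 'n mat) form \<Rightarrow> bool" where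
  "has_curvature \<A> A F \<longleftrightarrow> has_ext_deriv \<A> 1 A (F - A \<and>\<^sub>w A)"

definition has_cov_deriv ::
    "'x chart set \<Rightarrow> nat \<Rightarrow> ('x, 'n::finite mat) form \<Rightarrow> ('x, 'n mat) form \<Rightarrow> ('x, 'n mat) form \<Rightarrow> bool" where
  "has_cov_deriv \<A> r A a b \<longleftrightarrow>
     has_ext_deriv \<A> r a (b - (A \<and>\<^sub>w a - (-1) ^ r *\<^sub>R (a \<and>\<^sub>w A)))"

text \<open>
  Irreducibility: the stabiliser of \<open>A\<close> in the group of \<open>SU(n)\<close>-valued gauge transformations of
  class $L^2_{s+1/2}$ is the centre of \<open>SU(n)\<close>.  A gauge transformation \<open>u\<close> fixes \<open>A\<close>, that is
  $u^{-1}Au+u^{-1}du=A$, iff $du+Au-uA=0$.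
\<close>

definition irreducible_connection ::
    "'x chart set \<Rightarrow> ('x chart \<times> ('x \<Rightarrow> real)) set \<Rightarrow> real \<Rightarrow> ('x, 'n::finite mat) form \<Rightarrow> bool" where
  "irreducible_connection \<A> P s A \<longleftrightarrow>
     (\<forall>u\<in>sobolev_forms \<A> P (s + 1/2) 0 SU. has_cov_deriv \<A> 0 A u 0 \<longrightarrow>
        (\<exists>z\<in>SU_center. \<forall>c\<in>\<A>. \<forall>x\<in>cimg c. u c x [] = z))"

definition Omega ::
    "'x chart set \<Rightarrow> ('x chart \<times> ('x \<Rightarrow> real)) set \<Rightarrow> real \<Rightarrow> nat \<Rightarrow> ('x, 'n::finite mat) form nsp" where
  "Omega \<A> P s r = sobolev_space \<A> P s r su"

text \<open>
  The forms that represent cotangent vectors are allowed to take values in all complex matrices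
  rather than in \<open>su\<close>: for skew-Hermitian \<open>A\<close> and \<open>a\<close> the values of
  $A^2\wedge a+a\wedge A^2$ are Hermitian and need not be traceless.  Accordingly the pairing is
  complex valued.  As functionals on \<open>su\<close>-valued forms these are the ones given by the
  complexification of \<open>su\<close>, since scalar matrices pair to zero with \<open>su\<close>.
\<close>

definition Omega_cotangent ::
    "'x chart set \<Rightarrow> ('x chart \<times> ('x \<Rightarrow> real)) set \<Rightarrow> real \<Rightarrow> ('x, 'n::finite mat) form nsp" where
  "Omega_cotangent \<A> P s = sobolev_space \<A> P s 3 UNIV"

definition pairing ::
    "('x chart \<times> ('x \<Rightarrow> real)) set \<Rightarrow> ('x, 'n::finite mat) form \<Rightarrow> ('x, 'n mat) form \<Rightarrow> complex" where
  "pairing P \<alpha> a = form_integral P (form_trace (\<alpha> \<and>\<^sub>w a)) / complex_of_real (8 * pi ^ 3)"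

definition connections ::
    "'x chart set \<Rightarrow> ('x chart \<times> ('x \<Rightarrow> real)) set \<Rightarrow> real \<Rightarrow> ('x, 'n::finite mat) form set" where
  "connections \<A> P s = {A \<in> pts (Omega \<A> P (s - 1/2) 1). irreducible_connection \<A> P s A}"

definition flat_connections ::
    "'x chart set \<Rightarrow> ('x chart \<times> ('x \<Rightarrow> real)) set \<Rightarrow> real \<Rightarrow> ('x, 'n::finite mat) form set" where
  "flat_connections \<A> P s = {A \<in> connections \<A> P s. has_curvature \<A> A 0}"

definition flat_tangent ::
    "'x chart set \<Rightarrow> ('x chart \<times> ('x \<Rightarrow> real)) set \<Rightarrow> real \<Rightarrow> ('x, 'n::finite mat) form
      \<Rightarrow> ('x, 'n mat) form set" where
  "flat_tangent \<A> P s A = {a \<in> pts (Omega \<A> P (s - 1/2) 1). has_cov_deriv \<A> 1 A a 0}"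

definition gamma1 :: "('x, 'n::finite mat) form \<Rightarrow> ('x, 'n mat) form \<Rightarrow> ('x, 'n mat) form" where
  "gamma1 A a = A \<and>\<^sub>w A \<and>\<^sub>w a + a \<and>\<^sub>w (A \<and>\<^sub>w A)"

definition D_flat ::
    "'x chart set \<Rightarrow> ('x chart \<times> ('x \<Rightarrow> real)) set \<Rightarrow> real
      \<Rightarrow> (('x, 'n::finite mat) form \<times> ('x, 'n mat) form \<times> (('x, 'n mat) form \<Rightarrow> complex)) set" where
  "D_flat \<A> P s = Sigma (flat_connections \<A> P s) (\<lambda>A.
     {(a, covec (Omega \<A> P (s - 1/2) 1) (pairing P) (flat_connections \<A> P s) A (gamma1 A a)) | a.
       a \<in> flat_tangent \<A> P s A})"

end

theory Submission
  imports Defs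
begin

text \<open>The assignment \<open>a \<mapsto> \<gamma>\<^sup>1\<^sub>A(a)\<close> is a two-form \<open>\<omega>\<^sub>A(a, b) \<sim> \<integral> tr ((A\<^sup>2 a + a A\<^sup>2) b)\<close>. Moving a one-form
  cyclically past a three-form under the trace changes the sign; this alone makes \<open>\<omega>\<close> antisymmetric, and
  makes the terms of its exterior derivative on constant fields cancel, so \<open>\<omega>\<close> is closed. The graph of
  a two-form is a maximal isotropic subbundle, and closedness yields its closure under the Courant
  bracket.

  The analysis behind this is that \<open>\<omega>\<close> is smooth: for \<open>\<sigma> > 2 = dim X / 2\<close> the space \<open>L\<^sup>2\<^sub>\<sigma>\<close> is an
  algebra of bounded functions, because the weight \<open>(1 + \<bar>\<xi>\<bar>\<^sup>2)\<^sup>\<sigma>\<^sup>/\<^sup>2\<close> is subadditive up to a constant and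
  symbols of \<open>L\<^sup>2\<^sub>\<sigma>\<close> are integrable, so that Young's inequality applies to convolutions of symbols.
  Hence the wedge product and the pairing are bounded bilinear. That the Lie bracket of tangent
  fields is again tangent is read off a flattening chart, where the symmetric second derivative of
  the chart cancels.\<close>

section \<open>Normed spaces given by a carrier and a norm\<close>

text \<open>The spaces depend on charts, a partition of unity and an exponent, so calculus is done
  with norms on carriers. Second derivatives are compared after applying bounded real functionals,
  where the mean value theorem for real functions is at hand; on Sobolev forms the separating
  functionals are real and imaginary parts of components at points.

  A tangent vector is the velocity of a curve that stays in the submanifold on all of (-1, 1), and a
  derivative along the submanifold is a definite description over all such curves. Two constructions
  answer this: segments in a chart are reparametrised so as never to leave it, and fields are
  replaced by smooth local extensions, whose derivatives do not depend on the curve.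

  The Courant computation is carried out for abstract data. Its core is a quadrilinear form
  \<Theta>(x, y, z, w) that changes sign under cyclic rotation: rotating the base point to the front
  gives a normal form in which antisymmetry and closedness are cancellations of monomials.
  Maximality comes from testing against the graph, which has an element above every tangent
  vector.\<close>

locale nspace =
  fixes E :: "'v::real_vector nsp"
  assumes subspace_pts: "subspace (pts E)"
    and nrm_triangle: "x \<in> pts E \<Longrightarrow> y \<in> pts E \<Longrightarrow> nrm E (x + y) \<le> nrm E x + nrm E y"
    and nrm_scale: "x \<in> pts E \<Longrightarrow> nrm E (r *\<^sub>R x) = \<bar>r\<bar> * nrm E x"
    and nrm_eq_0D: "x \<in> pts E \<Longrightarrow> nrm E x = 0 \<Longrightarrow> x = 0"
begin

lemma pts_zero [simp]: "0 \<in> pts E"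
  using subspace_pts by (rule subspace_0)

lemma pts_add [simp]: "x \<in> pts E \<Longrightarrow> y \<in> pts E \<Longrightarrow> x + y \<in> pts E"
  using subspace_pts by (rule subspace_add)

lemma pts_diff [simp]: "x \<in> pts E \<Longrightarrow> y \<in> pts E \<Longrightarrow> x - y \<in> pts E"
  using subspace_pts by (rule subspace_diff)

lemma pts_scale [simp]: "x \<in> pts E \<Longrightarrow> r *\<^sub>R x \<in> pts E"
  using subspace_pts by (rule subspace_scale)

lemma pts_minus [simp]: "x \<in> pts E \<Longrightarrow> - x \<in> pts E"
  using subspace_pts by (rule subspace_neg)

lemma pts_sum_list: "(\<And>x. x \<in> set xs \<Longrightarrow> f x \<in> pts E) \<Longrightarrow> sum_list (map f xs) \<in> pts E"
  by (induction xs) auto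

lemma nrm_zero [simp]: "nrm E 0 = 0"
  using nrm_scale[of 0 0] by simp

lemma nrm_minus: "x \<in> pts E \<Longrightarrow> nrm E (- x) = nrm E x"
  using nrm_scale[of x "-1"] by simp

lemma nrm_nonneg [simp]: "x \<in> pts E \<Longrightarrow> 0 \<le> nrm E x"
  using nrm_triangle[of x "- x"] by (simp add: nrm_minus)

lemma nrm_diff_le: "x \<in> pts E \<Longrightarrow> y \<in> pts E \<Longrightarrow> nrm E (x - y) \<le> nrm E x + nrm E y"
  using nrm_triangle[of x "- y"] by (simp add: nrm_minus)

lemma nrm_sum_list_le:
  assumes "\<And>x. x \<in> set xs \<Longrightarrow> f x \<in> pts E" "\<And>x. x \<in> set xs \<Longrightarrow> nrm E (f x) \<le> c"
  shows "nrm E (sum_list (map f xs)) \<le> real (length xs) * c"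
  using assms
proof (induction xs)
  case (Cons a xs)
  have "nrm E (f a + sum_list (map f xs)) \<le> nrm E (f a) + nrm E (sum_list (map f xs))"
    using Cons.prems by (intro nrm_triangle pts_sum_list) auto
  also have "\<dots> \<le> c + real (length xs) * c"
    using Cons by (intro add_mono) auto
  finally show ?case by (simp add: algebra_simps)
qed auto

end

abbreviation npr :: "'v nsp \<Rightarrow> 'v list \<Rightarrow> real" where
  "npr E hs \<equiv> prod_list (map (nrm E) hs)"

lemma (in nspace) npr_nonneg: "hs \<in> lists (pts E) \<Longrightarrow> 0 \<le> npr E hs"
  by (induction hs) auto

lemma nspace_euclid: "nspace (euclid :: 'a::real_normed_vector nsp)"
  by unfold_locales (auto simp: euclid_def norm_triangle_ineq)

lemma pts_euclid [simp]: "pts euclid = UNIV" and nrm_euclid [simp]: "nrm euclid = norm"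
  by (simp_all add: euclid_def)

lemma pts_prod_nsp [simp]: "pts (prod_nsp E F) = pts E \<times> pts F"
  and nrm_prod_nsp: "nrm (prod_nsp E F) z = nrm E (fst z) + nrm F (snd z)"
  by (simp_all add: prod_nsp_def case_prod_unfold)

lemma nspace_prod:
  assumes "nspace E" "nspace F"
  shows "nspace (prod_nsp E F)"
proof -
  interpret E: nspace E by fact
  interpret F: nspace F by fact
  show ?thesis
  proof
    show "subspace (pts (prod_nsp E F))"
      unfolding pts_prod_nsp by (rule subspaceI) (auto simp: zero_prod_def)
    show "x = 0" if "x \<in> pts (prod_nsp E F)" "nrm (prod_nsp E F) x = 0" for x
    proof -
      have "nrm E (fst x) + nrm F (snd x) = 0" "fst x \<in> pts E" "snd x \<in> pts F"
        using that by (auto simp: nrm_prod_nsp)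
      then have "fst x = 0" "snd x = 0"
        by (meson E.nrm_eq_0D F.nrm_eq_0D E.nrm_nonneg F.nrm_nonneg add_nonneg_eq_0_iff)+
      then show ?thesis by (simp add: prod_eq_iff)
    qed
  qed (auto simp: nrm_prod_nsp E.nrm_scale F.nrm_scale algebra_simps
      intro: order_trans[OF add_mono[OF E.nrm_triangle F.nrm_triangle]])
qed

section \<open>Jets\<close>

text \<open>The filter of small increments \<open>h\<close> with \<open>x + h\<close> in
  \<open>U\<close>, the increment 0 included. It turns the \<epsilon>-\<delta> clause of
  \<open>smooth_on\<close> into an \<open>eventually\<close> statement, so that several estimates
  combine without tracking radii.\<close>

definition near :: "'v::real_vector nsp \<Rightarrow> 'v set \<Rightarrow> 'v \<Rightarrow> 'v filter" where
  "near E U x = (INF \<delta>\<in>{0<..}. principal {h \<in> pts E. nrm E h < \<delta> \<and> x + h \<in> U})"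

lemma eventually_near:
  "eventually P (near E U x) \<longleftrightarrow> (\<exists>\<delta>>0. \<forall>h\<in>pts E. nrm E h < \<delta> \<longrightarrow> x + h \<in> U \<longrightarrow> P h)"
  unfolding near_def
proof (subst eventually_INF_base)
  show "\<exists>x'\<in>{0<..}. principal {h \<in> pts E. nrm E h < x' \<and> x + h \<in> U}
      \<le> inf (principal {h \<in> pts E. nrm E h < a \<and> x + h \<in> U}) (principal {h \<in> pts E. nrm E h < b \<and> x + h \<in> U})"
    if "a \<in> {0<..}" "b \<in> {0<..}" for a b :: real
    using that by (intro bexI[of _ "min a b"]) auto
qed (auto simp: eventually_principal Bex_def intro: exI[of _ "1::real"])

lemma eventually_near_less: "0 < \<delta> \<Longrightarrow> eventually (\<lambda>h. h \<in> pts E \<and> nrm E h < \<delta> \<and> x + h \<in> U) (near E U x)"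
  unfolding eventually_near by auto

text \<open>The clauses of \<open>smooth_on\<close> on the family \<open>D\<close> alone:
  derivatives of all orders are handled as one object. Linearity is demanded only in the most recent
  direction, the head of the list; the other slots follow in \<open>jet_multilinear\<close>.\<close>

definition jet :: "'v::real_vector nsp \<Rightarrow> 'w::real_vector nsp \<Rightarrow> 'v set \<Rightarrow> ('v list \<Rightarrow> 'v \<Rightarrow> 'w) \<Rightarrow> bool" where
  "jet E F U D \<longleftrightarrow>
     (\<forall>x\<in>U. \<forall>hs\<in>lists (pts E). D hs x \<in> pts F) \<and>
     (\<forall>x\<in>U. \<forall>hs\<in>lists (pts E). \<forall>h\<in>pts E. \<forall>h'\<in>pts E. \<forall>r.
        D ((r *\<^sub>R h + h') # hs) x = r *\<^sub>R D (h # hs) x + D (h' # hs) x) \<and>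
     (\<forall>x\<in>U. \<forall>k. \<exists>C. \<forall>hs\<in>lists (pts E). length hs = k \<longrightarrow> nrm F (D hs x) \<le> C * npr E hs) \<and>
     (\<forall>x\<in>U. \<forall>k. \<forall>\<epsilon>>0. eventually (\<lambda>h. \<forall>hs\<in>lists (pts E). length hs = k \<longrightarrow>
           nrm F (D hs (x + h) - D hs x - D (h # hs) x) \<le> \<epsilon> * nrm E h * npr E hs) (near E U x))"

lemma smooth_on_iff_jet: "smooth_on E F U f \<longleftrightarrow> (\<exists>D. jet E F U D \<and> (\<forall>x\<in>U. D [] x = f x))"
  unfolding smooth_on_def jet_def eventually_near
  by (rule iff_exI, rule iffI; (elim conjE, intro conjI; assumption))

lemma jet_subset:
  assumes "jet E F U D" "V \<subseteq> U"
  shows "jet E F V D"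
proof -
  have "near E V x \<le> near E U x" for x
    using assms(2) unfolding near_def by (intro INF_mono bexI) auto
  then show ?thesis
    using assms unfolding jet_def by (meson subsetD filter_leD)
qed

section \<open>Uniform estimates extracted from a jet\<close>

locale nspace2 = E: nspace E + F: nspace F
  for E :: "'v::real_vector nsp" and F :: "'w::real_vector nsp"
begin

lemma jet_pts: "jet E F U D \<Longrightarrow> x \<in> U \<Longrightarrow> hs \<in> lists (pts E) \<Longrightarrow> D hs x \<in> pts F"
  by (simp add: jet_def)

lemma jet_lin:
  assumes "jet E F U D" "x \<in> U" "hs \<in> lists (pts E)" "h \<in> pts E" "h' \<in> pts E"
  shows "D ((r *\<^sub>R h + h') # hs) x = r *\<^sub>R D (h # hs) x + D (h' # hs) x"
proof -
  have "\<forall>x\<in>U. \<forall>hs\<in>lists (pts E). \<forall>h\<in>pts E. \<forall>h'\<in>pts E. \<forall>r.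
        D ((r *\<^sub>R h + h') # hs) x = r *\<^sub>R D (h # hs) x + D (h' # hs) x"
    using assms(1) unfolding jet_def by (elim conjE)
  with assms(2-) show ?thesis by blast
qed

lemma jet_lin_zero:
  assumes "jet E F U D" "x \<in> U" "hs \<in> lists (pts E)"
  shows "D (0 # hs) x = 0"
  using jet_lin[OF assms E.pts_zero E.pts_zero, of 1] by simp

lemma jet_bound:
  "jet E F U D \<Longrightarrow> x \<in> U \<Longrightarrow> \<exists>C. \<forall>hs\<in>lists (pts E). length hs = k \<longrightarrow> nrm F (D hs x) \<le> C * npr E hs"
  by (simp only: jet_def)

text \<open>A jet supplies a constant for each order separately; compositions call for one constant
  for all orders up to \<open>k\<close>. The bound \<open>1 \<le> C\<close> keeps later products and
  quotients of constants positive.\<close>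

lemma jet_bdd:
  assumes "jet E F U D" "x \<in> U"
  obtains C where "1 \<le> C"
    "\<And>hs. hs \<in> lists (pts E) \<Longrightarrow> length hs \<le> k \<Longrightarrow> nrm F (D hs x) \<le> C * npr E hs"
proof -
  have "\<exists>C\<ge>1. \<forall>hs\<in>lists (pts E). length hs \<le> k \<longrightarrow> nrm F (D hs x) \<le> C * npr E hs"
  proof (induction k)
    case 0
    show ?case
      by (rule exI[of _ "max 1 (nrm F (D [] x))"]) auto
  next
    case (Suc k)
    then obtain C where C: "C \<ge> 1" "\<forall>hs\<in>lists (pts E). length hs \<le> k \<longrightarrow> nrm F (D hs x) \<le> C * npr E hs"
      by blast
    obtain C' where C': "\<forall>hs\<in>lists (pts E). length hs = Suc k \<longrightarrow> nrm F (D hs x) \<le> C' * npr E hs"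
      using jet_bound[OF assms] by blast
    show ?case
    proof (intro exI[of _ "max C C'"] conjI ballI impI)
      fix hs assume hs: "hs \<in> lists (pts E)" "length hs \<le> Suc k"
      have "nrm F (D hs x) \<le> C * npr E hs \<or> nrm F (D hs x) \<le> C' * npr E hs"
        using hs C C' by (cases "length hs = Suc k") auto
      moreover have "C * npr E hs \<le> max C C' * npr E hs" "C' * npr E hs \<le> max C C' * npr E hs"
        using E.npr_nonneg[OF hs(1)] by (auto intro!: mult_right_mono)
      ultimately show "nrm F (D hs x) \<le> max C C' * npr E hs" by linarith
    qed (use C in auto)
  qed
  then show ?thesis using that by blast
qed

lemma jet_deriv:
  assumes "jet E F U D" "x \<in> U" "0 < \<epsilon>"
  shows "eventually (\<lambda>h. \<forall>hs\<in>lists (pts E). length hs \<le> k \<longrightarrow>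
           nrm F (D hs (x + h) - D hs x - D (h # hs) x) \<le> \<epsilon> * nrm E h * npr E hs) (near E U x)"
proof -
  have "eventually (\<lambda>h. \<forall>j\<in>{..k}. \<forall>hs\<in>lists (pts E). length hs = j \<longrightarrow>
           nrm F (D hs (x + h) - D hs x - D (h # hs) x) \<le> \<epsilon> * nrm E h * npr E hs) (near E U x)"
    using assms by (intro eventually_ball_finite) (auto simp: jet_def)
  then show ?thesis by eventually_elim auto
qed

text \<open>The increment is the first-order remainder plus the next derivative. Taking \<epsilon> =
  1 in the remainder accounts for the summand 1 in \<open>C + 1\<close>, and the next derivative for
  the order \<open>Suc k\<close>.\<close>

lemma jet_lipschitz:
  assumes "jet E F U D" "x \<in> U"
  obtains C where "1 \<le> C"
    "eventually (\<lambda>h. \<forall>hs\<in>lists (pts E). length hs \<le> k \<longrightarrow>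
           nrm F (D hs (x + h) - D hs x) \<le> C * nrm E h * npr E hs) (near E U x)"
proof -
  obtain C where C: "1 \<le> C"
    "\<And>hs. hs \<in> lists (pts E) \<Longrightarrow> length hs \<le> Suc k \<Longrightarrow> nrm F (D hs x) \<le> C * npr E hs"
    using jet_bdd[OF assms, of "Suc k"] by blast
  show ?thesis
  proof (rule that[of "C + 1"])
    show "eventually (\<lambda>h. \<forall>hs\<in>lists (pts E). length hs \<le> k \<longrightarrow>
           nrm F (D hs (x + h) - D hs x) \<le> (C + 1) * nrm E h * npr E hs) (near E U x)"
      using jet_deriv[OF assms zero_less_one, of k] eventually_near_less[OF zero_less_one]
    proof eventually_elim
      case (elim h)
      show ?case
      proof (intro ballI impI)
        fix hs assume hs: "hs \<in> lists (pts E)" "length hs \<le> k"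
        have p: "D hs (x + h) \<in> pts F" "D hs x \<in> pts F" "D (h # hs) x \<in> pts F"
          using hs elim assms by (auto intro!: jet_pts[OF assms(1)])
        have "nrm F (D hs (x + h) - D hs x) \<le> nrm F (D hs (x + h) - D hs x - D (h # hs) x) + nrm F (D (h # hs) x)"
          using F.nrm_triangle[of "D hs (x + h) - D hs x - D (h # hs) x" "D (h # hs) x"] p by simp
        also have "\<dots> \<le> 1 * nrm E h * npr E hs + C * npr E (h # hs)"
          using elim hs by (intro add_mono C) auto
        finally show "nrm F (D hs (x + h) - D hs x) \<le> (C + 1) * nrm E h * npr E hs"
          by (simp add: algebra_simps)
      qed
    qed
  qed (use C in auto)
qed

lemma jet_bdd_near:
  assumes "jet E F U D" "x \<in> U"
  obtains C where "1 \<le> C"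
    "eventually (\<lambda>h. \<forall>hs\<in>lists (pts E). length hs \<le> k \<longrightarrow> nrm F (D hs (x + h)) \<le> C * npr E hs) (near E U x)"
proof -
  obtain C where C: "1 \<le> C"
    "\<And>hs. hs \<in> lists (pts E) \<Longrightarrow> length hs \<le> k \<Longrightarrow> nrm F (D hs x) \<le> C * npr E hs"
    using jet_bdd[OF assms, of k] by blast
  obtain C' where C': "1 \<le> C'" "eventually (\<lambda>h. \<forall>hs\<in>lists (pts E). length hs \<le> k \<longrightarrow>
           nrm F (D hs (x + h) - D hs x) \<le> C' * nrm E h * npr E hs) (near E U x)"
    using jet_lipschitz[OF assms, of k] by blast
  show ?thesis
  proof (rule that[of "C + C'"])
    show "eventually (\<lambda>h. \<forall>hs\<in>lists (pts E). length hs \<le> k \<longrightarrow> nrm F (D hs (x + h)) \<le> (C + C') * npr E hs) (near E U x)"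
      using C'(2) eventually_near_less[OF zero_less_one]
    proof eventually_elim
      case (elim h)
      show ?case
      proof (intro ballI impI)
        fix hs assume hs: "hs \<in> lists (pts E)" "length hs \<le> k"
        have p: "D hs (x + h) \<in> pts F" "D hs x \<in> pts F"
          using hs elim assms by (auto intro!: jet_pts[OF assms(1)])
        have "nrm F (D hs (x + h)) \<le> nrm F (D hs (x + h) - D hs x) + nrm F (D hs x)"
          using F.nrm_triangle[of "D hs (x + h) - D hs x" "D hs x"] p by simp
        also have "\<dots> \<le> C' * nrm E h * npr E hs + C * npr E hs"
          by (rule add_mono[OF elim(1)[rule_format, OF hs] C(2)[OF hs]])
        also have "C' * nrm E h * npr E hs \<le> C' * 1 * npr E hs"
        proof (intro mult_right_mono mult_left_mono)
          show "nrm E h \<le> 1" using elim(2) by simp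
          show "0 \<le> C'" using C'(1) by simp
        qed (rule E.npr_nonneg[OF hs(1)])
        finally show "nrm F (D hs (x + h)) \<le> (C + C') * npr E hs"
          by (simp add: algebra_simps)
      qed
    qed
    show "1 \<le> C + C'" using C(1) C'(1) by simp
  qed
qed

end

section \<open>Velocities\<close>

lemma tendsto_0_squeeze:
  fixes f g :: "'a \<Rightarrow> real"
  assumes "(f \<longlongrightarrow> 0) F" "eventually (\<lambda>x. 0 \<le> g x \<and> g x \<le> f x) F"
  shows "(g \<longlongrightarrow> 0) F"
  using assms(2) by (intro tendsto_sandwich[OF _ _ tendsto_const assms(1)]) (auto elim: eventually_mono)

lemma has_velocity_cong:
  assumes "eventually (\<lambda>t. c t = d t) (at 0)" "c 0 = d 0" "has_velocity E c v"
  shows "has_velocity E d v"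
proof -
  have "((\<lambda>t. nrm E ((1 / t) *\<^sub>R (c t - c 0) - v)) \<longlongrightarrow> 0) (at 0)"
    using assms(3) by (simp add: has_velocity_def)
  moreover have "eventually (\<lambda>t. nrm E ((1 / t) *\<^sub>R (c t - c 0) - v) = nrm E ((1 / t) *\<^sub>R (d t - d 0) - v)) (at 0)"
    using assms(1) by eventually_elim (simp add: assms(2))
  ultimately have "((\<lambda>t. nrm E ((1 / t) *\<^sub>R (d t - d 0) - v)) \<longlongrightarrow> 0) (at 0)"
    by (rule Lim_transform_eventually)
  then show ?thesis
    using assms(3) by (simp add: has_velocity_def)
qed

context nspace
begin

lemma has_velocity_unique:
  assumes "has_velocity E c v" "has_velocity E c w"
    and "eventually (\<lambda>t. c t \<in> pts E) (at 0)" "c 0 \<in> pts E"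
  shows "v = w"
proof -
  have vw: "v \<in> pts E" "w \<in> pts E"
    using assms by (auto simp: has_velocity_def)
  have "((\<lambda>t. nrm E ((1 / t) *\<^sub>R (c t - c 0) - v) + nrm E ((1 / t) *\<^sub>R (c t - c 0) - w)) \<longlongrightarrow> 0 + 0) (at 0)"
    using assms unfolding has_velocity_def by (intro tendsto_add) auto
  moreover have "eventually (\<lambda>t. nrm E (v - w) \<le> nrm E ((1 / t) *\<^sub>R (c t - c 0) - v) + nrm E ((1 / t) *\<^sub>R (c t - c 0) - w)) (at 0)"
    using assms(3)
  proof eventually_elim
    case (elim t)
    show ?case
      using nrm_diff_le[of "(1 / t) *\<^sub>R (c t - c 0) - w" "(1 / t) *\<^sub>R (c t - c 0) - v"] elim assms(4) vw
      by simp
  qed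
  ultimately have "nrm E (v - w) \<le> 0 + 0"
    by (intro tendsto_lowerbound) auto
  then have "nrm E (v - w) = 0"
    using nrm_nonneg[of "v - w"] pts_diff[OF vw] by linarith
  then show ?thesis
    using nrm_eq_0D[of "v - w"] vw by simp
qed

text \<open>A velocity at 0 says nothing about other times, yet it makes the curve Lipschitz at 0.
  This is the continuity behind all later statements that a curve stays in an open set for small
  times.\<close>

lemma has_velocity_bound:
  assumes "has_velocity E c v" "eventually (\<lambda>t. c t \<in> pts E) (at 0)" "c 0 \<in> pts E"
  shows "eventually (\<lambda>t. nrm E (c t - c 0) \<le> (nrm E v + 1) * \<bar>t\<bar>) (at 0)"
proof -
  have v: "v \<in> pts E"
    using assms by (auto simp: has_velocity_def)
  have "eventually (\<lambda>t. nrm E ((1 / t) *\<^sub>R (c t - c 0) - v) < 1) (at 0)"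
    using assms(1) unfolding has_velocity_def by (intro order_tendstoD) auto
  then show ?thesis
    using assms(2) eventually_neq_at_within[of 0 0 UNIV]
  proof eventually_elim
    case (elim t)
    have "c t - c 0 = t *\<^sub>R ((1 / t) *\<^sub>R (c t - c 0) - v) + t *\<^sub>R v"
      using elim by (simp add: algebra_simps)
    also have "nrm E \<dots> \<le> \<bar>t\<bar> * nrm E ((1 / t) *\<^sub>R (c t - c 0) - v) + \<bar>t\<bar> * nrm E v"
      using elim v assms(3) by (metis nrm_triangle nrm_scale pts_diff pts_scale)
    also have "\<dots> \<le> \<bar>t\<bar> * 1 + \<bar>t\<bar> * nrm E v"
      using elim by (intro add_mono mult_left_mono) auto
    finally show ?case by (simp add: algebra_simps)
  qed
qed

lemma has_velocity_small:
  assumes "has_velocity E c v" "eventually (\<lambda>t. c t \<in> pts E) (at 0)" "c 0 \<in> pts E" "0 < \<delta>"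
  shows "eventually (\<lambda>t. nrm E (c t - c 0) < \<delta>) (at 0)"
proof -
  have v: "0 \<le> nrm E v"
    using assms by (auto simp: has_velocity_def)
  have "((\<lambda>t. (nrm E v + 1) * \<bar>t\<bar>) \<longlongrightarrow> (nrm E v + 1) * \<bar>0\<bar>) (at 0)"
    by (intro tendsto_intros)
  then have "eventually (\<lambda>t. (nrm E v + 1) * \<bar>t\<bar> < \<delta>) (at 0)"
    using assms by (intro order_tendstoD) auto
  with has_velocity_bound[OF assms(1-3)] show ?thesis
    by eventually_elim auto
qed

lemma has_velocity_add:
  assumes "has_velocity E c v" "has_velocity E d w"
    and "eventually (\<lambda>t. c t \<in> pts E) (at 0)" "c 0 \<in> pts E"
    and "eventually (\<lambda>t. d t \<in> pts E) (at 0)" "d 0 \<in> pts E"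
  shows "has_velocity E (\<lambda>t. c t + d t) (v + w)"
proof -
  have vw: "v \<in> pts E" "w \<in> pts E"
    using assms by (auto simp: has_velocity_def)
  have "((\<lambda>t. nrm E ((1 / t) *\<^sub>R (c t - c 0) - v) + nrm E ((1 / t) *\<^sub>R (d t - d 0) - w)) \<longlongrightarrow> 0) (at 0)"
    using assms unfolding has_velocity_def by (intro tendsto_add_zero) auto
  moreover have "eventually (\<lambda>t. 0 \<le> nrm E ((1 / t) *\<^sub>R (c t + d t - (c 0 + d 0)) - (v + w)) \<and>
      nrm E ((1 / t) *\<^sub>R (c t + d t - (c 0 + d 0)) - (v + w))
      \<le> nrm E ((1 / t) *\<^sub>R (c t - c 0) - v) + nrm E ((1 / t) *\<^sub>R (d t - d 0) - w)) (at 0)"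
    using assms(3,5)
  proof eventually_elim
    case (elim t)
    have *: "(1 / t) *\<^sub>R (c t + d t - (c 0 + d 0)) - (v + w)
        = ((1 / t) *\<^sub>R (c t - c 0) - v) + ((1 / t) *\<^sub>R (d t - d 0) - w)"
      by (simp add: algebra_simps)
    have "(1 / t) *\<^sub>R (c t - c 0) - v \<in> pts E" "(1 / t) *\<^sub>R (d t - d 0) - w \<in> pts E"
      using elim vw assms(4,6) by auto
    then show ?case
      unfolding * by (auto intro: nrm_triangle)
  qed
  ultimately have "((\<lambda>t. nrm E ((1 / t) *\<^sub>R (c t + d t - (c 0 + d 0)) - (v + w))) \<longlongrightarrow> 0) (at 0)"
    by (rule tendsto_0_squeeze)
  then show ?thesis
    using vw by (simp add: has_velocity_def)
qed

lemma has_velocity_scale: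
  assumes "has_velocity E c v"
    and "eventually (\<lambda>t. c t \<in> pts E) (at 0)" "c 0 \<in> pts E"
  shows "has_velocity E (\<lambda>t. r *\<^sub>R c t) (r *\<^sub>R v)"
proof -
  have v: "v \<in> pts E"
    using assms by (auto simp: has_velocity_def)
  have "((\<lambda>t. \<bar>r\<bar> * nrm E ((1 / t) *\<^sub>R (c t - c 0) - v)) \<longlongrightarrow> \<bar>r\<bar> * 0) (at 0)"
    using assms unfolding has_velocity_def by (intro tendsto_mult) auto
  moreover have "eventually (\<lambda>t. \<bar>r\<bar> * nrm E ((1 / t) *\<^sub>R (c t - c 0) - v)
      = nrm E ((1 / t) *\<^sub>R (r *\<^sub>R c t - r *\<^sub>R c 0) - r *\<^sub>R v)) (at 0)"
    using assms(2)
  proof eventually_elim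
    case (elim t)
    have "(1 / t) *\<^sub>R (r *\<^sub>R c t - r *\<^sub>R c 0) - r *\<^sub>R v = r *\<^sub>R ((1 / t) *\<^sub>R (c t - c 0) - v)"
      by (simp add: algebra_simps)
    then show ?case
      using elim v assms(3) by (simp add: nrm_scale)
  qed
  ultimately have "((\<lambda>t. nrm E ((1 / t) *\<^sub>R (r *\<^sub>R c t - r *\<^sub>R c 0) - r *\<^sub>R v)) \<longlongrightarrow> 0) (at 0)"
    by (simp add: Lim_transform_eventually)
  then show ?thesis
    using v by (simp add: has_velocity_def)
qed

lemma has_velocity_line:
  assumes "h \<in> pts E"
  shows "has_velocity E (\<lambda>t. x + t *\<^sub>R h) h"
proof -
  have "eventually (\<lambda>t. nrm E ((1 / t) *\<^sub>R (x + t *\<^sub>R h - (x + 0 *\<^sub>R h)) - h) = 0) (at 0)"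
    unfolding eventually_at_filter by (rule always_eventually) simp
  then show ?thesis
    using assms by (simp add: has_velocity_def tendsto_eventually)
qed

lemma nopen_pts: "nopen E (pts E)"
  unfolding nopen_def by (auto intro: exI[of _ 1])

lemma eventually_in_nopen:
  assumes "has_velocity E c v" "eventually (\<lambda>t. c t \<in> pts E) (at 0)" "nopen E U" "c 0 \<in> U"
  shows "eventually (\<lambda>t. c t \<in> U) (at 0)"
proof -
  obtain \<delta> where \<delta>: "\<delta> > 0" "\<forall>y\<in>pts E. nrm E (y - c 0) < \<delta> \<longrightarrow> y \<in> U"
    using assms unfolding nopen_def by blast
  have "c 0 \<in> pts E"
    using assms unfolding nopen_def by blast
  from has_velocity_small[OF assms(1,2) this \<delta>(1)] assms(2) show ?thesis
  proof eventually_elim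
    case (elim t)
    then show ?case
      using \<delta>(2) by simp
  qed
qed

lemma eventually_near_velocity:
  assumes "has_velocity E c v" "eventually (\<lambda>t. c t \<in> pts E) (at 0)" "c 0 \<in> pts E"
    and "eventually (\<lambda>t. c t \<in> U) (at 0)" "eventually P (near E U (c 0))"
  shows "eventually (\<lambda>t. P (c t - c 0)) (at 0)"
proof -
  obtain \<delta> where "\<delta> > 0" "\<forall>h\<in>pts E. nrm E h < \<delta> \<longrightarrow> c 0 + h \<in> U \<longrightarrow> P h"
    using assms(5) unfolding eventually_near by blast
  note \<delta> = this
  show ?thesis
    using has_velocity_small[OF assms(1,2,3) \<delta>(1)] assms(2,4)
  proof eventually_elim
    case (elim t)
    then show ?case
      using \<delta>(2) assms(3) by simp
  qed
qed

end

context nspace2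
begin

text \<open>The chain rule for curves that are differentiable at 0 only. With
  \<open>h = c t - c 0\<close> the difference quotient splits into the remainder of the jet at
  \<open>h\<close>, divided by \<open>t\<close> and controlled by the speed bound, and the
  derivative applied to the error \<open>h / t - v\<close>.\<close>

lemma jet_velocity:
  assumes D: "jet E F U D" and c: "has_velocity E c v" "eventually (\<lambda>t. c t \<in> pts E) (at 0)" "c 0 \<in> pts E"
    and U: "eventually (\<lambda>t. c t \<in> U) (at 0)" "c 0 \<in> U" and hs: "hs \<in> lists (pts E)"
  shows "has_velocity F (\<lambda>t. D hs (c t)) (D (v # hs) (c 0))"
proof -
  have v: "v \<in> pts E"
    using c by (simp add: has_velocity_def)
  obtain C where C: "1 \<le> C"
    "\<And>hs'. hs' \<in> lists (pts E) \<Longrightarrow> length hs' \<le> Suc (length hs) \<Longrightarrow> nrm F (D hs' (c 0)) \<le> C * npr E hs'"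
    using jet_bdd[OF D U(2), of "Suc (length hs)"] by blast
  define P where "P = npr E hs"
  have P: "0 \<le> P" unfolding P_def by (rule E.npr_nonneg[OF hs])
  have "((\<lambda>t. nrm F ((1 / t) *\<^sub>R (D hs (c t) - D hs (c 0)) - D (v # hs) (c 0))) \<longlongrightarrow> 0) (at 0)"
  proof (rule tendstoI, simp only: dist_real_def diff_0_right)
    fix e :: real assume e: "e > 0"
    \<comment> \<open>\<open>\<epsilon>\<close> and \<open>\<epsilon>2\<close> give each of the two
      error terms at most \<open>e / 2 * (P / (P + 1))\<close>; the summands 1 prevent division by
      zero and make the total strictly less than \<open>e\<close>.\<close>
    define \<epsilon> where "\<epsilon> = e / (2 * (nrm E v + 1) * (P + 1))"
    have v0: "0 \<le> nrm E v" using v by simp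
    have \<epsilon>: "\<epsilon> > 0" unfolding \<epsilon>_def using e v0 P by (intro divide_pos_pos mult_pos_pos) auto
    define \<epsilon>2 where "\<epsilon>2 = e / (2 * C * (P + 1))"
    have \<epsilon>2: "\<epsilon>2 > 0" unfolding \<epsilon>2_def using e C P by (intro divide_pos_pos mult_pos_pos) auto
    have "eventually (\<lambda>t. nrm E ((1 / t) *\<^sub>R (c t - c 0) - v) < \<epsilon>2) (at 0)"
      using c \<epsilon>2 unfolding has_velocity_def by (intro order_tendstoD) auto
    with E.eventually_near_velocity[OF c U(1) jet_deriv[OF D U(2) \<epsilon>, of "length hs"]]
      E.has_velocity_bound[OF c] c(2) U(1)
      eventually_neq_at_within[of 0 0 UNIV]
    show "eventually (\<lambda>t. \<bar>nrm F ((1 / t) *\<^sub>R (D hs (c t) - D hs (c 0)) - D (v # hs) (c 0))\<bar> < e) (at 0)"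
    proof eventually_elim
      case (elim t)
      define h where "h = c t - c 0"
      define w where "w = (1 / t) *\<^sub>R h - v"
      have h: "h \<in> pts E" "c 0 + h = c t" and w: "w \<in> pts E"
        using elim(3) c(3) v by (auto simp: h_def w_def)
      have p: "D hs (c t) \<in> pts F" "D hs (c 0) \<in> pts F" "D (h # hs) (c 0) \<in> pts F" "D (w # hs) (c 0) \<in> pts F"
        using hs h w elim(4) U(2) by (auto intro!: jet_pts[OF D])
      have lin: "D (((1 / t) *\<^sub>R h + (-1) *\<^sub>R v) # hs) (c 0) = (1 / t) *\<^sub>R D (h # hs) (c 0) - D (v # hs) (c 0)"
        using jet_lin[OF D U(2) hs h(1) E.pts_scale[OF v], of "1 / t" "-1"]
          jet_lin[OF D U(2) hs v E.pts_zero, of "-1"] jet_lin_zero[OF D U(2) hs] by simp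
      have "(1 / t) *\<^sub>R (D hs (c t) - D hs (c 0)) - D (v # hs) (c 0)
          = (1 / t) *\<^sub>R (D hs (c t) - D hs (c 0) - D (h # hs) (c 0)) + D (w # hs) (c 0)"
        using lin by (simp add: w_def algebra_simps)
      also have "nrm F \<dots> \<le> \<bar>1 / t\<bar> * nrm F (D hs (c t) - D hs (c 0) - D (h # hs) (c 0)) + nrm F (D (w # hs) (c 0))"
        using p by (intro order_trans[OF F.nrm_triangle]) (auto simp: F.nrm_scale)
      also have "\<dots> \<le> \<bar>1 / t\<bar> * (\<epsilon> * ((nrm E v + 1) * \<bar>t\<bar>) * P) + C * (\<epsilon>2 * P)"
      proof (rule add_mono[OF mult_left_mono[OF _ abs_ge_zero]])
        have "nrm F (D hs (c t) - D hs (c 0) - D (h # hs) (c 0)) \<le> \<epsilon> * nrm E h * P"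
          using elim(1)[rule_format, OF hs order.refl] unfolding P_def h_def[symmetric] h(2) .
        also have "\<dots> \<le> \<epsilon> * ((nrm E v + 1) * \<bar>t\<bar>) * P"
          by (rule mult_right_mono[OF mult_left_mono[OF elim(2)[folded h_def] less_imp_le[OF \<epsilon>]] P])
        finally show "nrm F (D hs (c t) - D hs (c 0) - D (h # hs) (c 0)) \<le> \<epsilon> * ((nrm E v + 1) * \<bar>t\<bar>) * P" .
        have "nrm F (D (w # hs) (c 0)) \<le> C * npr E (w # hs)"
          by (rule C(2)) (simp_all add: w hs del: in_lists_conv_set)
        also have "\<dots> \<le> C * (\<epsilon>2 * P)"
        proof -
          have "nrm E w \<le> \<epsilon>2" unfolding w_def h_def by (rule less_imp_le[OF elim(6)])
          then have "nrm E w * P \<le> \<epsilon>2 * P" using P by (rule mult_right_mono)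
          then show ?thesis unfolding list.map prod_list.Cons P_def[symmetric]
            by (rule mult_left_mono) (use C(1) in linarith)
        qed
        finally show "nrm F (D (w # hs) (c 0)) \<le> C * (\<epsilon>2 * P)" .
      qed
      also have "\<dots> = e / 2 * (P / (P + 1)) + e / 2 * (P / (P + 1))"
      proof -
        have "\<epsilon> * (nrm E v + 1) = e / (2 * (P + 1))" "C * \<epsilon>2 = e / (2 * (P + 1))"
        proof -
          have "e / (2 * V * Q) * V = e / (2 * Q)" if "V \<noteq> 0" for V Q :: real
            using that by simp
          from this[of "nrm E v + 1" "P + 1"] v0 show "\<epsilon> * (nrm E v + 1) = e / (2 * (P + 1))"
            by (simp only: \<epsilon>_def)
          show "C * \<epsilon>2 = e / (2 * (P + 1))"
            using C(1) by (simp add: \<epsilon>2_def)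
        qed
        moreover have "\<bar>1 / t\<bar> * \<bar>t\<bar> = 1"
          using elim(5) by (simp add: abs_mult[symmetric])
        moreover have "\<bar>1 / t\<bar> * (\<epsilon> * ((nrm E v + 1) * \<bar>t\<bar>) * P) + C * (\<epsilon>2 * P)
            = (\<bar>1 / t\<bar> * \<bar>t\<bar>) * (\<epsilon> * (nrm E v + 1)) * P + (C * \<epsilon>2) * P"
          by (simp only: ac_simps)
        ultimately show ?thesis
          by (simp only: mult_1_left times_divide_eq_left times_divide_eq_right divide_divide_eq_left)
      qed
      also have "\<dots> < e"
      proof -
        have "P / (P + 1) < 1" using P by simp
        then have "e * (P / (P + 1)) < e * 1" using e by (intro mult_strict_left_mono) auto
        moreover have "e / 2 * y + e / 2 * y = e * y" for y :: real by simp
        ultimately show ?thesis by (simp only: mult_1_right)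
      qed
      finally show ?case
      proof (subst abs_of_nonneg)
        have "D (v # hs) (c 0) \<in> pts F" by (rule jet_pts[OF D U(2)]) (use hs v in auto)
        then show "0 \<le> nrm F ((1 / t) *\<^sub>R (D hs (c t) - D hs (c 0)) - D (v # hs) (c 0))"
          using p by (intro F.nrm_nonneg F.pts_diff F.pts_scale)
      qed
    qed
  qed
  then show ?thesis
    using v hs U by (auto simp: has_velocity_def intro!: jet_pts[OF D])
qed

text \<open>Induction on the directions taken after the slot in question: the identity already known
  on all of \<open>U\<close> is differentiated along the line through \<open>x\<close> in direction
  \<open>p\<close>, and uniqueness of velocities equates the two sides.\<close>

lemma jet_multilinear:
  assumes D: "jet E F U D" and U: "nopen E U" and "x \<in> U"
    and "us \<in> lists (pts E)" "vs \<in> lists (pts E)" "h \<in> pts E" "h' \<in> pts E"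
  shows "D (us @ (r *\<^sub>R h + h') # vs) x = r *\<^sub>R D (us @ h # vs) x + D (us @ h' # vs) x"
  using assms(3-)
proof (induction us arbitrary: x)
  case Nil
  then show ?case using jet_lin[OF D] by simp
next
  case (Cons p us)
  define c where "c = (\<lambda>t. x + t *\<^sub>R p)"
  have x: "x \<in> pts E" using Cons.prems(1) U by (auto simp: nopen_def)
  have p: "p \<in> pts E" "us \<in> lists (pts E)" using Cons.prems(2) by auto
  have c: "has_velocity E c p" "eventually (\<lambda>t. c t \<in> pts E) (at 0)" "c 0 = x"
    using x p by (auto simp: c_def intro: E.has_velocity_line)
  have cU: "eventually (\<lambda>t. c t \<in> U) (at 0)"
    using E.eventually_in_nopen[OF c(1,2) U] c(3) Cons.prems(1) by simp
  have vel: "has_velocity F (\<lambda>t. D hs (c t)) (D (p # hs) x)"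
    and ev: "eventually (\<lambda>t. D hs (c t) \<in> pts F) (at 0)" "D hs (c 0) \<in> pts F"
    if "hs \<in> lists (pts E)" for hs
  proof -
    show "has_velocity F (\<lambda>t. D hs (c t)) (D (p # hs) x)"
      using jet_velocity[OF D c(1,2) _ cU _ that] x Cons.prems(1) c(3) by simp
    show "eventually (\<lambda>t. D hs (c t) \<in> pts F) (at 0)"
      using cU by eventually_elim (rule jet_pts[OF D _ that])
    show "D hs (c 0) \<in> pts F"
      using jet_pts[OF D _ that] Cons.prems(1) c(3) by simp
  qed
  have IH: "D (us @ (r *\<^sub>R h + h') # vs) y = r *\<^sub>R D (us @ h # vs) y + D (us @ h' # vs) y" if "y \<in> U" for y
    by (rule Cons.IH[OF that p(2) Cons.prems(3-5)])
  let ?a = "us @ (r *\<^sub>R h + h') # vs" and ?b = "us @ h # vs" and ?c = "us @ h' # vs"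
  have L: "?a \<in> lists (pts E)" "?b \<in> lists (pts E)" "?c \<in> lists (pts E)"
    using p Cons.prems by auto
  have "has_velocity F (\<lambda>t. r *\<^sub>R D ?b (c t) + D ?c (c t)) (r *\<^sub>R D (p # ?b) x + D (p # ?c) x)"
    by (rule F.has_velocity_add[OF F.has_velocity_scale[OF vel[OF L(2)] ev[OF L(2)]] vel[OF L(3)]
          eventually_mono[OF ev(1)[OF L(2)] F.pts_scale] F.pts_scale[OF ev(2)[OF L(2)]] ev[OF L(3)]])
  moreover have "eventually (\<lambda>t. r *\<^sub>R D ?b (c t) + D ?c (c t) = D ?a (c t)) (at 0)"
    using cU by eventually_elim (rule IH[symmetric])
  moreover have "r *\<^sub>R D ?b (c 0) + D ?c (c 0) = D ?a (c 0)"
    using Cons.prems(1) c(3) by (intro IH[symmetric]) simp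
  ultimately have "has_velocity F (\<lambda>t. D ?a (c t)) (r *\<^sub>R D (p # ?b) x + D (p # ?c) x)"
    by (rule has_velocity_cong[rotated 2])
  from F.has_velocity_unique[OF vel[OF L(1)] this ev[OF L(1)]] show ?case
    by (simp only: append_Cons)
qed

end

section \<open>Composition of smooth maps\<close>

definition mlin :: "'v::real_vector nsp \<Rightarrow> 'w::real_vector nsp \<Rightarrow> nat \<Rightarrow> real \<Rightarrow> ('v list \<Rightarrow> 'w) \<Rightarrow> bool" where
  "mlin F G m C N \<longleftrightarrow> 0 \<le> C \<and>
     (\<forall>zs\<in>lists (pts F). length zs = m \<longrightarrow> N zs \<in> pts G \<and> nrm G (N zs) \<le> C * npr F zs) \<and>
     (\<forall>us\<in>lists (pts F). \<forall>vs\<in>lists (pts F). \<forall>z\<in>pts F. \<forall>z'\<in>pts F. \<forall>r. Suc (length us + length vs) = m \<longrightarrow>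
        N (us @ (r *\<^sub>R z + z') # vs) = r *\<^sub>R N (us @ z # vs) + N (us @ z' # vs))"

text \<open>The derivative of a multilinear map: a pair \<open>(z, l)\<close> consists of an argument and its increment.\<close>

fun slot_sum :: "('w list \<Rightarrow> 'u::real_vector) \<Rightarrow> ('w \<times> 'w) list \<Rightarrow> 'u" where
  "slot_sum N [] = 0"
| "slot_sum N ((z, l) # ps) = N (l # map fst ps) + slot_sum (\<lambda>ws. N (z # ws)) ps"

lemma slot_sum_diff: "slot_sum (\<lambda>ws. N ws - M ws) ps = slot_sum N ps - slot_sum M ps"
  by (induction ps arbitrary: N M) auto

lemma lists_map_fst: "ps \<in> lists (A \<times> B) \<Longrightarrow> map fst ps \<in> lists A"
  by (induction ps) auto

lemma (in nspace) npr_map_le: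
  assumes "\<And>x. x \<in> set xs \<Longrightarrow> z x \<in> pts E \<and> nrm E (z x) \<le> \<beta> x"
  shows "npr E (map z xs) \<le> prod_list (map \<beta> xs)" "0 \<le> prod_list (map \<beta> xs)"
proof -
  have "npr E (map z xs) \<le> prod_list (map \<beta> xs) \<and> 0 \<le> prod_list (map \<beta> xs)"
    using assms
  proof (induction xs)
    case (Cons x xs)
    have x: "z x \<in> pts E" "nrm E (z x) \<le> \<beta> x"
      using Cons.prems by auto
    have IH: "npr E (map z xs) \<le> prod_list (map \<beta> xs)" "0 \<le> prod_list (map \<beta> xs)"
      using Cons by auto
    have n: "0 \<le> npr E (map z xs)"
      using Cons.prems by (intro npr_nonneg) auto
    have b: "0 \<le> \<beta> x"
      by (rule order_trans[OF nrm_nonneg[OF x(1)] x(2)])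
    show ?case
      using mult_mono[OF x(2) IH(1) b n] mult_nonneg_nonneg[OF b IH(2)] by simp
  qed simp
  then show "npr E (map z xs) \<le> prod_list (map \<beta> xs)" "0 \<le> prod_list (map \<beta> xs)"
    by auto
qed

context nspace2
begin

lemma mlin_nonneg: "mlin E F m C N \<Longrightarrow> 0 \<le> C"
  unfolding mlin_def by (elim conjE)

lemma mlin_pts: "mlin E F m C N \<Longrightarrow> zs \<in> lists (pts E) \<Longrightarrow> length zs = m \<Longrightarrow> N zs \<in> pts F"
  and mlin_le: "mlin E F m C N \<Longrightarrow> zs \<in> lists (pts E) \<Longrightarrow> length zs = m \<Longrightarrow> nrm F (N zs) \<le> C * npr E zs"
  unfolding mlin_def by blast+

lemma mlin_lin:
  "mlin E F m C N \<Longrightarrow> us \<in> lists (pts E) \<Longrightarrow> vs \<in> lists (pts E) \<Longrightarrow> z \<in> pts E \<Longrightarrow> z' \<in> pts E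
    \<Longrightarrow> Suc (length us + length vs) = m
    \<Longrightarrow> N (us @ (r *\<^sub>R z + z') # vs) = r *\<^sub>R N (us @ z # vs) + N (us @ z' # vs)"
  unfolding mlin_def by blast

lemma mlin_Cons:
  assumes N: "mlin E F (Suc m) C N" and z: "z \<in> pts E" "nrm E z \<le> b"
  shows "mlin E F m (C * b) (\<lambda>ws. N (z # ws))"
  unfolding mlin_def
proof (intro conjI ballI allI impI)
  show "0 \<le> C * b"
    using mlin_nonneg[OF N] order_trans[OF E.nrm_nonneg[OF z(1)] z(2)] by simp
  fix zs assume zs: "zs \<in> lists (pts E)" "length zs = m"
  show "N (z # zs) \<in> pts F"
    using zs z by (intro mlin_pts[OF N]) auto
  have "nrm F (N (z # zs)) \<le> C * npr E (z # zs)"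
    using zs z by (intro mlin_le[OF N]) auto
  also have "\<dots> = (C * nrm E z) * npr E zs"
    by simp
  also have "\<dots> \<le> (C * b) * npr E zs"
    using z mlin_nonneg[OF N] E.npr_nonneg[OF zs(1)] by (intro mult_right_mono mult_left_mono)
  finally show "nrm F (N (z # zs)) \<le> C * b * npr E zs" .
next
  fix us vs y y' and r :: real assume *: "us \<in> lists (pts E)" "vs \<in> lists (pts E)" "y \<in> pts E" "y' \<in> pts E"
    "Suc (length us + length vs) = m"
  show "N (z # us @ (r *\<^sub>R y + y') # vs) = r *\<^sub>R N (z # us @ y # vs) + N (z # us @ y' # vs)"
    using mlin_lin[OF N, of "z # us" vs y y'] * z by simp
qed

lemma mlin_head_diff:
  assumes N: "mlin E F (Suc m) C N" and z: "z \<in> pts E" "z' \<in> pts E" and zs: "zs \<in> lists (pts E)" "length zs = m"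
  shows "N ((z - z') # zs) = N (z # zs) - N (z' # zs)"
  using mlin_lin[OF N, of "[]" zs "z - z'" z' 1] z zs by simp

lemma slot_sum_head_diff:
  assumes N: "mlin E F (Suc (length ps)) C N" and z: "z \<in> pts E" "z' \<in> pts E"
    and ps: "ps \<in> lists (pts E \<times> pts E)"
  shows "slot_sum (\<lambda>ws. N ((z - z') # ws)) ps = slot_sum (\<lambda>ws. N (z # ws)) ps - slot_sum (\<lambda>ws. N (z' # ws)) ps"
proof -
  \<comment> \<open>Only additivity in the head is kept for the induction, so that \<open>M\<close>
    may vary: the recursion of \<open>slot_sum\<close> fixes a further argument behind the
    head.\<close>
  have "slot_sum (\<lambda>ws. M ((z - z') # ws)) ps = slot_sum (\<lambda>ws. M (z # ws)) ps - slot_sum (\<lambda>ws. M (z' # ws)) ps"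
    if "\<And>ws. ws \<in> lists (pts E) \<Longrightarrow> length ws = length ps \<Longrightarrow> M ((z - z') # ws) = M (z # ws) - M (z' # ws)" for M
    using ps that
  proof (induction ps arbitrary: M rule: list.induct)
    case (Cons p ps)
    obtain y l where p: "p = (y, l)" by force
    have yl: "y \<in> pts E" "l \<in> pts E" and ps: "ps \<in> lists (pts E \<times> pts E)"
      using Cons.prems(1) p by auto
    have fs: "map fst ps \<in> lists (pts E)"
      using ps by (rule lists_map_fst)
    have "slot_sum (\<lambda>ws. M ((z - z') # y # ws)) ps = slot_sum (\<lambda>ws. M (z # y # ws)) ps - slot_sum (\<lambda>ws. M (z' # y # ws)) ps"
      \<comment> \<open>The argument \<open>y\<close> becomes fixed in second place, so the function
        handed to the induction hypothesis has to split its list into head and tail.\<close>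
      by (rule Cons.IH[OF ps, of "\<lambda>ws. M (hd ws # y # tl ws)", simplified])
        (use Cons.prems(2) yl in auto)
    moreover have "M ((z - z') # l # map fst ps) = M (z # l # map fst ps) - M (z' # l # map fst ps)"
      using Cons.prems(2)[of "l # map fst ps"] yl fs by simp
    ultimately show ?case
      by (simp add: p)
  qed simp
  then show ?thesis
    using mlin_head_diff[OF N z] by blast
qed

lemma slot_sum_pts:
  assumes "mlin E F (length ps) C N" "ps \<in> lists (pts E \<times> pts E)"
  shows "slot_sum N ps \<in> pts F"
  using assms
proof (induction ps arbitrary: N C)
  case (Cons p ps)
  obtain z l where p: "p = (z, l)" by force
  have zl: "z \<in> pts E" "l \<in> pts E" and ps: "ps \<in> lists (pts E \<times> pts E)"
    using Cons.prems(2) p by auto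
  note zl = zl ps lists_map_fst[OF ps]
  have "N (l # map fst ps) \<in> pts F"
    using zl by (intro mlin_pts[OF Cons.prems(1)]) auto
  moreover have "slot_sum (\<lambda>ws. N (z # ws)) ps \<in> pts F"
    using mlin_Cons[OF Cons.prems(1)[simplified] zl(1) order.refl] zl by (intro Cons.IH) auto
  ultimately show ?case
    by (simp add: p)
qed simp

text \<open>Each of the \<open>length xs\<close> summands has one argument replaced by its
  increment, which costs one factor \<eta>.\<close>

lemma slot_sum_le:
  assumes "mlin E F (length xs) C N" "0 \<le> \<eta>"
    and "\<And>x. x \<in> set xs \<Longrightarrow> z x \<in> pts E \<and> l x \<in> pts E \<and> nrm E (z x) \<le> \<beta> x \<and> nrm E (l x) \<le> \<eta> * \<beta> x"
  shows "nrm F (slot_sum N (map (\<lambda>x. (z x, l x)) xs)) \<le> real (length xs) * C * \<eta> * prod_list (map \<beta> xs)"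
  using assms
proof (induction xs arbitrary: N C)
  case (Cons x xs)
  let ?ps = "map (\<lambda>x. (z x, l x)) xs"
  have x: "z x \<in> pts E" "l x \<in> pts E" "nrm E (z x) \<le> \<beta> x" "nrm E (l x) \<le> \<eta> * \<beta> x"
    using Cons.prems(3) by auto
  have xs: "map z xs \<in> lists (pts E)"
    using Cons.prems(3) by auto
  have C: "0 \<le> C" using mlin_nonneg[OF Cons.prems(1)] .
  have \<beta>0: "0 \<le> \<beta> y" if "y \<in> set (x # xs)" for y
    using Cons.prems(3)[OF that] E.nrm_nonneg[of "z y"] by linarith
  have le: "npr E (map z xs) \<le> prod_list (map \<beta> xs)"
    using Cons.prems(3) by (intro E.npr_map_le) auto
  have 0: "0 \<le> prod_list (map \<beta> xs)"
    using Cons.prems(3) by (intro E.npr_map_le(2)[of _ z]) auto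
  note N' = mlin_Cons[OF Cons.prems(1)[simplified] x(1,3)]
  have "nrm F (slot_sum (\<lambda>ws. N (z x # ws)) ?ps) \<le> real (length xs) * (C * \<beta> x) * \<eta> * prod_list (map \<beta> xs)"
    using Cons.prems(3) by (intro Cons.IH N' Cons.prems(2)) auto
  moreover have "nrm F (N (l x # map z xs)) \<le> C * (\<eta> * \<beta> x * prod_list (map \<beta> xs))"
  proof -
    have "nrm F (N (l x # map z xs)) \<le> C * npr E (l x # map z xs)"
      using x xs by (intro mlin_le[OF Cons.prems(1)]) auto
    also have "\<dots> \<le> C * (\<eta> * \<beta> x * prod_list (map \<beta> xs))"
      unfolding list.map prod_list.Cons
      using C x \<beta>0[of x] Cons.prems(2) le E.npr_nonneg[OF xs] E.nrm_nonneg[OF x(2)]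
      by (intro mult_left_mono mult_mono) auto
    finally show ?thesis .
  qed
  moreover have "nrm F (N (l x # map z xs) + slot_sum (\<lambda>ws. N (z x # ws)) ?ps)
      \<le> nrm F (N (l x # map z xs)) + nrm F (slot_sum (\<lambda>ws. N (z x # ws)) ?ps)"
  proof (rule F.nrm_triangle)
    show "N (l x # map z xs) \<in> pts F"
      using x xs by (intro mlin_pts[OF Cons.prems(1)]) auto
    show "slot_sum (\<lambda>ws. N (z x # ws)) ?ps \<in> pts F"
      using N' Cons.prems(3) by (intro slot_sum_pts) auto
  qed
  ultimately show ?case
    by (simp add: o_def algebra_simps)
qed simp

text \<open>A quantitative product rule: \<open>u\<close> is the new argument, \<open>z\<close> the
  old one and \<open>l\<close> the linear increment, of relative size \<eta> and correct up to
  relative size \<epsilon> \<eta>. In the induction the head grows from \<open>\<beta>\<close> to at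
  most \<open>3 * \<beta>\<close>, whence a power of 4.\<close>

lemma mlin_product_rule:
  assumes "mlin E F (length xs) C N" "0 \<le> \<eta>" "\<eta> \<le> 1" "0 \<le> \<epsilon>" "\<epsilon> \<le> 1"
    and "\<And>x. x \<in> set xs \<Longrightarrow> u x \<in> pts E \<and> z x \<in> pts E \<and> l x \<in> pts E \<and> nrm E (z x) \<le> \<beta> x
       \<and> nrm E (l x) \<le> \<eta> * \<beta> x \<and> nrm E (u x - z x - l x) \<le> \<epsilon> * \<eta> * \<beta> x"
  shows "nrm F (N (map u xs) - N (map z xs) - slot_sum N (map (\<lambda>x. (z x, l x)) xs))
    \<le> C * 4 ^ length xs * (\<epsilon> + \<eta>) * \<eta> * prod_list (map \<beta> xs)"
  using assms(1,6)
proof (induction xs arbitrary: N C)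
  case Nil
  then show ?case
    using assms(2,4) mlin_nonneg[OF Nil(1)] by simp
next
  case (Cons x xs)
  let ?ps = "map (\<lambda>x. (z x, l x)) xs"
  define B where "B = prod_list (map \<beta> xs)"
  define m where "m = length xs"
  have x: "u x \<in> pts E" "z x \<in> pts E" "l x \<in> pts E" "nrm E (z x) \<le> \<beta> x" "nrm E (l x) \<le> \<eta> * \<beta> x"
      "nrm E (u x - z x - l x) \<le> \<epsilon> * \<eta> * \<beta> x"
    using Cons.prems(2) by auto
  have xs: "map z xs \<in> lists (pts E)" "map u xs \<in> lists (pts E)" "?ps \<in> lists (pts E \<times> pts E)"
    using Cons.prems(2) by auto
  have C: "0 \<le> C" using mlin_nonneg[OF Cons.prems(1)] .
  have \<beta>0: "0 \<le> \<beta> y" if "y \<in> set (x # xs)" for y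
    using Cons.prems(2)[OF that] E.nrm_nonneg[of "z y"] by linarith
  have le: "npr E (map z xs) \<le> B"
    unfolding B_def using Cons.prems(2) by (intro E.npr_map_le) auto
  have B: "0 \<le> B"
    unfolding B_def using Cons.prems(2) by (intro E.npr_map_le(2)[of _ z]) auto
  have \<beta>x: "0 \<le> \<beta> x" using \<beta>0 by simp
  have ux: "nrm E (u x - z x) \<le> 2 * (\<eta> * \<beta> x)"
  proof -
    have "nrm E (u x - z x) \<le> nrm E (u x - z x - l x) + nrm E (l x)"
      using E.nrm_triangle[of "u x - z x - l x" "l x"] x by simp
    also have "\<dots> \<le> \<epsilon> * (\<eta> * \<beta> x) + \<eta> * \<beta> x"
      using x by simp
    also have "\<epsilon> * (\<eta> * \<beta> x) \<le> 1 * (\<eta> * \<beta> x)"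
      using assms \<beta>x by (intro mult_right_mono) auto
    finally show ?thesis by simp
  qed
  have u3: "nrm E (u x) \<le> 3 * \<beta> x"
  proof -
    have "nrm E (u x) \<le> nrm E (u x - z x) + nrm E (z x)"
      using E.nrm_triangle[of "u x - z x" "z x"] x by simp
    also have "\<dots> \<le> 2 * (\<eta> * \<beta> x) + \<beta> x"
      using ux x by simp
    also have "\<eta> * \<beta> x \<le> 1 * \<beta> x"
      using assms \<beta>x by (intro mult_right_mono) auto
    finally show ?thesis by simp
  qed
  have sl: "mlin E F (Suc (length xs)) C N"
    using Cons.prems(1) by simp
  note Nu = mlin_Cons[OF sl x(1) u3]
  \<comment> \<open>The error splits at the head: \<open>e1\<close> is the error of the tail behind
    the new head, \<open>e2\<close> the remainder of the head increment, and \<open>e3\<close> the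
    second-order interaction of the change of the head with the linear increment of the
    tail.\<close>
  define e1 where "e1 = N (u x # map u xs) - N (u x # map z xs) - slot_sum (\<lambda>ws. N (u x # ws)) ?ps"
  define e2 where "e2 = N ((u x - z x - l x) # map z xs)"
  define e3 where "e3 = slot_sum (\<lambda>ws. N ((u x - z x) # ws)) ?ps"
  have e1: "nrm F e1 \<le> (C * (3 * \<beta> x)) * 4 ^ m * (\<epsilon> + \<eta>) * \<eta> * B"
    unfolding e1_def m_def B_def using Cons.prems(2) by (intro Cons.IH Nu) auto
  have e2: "nrm F e2 \<le> C * (\<epsilon> * \<eta> * \<beta> x * B)"
  proof -
    have "nrm F e2 \<le> C * npr E ((u x - z x - l x) # map z xs)"
      unfolding e2_def using x xs by (intro mlin_le[OF sl]) auto
    also have "\<dots> \<le> C * (\<epsilon> * \<eta> * \<beta> x * B)"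
      unfolding list.map prod_list.Cons
      using C x(6) \<beta>x assms le E.npr_nonneg[OF xs(1)] E.nrm_nonneg[OF x(2)]
      by (intro mult_left_mono mult_mono) auto
    finally show ?thesis .
  qed
  have e3: "nrm F e3 \<le> real m * (C * (2 * (\<eta> * \<beta> x))) * \<eta> * B"
    unfolding e3_def m_def B_def
    using Cons.prems(2) x assms(2) by (intro slot_sum_le mlin_Cons[OF sl _ ux]) auto
  have p: "e1 \<in> pts F" "e2 \<in> pts F" "e3 \<in> pts F"
    unfolding e1_def e2_def e3_def using x xs
    by (auto simp del: in_lists_conv_set simp add: length_map
        intro!: F.pts_diff mlin_pts[OF sl] slot_sum_pts mlin_Cons[OF sl] E.pts_diff)
  have "N (map u (x # xs)) - N (map z (x # xs)) - slot_sum N (map (\<lambda>x. (z x, l x)) (x # xs)) = e1 + e2 + e3"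
  proof -
    have "e2 = N (u x # map z xs) - N (z x # map z xs) - N (l x # map z xs)"
      unfolding e2_def using x xs mlin_head_diff[OF sl] by simp
    moreover have "e3 = slot_sum (\<lambda>ws. N (u x # ws)) ?ps - slot_sum (\<lambda>ws. N (z x # ws)) ?ps"
      unfolding e3_def using x xs sl by (intro slot_sum_head_diff) auto
    ultimately show ?thesis
      by (simp add: e1_def o_def)
  qed
  also have "nrm F (e1 + e2 + e3) \<le> nrm F e1 + nrm F e2 + nrm F e3"
    using F.nrm_triangle[of "e1 + e2" e3] F.nrm_triangle[of e1 e2] p by simp
  also have "\<dots> \<le> (C * (3 * \<beta> x)) * 4 ^ m * (\<epsilon> + \<eta>) * \<eta> * B + C * (\<epsilon> * \<eta> * \<beta> x * B)
      + real m * (C * (2 * (\<eta> * \<beta> x))) * \<eta> * B"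
    using e1 e2 e3 by simp
  also have "\<dots> = (C * \<beta> x * \<eta> * B) * (3 * 4 ^ m * (\<epsilon> + \<eta>) + \<epsilon> + 2 * real m * \<eta>)"
    by (simp add: algebra_simps)
  also have "\<dots> \<le> (C * \<beta> x * \<eta> * B) * (4 * 4 ^ m * (\<epsilon> + \<eta>))"
  proof (rule mult_left_mono)
    \<comment> \<open>Three quarters of \<open>4 * 4 ^ m\<close> are used by \<open>e1\<close>; the
      last quarter absorbs \<open>e2\<close> and \<open>e3\<close>, as 1 and \<open>2 * m\<close>
      are both at most \<open>4 ^ m\<close>.\<close>
    have 2: "2 * real m \<le> 4 ^ m"
    proof (induction m)
      case (Suc m)
      have "2 * real (Suc m) = 2 * real m + 2 * 1" by simp
      also have "\<dots> \<le> 4 ^ m + 2 * 4 ^ m" by (intro add_mono Suc mult_left_mono) auto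
      also have "\<dots> \<le> 4 ^ Suc m" by simp
      finally show ?case .
    qed simp
    have "2 * real m * \<eta> \<le> 4 ^ m * \<eta>"
      by (rule mult_right_mono[OF 2 assms(2)])
    moreover have "1 * \<epsilon> \<le> 4 ^ m * \<epsilon>"
      by (rule mult_right_mono[OF _ assms(4)]) simp
    ultimately show "3 * 4 ^ m * (\<epsilon> + \<eta>) + \<epsilon> + 2 * real m * \<eta> \<le> 4 * 4 ^ m * (\<epsilon> + \<eta>)"
      by (simp add: algebra_simps)
    show "0 \<le> C * \<beta> x * \<eta> * B"
      using C \<beta>x assms B by simp
  qed
  finally show ?case
    by (simp add: m_def B_def mult_ac)
qed

lemma slot_sum_lin:
  assumes "mlin E F (length xs) C N" 
    and "\<And>x. x \<in> set xs \<Longrightarrow> z x \<in> pts E \<and> l x \<in> pts E \<and> l' x \<in> pts E"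
  shows "slot_sum N (map (\<lambda>x. (z x, r *\<^sub>R l x + l' x)) xs)
    = r *\<^sub>R slot_sum N (map (\<lambda>x. (z x, l x)) xs) + slot_sum N (map (\<lambda>x. (z x, l' x)) xs)"
  using assms
proof (induction xs arbitrary: N C)
  case (Cons x xs)
  have x: "z x \<in> pts E" "l x \<in> pts E" "l' x \<in> pts E" "map z xs \<in> lists (pts E)"
    using Cons.prems(2) by auto
  have sl: "mlin E F (Suc (length xs)) C N"
    using Cons.prems(1) by simp
  have "N ((r *\<^sub>R l x + l' x) # map z xs) = r *\<^sub>R N (l x # map z xs) + N (l' x # map z xs)"
    using mlin_lin[OF sl, of "[]" "map z xs" "l x" "l' x" r] x by simp
  moreover have "slot_sum (\<lambda>ws. N (z x # ws)) (map (\<lambda>x. (z x, r *\<^sub>R l x + l' x)) xs)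
    = r *\<^sub>R slot_sum (\<lambda>ws. N (z x # ws)) (map (\<lambda>x. (z x, l x)) xs) + slot_sum (\<lambda>ws. N (z x # ws)) (map (\<lambda>x. (z x, l' x)) xs)"
    by (rule Cons.IH[OF mlin_Cons[OF sl x(1) order.refl]]) (use Cons.prems(2) in auto)
  ultimately show ?case
    by (simp add: o_def scaleR_add_right)
qed simp

lemma jet_mlin:
  assumes "jet E F U D" "nopen E U" "x \<in> U" "0 \<le> C"
    and "\<And>hs. hs \<in> lists (pts E) \<Longrightarrow> length hs = m \<Longrightarrow> nrm F (D hs x) \<le> C * npr E hs"
  shows "mlin E F m C (\<lambda>hs. D hs x)"
  unfolding mlin_def using assms jet_multilinear[OF assms(1-3)] jet_pts[OF assms(1,3)] by blast

text \<open>A Lipschitz bound makes the image increment small along with \<open>h\<close>. This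
  carries estimates for the outer map of a composition back to the filter of the inner one.\<close>

lemma eventually_near_image:
  assumes "eventually P (near F V (f x))" "0 \<le> L" "\<And>x. x \<in> U \<Longrightarrow> f x \<in> V \<inter> pts F" "x \<in> U"
    and "eventually (\<lambda>h. nrm F (f (x + h) - f x) \<le> L * nrm E h) (near E U x)"
  shows "eventually (\<lambda>h. P (f (x + h) - f x)) (near E U x)"
proof -
  obtain \<delta> where \<delta>: "\<delta> > 0" "\<And>h. h \<in> pts F \<Longrightarrow> nrm F h < \<delta> \<Longrightarrow> f x + h \<in> V \<Longrightarrow> P h"
    using assms(1) unfolding eventually_near by blast
  have "0 < \<delta> / (L + 1)" using \<delta>(1) assms(2) by simp
  from eventually_near_less[OF this, of E x U] assms(5) show ?thesis
  proof eventually_elim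
    case (elim h)
    have "L * nrm E h \<le> (L + 1) * nrm E h"
      using elim by (intro mult_right_mono) auto
    also have "\<dots> < \<delta>"
      using elim assms(2) by (simp add: field_simps)
    finally show ?case
      using elim assms(3)[of x] assms(3)[of "x + h"] assms(4) by (intro \<delta>(2)) auto
  qed
qed

end

section \<open>Partitions of a list of directions into blocks\<close>

primrec ins :: "'v \<Rightarrow> 'v list list \<Rightarrow> 'v list list list" where
  "ins h [] = []"
| "ins h (B # \<pi>) = ((h # B) # \<pi>) # map (Cons B) (ins h \<pi>)"

text \<open>The partitions of a list of directions into blocks, as they occur in the formula of
  Faa di Bruno: a new direction forms a new block or joins one of the blocks.\<close>

primrec parts :: "'v list \<Rightarrow> 'v list list list" where
  "parts [] = [[]]"
| "parts (h # hs) = concat (map (\<lambda>\<pi>. ([h] # \<pi>) # ins h \<pi>) (parts hs))"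

lemma sum_list_concat_map:
  "sum_list (map f (concat (map g xs))) = sum_list (map (\<lambda>x. sum_list (map f (g x))) xs)"
  by (induction xs) auto

text \<open>Letting the new direction join each block in turn is the product rule for the block
  values: the sum is the derivative of \<open>N\<close> with increments
  \<open>z (h # B)\<close>.\<close>

lemma sum_list_ins: "sum_list (map (\<lambda>\<pi>'. N (map z \<pi>')) (ins h \<pi>)) = slot_sum N (map (\<lambda>B. (z B, z (h # B))) \<pi>)"
  by (induction \<pi> arbitrary: N) (auto simp: o_def)

lemma ins_props:
  assumes "\<pi>' \<in> set (ins h \<pi>)"
  shows "length \<pi>' = length \<pi>" "set (concat \<pi>') \<subseteq> insert h (set (concat \<pi>))"
    "\<forall>B\<in>set \<pi>'. length B \<le> Suc (length (concat \<pi>))"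
    "prod_list (map (npr E) \<pi>') = nrm E h * prod_list (map (npr E) \<pi>)"
    "length (concat \<pi>') = Suc (length (concat \<pi>))"
proof -
  have "length \<pi>' = length \<pi> \<and> set (concat \<pi>') \<subseteq> insert h (set (concat \<pi>)) \<and>
    (\<forall>B\<in>set \<pi>'. length B \<le> Suc (length (concat \<pi>))) \<and>
    prod_list (map (npr E) \<pi>') = nrm E h * prod_list (map (npr E) \<pi>) \<and> length (concat \<pi>') = Suc (length (concat \<pi>))"
    using assms
  proof (induction \<pi> arbitrary: \<pi>')
    case (Cons B \<pi>)
    then consider "\<pi>' = (h # B) # \<pi>" | \<rho> where "\<pi>' = B # \<rho>" "\<rho> \<in> set (ins h \<pi>)"
      by auto
    then show ?case
    proof cases
      case 1
      have "length A \<le> length (concat \<pi>)" if "A \<in> set \<pi>" for A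
        using that by (induction \<pi>) auto
      then show ?thesis using 1 by (force simp: trans_le_add2 le_SucI)
    next
      case 2
      with Cons.IH[OF 2(2)] show ?thesis by (force simp: trans_le_add2 le_SucI)
    qed
  qed simp
  then show "length \<pi>' = length \<pi>" "set (concat \<pi>') \<subseteq> insert h (set (concat \<pi>))"
    "\<forall>B\<in>set \<pi>'. length B \<le> Suc (length (concat \<pi>))"
    "prod_list (map (npr E) \<pi>') = nrm E h * prod_list (map (npr E) \<pi>)"
    "length (concat \<pi>') = Suc (length (concat \<pi>))"
    by auto
qed

text \<open>Each direction lies in exactly one block, so the norms of the blocks multiply to the
  norms of all directions. This homogeneity turns bounds for single partition terms into the bounds
  that a jet requires.\<close>

lemma parts_props:
  assumes "\<pi> \<in> set (parts hs)"
  shows "length \<pi> \<le> length hs" "set (concat \<pi>) \<subseteq> set hs" "\<forall>B\<in>set \<pi>. length B \<le> length hs"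
    "prod_list (map (npr E) \<pi>) = npr E hs"
proof -
  have "length \<pi> \<le> length hs \<and> set (concat \<pi>) \<subseteq> set hs \<and> length (concat \<pi>) = length hs \<and>
    prod_list (map (npr E) \<pi>) = npr E hs"
    using assms
  proof (induction hs arbitrary: \<pi>)
    case (Cons h hs)
    then obtain \<rho> where \<rho>: "\<rho> \<in> set (parts hs)" "\<pi> = [h] # \<rho> \<or> \<pi> \<in> set (ins h \<rho>)"
      by auto
    note IH = Cons.IH[OF \<rho>(1)]
    from \<rho>(2) show ?case
    proof
      assume "\<pi> = [h] # \<rho>"
      then show ?thesis using IH by auto
    next
      assume p: "\<pi> \<in> set (ins h \<rho>)"
      have "set (concat \<pi>) \<subseteq> set (h # hs)" using IH ins_props(2)[OF p] by auto
      then show ?thesis using IH ins_props(1,4,5)[OF p] by auto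
    qed
  qed simp
  moreover have "length A \<le> length (concat \<pi>)" if "A \<in> set \<pi>" for A
    using that by (induction \<pi>) auto
  ultimately show "length \<pi> \<le> length hs" "set (concat \<pi>) \<subseteq> set hs" "\<forall>B\<in>set \<pi>. length B \<le> length hs"
    "prod_list (map (npr E) \<pi>) = npr E hs"
    by auto
qed

text \<open>A partition with \<open>m\<close> blocks has \<open>m + 1\<close> successors, and
  \<open>m\<close> is at most the number of directions; the factorial is a convenient bound for the
  Bell numbers.\<close>

lemma length_parts: "length (parts hs) \<le> fact (length hs)"
proof (induction hs)
  case (Cons h hs)
  have l: "length (ins h \<pi>) = length \<pi>" for h :: 'a and \<pi>
    by (induction \<pi>) auto
  have "length (parts (h # hs)) = sum_list (map (\<lambda>\<pi>. Suc (length \<pi>)) (parts hs))"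
    by (simp add: length_concat o_def l)
  also have "\<dots> \<le> sum_list (map (\<lambda>\<pi>. Suc (length hs)) (parts hs))"
    by (intro sum_list_mono) (use parts_props(1) in auto)
  also have "\<dots> = Suc (length hs) * length (parts hs)"
    by (simp add: sum_list_triv)
  also have "\<dots> \<le> Suc (length hs) * fact (length hs)"
    by (rule mult_le_mono2[OF Cons])
  finally show ?case by simp
qed simp

lemma (in nspace) prod_list_scale: "prod_list (map (\<lambda>B. K * npr E B) \<pi>) = K ^ length \<pi> * prod_list (map (npr E) \<pi>)"
  by (induction \<pi>) (auto simp: algebra_simps)

section \<open>The formula of Faa di Bruno and its error estimate\<close>

definition comp_term :: "('w list \<Rightarrow> 'w \<Rightarrow> 'u) \<Rightarrow> ('v list \<Rightarrow> 'v \<Rightarrow> 'w) \<Rightarrow> 'v list list \<Rightarrow> 'v \<Rightarrow> 'u" where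
  "comp_term Dg Df \<pi> x = Dg (map (\<lambda>B. Df B x) \<pi>) (Df [] x)"

definition comp_jet :: "('w list \<Rightarrow> 'w \<Rightarrow> 'u::real_vector) \<Rightarrow> ('v list \<Rightarrow> 'v \<Rightarrow> 'w) \<Rightarrow> 'v list \<Rightarrow> 'v \<Rightarrow> 'u" where
  "comp_jet Dg Df hs x = sum_list (map (\<lambda>\<pi>. comp_term Dg Df \<pi> x) (parts hs))"

text \<open>The derivative of a partition term: the first summand moves the base point
  \<open>Df [] x\<close> of the outer map, the second moves the block values. They correspond to a
  new singleton block and to an enlarged block.\<close>

definition comp_deriv :: "('w list \<Rightarrow> 'w \<Rightarrow> 'u::real_vector) \<Rightarrow> ('v list \<Rightarrow> 'v \<Rightarrow> 'w) \<Rightarrow> 'v \<Rightarrow> 'v list list \<Rightarrow> 'v \<Rightarrow> 'u" where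
  "comp_deriv Dg Df h \<pi> x = comp_term Dg Df ([h] # \<pi>) x
     + slot_sum (\<lambda>zs. Dg zs (Df [] x)) (map (\<lambda>B. (Df B x, Df (h # B) x)) \<pi>)"

lemma comp_jet_Cons: "comp_jet Dg Df (h # hs) x = sum_list (map (\<lambda>\<pi>. comp_deriv Dg Df h \<pi> x) (parts hs))"
proof -
  have "sum_list (map (\<lambda>\<pi>'. comp_term Dg Df \<pi>' x) (ins h \<pi>))
    = slot_sum (\<lambda>zs. Dg zs (Df [] x)) (map (\<lambda>B. (Df B x, Df (h # B) x)) \<pi>)" for \<pi>
    unfolding comp_term_def by (rule sum_list_ins[where N="\<lambda>zs. Dg zs (Df [] x)" and z="\<lambda>B. Df B x"])
  then show ?thesis
    by (simp add: comp_jet_def comp_deriv_def sum_list_concat_map o_def)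
qed

locale comp_jets = EF: nspace2 E F + FG: nspace2 F G
  for E :: "'v::real_vector nsp" and F :: "'w::real_vector nsp" and G :: "'u::real_vector nsp" +
  fixes U V Df Dg
  assumes Df: "jet E F U Df" and Dg: "jet F G V Dg" and V: "nopen F V" and sub: "\<And>x. x \<in> U \<Longrightarrow> Df [] x \<in> V"
begin

text \<open>In a jet the radius for a given \<epsilon> may depend on the order but not on the
  directions. Estimates are therefore proved for all block lists of given number \<open>m\<close>
  and block length at most \<open>k\<close> at once.\<close>

definition blocks :: "nat \<Rightarrow> nat \<Rightarrow> 'v list list \<Rightarrow> bool" where
  "blocks m k \<pi> \<longleftrightarrow> length \<pi> = m \<and> (\<forall>B\<in>set \<pi>. B \<in> lists (pts E) \<and> length B \<le> k)"

lemma length_blocks: "blocks m k \<pi> \<Longrightarrow> length \<pi> = m"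
  by (simp add: blocks_def)

lemma Df_block:
  assumes "x \<in> U" "blocks m k \<pi>" "B \<in> set \<pi>"
  shows "Df B x \<in> pts F" "h \<in> pts E \<Longrightarrow> Df (h # B) x \<in> pts F"
proof -
  have B: "B \<in> lists (pts E)" using assms by (auto simp: blocks_def)
  show "Df B x \<in> pts F" by (rule EF.jet_pts[OF Df assms(1) B])
  show "Df (h # B) x \<in> pts F" if "h \<in> pts E"
    by (rule EF.jet_pts[OF Df assms(1) lists.Cons[OF that B]])
qed

lemma Df_pts: "x \<in> U \<Longrightarrow> blocks m k \<pi> \<Longrightarrow> map (\<lambda>B. Df B x) \<pi> \<in> lists (pts F)"
  by (auto dest: Df_block(1))

lemma comp_term_pts: "x \<in> U \<Longrightarrow> blocks m k \<pi> \<Longrightarrow> comp_term Dg Df \<pi> x \<in> pts G"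
  unfolding comp_term_def by (rule FG.jet_pts[OF Dg sub Df_pts])

lemma mlin_Dg:
  assumes "x \<in> U" "0 \<le> C" "\<And>zs. zs \<in> lists (pts F) \<Longrightarrow> length zs = m \<Longrightarrow> nrm G (Dg zs (Df [] x)) \<le> C * npr F zs"
  shows "mlin F G m C (\<lambda>zs. Dg zs (Df [] x))"
  by (rule FG.jet_mlin[OF Dg V sub]) (use assms in auto)

lemma mlin_Dg_ex: "x \<in> U \<Longrightarrow> \<exists>C. mlin F G m C (\<lambda>zs. Dg zs (Df [] x))"
  using FG.jet_bdd[OF Dg sub, of x m] mlin_Dg[of x _ m] by (metis le_eq_less_or_eq zero_le_one order_trans)

lemma prod_nonneg: "blocks m k \<pi> \<Longrightarrow> 0 \<le> prod_list (map (npr E) \<pi>)"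
  unfolding blocks_def by (induction \<pi> arbitrary: m) (auto intro!: mult_nonneg_nonneg EF.E.npr_nonneg)

lemma comp_deriv_pts:
  assumes x: "x \<in> U" and h: "h \<in> pts E" and \<pi>: "blocks m k \<pi>"
  shows "comp_deriv Dg Df h \<pi> x \<in> pts G"
proof -
  have "blocks (Suc m) (Suc k) ([h] # \<pi>)"
    using h \<pi> by (auto simp: blocks_def)
  moreover obtain C where "mlin F G m C (\<lambda>zs. Dg zs (Df [] x))"
    using mlin_Dg_ex[OF x] by blast
  then have "slot_sum (\<lambda>zs. Dg zs (Df [] x)) (map (\<lambda>B. (Df B x, Df (h # B) x)) \<pi>) \<in> pts G"
    using \<pi> by (intro FG.slot_sum_pts) (auto simp: length_blocks intro: Df_block[OF x \<pi>] Df_block(2)[OF x \<pi> _ h])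
  ultimately show ?thesis
    unfolding comp_deriv_def using comp_term_pts[OF x] by auto
qed

lemma comp_deriv_lin:
  assumes x: "x \<in> U" and h: "h \<in> pts E" "h' \<in> pts E" and \<pi>: "blocks m k \<pi>"
  shows "comp_deriv Dg Df (r *\<^sub>R h + h') \<pi> x = r *\<^sub>R comp_deriv Dg Df h \<pi> x + comp_deriv Dg Df h' \<pi> x"
proof -
  have l: "Df ((r *\<^sub>R h + h') # B) x = r *\<^sub>R Df (h # B) x + Df (h' # B) x" if "B \<in> lists (pts E)" for B
    by (rule EF.jet_lin[OF Df x that h])
  obtain C where C: "mlin F G m C (\<lambda>zs. Dg zs (Df [] x))"
    using mlin_Dg_ex[OF x] by blast
  have "slot_sum (\<lambda>zs. Dg zs (Df [] x)) (map (\<lambda>B. (Df B x, Df ((r *\<^sub>R h + h') # B) x)) \<pi>)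
    = slot_sum (\<lambda>zs. Dg zs (Df [] x)) (map (\<lambda>B. (Df B x, r *\<^sub>R Df (h # B) x + Df (h' # B) x)) \<pi>)"
    using \<pi> l by (intro arg_cong[of _ _ "slot_sum _"] map_cong) (auto simp: blocks_def)
  also have "\<dots> = r *\<^sub>R slot_sum (\<lambda>zs. Dg zs (Df [] x)) (map (\<lambda>B. (Df B x, Df (h # B) x)) \<pi>)
      + slot_sum (\<lambda>zs. Dg zs (Df [] x)) (map (\<lambda>B. (Df B x, Df (h' # B) x)) \<pi>)"
    using C h \<pi> by (intro FG.slot_sum_lin[where C=C]) (auto simp: length_blocks intro: Df_block[OF x \<pi>])
  finally have 1: "slot_sum (\<lambda>zs. Dg zs (Df [] x)) (map (\<lambda>B. (Df B x, Df ((r *\<^sub>R h + h') # B) x)) \<pi>)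
      = r *\<^sub>R slot_sum (\<lambda>zs. Dg zs (Df [] x)) (map (\<lambda>B. (Df B x, Df (h # B) x)) \<pi>)
      + slot_sum (\<lambda>zs. Dg zs (Df [] x)) (map (\<lambda>B. (Df B x, Df (h' # B) x)) \<pi>)" .
  have "Df [h] x \<in> pts F" "Df [h'] x \<in> pts F"
    using h by (auto intro!: EF.jet_pts[OF Df x])
  then have 2: "Dg ((r *\<^sub>R Df [h] x + Df [h'] x) # map (\<lambda>B. Df B x) \<pi>) (Df [] x)
    = r *\<^sub>R Dg (Df [h] x # map (\<lambda>B. Df B x) \<pi>) (Df [] x) + Dg (Df [h'] x # map (\<lambda>B. Df B x) \<pi>) (Df [] x)"
    by (intro FG.jet_lin[OF Dg sub[OF x] Df_pts[OF x \<pi>]])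
  show ?thesis
    unfolding comp_deriv_def 1 comp_term_def using 2 l[of "[]"] by (simp add: scaleR_add_right)
qed

lemma comp_term_deriv:
  assumes x: "x \<in> U" and "0 < \<epsilon>0"
  shows "eventually (\<lambda>h. \<forall>\<pi>. blocks m k \<pi> \<longrightarrow>
    nrm G (comp_term Dg Df \<pi> (x + h) - comp_term Dg Df \<pi> x - comp_deriv Dg Df h \<pi> x)
      \<le> \<epsilon>0 * nrm E h * prod_list (map (npr E) \<pi>)) (near E U x)"
proof -
  define y where "y = Df [] x"
  have y: "y \<in> V" unfolding y_def by (rule sub[OF x])
  obtain K where K: "1 \<le> K"
    "\<And>hs. hs \<in> lists (pts E) \<Longrightarrow> length hs \<le> Suc k \<Longrightarrow> nrm F (Df hs x) \<le> K * npr E hs"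
    using EF.jet_bdd[OF Df x, of "Suc k"] by blast
  obtain Lf where Lf: "1 \<le> Lf" "eventually (\<lambda>h. \<forall>hs\<in>lists (pts E). length hs \<le> 0 \<longrightarrow>
           nrm F (Df hs (x + h) - Df hs x) \<le> Lf * nrm E h * npr E hs) (near E U x)"
    using EF.jet_lipschitz[OF Df x, of 0] by blast
  obtain Cg where Cg: "1 \<le> Cg"
    "\<And>zs. zs \<in> lists (pts F) \<Longrightarrow> length zs \<le> Suc m \<Longrightarrow> nrm G (Dg zs y) \<le> Cg * npr F zs"
    using FG.jet_bdd[OF Dg y, of "Suc m"] by blast
  obtain Lg where Lg: "1 \<le> Lg" "eventually (\<lambda>d. \<forall>zs\<in>lists (pts F). length zs \<le> m \<longrightarrow>
           nrm G (Dg zs (y + d) - Dg zs y) \<le> Lg * nrm F d * npr F zs) (near F V y)"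
    using FG.jet_lipschitz[OF Dg y, of m] by blast
  obtain Bg where Bg: "1 \<le> Bg" "eventually (\<lambda>d. \<forall>zs\<in>lists (pts F). length zs \<le> m \<longrightarrow>
           nrm G (Dg zs (y + d)) \<le> Bg * npr F zs) (near F V y)"
    using FG.jet_bdd_near[OF Dg y, of m] by blast
  \<comment> \<open>\<open>M\<close> collects the coefficients of the four errors below.
    \<open>\<epsilon>\<close> is chosen with \<open>2 * M * \<epsilon> \<le> \<epsilon>0\<close>,
    and the increment is kept below \<open>\<epsilon>\<close>, so that terms quadratic in the
    increment count as small too.\<close>
  define M where "M = K ^ m * (Bg * 4 ^ m + Lf + Cg + real m * Lg * Lf)"
  have Km: "1 \<le> K ^ m" using K(1) by simp
  have M: "0 < M"
    unfolding M_def using Km Bg(1) Lf(1) Cg(1) Lg(1) by (intro mult_pos_pos add_pos_nonneg) auto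
  define \<epsilon> where "\<epsilon> = min 1 (\<epsilon>0 / (2 * M))"
  have \<epsilon>: "0 < \<epsilon>" "\<epsilon> \<le> 1" "M * \<epsilon> \<le> \<epsilon>0 / 2"
    using M assms(2) by (auto simp: \<epsilon>_def field_simps min_def)
  have tr: "eventually (\<lambda>h. P (Df [] (x + h) - Df [] x)) (near E U x)" if "eventually P (near F V y)" for P
  proof (rule EF.eventually_near_image[where f="\<lambda>x. Df [] x" and V=V and L=Lf])
    show "eventually (\<lambda>h. nrm F (Df [] (x + h) - Df [] x) \<le> Lf * nrm E h) (near E U x)"
      using Lf(2) by eventually_elim auto
  qed (use that Lf(1) sub x EF.jet_pts[OF Df] in \<open>auto simp: y_def\<close>)
  from EF.jet_deriv[OF Df x \<epsilon>(1), of k] Lf(2) tr[OF Lg(2)] tr[OF Bg(2)]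
    tr[OF FG.jet_deriv[OF Dg y \<epsilon>(1), of m]] eventually_near_less[OF \<epsilon>(1), of E x U]
  show ?thesis
  proof eventually_elim
    case (elim h)
    define \<eta> where "\<eta> = nrm E h"
    have h: "h \<in> pts E" "x + h \<in> U" and \<eta>: "0 \<le> \<eta>" "\<eta> < \<epsilon>" "\<eta> \<le> 1"
      using elim(6) \<epsilon>(2) by (auto simp: \<eta>_def)
    define d where "d = Df [] (x + h) - Df [] x"
    have yd: "y + d = Df [] (x + h)" by (simp add: y_def d_def)
    have d: "d \<in> pts F" "nrm F d \<le> Lf * \<eta>"
      using elim(2) h EF.jet_pts[OF Df, of _ "[]"] x by (auto simp: d_def \<eta>_def)
    define w where "w = d - Df [h] x"
    have hF: "Df [h] x \<in> pts F" using h by (auto intro!: EF.jet_pts[OF Df x])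
    have w: "w \<in> pts F" "nrm F w \<le> \<epsilon> * \<eta>"
    proof -
      show "w \<in> pts F" unfolding w_def using d hF by simp
      show "nrm F w \<le> \<epsilon> * \<eta>"
        using elim(1)[rule_format, of "[]"] by (simp add: w_def d_def \<eta>_def)
    qed
    show ?case
    proof (intro allI impI)
      fix \<pi> assume \<pi>: "blocks m k \<pi>"
      define P where "P = prod_list (map (npr E) \<pi>)"
      have P: "0 \<le> P" unfolding P_def by (rule prod_nonneg[OF \<pi>])
      have len: "length \<pi> = m" using \<pi> by (simp add: blocks_def)
      define \<beta> where "\<beta> = (\<lambda>B. K * npr E B)"
      have \<beta>: "prod_list (map \<beta> \<pi>) = K ^ m * P"
        unfolding \<beta>_def P_def EF.E.prod_list_scale len ..
      define z where "z = (\<lambda>B. Df B x)"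
      define l where "l = (\<lambda>B. Df (h # B) x)"
      define u where "u = (\<lambda>B. Df B (x + h))"
      have BB: "B \<in> lists (pts E)" "length B \<le> k" if "B \<in> set \<pi>" for B
        using that \<pi> by (auto simp: blocks_def)
      have zul: "u B \<in> pts F \<and> z B \<in> pts F \<and> l B \<in> pts F \<and> nrm F (z B) \<le> \<beta> B
         \<and> nrm F (l B) \<le> \<eta> * \<beta> B \<and> nrm F (u B - z B - l B) \<le> \<epsilon> * \<eta> * \<beta> B" if "B \<in> set \<pi>" for B
      proof (intro conjI)
        have hB: "h # B \<in> lists (pts E)" using h BB[OF that] by simp
        show "u B \<in> pts F" "z B \<in> pts F" "l B \<in> pts F"
          unfolding u_def z_def l_def using EF.jet_pts[OF Df] h x BB(1)[OF that] hB by blast+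
        show "nrm F (z B) \<le> \<beta> B"
          unfolding z_def \<beta>_def using BB[OF that] by (intro K(2)) auto
        have "nrm F (l B) \<le> K * npr E (h # B)"
          unfolding l_def using BB[OF that] hB by (intro K(2)) auto
        then show "nrm F (l B) \<le> \<eta> * \<beta> B"
          by (simp add: \<beta>_def \<eta>_def mult_ac)
        have "nrm F (u B - z B - l B) \<le> \<epsilon> * \<eta> * npr E B"
          using elim(1)[rule_format, OF BB[OF that]] by (simp add: u_def z_def l_def \<eta>_def)
        also have "\<dots> \<le> \<epsilon> * \<eta> * \<beta> B"
        proof (rule mult_left_mono)
          have "1 * npr E B \<le> K * npr E B"
            by (rule mult_right_mono[OF K(1) EF.E.npr_nonneg[OF BB(1)[OF that]]])
          then show "npr E B \<le> \<beta> B" by (simp add: \<beta>_def)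
          show "0 \<le> \<epsilon> * \<eta>" using \<epsilon>(1) \<eta>(1) by simp
        qed
        finally show "nrm F (u B - z B - l B) \<le> \<epsilon> * \<eta> * \<beta> B" .
      qed
      have zl: "map z \<pi> \<in> lists (pts F)" "map u \<pi> \<in> lists (pts F)"
        using zul by auto
      have npz: "npr F (map z \<pi>) \<le> K ^ m * P" "0 \<le> npr F (map z \<pi>)"
        using EF.F.npr_map_le(1)[of \<pi> z \<beta>] zul EF.F.npr_nonneg[OF zl(1)] unfolding \<beta> by auto
      define N where "N = (\<lambda>zs. Dg zs (Df [] (x + h)))"
      define N0 where "N0 = (\<lambda>zs. Dg zs y)"
      define ps where "ps = map (\<lambda>B. (z B, l B)) \<pi>"
      have mN: "mlin F G (length \<pi>) Bg N"
        unfolding N_def len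
      proof (rule mlin_Dg[OF h(2)])
        show "nrm G (Dg zs (Df [] (x + h))) \<le> Bg * npr F zs" if "zs \<in> lists (pts F)" "length zs = m" for zs
          using elim(4) that yd unfolding d_def[symmetric] by auto
      qed (use Bg(1) in simp)
      have mN0: "mlin F G (length \<pi>) Cg N0"
        unfolding N0_def len y_def using Cg by (intro mlin_Dg[OF x]) (auto simp: y_def)
      have mNN: "mlin F G (length \<pi>) (Lg * nrm F d) (\<lambda>zs. N zs - N0 zs)"
        unfolding mlin_def
      proof (intro conjI ballI allI impI)
        show "0 \<le> Lg * nrm F d" using Lg(1) d(1) by simp
        fix zs assume zs: "zs \<in> lists (pts F)" "length zs = length \<pi>"
        show "N zs - N0 zs \<in> pts G"
          using FG.mlin_pts[OF mN zs] FG.mlin_pts[OF mN0 zs] by simp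
        show "nrm G (N zs - N0 zs) \<le> Lg * nrm F d * npr F zs"
          using elim(3) zs len unfolding d_def[symmetric] yd N_def N0_def by auto
      next
        fix us vs z z' and r :: real
        assume *: "us \<in> lists (pts F)" "vs \<in> lists (pts F)" "z \<in> pts F" "z' \<in> pts F" "Suc (length us + length vs) = length \<pi>"
        show "N (us @ (r *\<^sub>R z + z') # vs) - N0 (us @ (r *\<^sub>R z + z') # vs)
          = r *\<^sub>R (N (us @ z # vs) - N0 (us @ z # vs)) + (N (us @ z' # vs) - N0 (us @ z' # vs))"
          unfolding FG.mlin_lin[OF mN *] FG.mlin_lin[OF mN0 *] by (simp add: algebra_simps)
      qed
      have psl: "ps \<in> lists (pts F \<times> pts F)" "length ps = length \<pi>"
        using zul by (auto simp: ps_def)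
      \<comment> \<open>The four errors: change of the block values at the new base point;
        first-order remainder of the outer jet in the base point; replacement of the base increment
        \<open>d\<close> by \<open>Df [h] x\<close>; change of the base point inside the linearised
        term.\<close>
      define e1 where "e1 = N (map u \<pi>) - N (map z \<pi>) - slot_sum N ps"
      define e2 where "e2 = Dg (map z \<pi>) (y + d) - Dg (map z \<pi>) y - Dg (d # map z \<pi>) y"
      define e3 where "e3 = Dg (w # map z \<pi>) y"
      define e4 where "e4 = slot_sum (\<lambda>zs. N zs - N0 zs) ps"
      have b1: "nrm G e1 \<le> Bg * 4 ^ m * (\<epsilon> + \<eta>) * \<eta> * (K ^ m * P)"
      proof -
        have "nrm G e1 \<le> Bg * 4 ^ length \<pi> * (\<epsilon> + \<eta>) * \<eta> * prod_list (map \<beta> \<pi>)"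
          unfolding e1_def ps_def using \<eta> \<epsilon> zul by (intro FG.mlin_product_rule[OF mN]) auto
        then show ?thesis by (simp only: len \<beta>)
      qed
      have b2: "nrm G e2 \<le> \<epsilon> * (Lf * \<eta>) * (K ^ m * P)"
      proof -
        have "nrm G e2 \<le> \<epsilon> * nrm F d * npr F (map z \<pi>)"
          unfolding e2_def using elim(5)[folded d_def, rule_format, OF zl(1)] len by simp
        also have "\<dots> \<le> \<epsilon> * (Lf * \<eta>) * (K ^ m * P)"
          using d npz \<epsilon>(1) Lf(1) \<eta>(1) by (intro mult_mono mult_left_mono) auto
        finally show ?thesis .
      qed
      have b3: "nrm G e3 \<le> Cg * (\<epsilon> * \<eta> * (K ^ m * P))"
      proof -
        have "nrm G e3 \<le> Cg * npr F (w # map z \<pi>)"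
          unfolding e3_def using w(1) zl(1) len by (intro Cg(2)) auto
        also have "\<dots> \<le> Cg * (\<epsilon> * \<eta> * (K ^ m * P))"
          unfolding list.map prod_list.Cons
          using Cg(1) w npz \<epsilon>(1) \<eta>(1) by (intro mult_left_mono[OF mult_mono]) auto
        finally show ?thesis .
      qed
      have b4: "nrm G e4 \<le> real m * Lg * Lf * \<eta> * \<eta> * (K ^ m * P)"
      proof -
        have "nrm G e4 \<le> real (length \<pi>) * (Lg * nrm F d) * \<eta> * prod_list (map \<beta> \<pi>)"
          unfolding e4_def ps_def using zul \<eta> by (intro FG.slot_sum_le[OF mNN]) auto
        also have "\<dots> \<le> real m * (Lg * (Lf * \<eta>)) * \<eta> * prod_list (map \<beta> \<pi>)"
          unfolding len \<beta> using d Lg(1) \<eta>(1) P Km by (intro mult_right_mono mult_left_mono) auto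
        finally show ?thesis by (simp add: \<beta> mult_ac)
      qed
      have p: "e1 \<in> pts G" "e2 \<in> pts G" "e3 \<in> pts G" "e4 \<in> pts G"
      proof -
        have mps: "mlin F G (length ps) Bg N" "mlin F G (length ps) (Lg * nrm F d) (\<lambda>zs. N zs - N0 zs)"
          using mN mNN psl(2) by simp_all
        show "e1 \<in> pts G"
          unfolding e1_def using zl psl(1) len by (intro FG.F.pts_diff FG.mlin_pts[OF mN] FG.slot_sum_pts[OF mps(1)]) auto
        have "y + d \<in> V" unfolding yd by (rule sub[OF h(2)])
        then show "e2 \<in> pts G"
          unfolding e2_def using zl(1) d(1) y by (intro FG.F.pts_diff FG.jet_pts[OF Dg]) auto
        show "e3 \<in> pts G"
          unfolding e3_def using zl(1) w(1) y by (intro FG.jet_pts[OF Dg]) auto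
        show "e4 \<in> pts G"
          unfolding e4_def by (rule FG.slot_sum_pts[OF mps(2) psl(1)])
      qed
      have "Dg (d # map z \<pi>) y = Dg (w # map z \<pi>) y + Dg (Df [h] x # map z \<pi>) y"
        using FG.jet_lin[OF Dg y zl(1) w(1) hF, of 1] by (simp add: w_def)
      then have "comp_term Dg Df \<pi> (x + h) - comp_term Dg Df \<pi> x - comp_deriv Dg Df h \<pi> x = e1 + e2 + e3 + e4"
        unfolding e1_def e2_def e3_def e4_def slot_sum_diff comp_term_def comp_deriv_def yd
        by (simp add: N_def N0_def ps_def z_def l_def u_def y_def)
      then have "nrm G (comp_term Dg Df \<pi> (x + h) - comp_term Dg Df \<pi> x - comp_deriv Dg Df h \<pi> x)
        \<le> nrm G e1 + nrm G e2 + nrm G e3 + nrm G e4"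
        using FG.F.nrm_triangle[of "e1 + e2 + e3" e4] FG.F.nrm_triangle[of "e1 + e2" e3] FG.F.nrm_triangle[of e1 e2] p
        by simp
      also have "\<dots> \<le> Bg * 4 ^ m * (\<epsilon> + \<eta>) * \<eta> * (K ^ m * P) + \<epsilon> * (Lf * \<eta>) * (K ^ m * P)
          + Cg * (\<epsilon> * \<eta> * (K ^ m * P)) + real m * Lg * Lf * \<eta> * \<eta> * (K ^ m * P)"
        using b1 b2 b3 b4 by linarith
      also have "\<dots> = (\<eta> * (K ^ m * P)) * (Bg * 4 ^ m * (\<epsilon> + \<eta>) + Lf * \<epsilon> + Cg * \<epsilon> + real m * Lg * Lf * \<eta>)"
        by (simp add: algebra_simps)
      also have "\<dots> \<le> (\<eta> * (K ^ m * P)) * ((Bg * 4 ^ m + Lf + Cg + real m * Lg * Lf) * (2 * \<epsilon>))"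
      proof (rule mult_left_mono)
        have "Bg * 4 ^ m * (\<epsilon> + \<eta>) \<le> Bg * 4 ^ m * (2 * \<epsilon>)" "Lf * \<epsilon> \<le> Lf * (2 * \<epsilon>)" "Cg * \<epsilon> \<le> Cg * (2 * \<epsilon>)"
          "real m * Lg * Lf * \<eta> \<le> real m * Lg * Lf * (2 * \<epsilon>)"
          using Bg(1) Lf(1) Cg(1) Lg(1) \<eta> \<epsilon>(1) by (auto intro!: mult_left_mono)
        then show "Bg * 4 ^ m * (\<epsilon> + \<eta>) + Lf * \<epsilon> + Cg * \<epsilon> + real m * Lg * Lf * \<eta>
          \<le> (Bg * 4 ^ m + Lf + Cg + real m * Lg * Lf) * (2 * \<epsilon>)"
          unfolding distrib_right by linarith
        show "0 \<le> \<eta> * (K ^ m * P)" using \<eta>(1) Km P by simp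
      qed
      also have "\<dots> = 2 * (M * \<epsilon>) * (\<eta> * P)"
        by (simp add: M_def mult_ac)
      also have "\<dots> \<le> \<epsilon>0 * (\<eta> * P)"
        using \<epsilon>(3) \<eta>(1) P by (intro mult_right_mono) auto
      finally show "nrm G (comp_term Dg Df \<pi> (x + h) - comp_term Dg Df \<pi> x - comp_deriv Dg Df h \<pi> x)
        \<le> \<epsilon>0 * nrm E h * prod_list (map (npr E) \<pi>)"
        by (simp add: \<eta>_def P_def mult_ac)
    qed
  qed
qed

lemma jet_comp: "jet E G U (comp_jet Dg Df)"
  unfolding jet_def
proof (intro conjI ballI allI impI)
  fix x hs assume x: "x \<in> U" and hs: "hs \<in> lists (pts E)"
  have bl: "blocks (length \<pi>) (length hs) \<pi>" if "\<pi> \<in> set (parts hs)" for \<pi>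
    using parts_props(2,3)[OF that] hs unfolding blocks_def by fastforce
  show "comp_jet Dg Df hs x \<in> pts G"
    unfolding comp_jet_def by (rule FG.F.pts_sum_list) (rule comp_term_pts[OF x bl])
  show "comp_jet Dg Df ((r *\<^sub>R h + h') # hs) x = r *\<^sub>R comp_jet Dg Df (h # hs) x + comp_jet Dg Df (h' # hs) x"
    if h: "h \<in> pts E" "h' \<in> pts E" for h h' r
  proof -
    have "map (\<lambda>\<pi>. comp_deriv Dg Df (r *\<^sub>R h + h') \<pi> x) (parts hs)
      = map (\<lambda>\<pi>. r *\<^sub>R comp_deriv Dg Df h \<pi> x + comp_deriv Dg Df h' \<pi> x) (parts hs)"
      by (intro map_cong refl comp_deriv_lin[OF x h bl])
    moreover have "sum_list (map (\<lambda>\<pi>. r *\<^sub>R f \<pi> + g \<pi>) xs) = r *\<^sub>R sum_list (map f xs) + sum_list (map g xs)"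
      for f g :: "'v list list \<Rightarrow> 'u" and xs
      by (induction xs) (auto simp: algebra_simps)
    ultimately show ?thesis
      unfolding comp_jet_Cons by (simp only:)
  qed
next
  fix x k assume x: "x \<in> U"
  obtain K where K: "1 \<le> K"
    "\<And>hs. hs \<in> lists (pts E) \<Longrightarrow> length hs \<le> k \<Longrightarrow> nrm F (Df hs x) \<le> K * npr E hs"
    using EF.jet_bdd[OF Df x, of k] by blast
  obtain C where C: "1 \<le> C"
    "\<And>zs. zs \<in> lists (pts F) \<Longrightarrow> length zs \<le> k \<Longrightarrow> nrm G (Dg zs (Df [] x)) \<le> C * npr F zs"
    using FG.jet_bdd[OF Dg sub[OF x], of k] by blast
  show "\<exists>M. \<forall>hs\<in>lists (pts E). length hs = k \<longrightarrow> nrm G (comp_jet Dg Df hs x) \<le> M * npr E hs"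
  proof (intro exI ballI impI)
    fix hs assume hs: "hs \<in> lists (pts E)" "length hs = k"
    have P: "0 \<le> npr E hs" by (rule EF.E.npr_nonneg[OF hs(1)])
    have t: "comp_term Dg Df \<pi> x \<in> pts G \<and> nrm G (comp_term Dg Df \<pi> x) \<le> C * (K ^ k * npr E hs)"
      if \<pi>: "\<pi> \<in> set (parts hs)" for \<pi>
    proof
      have bl: "blocks (length \<pi>) k \<pi>"
        using parts_props(2,3)[OF \<pi>] hs unfolding blocks_def by fastforce
      show "comp_term Dg Df \<pi> x \<in> pts G"
        by (rule comp_term_pts[OF x bl])
      have zs: "map (\<lambda>B. Df B x) \<pi> \<in> lists (pts F)" "length (map (\<lambda>B. Df B x) \<pi>) \<le> k"
        using Df_pts[OF x bl] parts_props(1)[OF \<pi>] hs(2) by auto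
      have "nrm G (comp_term Dg Df \<pi> x) \<le> C * npr F (map (\<lambda>B. Df B x) \<pi>)"
        unfolding comp_term_def by (rule C(2)[OF zs])
      also have "\<dots> \<le> C * (K ^ k * npr E hs)"
      proof (rule mult_left_mono)
        have "npr F (map (\<lambda>B. Df B x) \<pi>) \<le> prod_list (map (\<lambda>B. K * npr E B) \<pi>)"
          using bl K(2) by (intro EF.F.npr_map_le(1) conjI Df_block(1)[OF x bl]) (auto simp: blocks_def)
        also have "\<dots> = K ^ length \<pi> * npr E hs"
          unfolding EF.E.prod_list_scale parts_props(4)[OF \<pi>] ..
        also have "\<dots> \<le> K ^ k * npr E hs"
          using parts_props(1)[OF \<pi>] hs(2) K(1) P by (intro mult_right_mono power_increasing) auto
        finally show "npr F (map (\<lambda>B. Df B x) \<pi>) \<le> K ^ k * npr E hs" .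
      qed (use C(1) in simp)
      finally show "nrm G (comp_term Dg Df \<pi> x) \<le> C * (K ^ k * npr E hs)" .
    qed
    have "nrm G (comp_jet Dg Df hs x) \<le> real (length (parts hs)) * (C * (K ^ k * npr E hs))"
      unfolding comp_jet_def using t by (intro FG.F.nrm_sum_list_le) auto
    also have "\<dots> \<le> real (fact k) * (C * (K ^ k * npr E hs))"
    proof (rule mult_right_mono)
      show "real (length (parts hs)) \<le> real (fact k)"
        using length_parts[of hs] hs(2) by (simp only: of_nat_le_iff)
      show "0 \<le> C * (K ^ k * npr E hs)"
        using C(1) K(1) P by simp
    qed
    finally show "nrm G (comp_jet Dg Df hs x) \<le> (real (fact k) * C * K ^ k) * npr E hs"
      by (simp only: mult.assoc)
  qed
next
  fix x k and \<epsilon> :: real assume x: "x \<in> U" and \<epsilon>: "0 < \<epsilon>"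
  have f: "0 < real (fact k)" by simp
  \<comment> \<open>A list of \<open>k\<close> directions has at most \<open>fact k\<close>
    partitions, each with at most \<open>k\<close> blocks: \<epsilon> is shared among the
    partitions, and finitely many instances of the term estimate are intersected.\<close>
  then have "0 < \<epsilon> / real (fact k)" using \<epsilon> by (rule divide_pos_pos[rotated])
  then have "eventually (\<lambda>h. \<forall>m\<in>{..k}. \<forall>\<pi>. blocks m k \<pi> \<longrightarrow>
    nrm G (comp_term Dg Df \<pi> (x + h) - comp_term Dg Df \<pi> x - comp_deriv Dg Df h \<pi> x)
      \<le> \<epsilon> / real (fact k) * nrm E h * prod_list (map (npr E) \<pi>)) (near E U x)"
    by (intro eventually_ball_finite ballI comp_term_deriv[OF x]) auto
  with eventually_near_less[OF zero_less_one, of E x U]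
  show "eventually (\<lambda>h. \<forall>hs\<in>lists (pts E). length hs = k \<longrightarrow>
    nrm G (comp_jet Dg Df hs (x + h) - comp_jet Dg Df hs x - comp_jet Dg Df (h # hs) x)
      \<le> \<epsilon> * nrm E h * npr E hs) (near E U x)"
  proof eventually_elim
    case (elim h)
    show ?case
    proof (intro ballI impI)
      fix hs assume hs: "hs \<in> lists (pts E)" "length hs = k"
      define t where "t = (\<lambda>\<pi>. comp_term Dg Df \<pi> (x + h) - comp_term Dg Df \<pi> x - comp_deriv Dg Df h \<pi> x)"
      have P: "0 \<le> npr E hs" by (rule EF.E.npr_nonneg[OF hs(1)])
      have h: "h \<in> pts E" "x + h \<in> U" using elim(1) by auto
      have tt: "t \<pi> \<in> pts G \<and> nrm G (t \<pi>) \<le> \<epsilon> / real (fact k) * nrm E h * npr E hs"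
        if \<pi>: "\<pi> \<in> set (parts hs)" for \<pi>
      proof
        have bl: "blocks (length \<pi>) k \<pi>"
          using parts_props(2,3)[OF \<pi>] hs unfolding blocks_def by fastforce
        show "t \<pi> \<in> pts G"
          unfolding t_def
          by (intro FG.F.pts_diff comp_term_pts[OF x bl] comp_term_pts[OF h(2) bl] comp_deriv_pts[OF x h(1) bl])
        have "length \<pi> \<in> {..k}" using parts_props(1)[OF \<pi>] hs(2) by simp
        from elim(2)[rule_format, OF this bl] show "nrm G (t \<pi>) \<le> \<epsilon> / real (fact k) * nrm E h * npr E hs"
          unfolding t_def parts_props(4)[OF \<pi>] .
      qed
      have "comp_jet Dg Df hs (x + h) - comp_jet Dg Df hs x - comp_jet Dg Df (h # hs) x = sum_list (map t (parts hs))"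
        unfolding comp_jet_Cons t_def unfolding comp_jet_def by (simp add: sum_list_subtractf)
      then have "nrm G (comp_jet Dg Df hs (x + h) - comp_jet Dg Df hs x - comp_jet Dg Df (h # hs) x)
        \<le> real (length (parts hs)) * (\<epsilon> / real (fact k) * nrm E h * npr E hs)"
        using tt by (simp only:) (intro FG.F.nrm_sum_list_le, auto)
      also have "\<dots> \<le> real (fact k) * (\<epsilon> / real (fact k) * nrm E h * npr E hs)"
      proof (rule mult_right_mono)
        show "real (length (parts hs)) \<le> real (fact k)"
          using length_parts[of hs] hs(2) by (simp only: of_nat_le_iff)
        show "0 \<le> \<epsilon> / real (fact k) * nrm E h * npr E hs"
          using \<epsilon> h(1) P by simp
      qed
      also have "\<dots> = \<epsilon> * nrm E h * npr E hs"
        by simp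
      finally show "nrm G (comp_jet Dg Df hs (x + h) - comp_jet Dg Df hs x - comp_jet Dg Df (h # hs) x)
        \<le> \<epsilon> * nrm E h * npr E hs" .
    qed
  qed
qed

end

section \<open>Smooth maps together with their first derivative\<close>

definition smooth_deriv :: "'v::real_vector nsp \<Rightarrow> 'w::real_vector nsp \<Rightarrow> 'v set \<Rightarrow> ('v \<Rightarrow> 'w) \<Rightarrow> ('v \<Rightarrow> 'v \<Rightarrow> 'w) \<Rightarrow> bool" where
  "smooth_deriv E F U f f' \<longleftrightarrow> (\<exists>D. jet E F U D \<and> (\<forall>x\<in>U. D [] x = f x \<and> (\<forall>h\<in>pts E. D [h] x = f' x h)))"

lemma smooth_on_iff_deriv: "smooth_on E F U f \<longleftrightarrow> (\<exists>f'. smooth_deriv E F U f f')"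
  unfolding smooth_on_iff_jet smooth_deriv_def by fastforce

lemma smooth_deriv_subset: "smooth_deriv E F U f f' \<Longrightarrow> V \<subseteq> U \<Longrightarrow> smooth_deriv E F V f f'"
  unfolding smooth_deriv_def by (meson jet_subset subsetD)

lemma smooth_deriv_cong:
  "smooth_deriv E F U f f' \<Longrightarrow> (\<And>x. x \<in> U \<Longrightarrow> f x = g x) \<Longrightarrow> (\<And>x h. x \<in> U \<Longrightarrow> h \<in> pts E \<Longrightarrow> f' x h = g' x h)
    \<Longrightarrow> smooth_deriv E F U g g'"
  unfolding smooth_deriv_def by (metis (full_types))

text \<open>To order one the only partition is \<open>[[h]]\<close>, and the formula of Faa di Bruno
  reads as the chain rule; the higher orders are carried along by \<open>comp_jet\<close>.\<close>

lemma smooth_deriv_comp: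
  assumes "nspace E" "nspace F" "nspace G" "smooth_deriv E F U f f'" "smooth_deriv F G V g g'"
    and "nopen F V" "\<And>x. x \<in> U \<Longrightarrow> f x \<in> V"
  shows "smooth_deriv E G U (\<lambda>x. g (f x)) (\<lambda>x h. g' (f x) (f' x h))"
proof -
  obtain Df Dg where D: "jet E F U Df" "jet F G V Dg"
    and f: "\<And>x. x \<in> U \<Longrightarrow> Df [] x = f x" "\<And>x h. x \<in> U \<Longrightarrow> h \<in> pts E \<Longrightarrow> Df [h] x = f' x h"
    and g: "\<And>x. x \<in> V \<Longrightarrow> Dg [] x = g x" "\<And>x h. x \<in> V \<Longrightarrow> h \<in> pts F \<Longrightarrow> Dg [h] x = g' x h"
    using assms(4,5) unfolding smooth_deriv_def by blast
  interpret E: nspace E by fact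
  interpret F: nspace F by fact
  interpret G: nspace G by fact
  interpret nspace2 E F ..
  interpret comp_jets E F G U V Df Dg
    by unfold_locales (use D assms f in auto)
  have "f' x h \<in> pts F" if "x \<in> U" "h \<in> pts E" for x h
    using jet_pts[OF D(1), of x "[h]"] that f by auto
  then show ?thesis
    unfolding smooth_deriv_def
    by (intro exI[of _ "comp_jet Dg Df"] conjI jet_comp)
      (auto simp: comp_jet_def comp_term_def f g assms(7))
qed

lemma smooth_deriv_pts:
  assumes "smooth_deriv E F U f f'" "x \<in> U"
  shows "f x \<in> pts F" "h \<in> pts E \<Longrightarrow> f' x h \<in> pts F"
proof -
  obtain D where D: "jet E F U D" and f: "D [] x = f x" "\<And>h. h \<in> pts E \<Longrightarrow> D [h] x = f' x h"
    using assms unfolding smooth_deriv_def by blast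
  have p: "D hs x \<in> pts F" if "hs \<in> lists (pts E)" for hs
    using D assms(2) that by (simp add: jet_def)
  show "f x \<in> pts F" using p[of "[]"] f by simp
  show "h \<in> pts E \<Longrightarrow> f' x h \<in> pts F" using p[of "[h]"] f by simp
qed

lemma smooth_deriv_velocity:
  assumes "nspace E" "nspace F" "smooth_deriv E F U f f'" "nopen E U"
    and c: "has_velocity E c v" "eventually (\<lambda>t. c t \<in> pts E) (at 0)" "c 0 \<in> U"
  shows "has_velocity F (\<lambda>t. f (c t)) (f' (c 0) v)"
proof -
  interpret E: nspace E by fact
  interpret F: nspace F by fact
  interpret nspace2 E F ..
  obtain D where D: "jet E F U D" and f: "\<And>x. x \<in> U \<Longrightarrow> D [] x = f x" "\<And>x h. x \<in> U \<Longrightarrow> h \<in> pts E \<Longrightarrow> D [h] x = f' x h"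
    using assms(3) unfolding smooth_deriv_def by blast
  have U: "eventually (\<lambda>t. c t \<in> U) (at 0)"
    by (rule E.eventually_in_nopen[OF c(1,2) assms(4) c(3)])
  have "c 0 \<in> pts E" using c(3) assms(4) by (auto simp: nopen_def)
  from jet_velocity[OF D c(1,2) this U c(3), of "[]"]
  have "has_velocity F (\<lambda>t. D [] (c t)) (D [v] (c 0))" by simp
  then have "has_velocity F (\<lambda>t. f (c t)) (D [v] (c 0))"
  proof (rule has_velocity_cong[rotated 2])
    show "eventually (\<lambda>t. D [] (c t) = f (c t)) (at 0)"
      using U by eventually_elim (rule f(1))
  qed (rule f(1)[OF c(3)])
  then show ?thesis
    using f(2)[OF c(3)] c(1) by (simp add: has_velocity_def)
qed

lemma smooth_deriv_Pair:
  assumes "nspace E" "nspace F" "nspace G" "smooth_deriv E F U f f'" "smooth_deriv E G U g g'"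
  shows "smooth_deriv E (prod_nsp F G) U (\<lambda>x. (f x, g x)) (\<lambda>x h. (f' x h, g' x h))"
proof -
  interpret E: nspace E by fact
  interpret F: nspace F by fact
  interpret G: nspace G by fact
  interpret EF: nspace2 E F ..
  interpret EG: nspace2 E G ..
  obtain Df Dg where D: "jet E F U Df" "jet E G U Dg"
    and f: "\<And>x. x \<in> U \<Longrightarrow> Df [] x = f x" "\<And>x h. x \<in> U \<Longrightarrow> h \<in> pts E \<Longrightarrow> Df [h] x = f' x h"
    and g: "\<And>x. x \<in> U \<Longrightarrow> Dg [] x = g x" "\<And>x h. x \<in> U \<Longrightarrow> h \<in> pts E \<Longrightarrow> Dg [h] x = g' x h"
    using assms(4,5) unfolding smooth_deriv_def by blast
  have "jet E (prod_nsp F G) U (\<lambda>hs x. (Df hs x, Dg hs x))"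
    unfolding jet_def
  proof (intro conjI ballI allI impI)
    fix x k assume x: "x \<in> U"
    obtain C1 where C1: "\<forall>hs\<in>lists (pts E). length hs = k \<longrightarrow> nrm F (Df hs x) \<le> C1 * npr E hs"
      using EF.jet_bound[OF D(1) x] by blast
    obtain C2 where C2: "\<forall>hs\<in>lists (pts E). length hs = k \<longrightarrow> nrm G (Dg hs x) \<le> C2 * npr E hs"
      using EG.jet_bound[OF D(2) x] by blast
    show "\<exists>C. \<forall>hs\<in>lists (pts E). length hs = k \<longrightarrow> nrm (prod_nsp F G) (Df hs x, Dg hs x) \<le> C * npr E hs"
    proof (intro exI ballI impI)
      fix hs assume "hs \<in> lists (pts E)" "length hs = k"
      then show "nrm (prod_nsp F G) (Df hs x, Dg hs x) \<le> (C1 + C2) * npr E hs"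
        using C1 C2 by (simp add: nrm_prod_nsp distrib_right add_mono)
    qed
  next
    fix x k and \<epsilon> :: real assume x: "x \<in> U" and "0 < \<epsilon>"
    then have \<epsilon>: "0 < \<epsilon> / 2" by simp
    from EF.jet_deriv[OF D(1) x \<epsilon>, of k] EG.jet_deriv[OF D(2) x \<epsilon>, of k]
    show "eventually (\<lambda>h. \<forall>hs\<in>lists (pts E). length hs = k \<longrightarrow>
        nrm (prod_nsp F G) ((Df hs (x + h), Dg hs (x + h)) - (Df hs x, Dg hs x) - (Df (h # hs) x, Dg (h # hs) x))
          \<le> \<epsilon> * nrm E h * npr E hs) (near E U x)"
    proof eventually_elim
      case (elim h)
      show ?case
      proof (intro ballI impI)
        fix hs assume hs: "hs \<in> lists (pts E)" "length hs = k"
        have "\<epsilon> / 2 * nrm E h * npr E hs + \<epsilon> / 2 * nrm E h * npr E hs = \<epsilon> * nrm E h * npr E hs" by simp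
        then show "nrm (prod_nsp F G) ((Df hs (x + h), Dg hs (x + h)) - (Df hs x, Dg hs x) - (Df (h # hs) x, Dg (h # hs) x))
          \<le> \<epsilon> * nrm E h * npr E hs"
          using add_mono[OF elim(1)[rule_format, OF hs(1)] elim(2)[rule_format, OF hs(1)]] hs(2)
          unfolding nrm_prod_nsp by simp
      qed
    qed
  qed (auto simp del: in_lists_conv_set intro: EF.jet_pts[OF D(1)] EG.jet_pts[OF D(2)] simp: EF.jet_lin[OF D(1)] EG.jet_lin[OF D(2)])
  then show ?thesis
    unfolding smooth_deriv_def using f g by (intro exI conjI) auto
qed

lemma smooth_deriv_linear:
  assumes "nspace E" "nspace F" "U \<subseteq> pts E"
    and L: "\<And>x. x \<in> pts E \<Longrightarrow> L x \<in> pts F" "\<And>r x y. x \<in> pts E \<Longrightarrow> y \<in> pts E \<Longrightarrow> L (r *\<^sub>R x + y) = r *\<^sub>R L x + L y"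
      "\<And>x. x \<in> pts E \<Longrightarrow> nrm F (L x) \<le> C * nrm E x"
  shows "smooth_deriv E F U L (\<lambda>x h. L h)"
proof -
  interpret E: nspace E by fact
  interpret F: nspace F by fact
  define D where "D hs x = (if hs = [] then L x else if length hs = 1 then L (hd hs) else 0)" for hs x
  have "jet E F U D"
    unfolding jet_def
  proof (intro conjI ballI allI impI)
    fix x k assume x: "x \<in> U"
    show "\<exists>C. \<forall>hs\<in>lists (pts E). length hs = k \<longrightarrow> nrm F (D hs x) \<le> C * npr E hs"
    proof (intro exI[of _ "if k = 0 then nrm F (L x) else if k = 1 then C else 0"] ballI impI)
      fix hs assume hs: "hs \<in> lists (pts E)" "length hs = k"
      then consider "hs = []" | h where "hs = [h]" "h \<in> pts E" | "k > 1"
        by (cases hs; cases "tl hs") auto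
      then show "nrm F (D hs x) \<le> (if k = 0 then nrm F (L x) else if k = 1 then C else 0) * npr E hs"
        by cases (use hs L(3) in \<open>auto simp: D_def\<close>)
    qed
  next
    fix x k and \<epsilon> :: real assume x: "x \<in> U" and "0 < \<epsilon>"
    from eventually_near_less[OF zero_less_one, of E x U]
    show "eventually (\<lambda>h. \<forall>hs\<in>lists (pts E). length hs = k \<longrightarrow>
        nrm F (D hs (x + h) - D hs x - D (h # hs) x) \<le> \<epsilon> * nrm E h * npr E hs) (near E U x)"
    proof eventually_elim
      case (elim h)
      have "L (x + h) = L x + L h" using L(2)[of x h 1] x assms(3) elim by auto
      then have 0: "D hs (x + h) - D hs x - D (h # hs) x = 0" for hs
        by (auto simp: D_def)
      show ?case
        unfolding 0 using elim \<open>0 < \<epsilon>\<close> by (auto intro!: mult_nonneg_nonneg E.npr_nonneg)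
    qed
  qed (use assms(3) L(1,2) in \<open>auto simp: D_def\<close>)
  then show ?thesis
    unfolding smooth_deriv_def by (intro exI[of _ D]) (auto simp: D_def)
qed

lemma smooth_deriv_bilinear:
  assumes "nspace E" "nspace E'" "nspace F" "U \<subseteq> pts (prod_nsp E E')"
    and B: "\<And>x y. x \<in> pts E \<Longrightarrow> y \<in> pts E' \<Longrightarrow> B x y \<in> pts F"
      "\<And>r x x' y. x \<in> pts E \<Longrightarrow> x' \<in> pts E \<Longrightarrow> y \<in> pts E' \<Longrightarrow> B (r *\<^sub>R x + x') y = r *\<^sub>R B x y + B x' y"
      "\<And>r x y y'. x \<in> pts E \<Longrightarrow> y \<in> pts E' \<Longrightarrow> y' \<in> pts E' \<Longrightarrow> B x (r *\<^sub>R y + y') = r *\<^sub>R B x y + B x y'"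
      "\<And>x y. x \<in> pts E \<Longrightarrow> y \<in> pts E' \<Longrightarrow> nrm F (B x y) \<le> C * nrm E x * nrm E' y"
  shows "smooth_deriv (prod_nsp E E') F U (\<lambda>z. B (fst z) (snd z)) (\<lambda>z h. B (fst h) (snd z) + B (fst z) (snd h))"
proof -
  interpret E: nspace E by fact
  interpret E': nspace E' by fact
  interpret F: nspace F by fact
  interpret EE: nspace "prod_nsp E E'" by (rule nspace_prod) fact+
  let ?E = "prod_nsp E E'"
  define C' where "C' = \<bar>C\<bar>"
  have C'0: "0 \<le> C'" by (simp add: C'_def)
  have le: "nrm F (B x y) \<le> C' * nrm E x * nrm E' y" if "x \<in> pts E" "y \<in> pts E'" for x y
  proof -
    have "C * (nrm E x * nrm E' y) \<le> C' * (nrm E x * nrm E' y)"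
      unfolding C'_def using that by (intro mult_right_mono) auto
    then show ?thesis using B(4)[OF that] by (simp add: mult.assoc)
  qed
  have mixed: "nrm F (B (fst h) (snd k)) \<le> C' * (nrm ?E h * nrm ?E k)" if "h \<in> pts ?E" "k \<in> pts ?E" for h k
  proof -
    have "nrm F (B (fst h) (snd k)) \<le> C' * nrm E (fst h) * nrm E' (snd k)"
      using that by (intro le) auto
    also have "\<dots> \<le> C' * (nrm ?E h * nrm ?E k)"
      unfolding mult.assoc using that C'0 by (intro mult_left_mono mult_mono) (auto simp: nrm_prod_nsp)
    finally show ?thesis .
  qed
  define P where "P h k = B (fst h) (snd k) + B (fst k) (snd h)" for h k
  have P: "P h k \<in> pts F" "nrm F (P h k) \<le> 2 * C' * (nrm ?E h * nrm ?E k)" if "h \<in> pts ?E" "k \<in> pts ?E" for h k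
  proof -
    have p: "B (fst h) (snd k) \<in> pts F" "B (fst k) (snd h) \<in> pts F" using that by (auto intro!: B(1))
    then show "P h k \<in> pts F" by (simp add: P_def)
    show "nrm F (P h k) \<le> 2 * C' * (nrm ?E h * nrm ?E k)"
      using F.nrm_triangle[OF p] mixed[OF that] mixed[OF that(2,1)] by (simp add: P_def mult_ac)
  qed
  have Plin: "P (r *\<^sub>R h + h') k = r *\<^sub>R P h k + P h' k" if "h \<in> pts ?E" "h' \<in> pts ?E" "k \<in> pts ?E" for r h h' k
    using that B(2)[of "fst h" "fst h'" "snd k" r] B(3)[of "fst k" "snd h" "snd h'" r]
    by (auto simp: P_def scaleR_add_right)
  have Pcomm: "P h k = P k h" for h k by (simp add: P_def add.commute)
  \<comment> \<open>The derivative in direction \<open>h\<close> is \<open>P h z\<close>. It is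
    linear in \<open>z\<close>, so the second derivative \<open>P h k\<close> is constant and the
    jet stops there.\<close>
  define D where "D hs z = (case hs of [] \<Rightarrow> B (fst z) (snd z) | [h] \<Rightarrow> P h z | [h, k] \<Rightarrow> P h k | _ \<Rightarrow> 0)" for hs z
  have D_simps: "D [] z = B (fst z) (snd z)" "D [h] z = P h z" "D [h, k] z = P h k" "D (h # k # l # hs) z = 0" for z h k l hs
    by (simp_all add: D_def)
  have "jet ?E F U D"
    unfolding jet_def
  proof (intro conjI ballI allI impI)
    fix z hs assume z: "z \<in> U" and hs: "hs \<in> lists (pts ?E)"
    then have z': "z \<in> pts ?E" using assms(4) by auto
    from hs consider "hs = []" | h where "hs = [h]" "h \<in> pts ?E" | h k where "hs = [h, k]" "h \<in> pts ?E" "k \<in> pts ?E"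
      | h k l hs' where "hs = h # k # l # hs'"
      by (cases hs; cases "tl hs"; cases "tl (tl hs)") auto
    then show "D hs z \<in> pts F"
      using z' by cases (auto simp: D_simps P(1) intro!: B(1))
    show "D ((r *\<^sub>R h + h') # hs) z = r *\<^sub>R D (h # hs) z + D (h' # hs) z"
      if h: "h \<in> pts ?E" "h' \<in> pts ?E" for h h' r
    proof -
      from hs consider "hs = []" | k where "hs = [k]" "k \<in> pts ?E" | k l hs' where "hs = k # l # hs'"
        by (cases hs; cases "tl hs") auto
      then show ?thesis
        by cases (simp_all only: D_simps Plin[OF h z'] Plin[OF h], simp)
    qed
  next
    fix z k assume z: "z \<in> U"
    then have z': "z \<in> pts ?E" using assms(4) by auto
    show "\<exists>C. \<forall>hs\<in>lists (pts ?E). length hs = k \<longrightarrow> nrm F (D hs z) \<le> C * npr ?E hs"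
    proof (intro exI[of _ "nrm F (B (fst z) (snd z)) + 2 * C' * nrm ?E z + 2 * C'"] ballI impI)
      fix hs assume hs: "hs \<in> lists (pts ?E)"
      define M where "M = nrm F (B (fst z) (snd z)) + 2 * C' * nrm ?E z + 2 * C'"
      have "0 \<le> nrm F (B (fst z) (snd z))" using z' by (auto intro!: F.nrm_nonneg B(1))
      then have M: "nrm F (B (fst z) (snd z)) \<le> M" "2 * C' * nrm ?E z \<le> M" "2 * C' \<le> M" "0 \<le> M"
        using C'0 EE.nrm_nonneg[OF z'] by (auto simp: M_def)
      from hs consider "hs = []" | h where "hs = [h]" "h \<in> pts ?E" | h k where "hs = [h, k]" "h \<in> pts ?E" "k \<in> pts ?E"
        | h k l hs' where "hs = h # k # l # hs'"
        by (cases hs; cases "tl hs"; cases "tl (tl hs)") auto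
      then have "nrm F (D hs z) \<le> M * npr ?E hs"
      proof cases
        case 1
        then show ?thesis using M by (simp add: D_simps)
      next
        case 2
        have "nrm F (P (hd hs) z) \<le> (2 * C' * nrm ?E z) * nrm ?E (hd hs)"
          using P(2)[OF 2(2) z'] 2 by (simp add: mult_ac)
        also have "\<dots> \<le> M * nrm ?E (hd hs)" using M(2) 2 by (intro mult_right_mono EE.nrm_nonneg) auto
        finally show ?thesis using 2 by (simp add: D_simps)
      next
        case (3 h k)
        have "nrm F (P h k) \<le> M * (nrm ?E h * nrm ?E k)"
          using P(2)[OF 3(2,3)] M(3) 3 by (intro order_trans[OF P(2)[OF 3(2,3)]] mult_right_mono mult_nonneg_nonneg EE.nrm_nonneg) auto
        then show ?thesis using 3 by (simp add: D_simps)
      next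
        case 4
        then show ?thesis using M(4) EE.npr_nonneg[OF hs] by (simp add: D_simps)
      qed
      then show "nrm F (D hs z) \<le> (nrm F (B (fst z) (snd z)) + 2 * C' * nrm ?E z + 2 * C') * npr ?E hs"
        by (simp add: M_def)
    qed
  next
    fix z k and \<epsilon> :: real assume z: "z \<in> U" and \<epsilon>: "0 < \<epsilon>"
    then have z': "z \<in> pts ?E" using assms(4) by auto
    \<comment> \<open>Only order zero has a nonzero remainder, the quadratic term
      \<open>B (fst h) (snd h)\<close>; this radius makes it at most \<epsilon> times the norm of
      \<open>h\<close>.\<close>
    have "0 < \<epsilon> / (C' + 1)" using \<epsilon> C'0 by simp
    from eventually_near_less[OF this, of ?E z U]
    show "eventually (\<lambda>h. \<forall>hs\<in>lists (pts ?E). length hs = k \<longrightarrow>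
        nrm F (D hs (z + h) - D hs z - D (h # hs) z) \<le> \<epsilon> * nrm ?E h * npr ?E hs) (near ?E U z)"
    proof eventually_elim
      case (elim h)
      then have h: "h \<in> pts ?E" and small: "nrm ?E h < \<epsilon> / (C' + 1)" by auto
      show ?case
      proof (intro ballI impI)
        fix hs assume hs: "hs \<in> lists (pts ?E)"
        have nn: "0 \<le> \<epsilon> * nrm ?E h * npr ?E hs"
          using \<epsilon> EE.nrm_nonneg[OF h] EE.npr_nonneg[OF hs] by simp
        from hs consider "hs = []" | k where "hs = [k]" "k \<in> pts ?E" | k l hs' where "hs = k # l # hs'"
          by (cases hs; cases "tl hs") auto
        then show "nrm F (D hs (z + h) - D hs z - D (h # hs) z) \<le> \<epsilon> * nrm ?E h * npr ?E hs"
        proof cases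
          case 1
          have "B (fst z + fst h) (snd z + snd h) = B (fst z) (snd z) + B (fst z) (snd h) + (B (fst h) (snd z) + B (fst h) (snd h))"
            using z' h B(2)[of "fst z" "fst h" "snd z + snd h" 1] B(3)[of "fst z" "snd z" "snd h" 1] B(3)[of "fst h" "snd z" "snd h" 1]
            by auto
          then have "D [] (z + h) - D [] z - D [h] z = B (fst h) (snd h)"
            by (simp add: D_simps P_def)
          moreover have "nrm F (B (fst h) (snd h)) \<le> (C' * nrm ?E h) * nrm ?E h"
            using mixed[OF h h] by (simp add: mult.assoc)
          moreover have "(C' * nrm ?E h) * nrm ?E h \<le> \<epsilon> * nrm ?E h"
          proof (rule mult_right_mono)
            have "C' * nrm ?E h \<le> (C' + 1) * nrm ?E h" using EE.nrm_nonneg[OF h] by (intro mult_right_mono) auto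
            also have "\<dots> \<le> \<epsilon>" using small C'0 by (simp add: field_simps)
            finally show "C' * nrm ?E h \<le> \<epsilon>" .
          qed (rule EE.nrm_nonneg[OF h])
          ultimately show ?thesis using 1 by simp
        next
          case 2
          have "P k (z + h) = P k z + P k h"
            using Plin[OF z' h 2(2), of 1] by (simp add: Pcomm[of k])
          then have "D hs (z + h) - D hs z - D (h # hs) z = 0"
            using 2 Pcomm[of h k] by (simp add: D_simps)
          then show ?thesis using nn by simp
        next
          case 3
          then have "D hs (z + h) - D hs z - D (h # hs) z = 0"
            by (cases hs') (simp_all add: D_simps)
          then show ?thesis using nn by simp
        qed
      qed
    qed
  qed
  then show ?thesis
    unfolding smooth_deriv_def by (intro exI[of _ D]) (auto simp: D_simps P_def)
qed

text \<open>New directions are prepended, so the last entry of a list is the direction of the first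
  derivative. Freezing it to \<open>v\<close> leaves a jet of \<open>f' x v\<close> in the remaining
  entries.\<close>

lemma smooth_deriv_direction:
  assumes "nspace E" "nspace F" "smooth_deriv E F U f f'" "v \<in> pts E"
  shows "smooth_on E F U (\<lambda>x. f' x v)"
proof -
  interpret E: nspace E by fact
  interpret F: nspace F by fact
  interpret nspace2 E F ..
  obtain D where D: "jet E F U D" and f: "\<And>x h. x \<in> U \<Longrightarrow> h \<in> pts E \<Longrightarrow> D [h] x = f' x h"
    using assms(3) unfolding smooth_deriv_def by blast
  have v: "hs @ [v] \<in> lists (pts E)" if "hs \<in> lists (pts E)" for hs
    using that assms(4) by auto
  have v0: "0 \<le> nrm E v" using assms(4) by simp
  have "jet E F U (\<lambda>hs x. D (hs @ [v]) x)"
    unfolding jet_def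
  proof (intro conjI ballI allI impI)
    fix x k assume x: "x \<in> U"
    obtain C where C: "\<forall>hs\<in>lists (pts E). length hs = Suc k \<longrightarrow> nrm F (D hs x) \<le> C * npr E hs"
      using jet_bound[OF D x] by blast
    show "\<exists>C. \<forall>hs\<in>lists (pts E). length hs = k \<longrightarrow> nrm F (D (hs @ [v]) x) \<le> C * npr E hs"
    proof (intro exI[of _ "C * nrm E v"] ballI impI)
      fix hs assume hs: "hs \<in> lists (pts E)" "length hs = k"
      show "nrm F (D (hs @ [v]) x) \<le> C * nrm E v * npr E hs"
        using C[rule_format, OF v[OF hs(1)]] hs(2) by (simp add: mult_ac)
    qed
  next
    fix x k and \<epsilon> :: real assume x: "x \<in> U" and \<epsilon>: "0 < \<epsilon>"
    have "0 < \<epsilon> / (nrm E v + 1)" using \<epsilon> v0 by simp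
    from jet_deriv[OF D x this, of "Suc k"] eventually_near_less[OF zero_less_one, of E x U]
    show "eventually (\<lambda>h. \<forall>hs\<in>lists (pts E). length hs = k \<longrightarrow>
        nrm F (D (hs @ [v]) (x + h) - D (hs @ [v]) x - D ((h # hs) @ [v]) x) \<le> \<epsilon> * nrm E h * npr E hs) (near E U x)"
    proof eventually_elim
      case (elim h)
      show ?case
      proof (intro ballI impI)
        fix hs assume hs: "hs \<in> lists (pts E)" "length hs = k"
        have "nrm F (D (hs @ [v]) (x + h) - D (hs @ [v]) x - D (h # hs @ [v]) x)
            \<le> \<epsilon> / (nrm E v + 1) * nrm E h * npr E (hs @ [v])"
          using elim(1)[rule_format, OF v[OF hs(1)]] hs(2) by simp
        also have "\<dots> = (nrm E v / (nrm E v + 1)) * (\<epsilon> * nrm E h * npr E hs)"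
          by simp
        also have "\<dots> \<le> 1 * (\<epsilon> * nrm E h * npr E hs)"
          using v0 \<epsilon> elim(2) E.npr_nonneg[OF hs(1)] by (intro mult_right_mono mult_nonneg_nonneg) auto
        finally show "nrm F (D (hs @ [v]) (x + h) - D (hs @ [v]) x - D ((h # hs) @ [v]) x) \<le> \<epsilon> * nrm E h * npr E hs"
          by simp
      qed
    qed
  qed (use jet_pts[OF D _ v] jet_lin[OF D _ v] in simp_all)
  then show ?thesis
    unfolding smooth_on_iff_jet using f assms(4) by fastforce
qed

lemma nopen_preimage:
  assumes "nspace E" "nspace F" "smooth_deriv E F U f f'" "nopen E U" "nopen F V"
  shows "nopen E {x \<in> U. f x \<in> V}"
proof -
  interpret E: nspace E by fact
  interpret F: nspace F by fact
  interpret nspace2 E F ..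
  obtain D where D: "jet E F U D" and f: "\<And>x. x \<in> U \<Longrightarrow> D [] x = f x"
    using assms(3) unfolding smooth_deriv_def by blast
  show ?thesis
    unfolding nopen_def
  proof (intro conjI ballI)
    show "{x \<in> U. f x \<in> V} \<subseteq> pts E" using assms(4) by (auto simp: nopen_def)
    fix x assume "x \<in> {x \<in> U. f x \<in> V}"
    then have x: "x \<in> U" "f x \<in> V" by auto
    have xE: "x \<in> pts E" using x assms(4) by (auto simp: nopen_def)
    obtain r where r: "r > 0" "\<forall>y\<in>pts E. nrm E (y - x) < r \<longrightarrow> y \<in> U"
      using assms(4) x unfolding nopen_def by blast
    obtain \<rho> where \<rho>: "\<rho> > 0" "\<forall>y\<in>pts F. nrm F (y - f x) < \<rho> \<longrightarrow> y \<in> V"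
      using assms(5) x unfolding nopen_def by blast
    obtain L where L: "1 \<le> L" "eventually (\<lambda>h. \<forall>hs\<in>lists (pts E). length hs \<le> 0 \<longrightarrow>
           nrm F (D hs (x + h) - D hs x) \<le> L * nrm E h * npr E hs) (near E U x)"
      using jet_lipschitz[OF D x(1)] by blast
    then obtain \<delta> where \<delta>: "\<delta> > 0" "\<And>h. h \<in> pts E \<Longrightarrow> nrm E h < \<delta> \<Longrightarrow> x + h \<in> U \<Longrightarrow> nrm F (D [] (x + h) - D [] x) \<le> L * nrm E h"
      unfolding eventually_near by force
    show "\<exists>r>0. \<forall>y\<in>pts E. nrm E (y - x) < r \<longrightarrow> y \<in> {x \<in> U. f x \<in> V}"
    proof (intro exI[of _ "min r (min \<delta> (\<rho> / L))"] conjI ballI impI)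
      show "0 < min r (min \<delta> (\<rho> / L))" using r(1) \<delta>(1) \<rho>(1) L(1) by simp
      fix y assume y: "y \<in> pts E" "nrm E (y - x) < min r (min \<delta> (\<rho> / L))"
      then have yU: "y \<in> U" using r(2) by simp
      have "nrm F (f y - f x) \<le> L * nrm E (y - x)"
        using \<delta>(2)[of "y - x"] y xE yU by (simp add: f x)
      also have "\<dots> < \<rho>" using y(2) L(1) by (simp add: field_simps)
      finally show "y \<in> {x \<in> U. f x \<in> V}"
        using \<rho>(2) yU smooth_deriv_pts[OF assms(3) yU] by simp
    qed
  qed
qed

definition bounded_bil :: "'v::real_vector nsp \<Rightarrow> 'w::real_vector nsp \<Rightarrow> 'u::real_vector nsp \<Rightarrow> ('v \<Rightarrow> 'w \<Rightarrow> 'u) \<Rightarrow> bool" where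
  "bounded_bil E E' F B \<longleftrightarrow>
     (\<forall>x\<in>pts E. \<forall>y\<in>pts E'. B x y \<in> pts F) \<and>
     (\<forall>x\<in>pts E. \<forall>x'\<in>pts E. \<forall>y\<in>pts E'. \<forall>r. B (r *\<^sub>R x + x') y = r *\<^sub>R B x y + B x' y) \<and>
     (\<forall>x\<in>pts E. \<forall>y\<in>pts E'. \<forall>y'\<in>pts E'. \<forall>r. B x (r *\<^sub>R y + y') = r *\<^sub>R B x y + B x y') \<and>
     (\<exists>C. \<forall>x\<in>pts E. \<forall>y\<in>pts E'. nrm F (B x y) \<le> C * nrm E x * nrm E' y)"

lemma smooth_deriv_const:
  assumes "nspace E" "nspace F" "y \<in> pts F"
  shows "smooth_deriv E F U (\<lambda>_. y) (\<lambda>_ _. 0)"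
proof -
  interpret E: nspace E by fact
  interpret F: nspace F by fact
  have "jet E F U (\<lambda>hs x. if hs = [] then y else 0)"
    unfolding jet_def
  proof (intro conjI ballI allI impI)
    show "\<exists>C. \<forall>hs\<in>lists (pts E). length hs = k \<longrightarrow> nrm F (if hs = [] then y else 0) \<le> C * npr E hs" for k
      by (rule exI[of _ "if k = 0 then nrm F y else 0"]) auto
    show "eventually (\<lambda>h. \<forall>hs\<in>lists (pts E). length hs = k \<longrightarrow>
        nrm F ((if hs = [] then y else 0) - (if hs = [] then y else 0) - (if h # hs = [] then y else 0))
          \<le> \<epsilon> * nrm E h * npr E hs) (near E U x)" if "0 < \<epsilon>" for \<epsilon> x k
      using eventually_near_less[OF zero_less_one, of E x U]
      by eventually_elim (use that in \<open>auto intro!: mult_nonneg_nonneg E.npr_nonneg\<close>)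
  qed (use assms(3) in auto)
  then show ?thesis
    unfolding smooth_deriv_def by (intro exI conjI) auto
qed

lemma smooth_deriv_id: "nspace E \<Longrightarrow> U \<subseteq> pts E \<Longrightarrow> smooth_deriv E E U (\<lambda>x. x) (\<lambda>x h. h)"
  by (rule smooth_deriv_linear[where C=1]) auto

lemma smooth_deriv_fst:
  assumes "nspace E" "nspace F" "smooth_deriv X (prod_nsp E F) U f f'" "nspace X"
  shows "smooth_deriv X E U (\<lambda>x. fst (f x)) (\<lambda>x h. fst (f' x h))"
proof (rule smooth_deriv_comp[OF assms(4) nspace_prod[OF assms(1,2)] assms(1,3)])
  show "nopen (prod_nsp E F) (pts (prod_nsp E F))"
    by (rule nspace.nopen_pts[OF nspace_prod[OF assms(1,2)]])
  show "smooth_deriv (prod_nsp E F) E (pts (prod_nsp E F)) fst (\<lambda>x. fst)"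
    using nspace.nrm_nonneg[OF assms(2)]
    by (intro smooth_deriv_linear[where C=1] nspace_prod assms(1,2)) (auto simp: nrm_prod_nsp)
qed (rule smooth_deriv_pts[OF assms(3)])

lemma smooth_deriv_snd:
  assumes "nspace E" "nspace F" "smooth_deriv X (prod_nsp E F) U f f'" "nspace X"
  shows "smooth_deriv X F U (\<lambda>x. snd (f x)) (\<lambda>x h. snd (f' x h))"
proof (rule smooth_deriv_comp[OF assms(4) nspace_prod[OF assms(1,2)] assms(2,3)])
  show "nopen (prod_nsp E F) (pts (prod_nsp E F))"
    by (rule nspace.nopen_pts[OF nspace_prod[OF assms(1,2)]])
  show "smooth_deriv (prod_nsp E F) F (pts (prod_nsp E F)) snd (\<lambda>x. snd)"
    using nspace.nrm_nonneg[OF assms(1)]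
    by (intro smooth_deriv_linear[where C=1] nspace_prod assms(1,2)) (auto simp: nrm_prod_nsp)
qed (rule smooth_deriv_pts[OF assms(3)])

lemma smooth_deriv_add:
  assumes "nspace E" "nspace F" "smooth_deriv E F U f f'" "smooth_deriv E F U g g'"
  shows "smooth_deriv E F U (\<lambda>x. f x + g x) (\<lambda>x h. f' x h + g' x h)"
proof -
  interpret F: nspace F by fact
  let ?P = "prod_nsp F F"
  note P = nspace_prod[OF assms(2,2)]
  have L: "smooth_deriv ?P F (pts ?P) (\<lambda>z. fst z + snd z) (\<lambda>z h. fst h + snd h)"
  proof (rule smooth_deriv_linear[where C=1, OF P assms(2) order.refl])
    show "nrm F (fst x + snd x) \<le> 1 * nrm ?P x" if "x \<in> pts ?P" for x
      using that by (auto simp: nrm_prod_nsp intro: F.nrm_triangle)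
  qed (auto simp: algebra_simps)
  have pr: "smooth_deriv E ?P U (\<lambda>x. (f x, g x)) (\<lambda>x h. (f' x h, g' x h))"
    by (rule smooth_deriv_Pair) fact+
  show ?thesis
    using smooth_deriv_comp[OF assms(1) P assms(2) pr L nspace.nopen_pts[OF P] smooth_deriv_pts(1)[OF pr]]
    by simp
qed

lemma smooth_deriv_bil:
  assumes "nspace X" "nspace E" "nspace E'" "nspace F" and B: "bounded_bil E E' F B"
    and "smooth_deriv X E U f f'" "smooth_deriv X E' U g g'"
  shows "smooth_deriv X F U (\<lambda>x. B (f x) (g x)) (\<lambda>x h. B (f' x h) (g x) + B (f x) (g' x h))"
proof -
  let ?P = "prod_nsp E E'"
  note P = nspace_prod[OF assms(2,3)]
  obtain C where C: "\<forall>x\<in>pts E. \<forall>y\<in>pts E'. nrm F (B x y) \<le> C * nrm E x * nrm E' y"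
    using B unfolding bounded_bil_def by blast
  have L: "smooth_deriv ?P F (pts ?P) (\<lambda>z. B (fst z) (snd z)) (\<lambda>z h. B (fst h) (snd z) + B (fst z) (snd h))"
    by (rule smooth_deriv_bilinear[where C=C, OF assms(2,3,4) order.refl])
      (use B C in \<open>simp_all add: bounded_bil_def\<close>)
  have pr: "smooth_deriv X ?P U (\<lambda>x. (f x, g x)) (\<lambda>x h. (f' x h, g' x h))"
    by (rule smooth_deriv_Pair) fact+
  show ?thesis
    using smooth_deriv_comp[OF assms(1) P assms(4) pr L nspace.nopen_pts[OF P] smooth_deriv_pts(1)[OF pr]]
    by simp
qed

lemma bounded_bil_scaleR: "nspace E \<Longrightarrow> bounded_bil euclid E E (\<lambda>r x. r *\<^sub>R x)"
  unfolding bounded_bil_def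
  by (auto simp: nspace.nrm_scale nspace.pts_scale algebra_simps intro!: exI[of _ 1])

text \<open>The tangent map \<open>(x, v) \<mapsto> f' x v\<close> is the derivative of \<open>(s, x, v) \<mapsto> f (x + s v)\<close> at \<open>s = 0\<close>
  in the fixed direction \<open>(1, 0, 0)\<close>.\<close>

lemma smooth_on_tangent_map:
  assumes E: "nspace E" and F: "nspace F" and f: "smooth_deriv E F U f f'" and U: "nopen E U"
  shows "smooth_on (prod_nsp E E) F (U \<times> pts E) (\<lambda>z. f' (fst z) (snd z))"
proof -
  let ?T = "prod_nsp E E"
  let ?X = "prod_nsp (euclid :: real nsp) ?T"
  note T = nspace_prod[OF E E]
  note X = nspace_prod[OF nspace_euclid T]
  interpret E: nspace E by fact
  have UE: "U \<subseteq> pts E" using U by (simp add: nopen_def)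
  define \<phi> where "\<phi> z = fst (snd z) + fst z *\<^sub>R snd (snd z)" for z :: "real \<times> 'a \<times> 'a"
  define \<phi>' where "\<phi>' z h = fst (snd h) + (fst h *\<^sub>R snd (snd z) + fst z *\<^sub>R snd (snd h))" for z h :: "real \<times> 'a \<times> 'a"
  have i: "smooth_deriv ?X ?X (pts ?X) (\<lambda>z. z) (\<lambda>z h. h)"
    by (rule smooth_deriv_id[OF X order.refl])
  note s = smooth_deriv_fst[OF nspace_euclid T i X] and t = smooth_deriv_snd[OF nspace_euclid T i X]
  have \<phi>: "smooth_deriv ?X E (pts ?X) \<phi> \<phi>'"
    unfolding \<phi>_def \<phi>'_def
    by (intro smooth_deriv_add[OF X E] smooth_deriv_bil[OF X nspace_euclid E E bounded_bil_scaleR[OF E]]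
        s smooth_deriv_fst[OF E E t X] smooth_deriv_snd[OF E E t X])
  \<comment> \<open>The triples \<open>(s, x, v)\<close> for which \<open>x + s v\<close> is in
    \<open>U\<close>. All triples with \<open>s = 0\<close> and \<open>x\<close> in \<open>U\<close>
    belong to it, and the result is finally restricted to these.\<close>
  define \<Omega> where "\<Omega> = {z \<in> pts ?X. \<phi> z \<in> U}"
  have \<Omega>: "nopen ?X \<Omega>"
    unfolding \<Omega>_def by (rule nopen_preimage[OF X E \<phi> nspace.nopen_pts[OF X] U])
  have "smooth_deriv ?X F \<Omega> (\<lambda>z. f (\<phi> z)) (\<lambda>z h. f' (\<phi> z) (\<phi>' z h))"
  proof (rule smooth_deriv_comp[OF X E F _ f U])
    show "smooth_deriv ?X E \<Omega> \<phi> \<phi>'"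
      by (rule smooth_deriv_subset[OF \<phi>]) (auto simp: \<Omega>_def)
  qed (auto simp: \<Omega>_def)
  then have "smooth_on ?X F \<Omega> (\<lambda>z. f' (\<phi> z) (\<phi>' z (1, 0, 0)))"
    by (rule smooth_deriv_direction[OF X F]) auto
  then obtain g' where g: "smooth_deriv ?X F \<Omega> (\<lambda>z. f' (\<phi> z) (\<phi>' z (1, 0, 0))) g'"
    unfolding smooth_on_iff_deriv ..
  have \<iota>: "smooth_deriv ?T ?X (U \<times> pts E) (\<lambda>z. (0, z)) (\<lambda>z h. (0, h))"
    using UE by (intro smooth_deriv_Pair nspace_euclid T smooth_deriv_const smooth_deriv_id) auto
  have "(0, z) \<in> \<Omega>" if "z \<in> U \<times> pts E" for z
    using that UE by (auto simp: \<Omega>_def \<phi>_def)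
  from smooth_deriv_comp[OF T X F \<iota> g \<Omega> this] show ?thesis
    unfolding smooth_on_iff_deriv \<phi>_def \<phi>'_def by (auto simp: case_prod_unfold)
qed

lemma smooth_on_subset: "smooth_on E F U f \<Longrightarrow> V \<subseteq> U \<Longrightarrow> smooth_on E F V f"
  unfolding smooth_on_iff_deriv by (meson smooth_deriv_subset)

lemma smooth_on_comp:
  assumes "nspace E" "nspace F" "nspace G" "smooth_on E F U f" "smooth_on F G V g"
    and "nopen F V" "\<And>x. x \<in> U \<Longrightarrow> f x \<in> V"
  shows "smooth_on E G U (\<lambda>x. g (f x))"
proof -
  obtain f' g' where "smooth_deriv E F U f f'" "smooth_deriv F G V g g'"
    using assms(4,5) unfolding smooth_on_iff_deriv by blast
  from smooth_deriv_comp[OF assms(1-3) this assms(6,7)] show ?thesis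
    unfolding smooth_on_iff_deriv by blast
qed

lemma smooth_on_Pair:
  assumes "nspace E" "nspace F" "nspace G" "smooth_on E F U f" "smooth_on E G U g"
  shows "smooth_on E (prod_nsp F G) U (\<lambda>x. (f x, g x))"
proof -
  obtain f' g' where "smooth_deriv E F U f f'" "smooth_deriv E G U g g'"
    using assms(4,5) unfolding smooth_on_iff_deriv by blast
  from smooth_deriv_Pair[OF assms(1-3) this] show ?thesis
    unfolding smooth_on_iff_deriv by blast
qed

lemma smooth_on_bil:
  assumes "nspace X" "nspace E" "nspace E'" "nspace F" "bounded_bil E E' F B"
    and "smooth_on X E U f" "smooth_on X E' U g"
  shows "smooth_on X F U (\<lambda>x. B (f x) (g x))"
proof -
  obtain f' g' where "smooth_deriv X E U f f'" "smooth_deriv X E' U g g'"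
    using assms(6,7) unfolding smooth_on_iff_deriv by blast
  from smooth_deriv_bil[OF assms(1-5) this] show ?thesis
    unfolding smooth_on_iff_deriv by blast
qed

lemma smooth_on_add:
  assumes "nspace E" "nspace F" "smooth_on E F U f" "smooth_on E F U g"
  shows "smooth_on E F U (\<lambda>x. f x + g x)"
proof -
  obtain f' g' where "smooth_deriv E F U f f'" "smooth_deriv E F U g g'"
    using assms(3,4) unfolding smooth_on_iff_deriv by blast
  from smooth_deriv_add[OF assms(1,2) this] show ?thesis
    unfolding smooth_on_iff_deriv by blast
qed

lemma smooth_on_id: "nspace E \<Longrightarrow> U \<subseteq> pts E \<Longrightarrow> smooth_on E E U (\<lambda>x. x)"
  unfolding smooth_on_iff_deriv using smooth_deriv_id by blast

lemma smooth_on_const: "nspace E \<Longrightarrow> nspace F \<Longrightarrow> y \<in> pts F \<Longrightarrow> smooth_on E F U (\<lambda>_. y)"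
  unfolding smooth_on_iff_deriv using smooth_deriv_const by blast

lemma smooth_on_minus:
  assumes "nspace E" "nspace F" "smooth_on E F U f" "smooth_on E F U g"
  shows "smooth_on E F U (\<lambda>x. f x - g x)"
proof -
  interpret F: nspace F by fact
  have "smooth_on E F U (\<lambda>x. (-1) *\<^sub>R g x)"
    by (rule smooth_on_bil[OF assms(1) nspace_euclid assms(2,2) bounded_bil_scaleR[OF assms(2)]])
      (use assms in \<open>auto intro!: smooth_on_const nspace_euclid\<close>)
  from smooth_on_add[OF assms(1-3) this] show ?thesis by simp
qed

lemma smooth_on_fst:
  assumes "nspace E" "nspace F" "nspace X" "smooth_on X (prod_nsp E F) U f"
  shows "smooth_on X E U (\<lambda>x. fst (f x))"
  using assms smooth_deriv_fst unfolding smooth_on_iff_deriv by blast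

lemma smooth_on_snd:
  assumes "nspace E" "nspace F" "nspace X" "smooth_on X (prod_nsp E F) U f"
  shows "smooth_on X F U (\<lambda>x. snd (f x))"
  using assms smooth_deriv_snd unfolding smooth_on_iff_deriv by blast

lemma smooth_deriv_unique:
  assumes "nspace E" "nspace F" "smooth_deriv E F U f f'" "smooth_deriv E F U f f''" "nopen E U" "x \<in> U" "h \<in> pts E"
  shows "f' x h = f'' x h"
proof -
  interpret E: nspace E by fact
  interpret F: nspace F by fact
  let ?c = "\<lambda>t. x + t *\<^sub>R h"
  have x: "x \<in> pts E" using assms(5,6) by (auto simp: nopen_def)
  have c: "has_velocity E ?c h" "eventually (\<lambda>t. ?c t \<in> pts E) (at 0)" "?c 0 \<in> U"
    using E.has_velocity_line[OF assms(7)] x assms(6,7) by auto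
  have v: "has_velocity F (\<lambda>t. f (?c t)) (f' (?c 0) h)" "has_velocity F (\<lambda>t. f (?c t)) (f'' (?c 0) h)"
    by (rule smooth_deriv_velocity[OF assms(1,2,3,5) c] smooth_deriv_velocity[OF assms(1,2,4,5) c])+
  have "f' (?c 0) h = f'' (?c 0) h"
  proof (rule F.has_velocity_unique[OF v])
    show "eventually (\<lambda>t. f (?c t) \<in> pts F) (at 0)"
      using E.eventually_in_nopen[OF c(1,2) assms(5) c(3)]
      by eventually_elim (rule smooth_deriv_pts(1)[OF assms(3)])
    show "f (?c 0) \<in> pts F" using c(3) by (rule smooth_deriv_pts(1)[OF assms(3)])
  qed
  then show ?thesis by simp
qed

lemma nopen_Int: "nopen E U \<Longrightarrow> nopen E V \<Longrightarrow> nopen E (U \<inter> V)"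
proof -
  assume U: "nopen E U" and V: "nopen E V"
  show ?thesis
    unfolding nopen_def
  proof (intro conjI ballI)
    show "U \<inter> V \<subseteq> pts E" using U by (auto simp: nopen_def)
    fix x assume x: "x \<in> U \<inter> V"
    obtain r where r: "r > 0" "\<forall>y\<in>pts E. nrm E (y - x) < r \<longrightarrow> y \<in> U"
      using U x unfolding nopen_def by blast
    obtain q where q: "q > 0" "\<forall>y\<in>pts E. nrm E (y - x) < q \<longrightarrow> y \<in> V"
      using V x unfolding nopen_def by blast
    show "\<exists>r>0. \<forall>y\<in>pts E. nrm E (y - x) < r \<longrightarrow> y \<in> U \<inter> V"
      by (rule exI[of _ "min r q"]) (use r q in auto)
  qed
qed

lemma nopen_Times:
  assumes "nspace E" "nspace F" "nopen E U" "nopen F V"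
  shows "nopen (prod_nsp E F) (U \<times> V)"
proof -
  interpret E: nspace E by fact
  interpret F: nspace F by fact
  show ?thesis
    unfolding nopen_def
  proof (intro conjI ballI)
    show "U \<times> V \<subseteq> pts (prod_nsp E F)" using assms(3,4) by (auto simp: nopen_def)
    fix z assume z: "z \<in> U \<times> V"
    then have zp: "fst z \<in> pts E" "snd z \<in> pts F" using assms(3,4) by (auto simp: nopen_def)
    obtain r where r: "r > 0" "\<forall>y\<in>pts E. nrm E (y - fst z) < r \<longrightarrow> y \<in> U"
      using assms(3) z unfolding nopen_def by (metis SigmaE fst_conv)
    obtain q where q: "q > 0" "\<forall>y\<in>pts F. nrm F (y - snd z) < q \<longrightarrow> y \<in> V"
      using assms(4) z unfolding nopen_def by (metis SigmaE snd_conv)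
    show "\<exists>r>0. \<forall>y\<in>pts (prod_nsp E F). nrm (prod_nsp E F) (y - z) < r \<longrightarrow> y \<in> U \<times> V"
    proof (intro exI[of _ "min r q"] conjI ballI impI)
      fix y assume y: "y \<in> pts (prod_nsp E F)" "nrm (prod_nsp E F) (y - z) < min r q"
      have "nrm E (fst y - fst z) \<ge> 0" "nrm F (snd y - snd z) \<ge> 0"
        using y(1) zp by auto
      then show "y \<in> U \<times> V" using y r(2) q(2) by (cases y) (auto simp: nrm_prod_nsp)
    qed (use r q in auto)
  qed
qed

lemma (in nspace) nopen_ball:
  assumes "x \<in> pts E" shows "nopen E {y \<in> pts E. nrm E (y - x) < r}"
  unfolding nopen_def
proof (intro conjI ballI)
  fix y assume y: "y \<in> {y \<in> pts E. nrm E (y - x) < r}"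
  show "\<exists>q>0. \<forall>z\<in>pts E. nrm E (z - y) < q \<longrightarrow> z \<in> {y \<in> pts E. nrm E (y - x) < r}"
  proof (intro exI[of _ "r - nrm E (y - x)"] conjI ballI impI)
    fix z assume z: "z \<in> pts E" "nrm E (z - y) < r - nrm E (y - x)"
    have "nrm E (z - x) \<le> nrm E (z - y) + nrm E (y - x)"
      using nrm_triangle[of "z - y" "y - x"] z y assms by simp
    then show "z \<in> {y \<in> pts E. nrm E (y - x) < r}" using z by simp
  qed (use y in auto)
qed auto

section \<open>Symmetry of the second derivative\<close>

definition functional :: "'v::real_vector nsp \<Rightarrow> ('v \<Rightarrow> real) \<Rightarrow> bool" where
  "functional E l \<longleftrightarrow> (\<forall>x\<in>pts E. \<forall>y\<in>pts E. \<forall>r. l (r *\<^sub>R x + y) = r * l x + l y) \<and>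
     (\<exists>C. \<forall>x\<in>pts E. \<bar>l x\<bar> \<le> C * nrm E x)"

text \<open>Enough bounded real functionals to detect zero, so that identities in \<open>E\<close>
  reduce to identities of real numbers. For Sobolev forms it is verified with evaluations at
  points.\<close>

definition separated :: "'v::real_vector nsp \<Rightarrow> bool" where
  "separated E \<longleftrightarrow> (\<forall>x\<in>pts E. (\<forall>l. functional E l \<longrightarrow> l x = 0) \<longrightarrow> x = 0)"

context nspace2
begin

text \<open>The classical argument for mixed derivatives: the mean value theorem in direction
  \<open>h\<close> turns the second difference into a first difference of \<open>D [h]\<close> in
  direction \<open>k\<close>, which the jet at \<open>x\<close> evaluates. Composing with
  \<open>l\<close> makes the functions real valued.\<close>

lemma functional_jet_symmetric_aux:
  assumes D: "jet E F U D" and U: "nopen E U" and x: "x \<in> U" and h: "h \<in> pts E" and k: "k \<in> pts E"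
    and lin: "\<And>r y z. y \<in> pts F \<Longrightarrow> z \<in> pts F \<Longrightarrow> l (r *\<^sub>R y + z) = r * l y + l z"
    and bd: "\<And>y. y \<in> pts F \<Longrightarrow> \<bar>l y\<bar> \<le> C * nrm F y" and "0 \<le> C" and \<epsilon>: "0 < \<epsilon>"
  shows "\<exists>\<delta>>0. \<forall>\<tau>. 0 < \<tau> \<longrightarrow> \<tau> < \<delta> \<longrightarrow>
    \<bar>l (D [] (x + \<tau> *\<^sub>R h + \<tau> *\<^sub>R k)) - l (D [] (x + \<tau> *\<^sub>R h)) - l (D [] (x + \<tau> *\<^sub>R k)) + l (D [] x)
      - \<tau>\<^sup>2 * l (D [k, h] x)\<bar> \<le> \<epsilon> * \<tau>\<^sup>2"
proof -
  define H where "H = nrm E h + nrm E k + 1"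
  have H: "1 \<le> H" unfolding H_def using h k by simp
  have xE: "x \<in> pts E" using U x by (auto simp: nopen_def)
  \<comment> \<open>Calibrated so that each of the two remainders is at most
    \<open>\<epsilon> / 2 * \<tau>\<close> after the bounds \<open>nrm E h \<le> H\<close>,
    \<open>nrm E v \<le> \<tau> * H\<close> and the bound \<open>C\<close> of
    \<open>l\<close>.\<close>
  define e where "e = \<epsilon> / (2 * (C + 1) * H * H)"
  have e: "0 < e" unfolding e_def using \<epsilon> \<open>0 \<le> C\<close> H by (intro divide_pos_pos mult_pos_pos) auto
  obtain \<delta>0 where \<delta>0: "\<delta>0 > 0" "\<And>v. v \<in> pts E \<Longrightarrow> nrm E v < \<delta>0 \<Longrightarrow> x + v \<in> U"
  proof -
    obtain r where "r > 0" "\<forall>y\<in>pts E. nrm E (y - x) < r \<longrightarrow> y \<in> U"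
      using U x unfolding nopen_def by blast
    then show ?thesis using that[of r] xE by simp
  qed
  obtain \<delta>1 where \<delta>1: "\<delta>1 > 0" "\<And>v. v \<in> pts E \<Longrightarrow> nrm E v < \<delta>1 \<Longrightarrow> x + v \<in> U \<Longrightarrow>
      nrm F (D [h] (x + v) - D [h] x - D [v, h] x) \<le> e * nrm E v * npr E [h]"
  proof -
    have "[h] \<in> lists (pts E)" "length [h] \<le> 1" using h by auto
    with jet_deriv[OF D x e, of 1] show ?thesis
      unfolding eventually_near using that by metis
  qed
  define \<delta> where "\<delta> = min \<delta>0 \<delta>1 / H"
  have \<delta>: "0 < \<delta>" unfolding \<delta>_def using \<delta>0(1) \<delta>1(1) H by simp
  have small: "s *\<^sub>R h + t *\<^sub>R k \<in> pts E" "x + (s *\<^sub>R h + t *\<^sub>R k) \<in> U" "nrm E (s *\<^sub>R h + t *\<^sub>R k) \<le> \<tau> * H"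
      "nrm E (s *\<^sub>R h + t *\<^sub>R k) < \<delta>1"
    if "0 \<le> s" "s \<le> \<tau>" "0 \<le> t" "t \<le> \<tau>" "0 < \<tau>" "\<tau> < \<delta>" for s t \<tau>
  proof -
    show p: "s *\<^sub>R h + t *\<^sub>R k \<in> pts E" using h k by simp
    have "nrm E (s *\<^sub>R h + t *\<^sub>R k) \<le> s * nrm E h + t * nrm E k"
      using E.nrm_triangle[of "s *\<^sub>R h" "t *\<^sub>R k"] h k that by (simp add: E.nrm_scale)
    also have "\<dots> \<le> \<tau> * nrm E h + \<tau> * nrm E k"
      using that h k by (intro add_mono mult_right_mono) auto
    also have "\<dots> \<le> \<tau> * H" using that by (simp add: H_def algebra_simps)
    finally show le: "nrm E (s *\<^sub>R h + t *\<^sub>R k) \<le> \<tau> * H" .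
    also have "\<tau> * H < min \<delta>0 \<delta>1" using that(6) H unfolding \<delta>_def by (simp add: field_simps)
    finally show "nrm E (s *\<^sub>R h + t *\<^sub>R k) < \<delta>1" "x + (s *\<^sub>R h + t *\<^sub>R k) \<in> U"
      using \<delta>0(2)[OF p] by auto
  qed
  show ?thesis
  proof (intro exI[of _ \<delta>] conjI allI impI \<delta>)
    fix \<tau> :: real assume \<tau>: "0 < \<tau>" "\<tau> < \<delta>"
    \<comment> \<open>The increment in direction \<open>k\<close> as a function of the displacement
      \<open>s\<close> along \<open>h\<close>; the second difference is
      \<open>\<theta> \<tau> - \<theta> 0\<close>.\<close>
    define \<theta> where "\<theta> s = l (D [] (x + (s *\<^sub>R h + \<tau> *\<^sub>R k))) - l (D [] (x + (s *\<^sub>R h + 0 *\<^sub>R k)))" for s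
    have d: "((\<lambda>s. l (D [] (x + (s *\<^sub>R h + t *\<^sub>R k)))) has_real_derivative l (D [h] (x + (s *\<^sub>R h + t *\<^sub>R k)))) (at s)"
      if st: "0 \<le> s" "s \<le> \<tau>" "0 \<le> t" "t \<le> \<tau>" for s t
    proof -
      define c where "c r = (x + (s *\<^sub>R h + t *\<^sub>R k)) + r *\<^sub>R h" for r
      have c0: "c 0 = x + (s *\<^sub>R h + t *\<^sub>R k)" by (simp add: c_def)
      have cU: "c 0 \<in> U" unfolding c0 by (rule small(2)[OF st \<tau>])
      have c: "has_velocity E c h" "eventually (\<lambda>t. c t \<in> pts E) (at 0)" "c 0 \<in> pts E"
        unfolding c_def using E.has_velocity_line[OF h] xE h k by auto
      have cU': "eventually (\<lambda>r. c r \<in> U) (at 0)"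
        by (rule E.eventually_in_nopen[OF c(1,2) U cU])
      have "has_velocity F (\<lambda>r. D [] (c r)) (D [h] (c 0))"
        by (rule jet_velocity[OF D c cU' cU]) simp
      then have "((\<lambda>r. C * nrm F ((1 / r) *\<^sub>R (D [] (c r) - D [] (c 0)) - D [h] (c 0))) \<longlongrightarrow> 0) (at 0)"
        unfolding has_velocity_def by (intro tendsto_mult_right_zero) auto
      moreover have "eventually (\<lambda>r. 0 \<le> \<bar>(l (D [] (c r)) - l (D [] (c 0))) / r - l (D [h] (c 0))\<bar> \<and>
         \<bar>(l (D [] (c r)) - l (D [] (c 0))) / r - l (D [h] (c 0))\<bar>
          \<le> C * nrm F ((1 / r) *\<^sub>R (D [] (c r) - D [] (c 0)) - D [h] (c 0))) (at 0)"
        using cU'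
      proof eventually_elim
        case (elim r)
        have p: "D [] (c r) \<in> pts F" "D [] (c 0) \<in> pts F" "D [h] (c 0) \<in> pts F"
          using elim cU h by (auto intro!: jet_pts[OF D])
        have l0: "l (y - z) = l y - l z" if "y \<in> pts F" "z \<in> pts F" for y z
          using lin[of z y "-1"] that by simp
        have lr: "l (r *\<^sub>R y) = r * l y" if "y \<in> pts F" for y r
          using lin[of y 0 r] lin[of 0 0 1] that by simp
        have "l ((1 / r) *\<^sub>R (D [] (c r) - D [] (c 0)) - D [h] (c 0)) = (l (D [] (c r)) - l (D [] (c 0))) / r - l (D [h] (c 0))"
          using p by (simp add: l0 lr)
        then show ?case using bd[of "(1 / r) *\<^sub>R (D [] (c r) - D [] (c 0)) - D [h] (c 0)"] p by simp
      qed
      ultimately have "((\<lambda>r. \<bar>(l (D [] (c r)) - l (D [] (c 0))) / r - l (D [h] (c 0))\<bar>) \<longlongrightarrow> 0) (at 0)"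
        by (rule tendsto_0_squeeze)
      then have "((\<lambda>r. (l (D [] (c r)) - l (D [] (c 0))) / r) \<longlongrightarrow> l (D [h] (c 0))) (at 0)"
        using tendsto_rabs_zero_iff Lim_null by blast
      moreover have "c r = x + ((s + r) *\<^sub>R h + t *\<^sub>R k)" for r
        by (simp add: c_def algebra_simps)
      ultimately show ?thesis
        by (simp add: DERIV_def)
    qed
    have "\<exists>z. 0 < z \<and> z < \<tau> \<and> \<theta> \<tau> - \<theta> 0 = (\<tau> - 0) * (l (D [h] (x + (z *\<^sub>R h + \<tau> *\<^sub>R k))) - l (D [h] (x + (z *\<^sub>R h + 0 *\<^sub>R k))))"
    proof (rule MVT2[OF \<tau>(1)])
      fix s assume "0 \<le> s" "s \<le> \<tau>"
      then show "(\<theta> has_real_derivative l (D [h] (x + (s *\<^sub>R h + \<tau> *\<^sub>R k))) - l (D [h] (x + (s *\<^sub>R h + 0 *\<^sub>R k)))) (at s)"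
        unfolding \<theta>_def using \<tau>(1) by (intro DERIV_diff d) auto
    qed
    then obtain z where z: "0 < z" "z < \<tau>"
      "\<theta> \<tau> - \<theta> 0 = \<tau> * (l (D [h] (x + (z *\<^sub>R h + \<tau> *\<^sub>R k))) - l (D [h] (x + (z *\<^sub>R h + 0 *\<^sub>R k))))"
      by auto
    define v1 where "v1 = z *\<^sub>R h + \<tau> *\<^sub>R k"
    define v2 where "v2 = z *\<^sub>R h + 0 *\<^sub>R k"
    have v1: "v1 \<in> pts E" "x + v1 \<in> U" "nrm E v1 \<le> \<tau> * H" "nrm E v1 < \<delta>1"
      unfolding v1_def using small[of z \<tau> \<tau>] z \<tau> by auto
    have v2: "v2 \<in> pts E" "x + v2 \<in> U" "nrm E v2 \<le> \<tau> * H" "nrm E v2 < \<delta>1"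
      unfolding v2_def using small[of z \<tau> 0] z \<tau> by auto
    define R where "R v = D [h] (x + v) - D [h] x - D [v, h] x" for v
    have R: "R v \<in> pts F" "\<bar>l (R v)\<bar> \<le> \<epsilon> / 2 * \<tau>"
      if v: "v \<in> pts E" "x + v \<in> U" "nrm E v \<le> \<tau> * H" "nrm E v < \<delta>1" for v
    proof -
      show p: "R v \<in> pts F"
        unfolding R_def using v h x by (auto intro!: F.pts_diff jet_pts[OF D])
      have "nrm F (R v) \<le> e * nrm E v * nrm E h"
        unfolding R_def using \<delta>1(2)[OF v(1,4,2)] by simp
      also have "\<dots> \<le> e * (\<tau> * H) * H"
      proof (rule mult_mono[OF mult_left_mono[OF v(3)]])
        show "nrm E h \<le> H" using k by (simp add: H_def)
        show "0 \<le> e * (\<tau> * H)" using e \<tau>(1) H by simp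
      qed (use e h in auto)
      finally have 1: "nrm F (R v) \<le> e * (\<tau> * H) * H" .
      have "\<bar>l (R v)\<bar> \<le> C * nrm F (R v)" by (rule bd[OF p])
      also have "\<dots> \<le> (C + 1) * nrm F (R v)" using p by (intro mult_right_mono) auto
      also have "\<dots> \<le> (C + 1) * (e * (\<tau> * H) * H)" using 1 \<open>0 \<le> C\<close> by (intro mult_left_mono) auto
      also have "\<dots> = \<epsilon> / 2 * \<tau>"
      proof -
        have "(C + 1) * (q / (2 * (C + 1) * H * H) * (\<tau> * H) * H) = q / 2 * \<tau>" for q
          using H \<open>0 \<le> C\<close> by (simp add: divide_simps)
        then show ?thesis unfolding e_def .
      qed
      finally show "\<bar>l (R v)\<bar> \<le> \<epsilon> / 2 * \<tau>" .
    qed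
    \<comment> \<open>Both points have the same displacement \<open>z\<close> along
      \<open>h\<close>, so linearity leaves only \<tau> times the mixed derivative.\<close>
    have "D [v1, h] x = \<tau> *\<^sub>R D [k, h] x + D [v2, h] x"
      using jet_lin[OF D x _ k v2(1), of "[h]" \<tau>] h by (simp add: v1_def v2_def add.commute)
    then have "D [h] (x + v1) = (\<tau> *\<^sub>R D [k, h] x + ((-1) *\<^sub>R R v2 + (1 *\<^sub>R R v1 + D [h] (x + v2))))"
      by (simp add: R_def algebra_simps)
    moreover have "D [k, h] x \<in> pts F" "D [h] (x + v2) \<in> pts F"
      using h k x v2 by (auto intro!: jet_pts[OF D])
    moreover have "l (\<tau> *\<^sub>R y + ((-1) *\<^sub>R z + (1 *\<^sub>R u + w))) = \<tau> * l y + (- l z + (l u + l w))"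
      if "y \<in> pts F" "z \<in> pts F" "u \<in> pts F" "w \<in> pts F" for y z u w
      using lin[of y "(-1) *\<^sub>R z + (1 *\<^sub>R u + w)" \<tau>] lin[of z "1 *\<^sub>R u + w" "-1"] lin[of u w 1] that by simp
    ultimately have L1: "l (D [h] (x + v1)) = \<tau> * l (D [k, h] x) + (- l (R v2) + (l (R v1) + l (D [h] (x + v2))))"
      using R(1)[OF v1] R(1)[OF v2] by (simp only:)
    have "\<theta> \<tau> - \<theta> 0 - \<tau>\<^sup>2 * l (D [k, h] x) = \<tau> * (l (R v1) - l (R v2))"
      unfolding z(3) v1_def[symmetric] v2_def[symmetric] L1 by (simp add: algebra_simps power2_eq_square)
    also have "\<bar>\<dots>\<bar> \<le> \<tau> * (\<epsilon> / 2 * \<tau> + \<epsilon> / 2 * \<tau>)"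
      unfolding abs_mult using R(2)[OF v1] R(2)[OF v2] \<tau> by (intro mult_mono) auto
    also have "\<dots> = \<epsilon> * \<tau>\<^sup>2" by (simp add: power2_eq_square)
    finally show "\<bar>l (D [] (x + \<tau> *\<^sub>R h + \<tau> *\<^sub>R k)) - l (D [] (x + \<tau> *\<^sub>R h)) - l (D [] (x + \<tau> *\<^sub>R k)) + l (D [] x)
      - \<tau>\<^sup>2 * l (D [k, h] x)\<bar> \<le> \<epsilon> * \<tau>\<^sup>2"
      by (simp add: \<theta>_def algebra_simps)
  qed
qed

text \<open>The second difference is symmetric in \<open>h\<close> and \<open>k\<close>, while its
  quotient by the square of the step approaches either mixed derivative under every bounded
  functional. Separation removes the functionals.\<close>

lemma jet_symmetric:
  assumes D: "jet E F U D" and U: "nopen E U" and x: "x \<in> U" and h: "h \<in> pts E" and k: "k \<in> pts E"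
    and "separated F"
  shows "D [h, k] x = D [k, h] x"
proof -
  have p: "D [h, k] x \<in> pts F" "D [k, h] x \<in> pts F"
    using h k x by (auto intro!: jet_pts[OF D])
  have "l (D [h, k] x - D [k, h] x) = 0" if l: "functional F l" for l
  proof -
    obtain C0 where C0: "\<forall>y\<in>pts F. \<bar>l y\<bar> \<le> C0 * nrm F y"
      and lin: "\<And>r y z. y \<in> pts F \<Longrightarrow> z \<in> pts F \<Longrightarrow> l (r *\<^sub>R y + z) = r * l y + l z"
      using l unfolding functional_def by blast
    have bd: "\<bar>l y\<bar> \<le> \<bar>C0\<bar> * nrm F y" if "y \<in> pts F" for y
    proof -
      have "C0 * nrm F y \<le> \<bar>C0\<bar> * nrm F y" using that by (intro mult_right_mono) auto
      then show ?thesis using C0[rule_format, OF that] by linarith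
    qed
    have "\<bar>l (D [h, k] x) - l (D [k, h] x)\<bar> \<le> \<epsilon>" if \<epsilon>: "0 < \<epsilon>" for \<epsilon>
    proof -
      have \<epsilon>2: "0 < \<epsilon> / 2" using \<epsilon> by simp
      obtain \<delta>1 where \<delta>1: "\<delta>1 > 0" "\<And>\<tau>. 0 < \<tau> \<Longrightarrow> \<tau> < \<delta>1 \<Longrightarrow>
        \<bar>l (D [] (x + \<tau> *\<^sub>R h + \<tau> *\<^sub>R k)) - l (D [] (x + \<tau> *\<^sub>R h)) - l (D [] (x + \<tau> *\<^sub>R k)) + l (D [] x)
          - \<tau>\<^sup>2 * l (D [k, h] x)\<bar> \<le> \<epsilon> / 2 * \<tau>\<^sup>2"
        using functional_jet_symmetric_aux[OF D U x h k lin bd _ \<epsilon>2] by auto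
      obtain \<delta>2 where \<delta>2: "\<delta>2 > 0" "\<And>\<tau>. 0 < \<tau> \<Longrightarrow> \<tau> < \<delta>2 \<Longrightarrow>
        \<bar>l (D [] (x + \<tau> *\<^sub>R k + \<tau> *\<^sub>R h)) - l (D [] (x + \<tau> *\<^sub>R k)) - l (D [] (x + \<tau> *\<^sub>R h)) + l (D [] x)
          - \<tau>\<^sup>2 * l (D [h, k] x)\<bar> \<le> \<epsilon> / 2 * \<tau>\<^sup>2"
        using functional_jet_symmetric_aux[OF D U x k h lin bd _ \<epsilon>2] by auto
      define \<tau> where "\<tau> = min \<delta>1 \<delta>2 / 2"
      have \<tau>: "0 < \<tau>" "\<tau> < \<delta>1" "\<tau> < \<delta>2" using \<delta>1(1) \<delta>2(1) by (auto simp: \<tau>_def)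
      have c: "x + \<tau> *\<^sub>R k + \<tau> *\<^sub>R h = x + \<tau> *\<^sub>R h + \<tau> *\<^sub>R k" by simp
      have "\<bar>\<tau>\<^sup>2 * l (D [h, k] x) - \<tau>\<^sup>2 * l (D [k, h] x)\<bar> \<le> \<epsilon> / 2 * \<tau>\<^sup>2 + \<epsilon> / 2 * \<tau>\<^sup>2"
        using \<delta>1(2)[OF \<tau>(1,2)] \<delta>2(2)[OF \<tau>(1,3)] unfolding c by linarith
      then have "\<tau>\<^sup>2 * \<bar>l (D [h, k] x) - l (D [k, h] x)\<bar> \<le> \<tau>\<^sup>2 * \<epsilon>"
        unfolding right_diff_distrib[symmetric] abs_mult by (simp add: mult.commute)
      then show ?thesis using \<tau>(1) by simp
    qed
    then have "\<bar>l (D [h, k] x) - l (D [k, h] x)\<bar> \<le> 0"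
      by (meson dense not_le)
    then show ?thesis
      using lin[OF p(2,1), of "-1"] by simp
  qed
  then have "D [h, k] x - D [k, h] x = 0"
    using assms(6) F.pts_diff[OF p] unfolding separated_def by blast
  then show ?thesis by simp
qed

text \<open>Product rule for a derivative at a moving point in a moving direction. The direction is
  split as \<open>u 0 + (u t - u 0)\<close>; the second part vanishes at 0 and contributes
  \<open>D [w] (c 0)\<close>, because \<open>D [w]\<close> is continuous along the curve at
  0.\<close>

lemma jet_velocity_direction:
  assumes D: "jet E F U D" and U: "nopen E U"
    and c: "has_velocity E c v" "eventually (\<lambda>t. c t \<in> pts E) (at 0)" "c 0 \<in> U"
    and u: "has_velocity E u w" "eventually (\<lambda>t. u t \<in> pts E) (at 0)" "u 0 \<in> pts E"
  shows "has_velocity F (\<lambda>t. D [u t] (c t)) (D [v, u 0] (c 0) + D [w] (c 0))"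
proof -
  have c0: "c 0 \<in> pts E" using c(3) U by (auto simp: nopen_def)
  have cU: "eventually (\<lambda>t. c t \<in> U) (at 0)"
    by (rule E.eventually_in_nopen[OF c(1,2) U c(3)])
  have w: "w \<in> pts E" "v \<in> pts E" using u c by (auto simp: has_velocity_def)
  have 1: "has_velocity F (\<lambda>t. D [k] (c t)) (D [v, k] (c 0))" if "k \<in> pts E" for k
    using that by (intro jet_velocity[OF D c(1,2) c0 cU c(3)]) simp
  obtain C where C: "1 \<le> C" "eventually (\<lambda>h. \<forall>hs\<in>lists (pts E). length hs \<le> 1 \<longrightarrow> nrm F (D hs (c 0 + h)) \<le> C * npr E hs) (near E U (c 0))"
    using jet_bdd_near[OF D c(3)] by blast
  define e where "e t = D [u t - u 0] (c t)" for t
  have e0: "e 0 = 0"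
    unfolding e_def using jet_lin_zero[OF D c(3), of "[]"] by simp
  have wE: "eventually (\<lambda>t. D [w] (c t) \<in> pts F) (at 0)"
    using cU by eventually_elim (use w in \<open>auto intro!: jet_pts[OF D]\<close>)
  have dw: "((\<lambda>t. nrm F (D [w] (c t) - D [w] (c 0))) \<longlongrightarrow> 0) (at 0)"
  proof (rule tendsto_0_squeeze)
    have p: "D [w] (c 0) \<in> pts F" using w c(3) by (auto intro!: jet_pts[OF D])
    have "((\<lambda>t. (nrm F (D [v, w] (c 0)) + 1) * \<bar>t\<bar>) \<longlongrightarrow> (nrm F (D [v, w] (c 0)) + 1) * \<bar>0\<bar>) (at 0)"
      by (intro tendsto_intros)
    then show "((\<lambda>t. (nrm F (D [v, w] (c 0)) + 1) * \<bar>t\<bar>) \<longlongrightarrow> 0) (at 0)" by simp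
    show "eventually (\<lambda>t. 0 \<le> nrm F (D [w] (c t) - D [w] (c 0)) \<and>
        nrm F (D [w] (c t) - D [w] (c 0)) \<le> (nrm F (D [v, w] (c 0)) + 1) * \<bar>t\<bar>) (at 0)"
      using F.has_velocity_bound[OF 1[OF w(1)] wE p] wE
      by eventually_elim (use p in auto)
  qed
  have "((\<lambda>t. C * nrm E ((1 / t) *\<^sub>R (u t - u 0) - w)) \<longlongrightarrow> 0) (at 0)"
    using u(1) unfolding has_velocity_def by (intro tendsto_mult_right_zero) auto
  from tendsto_add_zero[OF this dw]
  have "((\<lambda>t. nrm F ((1 / t) *\<^sub>R (e t - e 0) - D [w] (c 0))) \<longlongrightarrow> 0) (at 0)"
  proof (rule tendsto_0_squeeze)
    show "eventually (\<lambda>t. 0 \<le> nrm F ((1 / t) *\<^sub>R (e t - e 0) - D [w] (c 0)) \<and>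
       nrm F ((1 / t) *\<^sub>R (e t - e 0) - D [w] (c 0))
        \<le> C * nrm E ((1 / t) *\<^sub>R (u t - u 0) - w) + nrm F (D [w] (c t) - D [w] (c 0))) (at 0)"
      using E.eventually_near_velocity[OF c(1,2) c0 cU C(2)] cU c(2) u(2)
    proof eventually_elim
      case (elim t)
      define k where "k = (1 / t) *\<^sub>R (u t - u 0) - w"
      have k: "k \<in> pts E" "u t - u 0 \<in> pts E" using elim u w by (auto simp: k_def)
      have lin: "D [r *\<^sub>R y + z] (c t) = r *\<^sub>R D [y] (c t) + D [z] (c t)" if "y \<in> pts E" "z \<in> pts E" for r y z
        using jet_lin[OF D elim(2), of "[]"] that by simp
      have "D [k] (c t) = (1 / t) *\<^sub>R e t - D [w] (c t)"
        using lin[OF k(2), of "(-1) *\<^sub>R w" "1 / t"] lin[OF w(1) E.pts_zero, of "-1"] jet_lin_zero[OF D elim(2), of "[]"] w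
        by (simp add: k_def e_def)
      then have eq: "(1 / t) *\<^sub>R (e t - e 0) - D [w] (c 0) = D [k] (c t) + (D [w] (c t) - D [w] (c 0))"
        by (simp add: e0)
      have p: "D [k] (c t) \<in> pts F" "D [w] (c t) \<in> pts F" "D [w] (c 0) \<in> pts F"
        using k w elim c by (auto intro!: jet_pts[OF D])
      have "nrm F (D [k] (c t)) \<le> C * nrm E k"
        using elim(1)[rule_format, of "[k]"] k by simp
      then show ?case
        unfolding eq using F.nrm_triangle[of "D [k] (c t)" "D [w] (c t) - D [w] (c 0)"] p
        by (auto simp: k_def)
    qed
  qed
  then have 2: "has_velocity F e (D [w] (c 0))"
    using w c(3) by (auto simp: has_velocity_def intro!: jet_pts[OF D])
  have p1: "eventually (\<lambda>t. D [u 0] (c t) \<in> pts F) (at 0)" "D [u 0] (c 0) \<in> pts F"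
    using cU u c by (auto intro!: jet_pts[OF D] elim!: eventually_mono)
  have p2: "eventually (\<lambda>t. e t \<in> pts F) (at 0)"
    using cU u(2) unfolding e_def by eventually_elim (use u(3) in \<open>auto intro!: jet_pts[OF D]\<close>)
  from F.has_velocity_add[OF 1[OF u(3)] 2 p1 p2] e0
  have "has_velocity F (\<lambda>t. D [u 0] (c t) + e t) (D [v, u 0] (c 0) + D [w] (c 0))" by simp
  then show ?thesis
  proof (rule has_velocity_cong[rotated 2])
    show "eventually (\<lambda>t. D [u 0] (c t) + e t = D [u t] (c t)) (at 0)"
      using cU u(2)
    proof eventually_elim
      case (elim t)
      show ?case
        using jet_lin[OF D elim(1), of "[]" "u t - u 0" "u 0" 1] elim(2) u(3) by (simp add: e_def add.commute)
    qed
    show "D [u 0] (c 0) + e 0 = D [u 0] (c 0)" by (simp add: e0)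
  qed
qed

end

section \<open>Submanifolds and derivatives along them\<close>

lemma curve_throughD:
  assumes "curve_through E Z A v c" "Z \<subseteq> pts E"
  shows "has_velocity E c v" "c 0 = A" "eventually (\<lambda>t. c t \<in> Z) (at 0)"
    "eventually (\<lambda>t. c t \<in> pts E) (at 0)" "v \<in> pts E" "A \<in> Z"
proof -
  have c: "c ` {-1<..<1} \<subseteq> Z" and *: "has_velocity E c v" "c 0 = A"
    using assms(1) by (auto simp: curve_through_def)
  then show "has_velocity E c v" "c 0 = A" "v \<in> pts E" by (auto simp: has_velocity_def)
  have "eventually (\<lambda>t. t \<in> {-1<..<1}) (at (0::real))"
    by (rule eventually_at_in_open') auto
  then show Z: "eventually (\<lambda>t. c t \<in> Z) (at 0)"
    by eventually_elim (use c in auto)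
  then show "eventually (\<lambda>t. c t \<in> pts E) (at 0)"
    by eventually_elim (use assms(2) in auto)
  show "A \<in> Z" using c *(2) by force
qed

text \<open>\<open>deriv_along\<close> is a definite description in which the curve is existentially
  quantified. Every curve with velocity \<open>v\<close> must therefore produce the same value, and
  the hypotheses range over all of them.\<close>

lemma deriv_along_eqI:
  assumes "nspace F" "v \<in> tangent_space E Z A" "f A \<in> pts F" "Z \<subseteq> pts E"
    and "\<And>c. curve_through E Z A v c \<Longrightarrow> has_velocity F (\<lambda>t. f (c t)) w"
    and "\<And>c. curve_through E Z A v c \<Longrightarrow> eventually (\<lambda>t. f (c t) \<in> pts F) (at 0)"
  shows "deriv_along E F Z f A v = w"
  unfolding deriv_along_def
proof (rule the_equality)
  show "\<exists>c. curve_through E Z A v c \<and> has_velocity F (\<lambda>t. f (c t)) w"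
    using assms(2,5) by (auto simp: tangent_space_def)
  fix w' assume "\<exists>c. curve_through E Z A v c \<and> has_velocity F (\<lambda>t. f (c t)) w'"
  then obtain c where c: "curve_through E Z A v c" "has_velocity F (\<lambda>t. f (c t)) w'" by blast
  have "f (c 0) \<in> pts F" using curve_throughD(2)[OF c(1) assms(4)] assms(3) by simp
  then show "w' = w"
    using nspace.has_velocity_unique[OF assms(1) c(2) assms(5)[OF c(1)] assms(6)[OF c(1)]] by simp
qed

text \<open>By the chain rule along curves, a smooth local extension gives the same velocity for
  every admissible curve; this is what makes the definite description denote.\<close>

lemma deriv_along_ext:
  assumes E: "nspace E" and F: "nspace F" and Z: "Z \<subseteq> pts E" and v: "v \<in> tangent_space E Z A"
    and W: "nopen E W" "A \<in> W" and g: "smooth_deriv E F W g g'" and f: "\<And>B. B \<in> Z \<inter> W \<Longrightarrow> f B = g B"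
  shows "deriv_along E F Z f A v = g' A v"
proof (rule deriv_along_eqI[OF F v _ Z])
  interpret E: nspace E by fact
  have "A \<in> Z" using v curve_throughD(6)[OF _ Z] by (auto simp: tangent_space_def)
  then show "f A \<in> pts F" using f W smooth_deriv_pts(1)[OF g] by auto
  fix c assume c: "curve_through E Z A v c"
  note * = curve_throughD[OF c Z]
  have cW: "eventually (\<lambda>t. c t \<in> W) (at 0)"
    using E.eventually_in_nopen[OF *(1,4) W(1)] *(2) W(2) by simp
  have "has_velocity F (\<lambda>t. g (c t)) (g' (c 0) v)"
    using *(2) W(2) by (intro smooth_deriv_velocity[OF E F g W(1) *(1,4)]) simp
  then have "has_velocity F (\<lambda>t. f (c t)) (g' (c 0) v)"
  proof (rule has_velocity_cong[rotated 2])
    show "eventually (\<lambda>t. g (c t) = f (c t)) (at 0)"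
      using cW *(3) by eventually_elim (use f in auto)
    show "g (c 0) = f (c 0)" using *(2) W(2) \<open>A \<in> Z\<close> f by auto
  qed
  then show "has_velocity F (\<lambda>t. f (c t)) (g' A v)" using *(2) by simp
  show "eventually (\<lambda>t. f (c t) \<in> pts F) (at 0)"
    using cW *(3) by eventually_elim (use f smooth_deriv_pts(1)[OF g] in auto)
qed

text \<open>Difference quotients stay in the subspace, and closedness keeps their limit in it.
  Closedness of the model space in a chart is used through this fact.\<close>

lemma (in nspace) velocity_in_closed_subspace:
  assumes "closed_subspace E K" "has_velocity E c v" "eventually (\<lambda>t. c t \<in> K) (at 0)" "c 0 \<in> K"
  shows "v \<in> K"
proof (rule ccontr)
  assume "v \<notin> K"
  moreover have v: "v \<in> pts E" using assms(2) by (simp add: has_velocity_def)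
  ultimately obtain r where r: "r > 0" "\<forall>y\<in>pts E. nrm E (y - v) < r \<longrightarrow> y \<in> pts E - K"
    using assms(1) unfolding closed_subspace_def nopen_def by blast
  have K: "subspace K" "K \<subseteq> pts E" using assms(1) by (auto simp: closed_subspace_def)
  have "eventually (\<lambda>t. nrm E ((1 / t) *\<^sub>R (c t - c 0) - v) < r) (at 0)"
    using assms(2) r(1) unfolding has_velocity_def by (intro order_tendstoD) auto
  then have "eventually (\<lambda>t::real. False) (at 0)"
    using assms(3)
  proof eventually_elim
    case (elim t)
    have "(1 / t) *\<^sub>R (c t - c 0) \<in> K"
      using elim assms(4) K(1) by (intro subspace_scale subspace_diff)
    then show False using r(2) elim(1) K(2) by auto
  qed
  then show False by simp
qed

text \<open>A curve through a point has to stay in the set on all of (-1, 1), whereas a chart covers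
  short segments only. The polynomial \<open>t * (1 - t * t) ^ n\<close> has speed 1 at 0 and stays
  below \<delta> once \<open>n\<close> is at least \<open>1 / \<delta>\<^sup>2\<close>.\<close>

lemma bounded_speed_function:
  fixes \<delta> :: real assumes "0 < \<delta>"
  obtains \<phi> where "smooth_on euclid euclid (UNIV :: real set) \<phi>" "\<phi> 0 = (0::real)"
    "\<And>t. t \<in> {-1<..<1} \<Longrightarrow> \<bar>\<phi> t\<bar> \<le> \<delta>" "(\<phi> has_real_derivative 1) (at 0)"
proof -
  obtain n :: nat where n: "1 / \<delta>\<^sup>2 \<le> real n" using real_arch_simple by blast
  define \<phi> where "\<phi> n t = t * (1 - t * t) ^ n" for n :: nat and t :: real
  show ?thesis
  proof (rule that[of "\<phi> n"])
    note e = nspace_euclid[where 'a=real]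
    have m: "bounded_bil (euclid :: real nsp) euclid euclid (*)"
      unfolding bounded_bil_def by (auto simp: algebra_simps abs_mult intro!: exI[of _ 1])
    have i: "smooth_on euclid euclid UNIV (\<lambda>t::real. t)" by (rule smooth_on_id[OF e]) simp
    have c: "smooth_on euclid euclid UNIV (\<lambda>t::real. 1 - t * t)"
      by (intro smooth_on_minus[OF e e] smooth_on_const[OF e e] smooth_on_bil[OF e e e e m] i) simp
    show "smooth_on euclid euclid UNIV (\<phi> n)" for n
    proof (induction n)
      case 0
      show ?case using i by (simp add: \<phi>_def[abs_def])
    next
      case (Suc n)
      have "smooth_on euclid euclid UNIV (\<lambda>t. \<phi> n t * (1 - t * t))"
        by (rule smooth_on_bil[OF e e e e m Suc c])
      then show ?case by (simp add: \<phi>_def[abs_def] mult_ac)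
    qed
    show "\<phi> n 0 = 0" by (simp add: \<phi>_def)
    show "(\<phi> n has_real_derivative 1) (at 0)"
      unfolding \<phi>_def[abs_def] by (auto intro!: derivative_eq_intros)
    fix t :: real assume t: "t \<in> {-1<..<1}"
    define x where "x = t * t"
    have x: "0 \<le> x" "x \<le> 1" using t abs_square_le_1[of t] by (auto simp: x_def power2_eq_square abs_le_iff)
    \<comment> \<open>Bernoulli's inequality bounds \<open>(1 - x) ^ n\<close> by the reciprocal of
      \<open>1 + n * x\<close>.\<close>
    have "(1 - x) ^ n * (1 + real n * x) \<le> (1 - x) ^ n * (1 + x) ^ n"
      using x by (intro mult_left_mono Bernoulli_inequality) auto
    also have "\<dots> = (1 - x * x) ^ n" by (simp add: power_mult_distrib[symmetric] algebra_simps)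
    also have "\<dots> \<le> 1" using x by (intro power_le_one) (auto simp: mult_le_one)
    finally have 1: "(1 - x) ^ n * (1 + real n * x) \<le> 1" .
    \<comment> \<open>Arithmetic-geometric mean:
      \<open>2 * \<delta> * \<bar>t\<bar> \<le> x + \<delta>\<^sup>2\<close>, and the choice of
      \<open>n\<close> bounds \<open>x\<close> by \<open>\<delta>\<^sup>2 * (n * x)\<close>.\<close>
    have "\<bar>t\<bar> \<le> \<delta> * (1 + real n * x)"
    proof -
      have "(\<bar>t\<bar> - \<delta>)\<^sup>2 = x + \<delta>\<^sup>2 - 2 * \<delta> * \<bar>t\<bar>"
        by (simp add: power2_diff x_def) (simp add: power2_eq_square)
      then have "2 * \<delta> * \<bar>t\<bar> \<le> x + \<delta>\<^sup>2"
        using zero_le_power2[of "\<bar>t\<bar> - \<delta>"] by linarith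
      moreover have "x \<le> \<delta>\<^sup>2 * (real n * x)"
      proof -
        have "1 \<le> real n * \<delta>\<^sup>2" using n assms by (simp add: field_simps)
        then have "1 * x \<le> (real n * \<delta>\<^sup>2) * x" using x(1) by (rule mult_right_mono)
        then show ?thesis by (simp add: mult_ac)
      qed
      ultimately have "2 * \<delta> * \<bar>t\<bar> \<le> \<delta> * (\<delta> * (1 + real n * x))"
        by (simp add: algebra_simps power2_eq_square)
      then have "\<delta> * (2 * \<bar>t\<bar>) \<le> \<delta> * (\<delta> * (1 + real n * x))" by (simp only: mult_ac)
      then show ?thesis using assms by simp
    qed
    then have "\<bar>t\<bar> * (1 - x) ^ n \<le> \<delta> * (1 + real n * x) * (1 - x) ^ n"
      using x by (intro mult_right_mono) auto
    also have "\<dots> = \<delta> * ((1 - x) ^ n * (1 + real n * x))" by (simp only: mult_ac)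
    also have "\<dots> \<le> \<delta> * 1" using 1 assms by (intro mult_left_mono) auto
    finally show "\<bar>\<phi> n t\<bar> \<le> \<delta>" using x by (simp add: \<phi>_def x_def abs_mult power_abs)
  qed
qed

text \<open>A chart as in \<open>submanifold\<close>, with the first derivatives of
  \<open>\<Psi>\<close> and of its inverse named, since tangent vectors are recognised through
  \<open>d\<Psi>\<close>.\<close>

locale flattening = nspace E for E :: "'v::real_vector nsp" +
  fixes Z U W \<Psi> \<Psi>' d\<Psi> d\<Psi>' K
  assumes U: "nopen E U" and W: "nopen E W" and ZE: "Z \<subseteq> pts E"
    and \<Psi>: "smooth_deriv E E U \<Psi> d\<Psi>" and \<Psi>': "smooth_deriv E E W \<Psi>' d\<Psi>'"
    and \<Psi>_W: "\<And>x. x \<in> U \<Longrightarrow> \<Psi> x \<in> W" and \<Psi>'_\<Psi>: "\<And>x. x \<in> U \<Longrightarrow> \<Psi>' (\<Psi> x) = x"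
    and \<Psi>'_U: "\<And>y. y \<in> W \<Longrightarrow> \<Psi>' y \<in> U" and \<Psi>_\<Psi>': "\<And>y. y \<in> W \<Longrightarrow> \<Psi> (\<Psi>' y) = y"
    and K: "closed_subspace E K" and Z_iff: "\<And>x. x \<in> U \<Longrightarrow> x \<in> Z \<longleftrightarrow> \<Psi> x \<in> K"
begin

lemma K_pts: "k \<in> K \<Longrightarrow> k \<in> pts E" and K_subspace: "subspace K"
  using K by (auto simp: closed_subspace_def)

text \<open>The identities between \<open>\<Psi>\<close> and \<open>\<Psi>'\<close> are
  differentiated; first derivatives on open sets are unique.\<close>

lemma d_inverse:
  assumes "x \<in> U" "h \<in> pts E"
  shows "d\<Psi>' (\<Psi> x) (d\<Psi> x h) = h" "d\<Psi> x (d\<Psi>' (\<Psi> x) h) = h"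
proof -
  have UE: "U \<subseteq> pts E" "W \<subseteq> pts E" using U W by (auto simp: nopen_def)
  have "smooth_deriv E E U (\<lambda>x. \<Psi>' (\<Psi> x)) (\<lambda>x h. d\<Psi>' (\<Psi> x) (d\<Psi> x h))"
    by (rule smooth_deriv_comp[OF nspace_axioms nspace_axioms nspace_axioms \<Psi> \<Psi>' W \<Psi>_W])
  then have 1: "smooth_deriv E E U (\<lambda>x. x) (\<lambda>x h. d\<Psi>' (\<Psi> x) (d\<Psi> x h))"
    by (rule smooth_deriv_cong) (auto simp: \<Psi>'_\<Psi>)
  show "d\<Psi>' (\<Psi> x) (d\<Psi> x h) = h"
    by (rule smooth_deriv_unique[OF nspace_axioms nspace_axioms 1 smooth_deriv_id[OF nspace_axioms UE(1)] U assms])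
  have "smooth_deriv E E W (\<lambda>y. \<Psi> (\<Psi>' y)) (\<lambda>y h. d\<Psi> (\<Psi>' y) (d\<Psi>' y h))"
    by (rule smooth_deriv_comp[OF nspace_axioms nspace_axioms nspace_axioms \<Psi>' \<Psi> U \<Psi>'_U])
  then have 2: "smooth_deriv E E W (\<lambda>y. y) (\<lambda>y h. d\<Psi> (\<Psi>' y) (d\<Psi>' y h))"
    by (rule smooth_deriv_cong) (auto simp: \<Psi>_\<Psi>')
  have "d\<Psi> (\<Psi>' (\<Psi> x)) (d\<Psi>' (\<Psi> x) h) = h"
    by (rule smooth_deriv_unique[OF nspace_axioms nspace_axioms 2 smooth_deriv_id[OF nspace_axioms UE(2)] W \<Psi>_W[OF assms(1)] assms(2)])
  then show "d\<Psi> x (d\<Psi>' (\<Psi> x) h) = h" by (simp add: \<Psi>'_\<Psi> assms(1))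
qed

lemma d_linear:
  assumes "x \<in> U" "h \<in> pts E" "k \<in> pts E"
  shows "d\<Psi> x (r *\<^sub>R h + k) = r *\<^sub>R d\<Psi> x h + d\<Psi> x k"
    "d\<Psi>' (\<Psi> x) (r *\<^sub>R h + k) = r *\<^sub>R d\<Psi>' (\<Psi> x) h + d\<Psi>' (\<Psi> x) k"
proof -
  interpret EE: nspace2 E E ..
  have *: "f' y (r *\<^sub>R h + k) = r *\<^sub>R f' y h + f' y k" if sd: "smooth_deriv E E V f f'" and y: "y \<in> V" for V f f' y
  proof -
    obtain D where D: "jet E E V D" and f: "\<And>h. h \<in> pts E \<Longrightarrow> D [h] y = f' y h"
      using sd y unfolding smooth_deriv_def by blast
    show ?thesis
      using EE.jet_lin[OF D y, of "[]" h k r] assms(2,3) by (simp add: f)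
  qed
  show "d\<Psi> x (r *\<^sub>R h + k) = r *\<^sub>R d\<Psi> x h + d\<Psi> x k"
    "d\<Psi>' (\<Psi> x) (r *\<^sub>R h + k) = r *\<^sub>R d\<Psi>' (\<Psi> x) h + d\<Psi>' (\<Psi> x) k"
    by (rule *[OF \<Psi> assms(1)] *[OF \<Psi>' \<Psi>_W[OF assms(1)]])+
qed

text \<open>Necessity: in the chart the curve runs in the closed subspace \<open>K\<close>, hence so
  does its velocity. Sufficiency: the segment from \<open>\<Psi> A\<close> in direction
  \<open>d\<Psi> A v\<close>, reparametrised so as to stay in \<open>W\<close>, is pulled back by
  \<open>\<Psi>'\<close>.\<close>

lemma tangent_space_iff:
  assumes A: "A \<in> Z" "A \<in> U"
  shows "v \<in> tangent_space E Z A \<longleftrightarrow> v \<in> pts E \<and> d\<Psi> A v \<in> K"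
proof safe
  assume "v \<in> tangent_space E Z A"
  then obtain c where c: "curve_through E Z A v c" by (auto simp: tangent_space_def)
  note * = curve_throughD[OF c ZE]
  show "v \<in> pts E" by (rule *)
  have cU: "eventually (\<lambda>t. c t \<in> U) (at 0)"
    using eventually_in_nopen[OF *(1,4) U] *(2) A by simp
  have "has_velocity E (\<lambda>t. \<Psi> (c t)) (d\<Psi> (c 0) v)"
    using *(2) A by (intro smooth_deriv_velocity[OF nspace_axioms nspace_axioms \<Psi> U *(1,4)]) simp
  moreover have "eventually (\<lambda>t. \<Psi> (c t) \<in> K) (at 0)"
    using cU *(3) by eventually_elim (use Z_iff in auto)
  moreover have "\<Psi> (c 0) \<in> K"
    using *(2) A Z_iff by auto
  ultimately have "d\<Psi> (c 0) v \<in> K"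
    by (rule velocity_in_closed_subspace[OF K])
  then show "d\<Psi> A v \<in> K" using *(2) by simp
next
  assume v: "v \<in> pts E" "d\<Psi> A v \<in> K"
  define k where "k = d\<Psi> A v"
  have k: "k \<in> K" "k \<in> pts E" using v K_pts by (auto simp: k_def)
  have \<Psi>A: "\<Psi> A \<in> W" "\<Psi> A \<in> K" "\<Psi> A \<in> pts E" using A Z_iff \<Psi>_W K_pts by auto
  obtain r where r: "r > 0" "\<forall>y\<in>pts E. nrm E (y - \<Psi> A) < r \<longrightarrow> y \<in> W"
    using W \<Psi>A(1) unfolding nopen_def by blast
  \<comment> \<open>Chosen so that displacements \<open>\<phi> t *\<^sub>R k\<close> have norm at
    most half the radius of the ball around \<open>\<Psi> A\<close>.\<close>
  define \<delta> where "\<delta> = r / (2 * (nrm E k + 1))"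
  have nk: "0 \<le> nrm E k" using k by simp
  have \<delta>: "0 < \<delta>" unfolding \<delta>_def using r(1) nk by (intro divide_pos_pos) auto
  obtain \<phi> where \<phi>: "smooth_on euclid euclid (UNIV :: real set) \<phi>" "\<phi> 0 = (0::real)"
    "\<And>t. t \<in> {-1<..<1} \<Longrightarrow> \<bar>\<phi> t\<bar> \<le> \<delta>" "(\<phi> has_real_derivative 1) (at 0)"
    using bounded_speed_function[OF \<delta>] by blast
  define b where "b t = \<Psi> A + \<phi> t *\<^sub>R k" for t
  note e = nspace_euclid[where 'a=real] and this_ax = nspace_axioms
  have b: "smooth_on euclid E UNIV b"
    unfolding b_def[abs_def]
    by (intro smooth_on_add[OF e this_ax] smooth_on_const[OF e this_ax] \<Psi>A
        smooth_on_bil[OF e e this_ax this_ax bounded_bil_scaleR[OF this_ax]] \<phi>(1) k)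
  have bW: "b t \<in> W" if "t \<in> {-1<..<1}" for t
  proof -
    have "nrm E (\<phi> t *\<^sub>R k) \<le> \<delta> * nrm E k"
      using \<phi>(3)[OF that] k nk by (simp add: nrm_scale mult_right_mono)
    also have "\<dots> \<le> \<delta> * (nrm E k + 1)" using \<delta> by simp
    also have "\<delta> * (nrm E k + 1) = r / 2"
    proof -
      have "r / (2 * q) * q = r / 2" if "q \<noteq> 0" for q using that by simp
      from this[of "nrm E k + 1"] nk show ?thesis unfolding \<delta>_def by linarith
    qed
    also have "r / 2 < r" using r(1) by simp
    finally show ?thesis using r(2) \<Psi>A k by (simp add: b_def)
  qed
  have bK: "b t \<in> K" for t
    unfolding b_def using \<Psi>A k K_subspace by (intro subspace_add subspace_scale)
  obtain b' where b': "smooth_deriv euclid E UNIV b b'" using b unfolding smooth_on_iff_deriv by blast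
  have bv: "has_velocity E b k"
  proof -
    have "((\<lambda>t. (\<phi> t - \<phi> 0) / t) \<longlongrightarrow> 1) (at 0)"
      using \<phi>(4) by (simp add: DERIV_def)
    then have "((\<lambda>t. \<bar>(\<phi> t - \<phi> 0) / t - 1\<bar> * nrm E k) \<longlongrightarrow> 0) (at 0)"
      by (intro tendsto_mult_left_zero tendsto_rabs_zero) (simp add: LIM_zero)
    moreover have "nrm E ((1 / t) *\<^sub>R (b t - b 0) - k) = \<bar>(\<phi> t - \<phi> 0) / t - 1\<bar> * nrm E k" for t
    proof -
      have "(1 / t) *\<^sub>R (b t - b 0) - k = ((\<phi> t - \<phi> 0) / t - 1) *\<^sub>R k"
        by (simp add: b_def algebra_simps \<phi>(2))
      then show ?thesis using k by (simp add: nrm_scale)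
    qed
    ultimately show ?thesis using k by (simp add: has_velocity_def)
  qed
  define c where "c t = \<Psi>' (b t)" for t
  have "smooth_on euclid E {-1<..<1} c"
    unfolding c_def[abs_def]
  proof (rule smooth_on_comp[OF e this_ax this_ax smooth_on_subset[OF b] _ W bW])
    show "smooth_on E E W \<Psi>'" unfolding smooth_on_iff_deriv using \<Psi>' by blast
  qed auto
  moreover have "c ` {-1<..<1} \<subseteq> Z"
    using bW bK Z_iff \<Psi>'_U \<Psi>_\<Psi>' by (auto simp: c_def)
  moreover have "c 0 = A" by (simp add: c_def b_def \<phi>(2) \<Psi>'_\<Psi> A)
  moreover have "has_velocity E c v"
  proof -
    have "eventually (\<lambda>t. b t \<in> pts E) (at 0)" using bK K_pts by simp
    from smooth_deriv_velocity[OF this_ax this_ax \<Psi>' W bv this] bW[of 0]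
    have "has_velocity E c (d\<Psi>' (b 0) k)" by (simp add: c_def[abs_def])
    moreover have "b 0 = \<Psi> A" by (simp add: b_def \<phi>(2))
    ultimately show ?thesis using d_inverse(1)[OF A(2) v(1)] by (simp add: k_def)
  qed
  ultimately show "v \<in> tangent_space E Z A"
    by (auto simp: tangent_space_def curve_through_def)
qed

lemma subspace_tangent_space:
  assumes A: "A \<in> Z" "A \<in> U"
  shows "subspace (tangent_space E Z A)"
proof (rule subspaceI)
  have 0: "d\<Psi> A 0 = 0" using d_linear(1)[OF A(2), of 0 0 1] by simp
  show "0 \<in> tangent_space E Z A"
    using K_subspace by (simp add: tangent_space_iff[OF A] 0 subspace_0)
  show "x + y \<in> tangent_space E Z A" if "x \<in> tangent_space E Z A" "y \<in> tangent_space E Z A" for x y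
    using that d_linear(1)[OF A(2), of x y 1] K_subspace by (auto simp: tangent_space_iff[OF A] intro: subspace_add)
  show "r *\<^sub>R x \<in> tangent_space E Z A" if "x \<in> tangent_space E Z A" for x r
    using that d_linear(1)[OF A(2), of x 0 r] K_subspace by (auto simp: tangent_space_iff[OF A] 0 intro: subspace_scale)
qed

text \<open>Differentiating \<open>d\<Psi> (a) \<in> K\<close> along \<open>b\<close> and vice versa, the second derivatives of \<open>\<Psi>\<close> cancel.\<close>

lemma bracket_tangent:
  assumes sep: "separated E" and A: "A \<in> Z" "A \<in> U" and V: "nopen E V" "A \<in> V"
    and a: "smooth_deriv E E V a a'" and b: "smooth_deriv E E V b b'"
    and aT: "\<And>B. B \<in> Z \<inter> V \<Longrightarrow> a B \<in> tangent_space E Z B" and bT: "\<And>B. B \<in> Z \<inter> V \<Longrightarrow> b B \<in> tangent_space E Z B"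
  shows "b' A (a A) - a' A (b A) \<in> tangent_space E Z A"
proof -
  interpret EE: nspace2 E E ..
  obtain D where D: "jet E E U D" and d: "\<And>x h. x \<in> U \<Longrightarrow> h \<in> pts E \<Longrightarrow> D [h] x = d\<Psi> x h"
    using \<Psi> unfolding smooth_deriv_def by blast
  \<comment> \<open>The derivative of \<open>d\<Psi>\<close> applied to \<open>a\<close> along a
    curve with velocity \<open>b A\<close>: the values lie in \<open>K\<close>, hence so does the
    velocity. The statement is generalised over the fields so that \<open>a\<close> and
    \<open>b\<close> can be exchanged.\<close>
  have key: "D [b A, a A] A + D [a' A (b A)] A \<in> K"
    if V: "nopen E V" "A \<in> V"
    and a: "smooth_deriv E E V a a'" and b: "smooth_deriv E E V b b'"
    and aT: "\<And>B. B \<in> Z \<inter> V \<Longrightarrow> a B \<in> tangent_space E Z B" and bT: "\<And>B. B \<in> Z \<inter> V \<Longrightarrow> b B \<in> tangent_space E Z B"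
    for a a' b b' V
  proof -
    obtain c where c: "curve_through E Z A (b A) c"
      using bT[of A] A V by (auto simp: tangent_space_def)
    note * = curve_throughD[OF c ZE]
    have cU: "eventually (\<lambda>t. c t \<in> U) (at 0)" "eventually (\<lambda>t. c t \<in> V) (at 0)"
      using eventually_in_nopen[OF *(1,4) U] eventually_in_nopen[OF *(1,4) V(1)] *(2) A V by auto
    have u: "has_velocity E (\<lambda>t. a (c t)) (a' (c 0) (b A))"
      using *(2) V by (intro smooth_deriv_velocity[OF nspace_axioms nspace_axioms a V(1) *(1,4)]) simp
    have up: "eventually (\<lambda>t. a (c t) \<in> pts E) (at 0)" "a (c 0) \<in> pts E"
      using cU(2) V(2) *(2) by (auto elim!: eventually_mono intro: smooth_deriv_pts(1)[OF a])
    have "has_velocity E (\<lambda>t. D [a (c t)] (c t)) (D [b A, a (c 0)] (c 0) + D [a' (c 0) (b A)] (c 0))"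
      using *(2) A by (intro EE.jet_velocity_direction[OF D U *(1,4) _ u up]) simp
    then have "D [b A, a (c 0)] (c 0) + D [a' (c 0) (b A)] (c 0) \<in> K"
    proof (rule velocity_in_closed_subspace[OF K])
      have in_K: "D [a B] B \<in> K" if "B \<in> Z" "B \<in> U" "B \<in> V" for B
        using aT[of B] tangent_space_iff[of B] that by (auto simp: d)
      show "eventually (\<lambda>t. D [a (c t)] (c t) \<in> K) (at 0)"
        using cU *(3) by eventually_elim (rule in_K)
      show "D [a (c 0)] (c 0) \<in> K" using *(2) A V by (auto intro: in_K)
    qed
    then show ?thesis using *(2) by simp
  qed
  have p: "a A \<in> pts E" "b A \<in> pts E" using smooth_deriv_pts(1)[OF a V(2)] smooth_deriv_pts(1)[OF b V(2)] .
  have p': "a' A (b A) \<in> pts E" "b' A (a A) \<in> pts E"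
    using smooth_deriv_pts(2)[OF a V(2) p(2)] smooth_deriv_pts(2)[OF b V(2) p(1)] .
  have "D [a A, b A] A + D [b' A (a A)] A - (D [b A, a A] A + D [a' A (b A)] A) \<in> K"
    by (intro subspace_diff[OF K_subspace] key[OF V a b aT bT] key[OF V b a bT aT])
  moreover have "D [a A, b A] A = D [b A, a A] A"
    by (rule EE.jet_symmetric[OF D U A(2) p sep])
  moreover have "D [b' A (a A)] A - D [a' A (b A)] A = d\<Psi> A (b' A (a A) - a' A (b A))"
    using d_linear(1)[OF A(2) p'(1,2), of "-1"] d A(2) p' by simp
  ultimately show ?thesis
    using p' by (simp add: tangent_space_iff[OF A])
qed

end

text \<open>\<open>\<Psi>'\<close> is given as a left inverse; since \<open>\<Psi>\<close> maps
  \<open>U\<close> onto \<open>W\<close>, it is a right inverse on \<open>W\<close> as well.\<close>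

lemma submanifold_flattening:
  assumes "nspace E" "submanifold E Z" "A \<in> Z"
  obtains U W \<Psi> \<Psi>' d\<Psi> d\<Psi>' K where "flattening E Z U W \<Psi> \<Psi>' d\<Psi> d\<Psi>' K" "A \<in> U"
proof -
  interpret nspace E by fact
  from assms(2,3) obtain U W \<Psi> \<Psi>' K where *: "nopen E U" "A \<in> U" "nopen E W"
      "smooth_on E E U \<Psi>" "smooth_on E E W \<Psi>'" "\<Psi> ` U = W" "\<forall>x\<in>U. \<Psi>' (\<Psi> x) = x"
      "closed_subspace E K" "\<Psi> ` (Z \<inter> U) = W \<inter> K"
    unfolding submanifold_def by metis
  obtain d\<Psi> d\<Psi>' where d: "smooth_deriv E E U \<Psi> d\<Psi>" "smooth_deriv E E W \<Psi>' d\<Psi>'"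
    using *(4,5) unfolding smooth_on_iff_deriv by blast
  have "flattening E Z U W \<Psi> \<Psi>' d\<Psi> d\<Psi>' K"
  proof
    show "Z \<subseteq> pts E" using assms(2) by (simp add: submanifold_def)
    show "x \<in> Z \<longleftrightarrow> \<Psi> x \<in> K" if "x \<in> U" for x
    proof
      assume "x \<in> Z" then show "\<Psi> x \<in> K" using *(9) that by blast
    next
      assume "\<Psi> x \<in> K"
      then have "\<Psi> x \<in> \<Psi> ` (Z \<inter> U)" using *(6,9) that by blast
      then show "x \<in> Z" using *(7) that by (metis IntD1 IntD2 imageE)
    qed
  qed (use * d in auto)
  then show ?thesis using that *(2) by blast
qed

section \<open>The graph of a closed two-form\<close>

lemma bil_pts: "bounded_bil E E' F B \<Longrightarrow> x \<in> pts E \<Longrightarrow> y \<in> pts E' \<Longrightarrow> B x y \<in> pts F"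
  by (simp add: bounded_bil_def)

lemma bil_left: "bounded_bil E E' F B \<Longrightarrow> x \<in> pts E \<Longrightarrow> x' \<in> pts E \<Longrightarrow> y \<in> pts E'
    \<Longrightarrow> B (r *\<^sub>R x + x') y = r *\<^sub>R B x y + B x' y"
  by (simp add: bounded_bil_def)

lemma bil_right: "bounded_bil E E' F B \<Longrightarrow> x \<in> pts E \<Longrightarrow> y \<in> pts E' \<Longrightarrow> y' \<in> pts E'
    \<Longrightarrow> B x (r *\<^sub>R y + y') = r *\<^sub>R B x y + B x y'"
  by (simp add: bounded_bil_def)

text \<open>\<open>E\<close>, \<open>M\<close> and \<open>F\<close> stand for forms of degree one,
  two and three, \<open>\<mu>\<close> and \<open>N\<close> for wedge products into degrees two and
  three, and \<open>Q\<close> for the pairing. Besides bilinearity, \<open>cyclic\<close> is the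
  relation from which antisymmetry and closedness are derived.\<close>

locale dirac_data = E: nspace E + M: nspace M + F: nspace F
  for E :: "'v::real_vector nsp" and M :: "'m::real_vector nsp" and F :: "'w::real_vector nsp" +
  fixes \<mu> :: "'v \<Rightarrow> 'v \<Rightarrow> 'm" and N :: "'m \<Rightarrow> 'v \<Rightarrow> 'w" and Q :: "'w \<Rightarrow> 'v \<Rightarrow> complex" and Z :: "'v set"
  assumes \<mu>: "bounded_bil E E M \<mu>" and N: "bounded_bil M E F N" and Q: "bounded_bil F E euclid Q"
    and sep: "separated E" and Z: "submanifold E Z"
    and cyclic: "\<And>x y z w. x \<in> pts E \<Longrightarrow> y \<in> pts E \<Longrightarrow> z \<in> pts E \<Longrightarrow> w \<in> pts E
      \<Longrightarrow> Q (N (\<mu> x y) z) w = - Q (N (\<mu> y z) w) x"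
begin

text \<open>Bracketed from the left, so that both summands lead to values of the one quadrilinear
  form \<open>\<Theta>\<close>. The bracketing of \<open>gamma1\<close> is reached by associativity
  in \<open>gamma1_eq\<close>.\<close>

definition \<gamma> :: "'v \<Rightarrow> 'v \<Rightarrow> 'w" where "\<gamma> A a = N (\<mu> A A) a + N (\<mu> a A) A"

definition \<Theta> :: "'v \<Rightarrow> 'v \<Rightarrow> 'v \<Rightarrow> 'v \<Rightarrow> complex" where "\<Theta> x y z w = Q (N (\<mu> x y) z) w"

definition graph :: "('v \<times> 'v \<times> ('v \<Rightarrow> complex)) set" where
  "graph = Sigma Z (\<lambda>A. {(a, covec E Q Z A (\<gamma> A a)) |a. a \<in> tangent_space E Z A})"

lemma Z_pts: "Z \<subseteq> pts E"
  using Z by (simp add: submanifold_def)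

lemma E_ax: "nspace E" and M_ax: "nspace M" and F_ax: "nspace F"
  by unfold_locales

lemma tangent_subspace: "A \<in> Z \<Longrightarrow> subspace (tangent_space E Z A)"
  by (rule submanifold_flattening[OF E_ax Z]) (auto dest: flattening.subspace_tangent_space)

lemma tangent_pts: "v \<in> tangent_space E Z A \<Longrightarrow> v \<in> pts E"
  using curve_throughD(5)[OF _ Z_pts] by (auto simp: tangent_space_def)

lemma \<gamma>_pts: "A \<in> pts E \<Longrightarrow> a \<in> pts E \<Longrightarrow> \<gamma> A a \<in> pts F"
  unfolding \<gamma>_def by (intro F.pts_add bil_pts[OF N] bil_pts[OF \<mu>])

lemma \<gamma>_linear:
  assumes "A \<in> pts E" "a \<in> pts E" "b \<in> pts E"
  shows "\<gamma> A (r *\<^sub>R a + b) = r *\<^sub>R \<gamma> A a + \<gamma> A b"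
proof -
  note m = bil_pts[OF \<mu>]
  show ?thesis
    unfolding \<gamma>_def bil_left[OF \<mu> assms(2,3,1)] bil_right[OF N m[OF assms(1,1)] assms(2,3)]
      bil_left[OF N m[OF assms(2,1)] m[OF assms(3,1)] assms(1)]
    by (simp add: algebra_simps)
qed

lemma covec_linear:
  assumes "\<alpha> \<in> pts F" "\<beta> \<in> pts F"
  shows "covec E Q Z A (r *\<^sub>R \<alpha> + \<beta>) = r *\<^sub>R covec E Q Z A \<alpha> + covec E Q Z A \<beta>"
proof
  fix b
  show "covec E Q Z A (r *\<^sub>R \<alpha> + \<beta>) b = (r *\<^sub>R covec E Q Z A \<alpha> + covec E Q Z A \<beta>) b"
    using bil_left[OF Q assms, of b r] tangent_pts[of b A] by (auto simp: covec_def scaleR_fun_def)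
qed

lemma pairing_\<gamma>:
  assumes "A \<in> pts E" "a \<in> pts E" "b \<in> pts E"
  shows "Q (\<gamma> A a) b = \<Theta> A A a b + \<Theta> a A A b"
  using bil_left[OF Q bil_pts[OF N bil_pts[OF \<mu>]] bil_pts[OF N bil_pts[OF \<mu>]], of A A a a A A b 1] assms
  by (simp add: \<gamma>_def \<Theta>_def)

lemma \<Theta>_cyclic: "x \<in> pts E \<Longrightarrow> y \<in> pts E \<Longrightarrow> z \<in> pts E \<Longrightarrow> w \<in> pts E \<Longrightarrow> \<Theta> x y z w = - \<Theta> y z w x"
  unfolding \<Theta>_def by (rule cyclic)

text \<open>One cyclic shift turns \<open>\<Theta> a A A b\<close> into
  \<open>- \<Theta> A A b a\<close>: it exchanges the two summands of the form and reverses their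
  sign.\<close>

lemma pairing_\<gamma>_antisym:
  assumes "A \<in> pts E" "a \<in> pts E" "b \<in> pts E"
  shows "Q (\<gamma> A a) b = - Q (\<gamma> A b) a"
  using assms \<Theta>_cyclic[of a A A b] \<Theta>_cyclic[of b A A a] by (simp add: pairing_\<gamma>)

text \<open>The derivative in the direction \<open>x\<close> of the two-form \<open>(y, z) \<mapsto> Q (\<gamma> A y) z\<close> on constant fields.\<close>

definition d\<Theta> :: "'v \<Rightarrow> 'v \<Rightarrow> 'v \<Rightarrow> 'v \<Rightarrow> complex" where
  "d\<Theta> A x y z = \<Theta> x A y z + \<Theta> A x y z + \<Theta> y x A z + \<Theta> y A x z"

text \<open>A normal form: each summand is rotated until the base point comes first, with one sign
  change for every shift.\<close>

lemma d\<Theta>_eq: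
  assumes "A \<in> pts E" "x \<in> pts E" "y \<in> pts E" "z \<in> pts E"
  shows "d\<Theta> A x y z = - \<Theta> A y z x + \<Theta> A x y z + \<Theta> A z y x - \<Theta> A x z y"
  using assms \<Theta>_cyclic[of x A y z] \<Theta>_cyclic[of y x A z] \<Theta>_cyclic[of x A z y] \<Theta>_cyclic[of y A x z]
  by (simp add: d\<Theta>_def)

text \<open>In normal form the twelve terms run twice through the six orders of \<open>x\<close>,
  \<open>y\<close>, \<open>z\<close> behind \<open>A\<close>, with opposite signs.\<close>

lemma d\<Theta>_closed:
  assumes "A \<in> pts E" "x \<in> pts E" "y \<in> pts E" "z \<in> pts E"
  shows "d\<Theta> A x y z - d\<Theta> A y x z + d\<Theta> A z x y = 0"
  using assms by (simp add: d\<Theta>_eq)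

lemma graph_Image: "A \<in> Z \<Longrightarrow> graph `` {A} = (\<lambda>a. (a, covec E Q Z A (\<gamma> A a))) ` tangent_space E Z A"
  by (auto simp: graph_def)

lemma graph_sub: "graph \<subseteq> Sigma Z (courant_fibre E F Q Z)"
  using Z_pts tangent_pts by (auto simp: graph_def courant_fibre_def cotangent_space_def intro!: imageI \<gamma>_pts)

lemma graph_linear:
  assumes "A \<in> Z" "a \<in> pts E" "b \<in> pts E"
  shows "covec E Q Z A (\<gamma> A (r *\<^sub>R a + b)) = r *\<^sub>R covec E Q Z A (\<gamma> A a) + covec E Q Z A (\<gamma> A b)"
proof -
  have "A \<in> pts E" using assms(1) Z_pts by auto
  then show ?thesis using assms by (simp add: \<gamma>_linear covec_linear \<gamma>_pts)
qed

lemma graph_fibre_subspace: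
  assumes A: "A \<in> Z"
  shows "subspace (graph `` {A})"
proof (rule subspaceI)
  have T: "subspace (tangent_space E Z A)" by (rule tangent_subspace[OF A])
  have c0: "covec E Q Z A (\<gamma> A 0) = 0"
    using graph_linear[OF A, of 0 0 1] by simp
  show "0 \<in> graph `` {A}"
    using subspace_0[OF T] c0 by (auto simp: graph_Image[OF A] zero_prod_def intro!: image_eqI[of _ _ 0])
  fix x assume "x \<in> graph `` {A}"
  then obtain a where a: "x = (a, covec E Q Z A (\<gamma> A a))" "a \<in> tangent_space E Z A"
    by (auto simp: graph_Image[OF A])
  show "r *\<^sub>R x \<in> graph `` {A}" for r
    using graph_linear[OF A tangent_pts[OF a(2)] E.pts_zero, of r] subspace_scale[OF T a(2), of r] a c0
    by (auto simp: graph_Image[OF A] intro!: image_eqI[of _ _ "r *\<^sub>R a"])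
  fix y assume "y \<in> graph `` {A}"
  then obtain b where b: "y = (b, covec E Q Z A (\<gamma> A b))" "b \<in> tangent_space E Z A"
    by (auto simp: graph_Image[OF A])
  show "x + y \<in> graph `` {A}"
    using graph_linear[OF A tangent_pts[OF a(2)] tangent_pts[OF b(2)], of 1] subspace_add[OF T a(2) b(2)] a b
    by (auto simp: graph_Image[OF A] intro!: image_eqI[of _ _ "a + b"])
qed

text \<open>Isotropy is antisymmetry of the two-form. For maximality an element
  \<open>(a, \<xi>)\<close> of a larger isotropic space is tested against the graph element above
  each tangent vector \<open>b\<close>; together these tests determine \<open>\<xi>\<close> on the
  whole tangent space.\<close>

lemma graph_maximal_isotropic:
  assumes A: "A \<in> Z"
  shows "maximal_isotropic (courant_fibre E F Q Z A) (graph `` {A})"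
  unfolding maximal_isotropic_def
proof (intro conjI allI impI)
  have AE: "A \<in> pts E" using A Z_pts by auto
  show "subspace (graph `` {A})" by (rule graph_fibre_subspace[OF A])
  show "graph `` {A} \<subseteq> courant_fibre E F Q Z A" using graph_sub by auto
  show "isotropic (graph `` {A})"
  proof -
    have "Q (\<gamma> A a) b + Q (\<gamma> A b) a = 0" if "a \<in> tangent_space E Z A" "b \<in> tangent_space E Z A" for a b
      using pairing_\<gamma>_antisym[OF AE tangent_pts[OF that(1)] tangent_pts[OF that(2)]] by simp
    then show ?thesis
      unfolding isotropic_def plus_form_def graph_Image[OF A] by (auto simp: covec_def)
  qed
  fix L assume L: "subspace L \<and> L \<subseteq> courant_fibre E F Q Z A \<and> isotropic L \<and> graph `` {A} \<subseteq> L"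
  have "x \<in> graph `` {A}" if x: "x \<in> L" for x
  proof -
    obtain a \<xi> where x_eq: "x = (a, \<xi>)" by force
    have a: "a \<in> tangent_space E Z A" and "\<xi> \<in> cotangent_space E F Q Z A"
      using x L by (auto simp: x_eq courant_fibre_def)
    then obtain \<alpha> where \<xi>: "\<xi> = covec E Q Z A \<alpha>" by (auto simp: cotangent_space_def)
    have "\<xi> b = covec E Q Z A (\<gamma> A a) b" for b
    proof (cases "b \<in> tangent_space E Z A")
      case True
      have "(b, covec E Q Z A (\<gamma> A b)) \<in> L" using True L by (auto simp: graph_Image[OF A])
      then have "\<xi> b + covec E Q Z A (\<gamma> A b) a = 0"
        using L x by (force simp: isotropic_def plus_form_def x_eq)
      then show ?thesis
        using True a pairing_\<gamma>_antisym[OF AE tangent_pts[OF a] tangent_pts[OF True]]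
        by (simp add: covec_def add_eq_0_iff2)
    qed (simp add: covec_def \<xi>)
    then have "\<xi> = covec E Q Z A (\<gamma> A a)" by (rule ext)
    then show ?thesis using a by (auto simp: graph_Image[OF A] x_eq)
  qed
  then show "L = graph `` {A}" using L by blast
qed

lemma smooth_on_\<gamma>:
  assumes "nspace X" "smooth_on X E U f" "smooth_on X E U g"
  shows "smooth_on X F U (\<lambda>x. \<gamma> (f x) (g x))"
  unfolding \<gamma>_def
  by (intro smooth_on_add[OF assms(1) F_ax] smooth_on_bil[OF assms(1) M_ax E_ax F_ax N]
      smooth_on_bil[OF assms(1) E_ax E_ax M_ax \<mu>] assms)

lemma smooth_on_tangent_comp:
  assumes X: "nspace X" and "smooth_deriv E E V g g'" "nopen E V" "smooth_on X E U f" "smooth_on X E U h"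
    and "\<And>x. x \<in> U \<Longrightarrow> f x \<in> V \<and> h x \<in> pts E"
  shows "smooth_on X E U (\<lambda>x. g' (f x) (h x))"
proof -
  have "smooth_on (prod_nsp E E) E (V \<times> pts E) (\<lambda>z. g' (fst z) (snd z))"
    by (rule smooth_on_tangent_map[OF E_ax E_ax assms(2,3)])
  from smooth_on_comp[OF X nspace_prod[OF E_ax E_ax] E_ax
      smooth_on_Pair[OF X E_ax E_ax assms(4,5)] this nopen_Times[OF E_ax E_ax assms(3) E.nopen_pts]]
  show ?thesis using assms(6) by auto
qed

text \<open>A fibre is trivialised by its tangent part: the chart identifies the tangent spaces with
  the fixed \<open>K\<close>, and the tangent vector determines the covector. The model is
  \<open>K\<close> placed in \<open>E \<times> F\<close> with second component zero.\<close>

lemma graph_subbundle: "subbundle E F Q Z graph"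
  unfolding subbundle_def
proof (intro conjI ballI graph_sub graph_fibre_subspace)
  fix A0 assume A0: "A0 \<in> Z"
  obtain U W \<Psi> \<Psi>' d\<Psi> d\<Psi>' K where fl: "flattening E Z U W \<Psi> \<Psi>' d\<Psi> d\<Psi>' K" and A0U: "A0 \<in> U"
    by (rule submanifold_flattening[OF E_ax Z A0])
  interpret flattening E Z U W \<Psi> \<Psi>' d\<Psi> d\<Psi>' K by (rule fl)
  interpret EE: nspace2 E E ..
  have A0E: "A0 \<in> pts E" using A0 Z_pts by auto
  obtain D where D: "jet E E U D" and d: "\<And>x h. x \<in> U \<Longrightarrow> h \<in> pts E \<Longrightarrow> D [h] x = d\<Psi> x h"
    using \<Psi> unfolding smooth_deriv_def by blast
  \<comment> \<open>A bound for \<open>d\<Psi>\<close> that is uniform near \<open>A0\<close>; it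
    becomes the constant for the inverses of the trivialising maps.\<close>
  obtain C where C: "1 \<le> C" "eventually (\<lambda>h. \<forall>hs\<in>lists (pts E). length hs \<le> 1 \<longrightarrow> nrm E (D hs (A0 + h)) \<le> C * npr E hs) (near E U A0)"
    using EE.jet_bdd_near[OF D A0U] by blast
  then obtain \<delta> where \<delta>: "\<delta> > 0" "\<And>h. h \<in> pts E \<Longrightarrow> nrm E h < \<delta> \<Longrightarrow> A0 + h \<in> U \<Longrightarrow>
      (\<forall>hs\<in>lists (pts E). length hs \<le> 1 \<longrightarrow> nrm E (D hs (A0 + h)) \<le> C * npr E hs)"
    unfolding eventually_near by blast
  define V where "V = U \<inter> {x \<in> pts E. nrm E (x - A0) < \<delta>}"
  have V: "nopen E V" unfolding V_def by (rule nopen_Int[OF U E.nopen_ball[OF A0E]])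
  have d_bound: "nrm E (d\<Psi> A h) \<le> C * nrm E h" if "A \<in> V" "h \<in> pts E" for A h
    using \<delta>(2)[of "A - A0", rule_format, of "[h]"] that A0E by (auto simp: V_def d)
  have UE: "U \<subseteq> pts E" using U by (simp add: nopen_def)
  let ?EF = "prod_nsp E F"
  let ?X = "prod_nsp E ?EF"
  note EF = nspace_prod[OF E_ax F_ax] and X = nspace_prod[OF E_ax nspace_prod[OF E_ax F_ax]]
  define L where "L = K \<times> {0 :: 'w}"
  define p where "p z = d\<Psi>' (\<Psi> (fst z)) (fst (snd z))" for z :: "'v \<times> 'v \<times> 'w"
  define q where "q z = \<gamma> (fst z) (p z)" for z :: "'v \<times> 'v \<times> 'w"
  define \<Omega> where "\<Omega> = U \<times> pts ?EF"
  have \<Omega>: "nopen ?X \<Omega>"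
    unfolding \<Omega>_def by (rule nopen_Times[OF E_ax EF U nspace.nopen_pts[OF EF]])
  have \<Omega>X: "\<Omega> \<subseteq> pts ?X" using \<Omega> by (simp add: nopen_def)
  have s1: "smooth_on ?X E \<Omega> fst"
    using smooth_on_fst[OF E_ax EF X smooth_on_id[OF X \<Omega>X]] .
  have s2: "smooth_on ?X E \<Omega> (\<lambda>z. fst (snd z))"
    using smooth_on_fst[OF E_ax F_ax X smooth_on_snd[OF E_ax EF X smooth_on_id[OF X \<Omega>X]]] .
  have \<Psi>s: "smooth_on E E U \<Psi>" using \<Psi> unfolding smooth_on_iff_deriv by blast
  have s3: "smooth_on ?X E \<Omega> (\<lambda>z. \<Psi> (fst z))"
    by (rule smooth_on_comp[OF X E_ax E_ax s1 \<Psi>s U]) (auto simp: \<Omega>_def)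
  \<comment> \<open>\<open>p\<close> depends on the base point through a derivative; its joint
    smoothness is that of the tangent map of \<open>\<Psi>'\<close>.\<close>
  have p: "smooth_on ?X E \<Omega> p"
    unfolding p_def[abs_def]
    by (rule smooth_on_tangent_comp[OF X \<Psi>' W s3 s2]) (auto simp: \<Omega>_def \<Psi>_W)
  have q: "smooth_on ?X F \<Omega> q"
    unfolding q_def[abs_def] by (rule smooth_on_\<gamma>[OF X s1 p])
  have VL: "(Z \<inter> V) \<times> L \<subseteq> \<Omega>"
    using K_pts by (auto simp: \<Omega>_def V_def L_def)
  have pT: "p (A, k) \<in> tangent_space E Z A" "d\<Psi> A (p (A, k)) = fst k" if "A \<in> Z \<inter> V" "k \<in> L" for A k
  proof -
    have A: "A \<in> Z" "A \<in> U" and k: "fst k \<in> K" using that by (auto simp: V_def L_def)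
    show 1: "d\<Psi> A (p (A, k)) = fst k" unfolding p_def using d_inverse(2)[OF A(2)] K_pts[OF k] by simp
    have "p (A, k) \<in> pts E"
      unfolding p_def using smooth_deriv_pts(2)[OF \<Psi>' \<Psi>_W[OF A(2)] K_pts[OF k]] by simp
    then show "p (A, k) \<in> tangent_space E Z A" using tangent_space_iff[OF A] 1 k by simp
  qed
  show "\<exists>W K p q C. nopen E W \<and> A0 \<in> W \<and> closed_subspace ?EF K \<and>
        smooth_along ?X E ((Z \<inter> W) \<times> K) p \<and> smooth_along ?X F ((Z \<inter> W) \<times> K) q \<and>
        (\<forall>A\<in>Z \<inter> W. let \<tau> = (\<lambda>k. (p (A, k), covec E Q Z A (q (A, k)))) in
           bij_betw \<tau> K (graph `` {A}) \<and>
           (\<forall>k\<in>K. \<forall>l\<in>K. \<forall>r. \<tau> (r *\<^sub>R k + l) = r *\<^sub>R \<tau> k + \<tau> l) \<and>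
           (\<forall>k\<in>K. nrm ?EF k \<le> C * (nrm E (fst (\<tau> k)) + cotangent_norm E F Q Z A (snd (\<tau> k)))))"
  proof (intro exI[of _ V] exI[of _ L] exI[of _ p] exI[of _ q] exI[of _ C] conjI ballI V)
    show "A0 \<in> V" using A0U A0E \<delta>(1) by (simp add: V_def)
    show "closed_subspace ?EF L"
      unfolding closed_subspace_def
    proof (intro conjI)
      show "L \<subseteq> pts ?EF" using K_pts by (auto simp: L_def)
      show "subspace L"
        unfolding L_def using K_subspace
        by (intro subspaceI) (auto simp: zero_prod_def subspace_0 intro: subspace_add subspace_scale)
      show "nopen ?EF (pts ?EF - L)"
        unfolding nopen_def
      proof (intro conjI ballI)
        fix z assume z: "z \<in> pts ?EF - L"
        obtain x y where z_eq: "z = (x, y)" by force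
        have xy: "x \<in> pts E" "y \<in> pts F" using z by (auto simp: z_eq)
        consider "x \<notin> K" | "y \<noteq> 0" using z by (auto simp: z_eq L_def)
        then show "\<exists>r>0. \<forall>w\<in>pts ?EF. nrm ?EF (w - z) < r \<longrightarrow> w \<in> pts ?EF - L"
        proof cases
          case 1
          then obtain r where r: "r > 0" "\<forall>y\<in>pts E. nrm E (y - x) < r \<longrightarrow> y \<in> pts E - K"
            using K xy unfolding closed_subspace_def nopen_def by blast
          show ?thesis
          proof (intro exI[of _ r] conjI ballI impI r(1))
            fix w assume w: "w \<in> pts ?EF" "nrm ?EF (w - z) < r"
            have "0 \<le> nrm F (snd w - y)" using w(1) xy by auto
            then have "nrm E (fst w - x) < r" using w(2) by (simp add: nrm_prod_nsp z_eq)
            then show "w \<in> pts ?EF - L" using r(2) w(1) by (auto simp: L_def)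
          qed
        next
          case 2
          have "nrm F y \<noteq> 0" using F.nrm_eq_0D[OF xy(2)] 2 by blast
          then have y0: "0 < nrm F y" using F.nrm_nonneg[OF xy(2)] by simp
          show ?thesis
          proof (intro exI[of _ "nrm F y"] conjI ballI impI y0)
            fix w assume w: "w \<in> pts ?EF" "nrm ?EF (w - z) < nrm F y"
            have "0 \<le> nrm E (fst w - x)" using w(1) xy by auto
            then have "nrm F (snd w - y) < nrm F y" using w(2) by (simp add: nrm_prod_nsp z_eq)
            then have "snd w \<noteq> 0" using F.nrm_minus[OF xy(2)] by auto
            then show "w \<in> pts ?EF - L" using w(1) by (auto simp: L_def)
          qed
        qed
      qed auto
    qed
    show "smooth_along ?X E ((Z \<inter> V) \<times> L) p"
      unfolding smooth_along_def using VL \<Omega> p by blast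
    show "smooth_along ?X F ((Z \<inter> V) \<times> L) q"
      unfolding smooth_along_def using VL \<Omega> q by blast
    fix A assume A: "A \<in> Z \<inter> V"
    then have AZ: "A \<in> Z" and AU: "A \<in> U" and AE: "A \<in> pts E" using Z_pts by (auto simp: V_def)
    define \<tau> where "\<tau> = (\<lambda>k. (p (A, k), covec E Q Z A (q (A, k))))"
    have p_lin: "p (A, r *\<^sub>R k + l) = r *\<^sub>R p (A, k) + p (A, l)" if "k \<in> L" "l \<in> L" for k l r
      using that K_pts d_linear(2)[OF AU, of "fst k" "fst l" r] by (auto simp: p_def L_def)
    have "bij_betw \<tau> L (graph `` {A})"
      unfolding bij_betw_def
    proof
      show "inj_on \<tau> L"
        using pT(2)[OF A] by (intro inj_onI) (metis (no_types, lifting) L_def SigmaE \<tau>_def fst_conv singletonD snd_conv prod.expand)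
      show "\<tau> ` L = graph `` {A}"
        unfolding graph_Image[OF AZ]
      proof (intro equalityI subsetI; elim imageE)
        show "x \<in> (\<lambda>a. (a, covec E Q Z A (\<gamma> A a))) ` tangent_space E Z A" if "x = \<tau> k" "k \<in> L" for x k
          using pT(1)[OF A that(2)] that(1) by (auto simp: \<tau>_def q_def)
        fix x a assume x: "x = (a, covec E Q Z A (\<gamma> A a))" and a: "a \<in> tangent_space E Z A"
        define k where "k = (d\<Psi> A a, 0 :: 'w)"
        have "k \<in> L" using a tangent_space_iff[OF AZ AU] by (simp add: k_def L_def)
        moreover have "p (A, k) = a" unfolding p_def k_def using d_inverse(1)[OF AU tangent_pts[OF a]] by simp
        ultimately show "x \<in> \<tau> ` L" using x by (auto simp: \<tau>_def q_def intro!: image_eqI[of _ _ k])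
      qed
    qed
    moreover have "\<tau> (r *\<^sub>R k + l) = r *\<^sub>R \<tau> k + \<tau> l" if "k \<in> L" "l \<in> L" for k l r
      using graph_linear[OF AZ tangent_pts[OF pT(1)[OF A that(1)]] tangent_pts[OF pT(1)[OF A that(2)]], of r] p_lin[OF that]
      by (simp add: \<tau>_def q_def)
    moreover have "nrm ?EF k \<le> C * (nrm E (fst (\<tau> k)) + cotangent_norm E F Q Z A (snd (\<tau> k)))" if "k \<in> L" for k
    proof -
      have pE: "p (A, k) \<in> pts E" by (rule tangent_pts[OF pT(1)[OF A that]])
      \<comment> \<open>The covector contributes a nonnegative amount, so a bound by the tangent
        part is enough. The infimum is over a nonempty set because
        \<open>\<gamma> A (p (A, k))\<close> represents the covector.\<close>
      have "0 \<le> cotangent_norm E F Q Z A (snd (\<tau> k))"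
        unfolding cotangent_norm_def
      proof (rule cInf_greatest)
        show "nrm F ` {\<alpha> \<in> pts F. covec E Q Z A \<alpha> = snd (\<tau> k)} \<noteq> {}"
          using \<gamma>_pts[OF AE pE] by (auto simp: \<tau>_def q_def)
      qed auto
      then have "C * nrm E (p (A, k)) \<le> C * (nrm E (fst (\<tau> k)) + cotangent_norm E F Q Z A (snd (\<tau> k)))"
        using C(1) by (intro mult_left_mono) (auto simp: \<tau>_def)
      moreover have "nrm ?EF k = nrm E (d\<Psi> A (p (A, k)))"
        unfolding pT(2)[OF A that] using that by (auto simp: nrm_prod_nsp L_def)
      ultimately show ?thesis
        using d_bound[of A "p (A, k)"] A pE by auto
    qed
    ultimately show "let \<tau> = (\<lambda>k. (p (A, k), covec E Q Z A (q (A, k)))) in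
           bij_betw \<tau> L (graph `` {A}) \<and>
           (\<forall>k\<in>L. \<forall>l\<in>L. \<forall>r. \<tau> (r *\<^sub>R k + l) = r *\<^sub>R \<tau> k + \<tau> l) \<and>
           (\<forall>k\<in>L. nrm ?EF k \<le> C * (nrm E (fst (\<tau> k)) + cotangent_norm E F Q Z A (snd (\<tau> k))))"
      unfolding \<tau>_def Let_def by blast
  qed
qed

section \<open>Vector fields on the submanifold and the Courant bracket on the graph\<close>

definition local_ext :: "'v set \<Rightarrow> ('v \<Rightarrow> 'v) \<Rightarrow> ('v \<Rightarrow> 'v) \<Rightarrow> ('v \<Rightarrow> 'v \<Rightarrow> 'v) \<Rightarrow> bool" where
  "local_ext V a g g' \<longleftrightarrow> smooth_deriv E E V g g' \<and> (\<forall>B\<in>Z \<inter> V. g B = a B \<and> a B \<in> tangent_space E Z B)"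

lemma local_ext_subset: "local_ext V a g g' \<Longrightarrow> V' \<subseteq> V \<Longrightarrow> local_ext V' a g g'"
  unfolding local_ext_def using smooth_deriv_subset by blast

lemma vector_field_ext:
  assumes "a \<in> vector_fields E Z (Z \<inter> W)" "nopen E W" "A \<in> Z \<inter> W"
  obtains V g g' where "nopen E V" "A \<in> V" "V \<subseteq> W" "local_ext V a g g'"
proof -
  obtain V g where V: "nopen E V" "A \<in> V" "smooth_on E E V g" "\<forall>B\<in>Z \<inter> W \<inter> V. g B = a B"
    using assms unfolding vector_fields_def smooth_along_def by blast
  then obtain g' where "smooth_deriv E E V g g'" unfolding smooth_on_iff_deriv by blast
  then have "smooth_deriv E E (V \<inter> W) g g'" by (rule smooth_deriv_subset) auto
  then have "local_ext (V \<inter> W) a g g'"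
    using V(4) assms(1) by (auto simp: local_ext_def vector_fields_def)
  then show ?thesis using that[of "V \<inter> W"] nopen_Int[OF V(1) assms(2)] V(2) assms(3) by auto
qed

lemma local_ext_deriv:
  assumes "local_ext V a g g'" "nopen E V" "A \<in> Z \<inter> V" "v \<in> tangent_space E Z A"
  shows "deriv_along E E Z a A v = g' A v" "deriv_along E E Z a A v \<in> pts E"
proof -
  have g: "smooth_deriv E E V g g'" using assms(1) by (simp add: local_ext_def)
  show "deriv_along E E Z a A v = g' A v"
    using assms by (intro deriv_along_ext[OF E_ax E_ax Z_pts assms(4,2) _ g]) (auto simp: local_ext_def)
  then show "deriv_along E E Z a A v \<in> pts E"
    using smooth_deriv_pts(2)[OF g _ tangent_pts[OF assms(4)], of A] assms(3) by simp
qed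

lemma local_ext_bracket:
  assumes a: "local_ext V a ga ga'" and b: "local_ext V b gb gb'" and V: "nopen E V" and A: "A \<in> Z \<inter> V"
  shows "lie_bracket E Z a b A = gb' A (ga A) - ga' A (gb A)"
    "lie_bracket E Z a b A \<in> tangent_space E Z A"
proof -
  have T: "a A \<in> tangent_space E Z A" "b A \<in> tangent_space E Z A" and ab: "ga A = a A" "gb A = b A"
    using a b A by (auto simp: local_ext_def)
  show *: "lie_bracket E Z a b A = gb' A (ga A) - ga' A (gb A)"
    unfolding lie_bracket_def ab local_ext_deriv(1)[OF a V A T(2)] local_ext_deriv(1)[OF b V A T(1)] ..
  obtain U W \<Psi> \<Psi>' d\<Psi> d\<Psi>' K where fl: "flattening E Z U W \<Psi> \<Psi>' d\<Psi> d\<Psi>' K" and AU: "A \<in> U"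
    using A by (auto intro: submanifold_flattening[OF E_ax Z])
  show "lie_bracket E Z a b A \<in> tangent_space E Z A"
    unfolding * using A AU a b
    by (intro flattening.bracket_tangent[OF fl sep _ _ V]) (auto simp: local_ext_def)
qed

text \<open>Near each point the bracket agrees on \<open>Z\<close> with an expression in the tangent
  maps of smooth extensions, which is smooth on an open set; tangency is
  \<open>bracket_tangent\<close> in a flattening chart.\<close>

lemma lie_bracket_vector_field:
  assumes "a \<in> vector_fields E Z (Z \<inter> W)" "b \<in> vector_fields E Z (Z \<inter> W)" and W: "nopen E W"
  shows "lie_bracket E Z a b \<in> vector_fields E Z (Z \<inter> W)"
proof -
  have "\<exists>V g. nopen E V \<and> A \<in> V \<and> smooth_on E E V g \<and> (\<forall>B\<in>Z \<inter> W \<inter> V. g B = lie_bracket E Z a b B) \<and>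
      lie_bracket E Z a b A \<in> tangent_space E Z A" if A: "A \<in> Z \<inter> W" for A
  proof -
    obtain V1 ga ga' where V1: "nopen E V1" "A \<in> V1" "V1 \<subseteq> W" "local_ext V1 a ga ga'"
      by (rule vector_field_ext[OF assms(1) W A])
    obtain V2 gb gb' where V2: "nopen E V2" "A \<in> V2" "V2 \<subseteq> W" "local_ext V2 b gb gb'"
      by (rule vector_field_ext[OF assms(2) W A])
    define V where "V = V1 \<inter> V2"
    have V: "nopen E V" unfolding V_def by (rule nopen_Int[OF V1(1) V2(1)])
    have VE: "V \<subseteq> pts E" using V by (simp add: nopen_def)
    have a: "local_ext V a ga ga'" and b: "local_ext V b gb gb'"
      using local_ext_subset[OF V1(4)] local_ext_subset[OF V2(4)] by (auto simp: V_def)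
    have sa: "smooth_deriv E E V ga ga'" and sb: "smooth_deriv E E V gb gb'"
      using a b by (auto simp: local_ext_def)
    have ga: "smooth_on E E V ga" and gb: "smooth_on E E V gb"
      using sa sb unfolding smooth_on_iff_deriv by blast+
    have "smooth_on E E V (\<lambda>B. gb' B (ga B) - ga' B (gb B))"
      by (intro smooth_on_minus[OF E_ax E_ax] smooth_on_tangent_comp[OF E_ax sb V]
          smooth_on_tangent_comp[OF E_ax sa V] smooth_on_id[OF E_ax VE] ga gb)
        (auto intro: smooth_deriv_pts(1)[OF sa] smooth_deriv_pts(1)[OF sb])
    moreover have "\<forall>B\<in>Z \<inter> W \<inter> V. gb' B (ga B) - ga' B (gb B) = lie_bracket E Z a b B"
      using local_ext_bracket(1)[OF a b V] by auto
    ultimately show ?thesis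
      using V V1(2) V2(2) A local_ext_bracket(2)[OF a b V, of A] by (auto simp: V_def)
  qed
  then show ?thesis
    unfolding vector_fields_def smooth_along_def by blast
qed

lemma graph_one_form:
  assumes "a \<in> vector_fields E Z (Z \<inter> W)" and W: "nopen E W"
  shows "(\<lambda>A. covec E Q Z A (\<gamma> A (a A))) \<in> one_forms E F Q Z (Z \<inter> W)"
  unfolding one_forms_def
proof (intro CollectI ballI)
  fix A assume A: "A \<in> Z \<inter> W"
  obtain V g g' where V: "nopen E V" "A \<in> V" "V \<subseteq> W" "local_ext V a g g'"
    by (rule vector_field_ext[OF assms(1) W A])
  have g: "smooth_on E E V g" using V(4) unfolding smooth_on_iff_deriv local_ext_def by blast
  have VE: "V \<subseteq> pts E" using V by (simp add: nopen_def)
  have "smooth_on E F V (\<lambda>B. \<gamma> B (g B))" by (rule smooth_on_\<gamma>[OF E_ax smooth_on_id[OF E_ax VE] g])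
  moreover have "\<forall>B\<in>Z \<inter> W \<inter> V. covec E Q Z B (\<gamma> B (a B)) = covec E Q Z B (\<gamma> B (g B))"
    using V(4) by (auto simp: local_ext_def)
  ultimately show "\<exists>V \<alpha>. nopen E V \<and> A \<in> V \<and> smooth_on E F V \<alpha> \<and>
      (\<forall>B\<in>Z \<inter> W \<inter> V. covec E Q Z B (\<gamma> B (a B)) = covec E Q Z B (\<alpha> B))"
    using V by blast
qed

text \<open>Product rule along \<open>Z\<close>: \<open>d\<Theta>\<close> differentiates the
  two-form in the base point, the other two terms differentiate the two fields. The computation is
  made with local extensions and read off on \<open>Z\<close>.\<close>

lemma deriv_along_pairing:
  assumes b: "b \<in> vector_fields E Z (Z \<inter> W)" and c: "c \<in> vector_fields E Z (Z \<inter> W)" and W: "nopen E W"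
    and \<xi>: "\<And>B. B \<in> Z \<inter> W \<Longrightarrow> \<xi> B = covec E Q Z B (\<gamma> B (b B))"
    and A: "A \<in> Z \<inter> W" and v: "v \<in> tangent_space E Z A"
  shows "deriv_along E euclid Z (\<lambda>B. \<xi> B (c B)) A v
    = d\<Theta> A v (b A) (c A)
      + Q (\<gamma> A (deriv_along E E Z b A v)) (c A) + Q (\<gamma> A (b A)) (deriv_along E E Z c A v)"
proof -
  obtain V1 gb gb' where V1: "nopen E V1" "A \<in> V1" "V1 \<subseteq> W" "local_ext V1 b gb gb'"
    by (rule vector_field_ext[OF b W A])
  obtain V2 gc gc' where V2: "nopen E V2" "A \<in> V2" "V2 \<subseteq> W" "local_ext V2 c gc gc'"
    by (rule vector_field_ext[OF c W A])
  define V where "V = V1 \<inter> V2"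
  have V: "nopen E V" unfolding V_def by (rule nopen_Int[OF V1(1) V2(1)])
  have VE: "V \<subseteq> pts E" using V by (simp add: nopen_def)
  have AV: "A \<in> V" "A \<in> Z" using V1 V2 A by (auto simp: V_def)
  have lb: "local_ext V b gb gb'" and lc: "local_ext V c gc gc'"
    using local_ext_subset[OF V1(4)] local_ext_subset[OF V2(4)] by (auto simp: V_def)
  have sb: "smooth_deriv E E V gb gb'" and sc: "smooth_deriv E E V gc gc'"
    using lb lc by (auto simp: local_ext_def)
  have i: "smooth_deriv E E V (\<lambda>x. x) (\<lambda>x h. h)" by (rule smooth_deriv_id[OF E_ax VE])
  note bm = smooth_deriv_bil[OF E_ax E_ax E_ax M_ax \<mu>] and bN = smooth_deriv_bil[OF E_ax M_ax E_ax F_ax N]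
    and bQ = smooth_deriv_bil[OF E_ax F_ax E_ax nspace_euclid Q]
  note \<gamma>s = smooth_deriv_add[OF E_ax F_ax bN[OF bm[OF i i] sb] bN[OF bm[OF sb i] i]]
  have "deriv_along E euclid Z (\<lambda>B. \<xi> B (c B)) A v
    = Q (N (\<mu> v A + \<mu> A v) (gb A) + N (\<mu> A A) (gb' A v) + (N (\<mu> (gb' A v) A + \<mu> (gb A) v) A + N (\<mu> (gb A) A) v)) (gc A)
      + Q (N (\<mu> A A) (gb A) + N (\<mu> (gb A) A) A) (gc' A v)"
  proof (rule deriv_along_ext[OF E_ax nspace_euclid Z_pts v V AV(1) bQ[OF \<gamma>s sc]])
    fix B assume B: "B \<in> Z \<inter> V"
    then have "\<xi> B = covec E Q Z B (\<gamma> B (b B))" using V1(3) by (intro \<xi>) (auto simp: V_def)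
    then show "\<xi> B (c B) = Q (N (\<mu> B B) (gb B) + N (\<mu> (gb B) B) B) (gc B)"
      using B lb lc by (auto simp: local_ext_def covec_def \<gamma>_def)
  qed
  moreover have eq: "gb A = b A" "gc A = c A" "deriv_along E E Z b A v = gb' A v" "deriv_along E E Z c A v = gc' A v"
    using lb lc AV local_ext_deriv(1)[OF lb V _ v] local_ext_deriv(1)[OF lc V _ v] by (auto simp: local_ext_def)
  moreover have p: "A \<in> pts E" "v \<in> pts E" "b A \<in> pts E" "c A \<in> pts E" "gb' A v \<in> pts E" "gc' A v \<in> pts E"
    using VE AV tangent_pts[OF v] smooth_deriv_pts(1)[OF sb AV(1)] smooth_deriv_pts(1)[OF sc AV(1)]
      smooth_deriv_pts(2)[OF sb AV(1) tangent_pts[OF v]] smooth_deriv_pts(2)[OF sc AV(1) tangent_pts[OF v]] eq(1,2)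
    by auto
  moreover have addN: "N (x + y) z = N x z + N y z" if "x \<in> pts M" "y \<in> pts M" "z \<in> pts E" for x y z
    using bil_left[OF N that, of 1] by simp
  moreover have addQ: "Q (x + y) z = Q x z + Q y z" if "x \<in> pts F" "y \<in> pts F" "z \<in> pts E" for x y z
    using bil_left[OF Q that, of 1] by simp
  ultimately show ?thesis
    by (simp add: \<gamma>_def d\<Theta>_def \<Theta>_def addN addQ bil_pts[OF \<mu>] bil_pts[OF N])
qed

text \<open>The test fields in \<open>is_courant_bracket\<close> live on smaller open sets; this
  restricts the other fields to the common domain.\<close>

lemma vector_fields_subset:
  assumes a: "a \<in> vector_fields E Z S" and S': "S' \<subseteq> S"
  shows "a \<in> vector_fields E Z S'"
proof -
  have "\<exists>W g. nopen E W \<and> A \<in> W \<and> smooth_on E E W g \<and> (\<forall>B\<in>S' \<inter> W. g B = a B)" if A: "A \<in> S'" for A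
  proof -
    obtain W g where "nopen E W" "A \<in> W" "smooth_on E E W g" "\<forall>B\<in>S \<inter> W. g B = a B"
      using a A S' unfolding vector_fields_def smooth_along_def by blast
    then show ?thesis using S' by (intro exI[of _ W] exI[of _ g]) auto
  qed
  then show ?thesis
    using a S' unfolding vector_fields_def smooth_along_def by blast
qed

text \<open>The one-form part of a bracket in the graph can only be the one attached to the Lie
  bracket of the tangent parts. This section is the witness, and it is tested against an arbitrary
  local field \<open>c\<close>.\<close>

lemma graph_courant_closed:
  assumes W: "nopen E W" and "e1 \<in> sections E F Q Z graph (Z \<inter> W)" "e2 \<in> sections E F Q Z graph (Z \<inter> W)"
  shows "\<exists>e\<in>sections E F Q Z graph (Z \<inter> W). is_courant_bracket E Z (Z \<inter> W) e1 e2 e"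
proof -
  obtain a \<xi> where e1: "e1 = (a, \<xi>)" by force
  obtain b \<eta> where e2: "e2 = (b, \<eta>)" by force
  have a: "a \<in> vector_fields E Z (Z \<inter> W)" and \<xi>: "\<And>B. B \<in> Z \<inter> W \<Longrightarrow> \<xi> B = covec E Q Z B (\<gamma> B (a B))"
    using assms(2) by (auto simp: e1 sections_def graph_def)
  have b: "b \<in> vector_fields E Z (Z \<inter> W)" and \<eta>: "\<And>B. B \<in> Z \<inter> W \<Longrightarrow> \<eta> B = covec E Q Z B (\<gamma> B (b B))"
    using assms(3) by (auto simp: e2 sections_def graph_def)
  define ab where "ab = lie_bracket E Z a b"
  define \<zeta> where "\<zeta> A = covec E Q Z A (\<gamma> A (ab A))" for A
  have ab: "ab \<in> vector_fields E Z (Z \<inter> W)"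
    unfolding ab_def by (rule lie_bracket_vector_field[OF a b W])
  have "(ab, \<zeta>) \<in> sections E F Q Z graph (Z \<inter> W)"
    using ab graph_one_form[OF ab W] by (auto simp: sections_def graph_def \<zeta>_def[abs_def] vector_fields_def)
  moreover have "is_courant_bracket E Z (Z \<inter> W) e1 e2 (ab, \<zeta>)"
    unfolding is_courant_bracket_def fst_conv snd_conv e1 e2
  proof (intro conjI ballI allI impI)
    show "ab A = lie_bracket E Z a b A" for A by (simp add: ab_def)
    fix W' c A assume W': "nopen E W'" and c0: "c \<in> vector_fields E Z (Z \<inter> W \<inter> W')" and A0: "A \<in> Z \<inter> W \<inter> W'"
    define V where "V = W \<inter> W'"
    have V: "nopen E V" unfolding V_def by (rule nopen_Int[OF W W'])
    have c: "c \<in> vector_fields E Z (Z \<inter> V)" and A: "A \<in> Z \<inter> V" using c0 A0 by (auto simp: V_def Int_assoc)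
    have VW: "Z \<inter> V \<subseteq> Z \<inter> W" by (auto simp: V_def)
    note a = vector_fields_subset[OF a VW] and b = vector_fields_subset[OF b VW]
    have \<xi>: "\<xi> B = covec E Q Z B (\<gamma> B (a B))" and \<eta>: "\<eta> B = covec E Q Z B (\<gamma> B (b B))" if "B \<in> Z \<inter> V" for B
      using \<xi> \<eta> VW that by auto
    have T: "x A \<in> tangent_space E Z A" if "x \<in> vector_fields E Z (Z \<inter> V)" for x
      using that A by (auto simp: vector_fields_def)
    note aT = T[OF a] and bT = T[OF b] and cT = T[OF c]
    have dp: "deriv_along E E Z x A v \<in> pts E" if x: "x \<in> vector_fields E Z (Z \<inter> V)" and v: "v \<in> tangent_space E Z A" for x v
    proof -
      obtain V' g g' where V': "nopen E V'" "A \<in> V'" "V' \<subseteq> V" "local_ext V' x g g'"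
        by (rule vector_field_ext[OF x V A])
      show ?thesis using local_ext_deriv(2)[OF V'(4,1) _ v] V'(2) A by auto
    qed
    have lT: "lie_bracket E Z x y A \<in> tangent_space E Z A"
      if "x \<in> vector_fields E Z (Z \<inter> V)" "y \<in> vector_fields E Z (Z \<inter> V)" for x y
      by (rule T[OF lie_bracket_vector_field[OF that V]])
    define p where "p = a A" define q where "q = b A" define r where "r = c A"
    define db where "db = (\<lambda>v. deriv_along E E Z b A v)"
    define da where "da = (\<lambda>v. deriv_along E E Z a A v)"
    define dc where "dc = (\<lambda>v. deriv_along E E Z c A v)"
    have AE: "A \<in> pts E" using A Z_pts by auto
    have pq: "p \<in> pts E" "q \<in> pts E" "r \<in> pts E"
      unfolding p_def q_def r_def using aT bT cT tangent_pts by auto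
    have dd: "db p \<in> pts E" "db r \<in> pts E" "da q \<in> pts E" "da r \<in> pts E" "dc p \<in> pts E" "dc q \<in> pts E"
      unfolding da_def db_def dc_def p_def q_def r_def by (rule dp a b c aT bT cT)+
    have diff1: "Q (\<gamma> A (x - y)) z = Q (\<gamma> A x) z - Q (\<gamma> A y) z" if "x \<in> pts E" "y \<in> pts E" "z \<in> pts E" for x y z
    proof -
      have "\<gamma> A (x - y) = (-1) *\<^sub>R \<gamma> A y + \<gamma> A x"
        using \<gamma>_linear[OF AE that(2,1), of "-1"] by (simp only: scaleR_minus1_left uminus_add_conv_diff)
      then show ?thesis
        using bil_left[OF Q \<gamma>_pts[OF AE that(2)] \<gamma>_pts[OF AE that(1)] that(3), of "-1"]
        by (simp only: scaleR_minus1_left uminus_add_conv_diff)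
    qed
    have diff2: "Q (\<gamma> A z) (x - y) = Q (\<gamma> A z) x - Q (\<gamma> A z) y" if "x \<in> pts E" "y \<in> pts E" "z \<in> pts E" for x y z
      using bil_right[OF Q \<gamma>_pts[OF AE that(3)] that(2,1), of "-1"] by (simp only: scaleR_minus1_left uminus_add_conv_diff)
    have 1: "\<zeta> A (c A) = Q (\<gamma> A (db p)) r - Q (\<gamma> A (da q)) r"
      using cT dd pq diff1 by (simp add: \<zeta>_def covec_def ab_def lie_bracket_def p_def q_def r_def da_def db_def)
    have 2: "\<eta> A (lie_bracket E Z a c A) = Q (\<gamma> A q) (dc p) - Q (\<gamma> A q) (da r)"
    proof -
      have l: "lie_bracket E Z a c A = dc p - da r"
        by (simp only: lie_bracket_def dc_def da_def p_def r_def)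
      have "\<eta> A (lie_bracket E Z a c A) = Q (\<gamma> A q) (lie_bracket E Z a c A)"
        unfolding \<eta>[OF A] covec_def using lT[OF a c] by (simp add: q_def)
      then show ?thesis unfolding l using diff2 dd pq by (simp only:)
    qed
    have 3: "\<xi> A (lie_bracket E Z b c A) = Q (\<gamma> A p) (dc q) - Q (\<gamma> A p) (db r)"
    proof -
      have l: "lie_bracket E Z b c A = dc q - db r"
        by (simp only: lie_bracket_def dc_def db_def q_def r_def)
      have "\<xi> A (lie_bracket E Z b c A) = Q (\<gamma> A p) (lie_bracket E Z b c A)"
        unfolding \<xi>[OF A] covec_def using lT[OF b c] by (simp add: p_def)
      then show ?thesis unfolding l using diff2 dd pq by (simp only:)
    qed
    have 4: "deriv_along E euclid Z (\<lambda>B. \<eta> B (c B)) A p = d\<Theta> A p q r + Q (\<gamma> A (db p)) r + Q (\<gamma> A q) (dc p)"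
      unfolding p_def q_def r_def da_def db_def dc_def by (rule deriv_along_pairing[OF b c V _ A aT]) (use \<eta> in auto)
    have 5: "deriv_along E euclid Z (\<lambda>B. \<xi> B (c B)) A q = d\<Theta> A q p r + Q (\<gamma> A (da q)) r + Q (\<gamma> A p) (dc q)"
      unfolding p_def q_def r_def da_def db_def dc_def by (rule deriv_along_pairing[OF a c V _ A bT]) (use \<xi> in auto)
    have 6: "deriv_along E euclid Z (\<lambda>B. \<xi> B (b B)) A r = d\<Theta> A r p q + Q (\<gamma> A (da r)) q + Q (\<gamma> A p) (db r)"
      unfolding p_def q_def r_def da_def db_def dc_def by (rule deriv_along_pairing[OF a b V _ A cT]) (use \<xi> in auto)
    \<comment> \<open>All terms with derivatives of \<open>c\<close>, and those with
      \<open>db r\<close>, cancel. Besides the pairing with the Lie bracket there remain the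
      exterior derivative of the two-form on constant fields and a pair that vanishes by
      antisymmetry.\<close>
    have "lie_derivative E Z a \<eta> c A - exterior_derivative E Z \<xi> b c A
      = (d\<Theta> A p q r - d\<Theta> A q p r + d\<Theta> A r p q)
        + Q (\<gamma> A (db p)) r - Q (\<gamma> A (da q)) r + (Q (\<gamma> A q) (da r) + Q (\<gamma> A (da r)) q)"
      unfolding lie_derivative_def exterior_derivative_def 2 3 
      by (simp add: p_def[symmetric] q_def[symmetric] r_def[symmetric] 4 5 6)
    also have "\<dots> = Q (\<gamma> A (db p)) r - Q (\<gamma> A (da q)) r"
      using d\<Theta>_closed[OF AE pq] pairing_\<gamma>_antisym[OF AE pq(2) dd(4)] by simp
    finally show "\<zeta> A (c A) = lie_derivative E Z a \<eta> c A - exterior_derivative E Z \<xi> b c A"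
      using 1 by simp
  qed
  ultimately show ?thesis by blast
qed

theorem dirac_structure_graph: "dirac_structure E F Q Z graph"
  unfolding dirac_structure_def
  using graph_subbundle graph_maximal_isotropic graph_courant_closed by blast

end

section \<open>Square integrable functions with a polynomial weight\<close>

lemma nn_integral_lborel_shift:
  fixes f :: "'a::euclidean_space \<Rightarrow> ennreal"
  assumes [measurable]: "f \<in> borel_measurable borel"
  shows "(\<integral>\<^sup>+x. f (x - y) \<partial>lborel) = (\<integral>\<^sup>+x. f x \<partial>lborel)"
proof -
  have "(\<integral>\<^sup>+x. f x \<partial>lborel) = (\<integral>\<^sup>+x. f x \<partial>distr lborel borel ((+) (- y)))"
    by (simp add: lborel_distr_plus)
  also have "\<dots> = (\<integral>\<^sup>+x. f (x - y) \<partial>lborel)"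
    by (subst nn_integral_distr) auto
  finally show ?thesis ..
qed

lemma nn_integral_lborel_reflect:
  fixes f :: "'a::euclidean_space \<Rightarrow> ennreal"
  assumes [measurable]: "f \<in> borel_measurable borel"
  shows "(\<integral>\<^sup>+x. f (y - x) \<partial>lborel) = (\<integral>\<^sup>+x. f x \<partial>lborel)"
proof -
  have *: "lborel = distr lborel borel (\<lambda>x. y - x)"
    using lborel_affine[of "-1" y] by (simp add: density_1)
  have "(\<integral>\<^sup>+x. f x \<partial>lborel) = (\<integral>\<^sup>+x. f x \<partial>distr lborel borel (\<lambda>x. y - x))"
    using * by simp
  also have "\<dots> = (\<integral>\<^sup>+x. f (y - x) \<partial>lborel)"
    by (subst nn_integral_distr) auto
  finally show ?thesis ..
qed

lemma integral_lborel_shift: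
  fixes f :: "'a::euclidean_space \<Rightarrow> 'b::{banach, second_countable_topology}"
  assumes [measurable]: "f \<in> borel_measurable borel"
  shows "(LINT x|lborel. f (x - y)) = (LINT x|lborel. f x)"
proof -
  have "(LINT x|lborel. f x) = (LINT x|distr lborel borel ((+) (- y)). f x)"
    by (simp add: lborel_distr_plus)
  also have "\<dots> = (LINT x|lborel. f (x - y))"
    by (subst integral_distr) auto
  finally show ?thesis ..
qed

text \<open>On the positive half line the weight is compared with the power
  \<open>- 2 * \<tau>\<close> of \<open>1 + x\<close>, whose antiderivative is explicit; the
  negative half line follows by reflection.\<close>

lemma nn_integral_weight_real:
  fixes \<tau> :: real assumes \<tau>: "\<tau> > 1 / 2"
  shows "(\<integral>\<^sup>+x. ennreal ((1 + (x::real)\<^sup>2) powr (- \<tau>)) \<partial>lborel) < \<infinity>"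
proof -
  define f where "f x = (1 + x) powr (- (2 * \<tau>))" for x :: real
  define F where "F x = - ((1 + x) powr (1 - 2 * \<tau>)) / (2 * \<tau> - 1)" for x :: real
  have [measurable]: "f \<in> borel_measurable borel" unfolding f_def by measurable
  have "((\<lambda>x. (1 + x) powr (1 - 2 * \<tau>)) \<longlongrightarrow> 0) at_top"
    using \<tau> by (intro tendsto_neg_powr filterlim_tendsto_add_at_top[OF tendsto_const]) (auto simp: filterlim_ident)
  then have "(F \<longlongrightarrow> - 0 / (2 * \<tau> - 1)) at_top"
    unfolding F_def by (intro tendsto_intros) (use \<tau> in auto)
  then have "(\<integral>\<^sup>+x. ennreal (f x) * indicator {0..} x \<partial>lborel) = 0 - F 0"
  proof (intro nn_integral_FTC_atLeast)
    fix x :: real assume x: "0 \<le> x"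
    have "((\<lambda>x. (1 + x) powr (1 - 2 * \<tau>)) has_real_derivative (1 - 2 * \<tau>) * (1 + x) powr (1 - 2 * \<tau> - 1) * (0 + 1)) (at x)"
      using x by (intro DERIV_fun_powr derivative_intros) auto
    then show "(F has_real_derivative f x) (at x)"
      unfolding F_def f_def by (rule DERIV_cong[OF DERIV_cdivide[OF DERIV_minus]]) (use \<tau> in \<open>simp add: field_simps\<close>)
    show "0 \<le> f x" by (simp add: f_def)
  qed auto
  then have fin: "(\<integral>\<^sup>+x. ennreal (f x) * indicator {0..} x \<partial>lborel) < \<infinity>" by simp
  have half: "(\<integral>\<^sup>+x. ennreal ((1 + x\<^sup>2) powr (- \<tau>)) * indicator {0..} x \<partial>lborel) < \<infinity>"
  proof -
    have "(1 + x\<^sup>2) powr (- \<tau>) \<le> 2 powr \<tau> * f x" if "0 \<le> x" for x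
    proof -
      have "(1 + x)\<^sup>2 \<le> 2 * (1 + x\<^sup>2)" using zero_le_power2[of "1 - x"] by (simp add: power2_eq_square algebra_simps)
      then have "(1 + x)\<^sup>2 / 2 \<le> 1 + x\<^sup>2" by simp
      then have "(1 + x\<^sup>2) powr (- \<tau>) \<le> ((1 + x)\<^sup>2 / 2) powr (- \<tau>)"
        using \<tau> that by (intro powr_mono2') auto
      also have "\<dots> = 2 powr \<tau> * f x"
      proof -
        have "((1 + x)\<^sup>2) powr (- \<tau>) = f x"
          using that by (simp add: f_def powr_powr flip: powr_numeral)
        then show ?thesis using that by (simp add: powr_divide powr_minus field_simps)
      qed
      finally show ?thesis .
    qed
    then have "(\<integral>\<^sup>+x. ennreal ((1 + x\<^sup>2) powr (- \<tau>)) * indicator {0..} x \<partial>lborel)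
        \<le> (\<integral>\<^sup>+x. ennreal (2 powr \<tau>) * (ennreal (f x) * indicator {0..} x) \<partial>lborel)"
      by (intro nn_integral_mono) (auto simp: indicator_def ennreal_mult'[symmetric] f_def intro!: ennreal_leI)
    also have "\<dots> = ennreal (2 powr \<tau>) * (\<integral>\<^sup>+x. ennreal (f x) * indicator {0..} x \<partial>lborel)"
      by (rule nn_integral_cmult) measurable
    also have "\<dots> < \<infinity>" using fin by (simp add: ennreal_mult_less_top)
    finally show ?thesis .
  qed
  have "(\<integral>\<^sup>+x. ennreal ((1 + x\<^sup>2) powr (- \<tau>)) * indicator {..0} x \<partial>lborel)
      = (\<integral>\<^sup>+x. ennreal ((1 + (0 - x)\<^sup>2) powr (- \<tau>)) * indicator {..0} (0 - x) \<partial>lborel)"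
    by (subst nn_integral_lborel_reflect[of _ "0::real"]) auto
  also have "\<dots> = (\<integral>\<^sup>+x. ennreal ((1 + x\<^sup>2) powr (- \<tau>)) * indicator {0..} x \<partial>lborel)"
    by (intro nn_integral_cong) (auto simp: indicator_def)
  finally have "(\<integral>\<^sup>+x. ennreal ((1 + x\<^sup>2) powr (- \<tau>)) * indicator {..0} x \<partial>lborel) < \<infinity>"
    using half by simp
  moreover have "(\<integral>\<^sup>+x. ennreal ((1 + x\<^sup>2) powr (- \<tau>)) \<partial>lborel)
    \<le> (\<integral>\<^sup>+x. ennreal ((1 + x\<^sup>2) powr (- \<tau>)) * indicator {0..} x + ennreal ((1 + x\<^sup>2) powr (- \<tau>)) * indicator {..0} x \<partial>lborel)"
    by (intro nn_integral_mono) (auto simp: indicator_def)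
  moreover have "\<dots> = (\<integral>\<^sup>+x. ennreal ((1 + x\<^sup>2) powr (- \<tau>)) * indicator {0..} x \<partial>lborel)
      + (\<integral>\<^sup>+x. ennreal ((1 + x\<^sup>2) powr (- \<tau>)) * indicator {..0} x \<partial>lborel)"
    by (rule nn_integral_add) measurable
  ultimately show ?thesis using half by (auto simp: top_unique less_top intro: le_less_trans)
qed

text \<open>\<open>1 + (norm x)\<^sup>2\<close> dominates \<open>1 + (x \<bullet> b)\<^sup>2\<close>
  for each coordinate. Sharing the exponent equally among the coordinates bounds the weight by a
  product of one-dimensional weights of exponent above 1/2.\<close>

lemma integrable_weight:
  fixes \<sigma> :: real assumes \<sigma>: "2 * \<sigma> > DIM('a)"
  shows "integrable lborel (\<lambda>x::'a::euclidean_space. (1 + (norm x)\<^sup>2) powr (- \<sigma>))"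
proof -
  define \<tau> where "\<tau> = \<sigma> / DIM('a)"
  have \<tau>: "\<tau> > 1 / 2" using \<sigma> by (simp add: \<tau>_def field_simps)
  have le: "(1 + (norm x)\<^sup>2) powr (- \<sigma>) \<le> (\<Prod>b\<in>Basis. (1 + (x \<bullet> b)\<^sup>2) powr (- \<tau>))" for x :: 'a
  proof -
    have "(1 + (norm x)\<^sup>2) powr (- \<sigma>) = (\<Prod>b\<in>(Basis::'a set). (1 + (norm x)\<^sup>2) powr (- \<tau>))"
      using add_pos_nonneg[of 1 "(norm x)\<^sup>2"] by (simp add: \<tau>_def powr_power)
    also have "\<dots> \<le> (\<Prod>b\<in>Basis. (1 + (x \<bullet> b)\<^sup>2) powr (- \<tau>))"
    proof (intro prod_mono conjI powr_mono2')
      fix b :: 'a assume "b \<in> Basis"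
      then have "\<bar>x \<bullet> b\<bar> \<le> norm x" by (rule Basis_le_norm)
      then show "1 + (x \<bullet> b)\<^sup>2 \<le> 1 + (norm x)\<^sup>2" by (simp add: abs_le_square_iff[symmetric])
    qed (use \<tau> in \<open>auto intro: add_pos_nonneg\<close>)
    finally show ?thesis .
  qed
  have "(\<integral>\<^sup>+x. ennreal ((1 + (norm (x::'a))\<^sup>2) powr (- \<sigma>)) \<partial>lborel)
      \<le> (\<integral>\<^sup>+x. (\<Prod>b\<in>Basis. ennreal ((1 + ((x::'a) \<bullet> b)\<^sup>2) powr (- \<tau>))) \<partial>lborel)"
    using le by (intro nn_integral_mono) (auto simp: prod_ennreal intro!: ennreal_leI)
  also have "\<dots> = (\<Prod>b\<in>(Basis::'a set). (\<integral>\<^sup>+x. ennreal ((1 + x\<^sup>2) powr (- \<tau>)) \<partial>lborel))"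
    by (rule nn_integral_lborel_prod) auto
  also have "\<dots> < \<infinity>"
    using nn_integral_weight_real[OF \<tau>] by (simp add: power_less_top_ennreal)
  finally show ?thesis
    by (intro integrableI_nonneg) auto
qed

text \<open>The larger of the two norms is at least half the norm of the sum, so the weight at the
  sum is at most \<open>4 powr \<tau>\<close> times the weight at the larger vector.\<close>

lemma weight_subadditive:
  fixes x y :: "'a::real_normed_vector"
  assumes "0 \<le> \<tau>"
  shows "(1 + (norm (x + y))\<^sup>2) powr \<tau> \<le> 4 powr \<tau> * ((1 + (norm x)\<^sup>2) powr \<tau> + (1 + (norm y)\<^sup>2) powr \<tau>)"
proof -
  have *: "(1 + (norm (x + y))\<^sup>2) powr \<tau> \<le> 4 powr \<tau> * (1 + (norm x)\<^sup>2) powr \<tau>" if "norm y \<le> norm x" for x y :: 'a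
  proof -
    have "norm (x + y) \<le> 2 * norm x" using norm_triangle_ineq[of x y] that by simp
    then have "(norm (x + y))\<^sup>2 \<le> (2 * norm x)\<^sup>2" by (intro power_mono) auto
    then have "1 + (norm (x + y))\<^sup>2 \<le> 4 * (1 + (norm x)\<^sup>2)" by (simp add: power_mult_distrib)
    then have "(1 + (norm (x + y))\<^sup>2) powr \<tau> \<le> (4 * (1 + (norm x)\<^sup>2)) powr \<tau>"
      using assms by (intro powr_mono2) auto
    also have "(4 * (1 + (norm x)\<^sup>2)) powr \<tau> = 4 powr \<tau> * (1 + (norm x)\<^sup>2) powr \<tau>"
      by (rule powr_mult)
    finally show ?thesis .
  qed
  have "0 \<le> 4 powr \<tau> * (1 + (norm z)\<^sup>2) powr \<tau>" for z :: 'a by simp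
  then show ?thesis
    using *[of y x] *[of x y] unfolding distrib_left
    by (cases "norm y \<le> norm x") (auto simp: add.commute intro: add_increasing add_increasing2)
qed

text \<open>Young's inequality for one integrable and one square integrable factor: Cauchy-Schwarz
  with respect to the density \<open>g\<close>, exchange of the integrals, translation invariance.
  All integrals take values in \<open>ennreal\<close>, so that finiteness can be settled
  afterwards.\<close>

lemma young_nn_integral:
  fixes f g :: "'a::euclidean_space \<Rightarrow> real"
  assumes [measurable]: "f \<in> borel_measurable borel" "g \<in> borel_measurable borel"
    and nn: "\<And>x. 0 \<le> f x" "\<And>x. 0 \<le> g x"
  shows "(\<integral>\<^sup>+x. (\<integral>\<^sup>+y. ennreal (f (x - y) * g y) \<partial>lborel)\<^sup>2 \<partial>lborel)
    \<le> (\<integral>\<^sup>+x. ennreal (g x) \<partial>lborel)\<^sup>2 * (\<integral>\<^sup>+x. ennreal ((f x)\<^sup>2) \<partial>lborel)"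
proof -
  let ?G = "\<integral>\<^sup>+x. ennreal (g x) \<partial>lborel"
  have cs: "(\<integral>\<^sup>+y. ennreal (f (x - y) * g y) \<partial>lborel)\<^sup>2 \<le> (\<integral>\<^sup>+y. ennreal ((f (x - y))\<^sup>2 * g y) \<partial>lborel) * ?G" for x
  proof -
    have "(\<integral>\<^sup>+y. ennreal (f (x - y) * sqrt (g y)) * ennreal (sqrt (g y)) \<partial>lborel)\<^sup>2
        \<le> (\<integral>\<^sup>+y. (ennreal (f (x - y) * sqrt (g y)))\<^sup>2 \<partial>lborel) * (\<integral>\<^sup>+y. (ennreal (sqrt (g y)))\<^sup>2 \<partial>lborel)"
      by (intro Cauchy_Schwarz_nn_integral) measurable
    moreover have "ennreal (f (x - y) * sqrt (g y)) * ennreal (sqrt (g y)) = ennreal (f (x - y) * g y)" for y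
      using nn by (simp add: ennreal_mult[symmetric] mult.assoc)
    moreover have "(ennreal (f (x - y) * sqrt (g y)))\<^sup>2 = ennreal ((f (x - y))\<^sup>2 * g y)" "(ennreal (sqrt (g y)))\<^sup>2 = ennreal (g y)" for y
      using nn by (simp_all add: ennreal_power power_mult_distrib)
    ultimately show ?thesis by simp
  qed
  have "(\<integral>\<^sup>+x. (\<integral>\<^sup>+y. ennreal (f (x - y) * g y) \<partial>lborel)\<^sup>2 \<partial>lborel)
      \<le> (\<integral>\<^sup>+x. (\<integral>\<^sup>+y. ennreal ((f (x - y))\<^sup>2 * g y) \<partial>lborel) * ?G \<partial>lborel)"
    by (intro nn_integral_mono cs)
  also have "\<dots> = (\<integral>\<^sup>+x. (\<integral>\<^sup>+y. ennreal ((f (x - y))\<^sup>2 * g y) \<partial>lborel) \<partial>lborel) * ?G"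
    by (rule nn_integral_multc) measurable
  also have "(\<integral>\<^sup>+x. (\<integral>\<^sup>+y. ennreal ((f (x - y))\<^sup>2 * g y) \<partial>lborel) \<partial>lborel)
      = (\<integral>\<^sup>+y. (\<integral>\<^sup>+x. ennreal ((f (x - y))\<^sup>2 * g y) \<partial>lborel) \<partial>lborel)"
    by (rule lborel_pair.Fubini') measurable
  also have "\<dots> = (\<integral>\<^sup>+y. (\<integral>\<^sup>+x. ennreal ((f x)\<^sup>2) \<partial>lborel) * ennreal (g y) \<partial>lborel)"
  proof (rule nn_integral_cong)
    fix y
    have "(\<integral>\<^sup>+x. ennreal ((f (x - y))\<^sup>2 * g y) \<partial>lborel) = (\<integral>\<^sup>+x. ennreal ((f (x - y))\<^sup>2) * ennreal (g y) \<partial>lborel)"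
      using nn by (simp add: ennreal_mult)
    also have "\<dots> = (\<integral>\<^sup>+x. ennreal ((f (x - y))\<^sup>2) \<partial>lborel) * ennreal (g y)"
      by (rule nn_integral_multc) measurable
    also have "(\<integral>\<^sup>+x. ennreal ((f (x - y))\<^sup>2) \<partial>lborel) = (\<integral>\<^sup>+x. ennreal ((f x)\<^sup>2) \<partial>lborel)"
      by (rule nn_integral_lborel_shift[where f="\<lambda>x. ennreal ((f x)\<^sup>2)"]) measurable
    finally show "(\<integral>\<^sup>+x. ennreal ((f (x - y))\<^sup>2 * g y) \<partial>lborel) = (\<integral>\<^sup>+x. ennreal ((f x)\<^sup>2) \<partial>lborel) * ennreal (g y)" .
  qed
  also have "\<dots> = (\<integral>\<^sup>+x. ennreal ((f x)\<^sup>2) \<partial>lborel) * ?G"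
    by (rule nn_integral_cmult) measurable
  finally show ?thesis by (simp add: power2_eq_square mult_ac)
qed

text \<open>Reflection exchanges the roles of the factors. The two versions serve the two terms in
  which the weight falls on one factor of a convolution or on the other.\<close>

lemma young_nn_integral':
  fixes f g :: "'a::euclidean_space \<Rightarrow> real"
  assumes [measurable]: "f \<in> borel_measurable borel" "g \<in> borel_measurable borel"
    and nn: "\<And>x. 0 \<le> f x" "\<And>x. 0 \<le> g x"
  shows "(\<integral>\<^sup>+x. (\<integral>\<^sup>+y. ennreal (f (x - y) * g y) \<partial>lborel)\<^sup>2 \<partial>lborel)
    \<le> (\<integral>\<^sup>+x. ennreal (f x) \<partial>lborel)\<^sup>2 * (\<integral>\<^sup>+x. ennreal ((g x)\<^sup>2) \<partial>lborel)"
proof -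
  have "(\<integral>\<^sup>+y. ennreal (f (x - y) * g y) \<partial>lborel) = (\<integral>\<^sup>+y. ennreal (g (x - y) * f y) \<partial>lborel)" for x
    using nn_integral_lborel_reflect[of "\<lambda>y. ennreal (g (x - y) * f y)" x] by (simp add: mult.commute)
  then show ?thesis using young_nn_integral[of g f] nn by simp
qed

section \<open>Fourier transforms of weighted square integrable functions\<close>

definition sobolev_symbol_norm :: "real \<Rightarrow> (real^4 \<Rightarrow> complex) \<Rightarrow> real" where
  "sobolev_symbol_norm \<sigma> h = sqrt (LINT \<xi>|lborel. (1 + (norm \<xi>)\<^sup>2) powr \<sigma> * (norm (h \<xi>))\<^sup>2)"

lemma sobolev_symbol_norm_nonneg: "0 \<le> sobolev_symbol_norm \<sigma> h"
  unfolding sobolev_symbol_norm_def by (intro real_sqrt_ge_zero Bochner_Integration.integral_nonneg) auto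

lemma sobolev_symbol_norm_square:
  "(sobolev_symbol_norm \<sigma> h)\<^sup>2 = (LINT \<xi>|lborel. (1 + (norm \<xi>)\<^sup>2) powr \<sigma> * (norm (h \<xi>))\<^sup>2)"
  unfolding sobolev_symbol_norm_def by (intro real_sqrt_pow2 Bochner_Integration.integral_nonneg) auto

lemma sobolev_symbolD:
  assumes "h \<in> sobolev_symbol \<sigma>"
  shows "h \<in> borel_measurable borel" "integrable lborel (\<lambda>\<xi>. (1 + (norm \<xi>)\<^sup>2) powr \<sigma> * (norm (h \<xi>))\<^sup>2)"
    "(\<integral>\<^sup>+\<xi>. ennreal ((1 + (norm \<xi>)\<^sup>2) powr \<sigma> * (norm (h \<xi>))\<^sup>2) \<partial>lborel) = ennreal ((sobolev_symbol_norm \<sigma> h)\<^sup>2)"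
  using assms unfolding sobolev_symbol_def sobolev_symbol_norm_square
  by (auto intro!: nn_integral_eq_integral)

lemma sobolev_symbolI:
  assumes [measurable]: "h \<in> borel_measurable borel"
    and "(\<integral>\<^sup>+\<xi>. ennreal ((1 + (norm \<xi>)\<^sup>2) powr \<sigma> * (norm (h \<xi>))\<^sup>2) \<partial>lborel) \<le> ennreal (C\<^sup>2)" "0 \<le> C"
  shows "h \<in> sobolev_symbol \<sigma>" "sobolev_symbol_norm \<sigma> h \<le> C"
proof -
  have i: "integrable lborel (\<lambda>\<xi>. (1 + (norm \<xi>)\<^sup>2) powr \<sigma> * (norm (h \<xi>))\<^sup>2)"
    using assms(2) by (intro integrableI_nonneg) (auto intro: le_less_trans)
  then show s: "h \<in> sobolev_symbol \<sigma>" by (simp add: sobolev_symbol_def)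
  have "ennreal ((sobolev_symbol_norm \<sigma> h)\<^sup>2) \<le> ennreal (C\<^sup>2)"
    using assms(2) sobolev_symbolD(3)[OF s] by simp
  then have "(sobolev_symbol_norm \<sigma> h)\<^sup>2 \<le> C\<^sup>2"
    by (simp add: ennreal_le_iff)
  then show "sobolev_symbol_norm \<sigma> h \<le> C" using assms(3) by (rule power2_le_imp_le)
qed

lemma sobolev_symbol_scale:
  assumes "h \<in> sobolev_symbol \<sigma>"
  shows "(\<lambda>\<xi>. r *\<^sub>R h \<xi>) \<in> sobolev_symbol \<sigma>" "sobolev_symbol_norm \<sigma> (\<lambda>\<xi>. r *\<^sub>R h \<xi>) = \<bar>r\<bar> * sobolev_symbol_norm \<sigma> h"
proof -
  have *: "(1 + (norm \<xi>)\<^sup>2) powr \<sigma> * (norm (r *\<^sub>R h \<xi>))\<^sup>2 = r\<^sup>2 * ((1 + (norm \<xi>)\<^sup>2) powr \<sigma> * (norm (h \<xi>))\<^sup>2)" for \<xi>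
    by (simp add: power_mult_distrib)
  show "(\<lambda>\<xi>. r *\<^sub>R h \<xi>) \<in> sobolev_symbol \<sigma>"
    using sobolev_symbolD(1,2)[OF assms] by (auto simp: sobolev_symbol_def * simp del: norm_scaleR)
  show "sobolev_symbol_norm \<sigma> (\<lambda>\<xi>. r *\<^sub>R h \<xi>) = \<bar>r\<bar> * sobolev_symbol_norm \<sigma> h"
    unfolding sobolev_symbol_norm_def * by (simp add: real_sqrt_mult)
qed

lemma sobolev_symbol_zero: "(\<lambda>_. 0) \<in> sobolev_symbol \<sigma>" "sobolev_symbol_norm \<sigma> (\<lambda>_. 0) = 0"
  by (auto simp: sobolev_symbol_def sobolev_symbol_norm_def)

text \<open>Minkowski's inequality in a weighted space, from a pointwise bound whose coefficients
  become optimal as \<open>a\<close> and \<open>b\<close> approach the two norms. Taking them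
  strictly larger keeps them positive when a norm vanishes.\<close>

lemma sobolev_symbol_add:
  assumes h: "h \<in> sobolev_symbol \<sigma>" and k: "k \<in> sobolev_symbol \<sigma>"
  shows "(\<lambda>\<xi>. h \<xi> + k \<xi>) \<in> sobolev_symbol \<sigma>"
    "sobolev_symbol_norm \<sigma> (\<lambda>\<xi>. h \<xi> + k \<xi>) \<le> sobolev_symbol_norm \<sigma> h + sobolev_symbol_norm \<sigma> k"
proof -
  note [measurable] = sobolev_symbolD(1)[OF h] sobolev_symbolD(1)[OF k]
  define w where "w \<xi> = (1 + (norm \<xi>)\<^sup>2) powr \<sigma>" for \<xi> :: "real^4"
  have [measurable]: "w \<in> borel_measurable borel" unfolding w_def by measurable
  have main: "(\<integral>\<^sup>+\<xi>. ennreal (w \<xi> * (norm (h \<xi> + k \<xi>))\<^sup>2) \<partial>lborel) \<le> ennreal ((a + b)\<^sup>2)"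
    if ab: "sobolev_symbol_norm \<sigma> h < a" "sobolev_symbol_norm \<sigma> k < b" for a b
  proof -
    have pos: "0 < a" "0 < b" using ab sobolev_symbol_norm_nonneg le_less_trans by blast+
    have pt: "w \<xi> * (norm (h \<xi> + k \<xi>))\<^sup>2 \<le> (1 + b / a) * (w \<xi> * (norm (h \<xi>))\<^sup>2) + (1 + a / b) * (w \<xi> * (norm (k \<xi>))\<^sup>2)" for \<xi>
    proof -
      define x where "x = norm (h \<xi>)" define y where "y = norm (k \<xi>)"
      have "(norm (h \<xi> + k \<xi>))\<^sup>2 \<le> (x + y)\<^sup>2"
        unfolding x_def y_def by (intro power_mono norm_triangle_ineq) auto
      also have "\<dots> \<le> (1 + b / a) * x\<^sup>2 + (1 + a / b) * y\<^sup>2"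
      proof -
        have "0 \<le> (b * x - a * y)\<^sup>2 / (a * b)" using pos by simp
        also have "\<dots> = b / a * x\<^sup>2 + a / b * y\<^sup>2 - 2 * x * y"
          using pos by (simp add: field_simps power2_eq_square)
        finally show ?thesis by (simp add: power2_sum algebra_simps)
      qed
      finally have "w \<xi> * (norm (h \<xi> + k \<xi>))\<^sup>2 \<le> w \<xi> * ((1 + b / a) * x\<^sup>2 + (1 + a / b) * y\<^sup>2)"
        by (intro mult_left_mono) (auto simp: w_def)
      then show ?thesis by (simp add: x_def y_def algebra_simps)
    qed
    have "(\<integral>\<^sup>+\<xi>. ennreal (w \<xi> * (norm (h \<xi> + k \<xi>))\<^sup>2) \<partial>lborel)
      \<le> (\<integral>\<^sup>+\<xi>. ennreal (1 + b / a) * ennreal (w \<xi> * (norm (h \<xi>))\<^sup>2) + ennreal (1 + a / b) * ennreal (w \<xi> * (norm (k \<xi>))\<^sup>2) \<partial>lborel)"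
      using pt pos by (intro nn_integral_mono) (simp add: ennreal_mult'[symmetric] ennreal_plus[symmetric] w_def del: ennreal_plus)
    also have "\<dots> = ennreal (1 + b / a) * (\<integral>\<^sup>+\<xi>. ennreal (w \<xi> * (norm (h \<xi>))\<^sup>2) \<partial>lborel)
        + ennreal (1 + a / b) * (\<integral>\<^sup>+\<xi>. ennreal (w \<xi> * (norm (k \<xi>))\<^sup>2) \<partial>lborel)"
      by (subst nn_integral_add) (auto simp: nn_integral_cmult)
    also have "\<dots> = ennreal ((1 + b / a) * (sobolev_symbol_norm \<sigma> h)\<^sup>2 + (1 + a / b) * (sobolev_symbol_norm \<sigma> k)\<^sup>2)"
      unfolding w_def sobolev_symbolD(3)[OF h] sobolev_symbolD(3)[OF k]
      using pos by (simp add: ennreal_mult'[symmetric] ennreal_plus[symmetric] del: ennreal_plus)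
    also have "\<dots> \<le> ennreal ((1 + b / a) * a\<^sup>2 + (1 + a / b) * b\<^sup>2)"
      using ab pos sobolev_symbol_norm_nonneg
      by (intro ennreal_leI add_mono mult_left_mono power_mono) auto
    also have "(1 + b / a) * a\<^sup>2 + (1 + a / b) * b\<^sup>2 = (a + b)\<^sup>2"
      using pos by (simp add: field_simps power2_eq_square)
    finally show ?thesis .
  qed
  have *: "(\<lambda>\<xi>. h \<xi> + k \<xi>) \<in> sobolev_symbol \<sigma> \<and> sobolev_symbol_norm \<sigma> (\<lambda>\<xi>. h \<xi> + k \<xi>) \<le> a + b"
    if ab: "sobolev_symbol_norm \<sigma> h < a" "sobolev_symbol_norm \<sigma> k < b" for a b
  proof -
    have "0 \<le> a + b" using ab sobolev_symbol_norm_nonneg[of \<sigma> h] sobolev_symbol_norm_nonneg[of \<sigma> k] by linarith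
    then show ?thesis
      using sobolev_symbolI[of "\<lambda>\<xi>. h \<xi> + k \<xi>" \<sigma> "a + b"] main[OF ab] by (simp add: w_def)
  qed
  show "(\<lambda>\<xi>. h \<xi> + k \<xi>) \<in> sobolev_symbol \<sigma>"
    using *[of "sobolev_symbol_norm \<sigma> h + 1" "sobolev_symbol_norm \<sigma> k + 1"] by simp
  show "sobolev_symbol_norm \<sigma> (\<lambda>\<xi>. h \<xi> + k \<xi>) \<le> sobolev_symbol_norm \<sigma> h + sobolev_symbol_norm \<sigma> k"
  proof (rule field_le_epsilon)
    fix e :: real assume "0 < e"
    then show "sobolev_symbol_norm \<sigma> (\<lambda>\<xi>. h \<xi> + k \<xi>) \<le> sobolev_symbol_norm \<sigma> h + sobolev_symbol_norm \<sigma> k + e"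
      using *[of "sobolev_symbol_norm \<sigma> h + e / 2" "sobolev_symbol_norm \<sigma> k + e / 2"] by simp
  qed
qed

text \<open>The integral of \<open>norm (h \<xi>)\<close> is at most
  \<open>(l * I + N\<^sup>2 / l) / 2\<close>, where \<open>I\<close> is the integral of the
  reciprocal weight and \<open>N\<close> the norm of \<open>h\<close>. With \<open>l = N\<close>
  this is \<open>(I + 1) / 2\<close> times \<open>N\<close>.\<close>

definition embedding_constant :: "real \<Rightarrow> real" where
  "embedding_constant \<sigma> = ((LINT \<xi>|lborel. (1 + (norm (\<xi> :: real^4))\<^sup>2) powr (- \<sigma>)) + 1) / 2"

lemma embedding_constant_pos: "0 < embedding_constant \<sigma>"
proof -
  have "0 \<le> (LINT \<xi>|lborel. (1 + (norm (\<xi> :: real^4))\<^sup>2) powr (- \<sigma>))" by (intro Bochner_Integration.integral_nonneg) auto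
  then show ?thesis unfolding embedding_constant_def by (intro divide_pos_pos add_nonneg_pos) simp_all
qed

lemma sobolev_symbol_integrable:
  assumes \<sigma>: "2 < \<sigma>" and h: "h \<in> sobolev_symbol \<sigma>"
  shows "integrable lborel h" "(LINT \<xi>|lborel. norm (h \<xi>)) \<le> embedding_constant \<sigma> * sobolev_symbol_norm \<sigma> h"
proof -
  note [measurable] = sobolev_symbolD(1)[OF h]
  define u where "u \<xi> = (1 + (norm \<xi>)\<^sup>2) powr (- \<sigma>)" for \<xi> :: "real^4"
  define v where "v \<xi> = (1 + (norm \<xi>)\<^sup>2) powr \<sigma> * (norm (h \<xi>))\<^sup>2" for \<xi> :: "real^4"
  define I where "I = (LINT \<xi>|lborel. u \<xi>)"
  have I: "0 \<le> I" unfolding I_def u_def by (intro Bochner_Integration.integral_nonneg) auto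
  have u: "integrable lborel u" unfolding u_def by (rule integrable_weight) (use \<sigma> in auto)
  have v: "integrable lborel v" unfolding v_def by (rule sobolev_symbolD(2)[OF h])
  have pt: "norm (h \<xi>) \<le> (l * u \<xi> + v \<xi> / l) / 2" if l: "0 < l" for l \<xi>
  proof -
    define W where "W = (1 + (norm \<xi>)\<^sup>2) powr \<sigma>"
    define x where "x = norm (h \<xi>)"
    have "0 < 1 + (norm \<xi>)\<^sup>2" by (intro add_pos_nonneg) auto
    then have W: "0 < W" unfolding W_def by simp
    have uW: "u \<xi> = 1 / W" by (simp add: u_def W_def powr_minus divide_inverse)
    have "0 \<le> (l - W * x)\<^sup>2 / (l * W)" using l W by simp
    also have "\<dots> = l * (1 / W) + W * x\<^sup>2 / l - 2 * x" using l W by (simp add: field_simps power2_eq_square)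
    finally show ?thesis by (simp add: uW v_def W_def[symmetric] x_def[symmetric])
  qed
  have ni: "integrable lborel (\<lambda>\<xi>. (l * u \<xi> + v \<xi> / l) / 2)" for l using u v by auto
  show int: "integrable lborel h"
    by (rule Bochner_Integration.integrable_bound[OF ni[of 1]]) (use pt[of 1] in \<open>auto intro!: AE_I2 order_trans[OF _ abs_ge_self]\<close>)
  have bd: "(LINT \<xi>|lborel. norm (h \<xi>)) \<le> (l * I + (sobolev_symbol_norm \<sigma> h)\<^sup>2 / l) / 2" if l: "0 < l" for l
  proof -
    have "(LINT \<xi>|lborel. norm (h \<xi>)) \<le> (LINT \<xi>|lborel. (l * u \<xi> + v \<xi> / l) / 2)"
      by (intro integral_mono integrable_norm int ni pt l)
    also have "\<dots> = (l * I + (LINT \<xi>|lborel. v \<xi>) / l) / 2"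
      using u v by (simp add: I_def)
    finally show ?thesis by (simp add: sobolev_symbol_norm_square v_def)
  qed
  show "(LINT \<xi>|lborel. norm (h \<xi>)) \<le> embedding_constant \<sigma> * sobolev_symbol_norm \<sigma> h"
  proof (cases "sobolev_symbol_norm \<sigma> h = 0")
    case False
    then have N: "0 < sobolev_symbol_norm \<sigma> h" using sobolev_symbol_norm_nonneg[of \<sigma> h] by simp
    show ?thesis
      using bd[OF N] N by (simp add: embedding_constant_def I_def u_def power2_eq_square algebra_simps)
  next
    case True
    \<comment> \<open>The choice \<open>l = N\<close> is not positive here. The norm term is zero
      for every \<open>l\<close>, so a small positive \<open>l\<close> brings the bound below any
      given \<open>e\<close>.\<close>
    have "(LINT \<xi>|lborel. norm (h \<xi>)) \<le> 0"
    proof (rule field_le_epsilon)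
      fix e :: real assume e: "0 < e"
      have "(LINT \<xi>|lborel. norm (h \<xi>)) \<le> e / (I + 1) * I / 2"
        using bd[of "e / (I + 1)"] e I True by simp
      also have "\<dots> \<le> e * 1"
        using e I by (simp add: field_simps)
      finally show "(LINT \<xi>|lborel. norm (h \<xi>)) \<le> 0 + e" by simp
    qed
    then show ?thesis using True by simp
  qed
qed

lemma fourier_integrable:
  assumes "2 < \<sigma>" "h \<in> sobolev_symbol \<sigma>"
  shows "integrable lborel (\<lambda>\<xi>. cis (x \<bullet> \<xi>) * h \<xi>)"
proof -
  note [measurable] = sobolev_symbolD(1)[OF assms(2)]
  have [measurable]: "(\<lambda>\<xi>. cis (x \<bullet> \<xi>)) \<in> borel_measurable borel"
    by (intro borel_measurable_continuous_onI continuous_intros)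
  show ?thesis
    by (rule Bochner_Integration.integrable_bound[OF sobolev_symbol_integrable(1)[OF assms]]) (auto simp: norm_mult)
qed

lemma fourier_add:
  assumes "2 < \<sigma>" "h \<in> sobolev_symbol \<sigma>" "k \<in> sobolev_symbol \<sigma>"
  shows "fourier (\<lambda>\<xi>. h \<xi> + k \<xi>) x = fourier h x + fourier k x"
  unfolding fourier_def distrib_left
  by (intro Bochner_Integration.integral_add fourier_integrable[OF assms(1)] assms)

lemma fourier_scale: "fourier (\<lambda>\<xi>. r *\<^sub>R h \<xi>) x = r *\<^sub>R fourier h x"
  unfolding fourier_def by (simp add: scaleR_conv_of_real mult.left_commute)

lemma norm_fourier_le:
  assumes "2 < \<sigma>" "h \<in> sobolev_symbol \<sigma>"
  shows "norm (fourier h x) \<le> embedding_constant \<sigma> * sobolev_symbol_norm \<sigma> h"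
proof -
  have "norm (fourier h x) \<le> (LINT \<xi>|lborel. norm (cis (x \<bullet> \<xi>) * h \<xi>))"
    unfolding fourier_def by (rule integral_norm_bound)
  also have "\<dots> = (LINT \<xi>|lborel. norm (h \<xi>))"
    by (simp add: norm_mult)
  finally show ?thesis using sobolev_symbol_integrable(2)[OF assms] by simp
qed

text \<open>A member of \<open>sobolev_fun\<close> is prescribed on a set only; the transform of a
  symbol is a measurable function on the whole space that agrees with it there, and it is this
  function that gets integrated.\<close>

lemma fourier_measurable:
  assumes "h \<in> sobolev_symbol \<sigma>"
  shows "fourier h \<in> borel_measurable borel"
proof -
  note [measurable] = sobolev_symbolD(1)[OF assms]
  have "(\<lambda>p. cis (fst p \<bullet> snd p)) \<in> borel_measurable (borel :: ((real^4) \<times> (real^4)) measure)"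
    by (intro borel_measurable_continuous_onI continuous_intros)
  moreover have s: "sets ((borel :: (real^4) measure) \<Otimes>\<^sub>M (lborel :: (real^4) measure)) = sets borel"
    by (subst borel_prod[symmetric]) (rule sets_pair_measure_cong; simp)
  ultimately have [measurable]: "(\<lambda>p. cis (fst p \<bullet> snd p)) \<in> borel_measurable ((borel :: (real^4) measure) \<Otimes>\<^sub>M lborel)"
    unfolding measurable_cong_sets[OF s refl] by blast
  have "(\<lambda>x. LINT \<xi>|lborel. cis (fst (x, \<xi>) \<bullet> snd (x, \<xi>)) * h \<xi>) \<in> borel_measurable borel"
    by (intro lborel.borel_measurable_lebesgue_integral) (simp add: split_beta')
  then show ?thesis by (simp add: fourier_def[abs_def])
qed

section \<open>Convolution of symbols and the algebra property\<close>

definition convolution :: "('a::euclidean_space \<Rightarrow> complex) \<Rightarrow> ('a \<Rightarrow> complex) \<Rightarrow> 'a \<Rightarrow> complex" where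
  "convolution h k x = (LINT y|lborel. h (x - y) * k y)"

lemma convolution_measurable:
  fixes h k :: "'a::euclidean_space \<Rightarrow> complex"
  assumes [measurable]: "h \<in> borel_measurable borel" "k \<in> borel_measurable borel"
  shows "convolution h k \<in> borel_measurable borel"
proof -
  have "(\<lambda>x. LINT y|lborel. h (x - y) * k y) \<in> borel_measurable borel"
    by (intro lborel.borel_measurable_lebesgue_integral) measurable
  then show ?thesis by (simp add: convolution_def[abs_def])
qed

lemma integral_convolution:
  fixes h k :: "'a::euclidean_space \<Rightarrow> complex"
  assumes h: "integrable lborel h" and k: "integrable lborel k"
  shows "(LINT x|lborel. convolution h k x) = (LINT x|lborel. h x) * (LINT x|lborel. k x)"
proof -
  have [measurable]: "h \<in> borel_measurable borel" "k \<in> borel_measurable borel"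
    using h k by (auto dest: borel_measurable_integrable)
  have nn: "(\<integral>\<^sup>+x. norm (h (x - y) * k y) \<partial>lborel) = (\<integral>\<^sup>+x. norm (h x) \<partial>lborel) * norm (k y)" for y
  proof -
    have "(\<integral>\<^sup>+x. norm (h (x - y) * k y) \<partial>lborel) = (\<integral>\<^sup>+x. ennreal (norm (h (x - y))) * ennreal (norm (k y)) \<partial>lborel)"
      by (simp add: norm_mult ennreal_mult)
    also have "\<dots> = (\<integral>\<^sup>+x. norm (h (x - y)) \<partial>lborel) * norm (k y)"
      by (rule nn_integral_multc) measurable
    also have "(\<integral>\<^sup>+x. norm (h (x - y)) \<partial>lborel) = (\<integral>\<^sup>+x. norm (h x) \<partial>lborel)"
      by (rule nn_integral_lborel_shift[where f="\<lambda>x. ennreal (norm (h x))"]) measurable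
    finally show ?thesis .
  qed
  have int: "integrable (lborel \<Otimes>\<^sub>M lborel) (\<lambda>(x, y). h (x - y) * k y)"
  proof (rule integrableI_bounded)
    have "(\<integral>\<^sup>+z. ennreal (norm (case z of (x, y) \<Rightarrow> h (x - y) * k y)) \<partial>(lborel \<Otimes>\<^sub>M lborel))
        = (\<integral>\<^sup>+y. (\<integral>\<^sup>+x. norm (h (x - y) * k y) \<partial>lborel) \<partial>lborel)"
      by (subst lborel_pair.nn_integral_snd[symmetric]) auto
    also have "\<dots> = (\<integral>\<^sup>+x. norm (h x) \<partial>lborel) * (\<integral>\<^sup>+y. norm (k y) \<partial>lborel)"
      unfolding nn by (rule nn_integral_cmult) measurable
    also have "\<dots> < \<infinity>"
      using h k by (simp add: integrable_iff_bounded ennreal_mult_less_top)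
    finally show "(\<integral>\<^sup>+z. ennreal (norm (case z of (x, y) \<Rightarrow> h (x - y) * k y)) \<partial>(lborel \<Otimes>\<^sub>M lborel)) < \<infinity>" .
  qed measurable
  have "(LINT x|lborel. convolution h k x) = (LINT y|lborel. LINT x|lborel. h (x - y) * k y)"
    unfolding convolution_def using lborel_pair.Fubini_integral[OF int] by simp
  also have "\<dots> = (LINT y|lborel. (LINT x|lborel. h x) * k y)"
  proof (rule Bochner_Integration.integral_cong)
    show "(LINT x|lborel. h (x - y) * k y) = (LINT x|lborel. h x) * k y" for y
      using integral_lborel_shift[of h y] by simp
  qed simp
  also have "\<dots> = (LINT x|lborel. h x) * (LINT x|lborel. k x)" by simp
  finally show ?thesis .
qed

text \<open>Characters are multiplicative, so a character can be distributed over the two factors of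
  a convolution, whose integral is the product of the integrals. With the normalisation of
  \<open>fourier\<close> no constant appears.\<close>

lemma fourier_convolution:
  assumes "2 < \<sigma>" "h \<in> sobolev_symbol \<sigma>" "k \<in> sobolev_symbol \<sigma>"
  shows "fourier (convolution h k) x = fourier h x * fourier k x"
proof -
  have "cis (x \<bullet> \<xi>) * convolution h k \<xi> = convolution (\<lambda>\<xi>. cis (x \<bullet> \<xi>) * h \<xi>) (\<lambda>\<xi>. cis (x \<bullet> \<xi>) * k \<xi>) \<xi>" for \<xi>
  proof -
    have "cis (x \<bullet> \<xi>) * (h (\<xi> - \<eta>) * k \<eta>) = cis (x \<bullet> (\<xi> - \<eta>)) * h (\<xi> - \<eta>) * (cis (x \<bullet> \<eta>) * k \<eta>)" for \<eta>
    proof -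
      have "cis (x \<bullet> \<xi>) = cis (x \<bullet> (\<xi> - \<eta>)) * cis (x \<bullet> \<eta>)"
        by (simp add: cis_mult inner_diff_right)
      then show ?thesis by (simp only: mult_ac)
    qed
    then have "(LINT \<eta>|lborel. cis (x \<bullet> \<xi>) * (h (\<xi> - \<eta>) * k \<eta>))
        = (LINT \<eta>|lborel. cis (x \<bullet> (\<xi> - \<eta>)) * h (\<xi> - \<eta>) * (cis (x \<bullet> \<eta>) * k \<eta>))"
      by (simp only:)
    then show ?thesis by (simp add: convolution_def)
  qed
  then have "fourier (convolution h k) x
      = (LINT \<xi>|lborel. convolution (\<lambda>\<xi>. cis (x \<bullet> \<xi>) * h \<xi>) (\<lambda>\<xi>. cis (x \<bullet> \<xi>) * k \<xi>) \<xi>)"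
    by (simp add: fourier_def)
  also have "\<dots> = fourier h x * fourier k x"
    unfolding fourier_def
    by (rule integral_convolution[OF fourier_integrable[OF assms(1,2)] fourier_integrable[OF assms(1,3)]])
  finally show ?thesis .
qed

text \<open>\<open>4 powr (\<sigma> / 2)\<close> comes from the subadditivity of the square root of
  the weight, the embedding constant from Young's inequality. The 2 is the root of 4: there are two
  terms, and squaring their sum costs another factor 2.\<close>

definition algebra_constant :: "real \<Rightarrow> real" where
  "algebra_constant \<sigma> = 2 * 4 powr (\<sigma> / 2) * embedding_constant \<sigma>"

lemma algebra_constant_pos: "0 < algebra_constant \<sigma>"
  by (simp add: algebra_constant_def embedding_constant_pos)

lemma sobolev_symbol_convolution:
  assumes \<sigma>: "2 < \<sigma>" and h: "h \<in> sobolev_symbol \<sigma>" and k: "k \<in> sobolev_symbol \<sigma>"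
  shows "convolution h k \<in> sobolev_symbol \<sigma>"
    "sobolev_symbol_norm \<sigma> (convolution h k) \<le> algebra_constant \<sigma> * sobolev_symbol_norm \<sigma> h * sobolev_symbol_norm \<sigma> k"
proof -
  note [measurable] = sobolev_symbolD(1)[OF h] sobolev_symbolD(1)[OF k]
  define w where "w \<xi> = (1 + (norm \<xi>)\<^sup>2) powr (\<sigma> / 2)" for \<xi> :: "real^4"
  have [measurable]: "w \<in> borel_measurable borel" unfolding w_def by measurable
  have w0: "0 \<le> w \<xi>" for \<xi> by (simp add: w_def)
  have w2: "(w \<xi> * norm z)\<^sup>2 = (1 + (norm \<xi>)\<^sup>2) powr \<sigma> * (norm z)\<^sup>2" for \<xi> and z :: complex
  proof -
    have "1 + (norm \<xi>)\<^sup>2 \<noteq> 0" using zero_le_power2[of "norm \<xi>"] by linarith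
    then have "(w \<xi>)\<^sup>2 = (1 + (norm \<xi>)\<^sup>2) powr \<sigma>" by (simp add: w_def powr_power)
    then show ?thesis by (simp add: power_mult_distrib)
  qed
  define c where "c = 4 powr (\<sigma> / 2)"
  have c: "0 \<le> c" by (simp add: c_def)
  define a where "a \<xi> = norm (h \<xi>)" for \<xi>
  define b where "b \<xi> = norm (k \<xi>)" for \<xi>
  define A where "A \<xi> = w \<xi> * a \<xi>" for \<xi>
  define B where "B \<xi> = w \<xi> * b \<xi>" for \<xi>
  have [measurable]: "a \<in> borel_measurable borel" "b \<in> borel_measurable borel"
    "A \<in> borel_measurable borel" "B \<in> borel_measurable borel"
    unfolding a_def b_def A_def B_def by measurable
  have nn: "0 \<le> a \<xi>" "0 \<le> b \<xi>" "0 \<le> A \<xi>" "0 \<le> B \<xi>" for \<xi>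
    using w0 by (auto simp: a_def b_def A_def B_def)
  define K where "K = embedding_constant \<sigma>"
  define Nh where "Nh = sobolev_symbol_norm \<sigma> h" define Nk where "Nk = sobolev_symbol_norm \<sigma> k"
  have pos: "0 < K" "0 \<le> Nh" "0 \<le> Nk"
    by (auto simp: K_def Nh_def Nk_def embedding_constant_pos sobolev_symbol_norm_nonneg)
  have KN: "0 \<le> K * Nk" "0 \<le> K * Nh" using pos by simp_all
  have intA: "(\<integral>\<^sup>+\<xi>. ennreal ((A \<xi>)\<^sup>2) \<partial>lborel) = ennreal (Nh\<^sup>2)"
    unfolding A_def a_def w2 Nh_def by (rule sobolev_symbolD(3)[OF h])
  have intB: "(\<integral>\<^sup>+\<xi>. ennreal ((B \<xi>)\<^sup>2) \<partial>lborel) = ennreal (Nk\<^sup>2)"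
    unfolding B_def b_def w2 Nk_def by (rule sobolev_symbolD(3)[OF k])
  have inta: "(\<integral>\<^sup>+\<xi>. ennreal (a \<xi>) \<partial>lborel) \<le> ennreal (K * Nh)"
    unfolding a_def K_def Nh_def using sobolev_symbol_integrable[OF \<sigma> h]
    by (subst nn_integral_eq_integral) (auto intro: ennreal_leI)
  have intb: "(\<integral>\<^sup>+\<xi>. ennreal (b \<xi>) \<partial>lborel) \<le> ennreal (K * Nk)"
    unfolding b_def K_def Nk_def using sobolev_symbol_integrable[OF \<sigma> k]
    by (subst nn_integral_eq_integral) (auto intro: ennreal_leI)
  \<comment> \<open>The weight of the sum of two frequencies is distributed over the summands: in
    \<open>P\<close> the factor \<open>h\<close> carries it, in \<open>R\<close> the factor
    \<open>k\<close>, and the other factor is measured by its integral.\<close>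
  define P where "P \<xi> = (\<integral>\<^sup>+\<eta>. ennreal (A (\<xi> - \<eta>) * b \<eta>) \<partial>lborel)" for \<xi>
  define R where "R \<xi> = (\<integral>\<^sup>+\<eta>. ennreal (a (\<xi> - \<eta>) * B \<eta>) \<partial>lborel)" for \<xi>
  have [measurable]: "P \<in> borel_measurable borel" "R \<in> borel_measurable borel"
    unfolding P_def R_def by measurable
  have pt: "ennreal (w \<xi> * norm (convolution h k \<xi>)) \<le> ennreal c * (P \<xi> + R \<xi>)" for \<xi>
  proof -
    \<comment> \<open>Where the convolution integral does not exist its value is 0, and the estimate
      holds as well.\<close>
    have "ennreal (norm (convolution h k \<xi>)) \<le> (\<integral>\<^sup>+\<eta>. norm (h (\<xi> - \<eta>) * k \<eta>) \<partial>lborel)"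
      unfolding convolution_def
      by (cases "integrable lborel (\<lambda>\<eta>. h (\<xi> - \<eta>) * k \<eta>)")
        (auto intro: integral_norm_bound_ennreal simp: not_integrable_integral_eq)
    then have "ennreal (w \<xi> * norm (convolution h k \<xi>)) \<le> ennreal (w \<xi>) * (\<integral>\<^sup>+\<eta>. norm (h (\<xi> - \<eta>) * k \<eta>) \<partial>lborel)"
      using w0 by (simp add: ennreal_mult mult_left_mono)
    also have "\<dots> = (\<integral>\<^sup>+\<eta>. ennreal (w \<xi>) * ennreal (norm (h (\<xi> - \<eta>) * k \<eta>)) \<partial>lborel)"
      by (rule nn_integral_cmult[symmetric]) measurable
    also have "\<dots> \<le> (\<integral>\<^sup>+\<eta>. ennreal c * (ennreal (A (\<xi> - \<eta>) * b \<eta>) + ennreal (a (\<xi> - \<eta>) * B \<eta>)) \<partial>lborel)"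
    proof (rule nn_integral_mono)
      fix \<eta>
      have "w \<xi> \<le> c * (w (\<xi> - \<eta>) + w \<eta>)"
        using weight_subadditive[of "\<sigma> / 2" "\<xi> - \<eta>" \<eta>] \<sigma> by (simp add: w_def c_def)
      then have "w \<xi> * (a (\<xi> - \<eta>) * b \<eta>) \<le> (c * (w (\<xi> - \<eta>) + w \<eta>)) * (a (\<xi> - \<eta>) * b \<eta>)"
        using nn by (intro mult_right_mono) auto
      also have "\<dots> = c * (A (\<xi> - \<eta>) * b \<eta> + a (\<xi> - \<eta>) * B \<eta>)"
        by (simp add: A_def B_def algebra_simps)
      finally show "ennreal (w \<xi>) * ennreal (norm (h (\<xi> - \<eta>) * k \<eta>))
          \<le> ennreal c * (ennreal (A (\<xi> - \<eta>) * b \<eta>) + ennreal (a (\<xi> - \<eta>) * B \<eta>))"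
        using nn w0 c by (simp add: ennreal_mult[symmetric] ennreal_plus[symmetric] norm_mult a_def b_def del: ennreal_plus)
    qed
    also have "\<dots> = ennreal c * (P \<xi> + R \<xi>)"
      unfolding P_def R_def by (subst nn_integral_cmult) (auto simp: nn_integral_add)
    finally show ?thesis .
  qed
  have sq: "(x + y)\<^sup>2 \<le> 2 * (x\<^sup>2 + y\<^sup>2)" for x y :: ennreal
  proof -
    have "2 * x * y = x * y + x * y" unfolding mult.assoc by (rule mult_2)
    then have "(x + y)\<^sup>2 = x\<^sup>2 + y\<^sup>2 + 2 * x * y"
      by (simp only: power2_eq_square distrib_left distrib_right ac_simps)
    also have "\<dots> \<le> x\<^sup>2 + y\<^sup>2 + (x\<^sup>2 + y\<^sup>2)" by (intro add_left_mono sum_of_squares_ge_ennreal)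
    also have "\<dots> = 2 * (x\<^sup>2 + y\<^sup>2)" by (rule mult_2[symmetric])
    finally show ?thesis .
  qed
  have "(\<integral>\<^sup>+\<xi>. ennreal ((1 + (norm \<xi>)\<^sup>2) powr \<sigma> * (norm (convolution h k \<xi>))\<^sup>2) \<partial>lborel)
      \<le> (\<integral>\<^sup>+\<xi>. ennreal (2 * c\<^sup>2) * ((P \<xi>)\<^sup>2 + (R \<xi>)\<^sup>2) \<partial>lborel)"
  proof (rule nn_integral_mono)
    fix \<xi>
    have "ennreal ((1 + (norm \<xi>)\<^sup>2) powr \<sigma> * (norm (convolution h k \<xi>))\<^sup>2) = (ennreal (w \<xi> * norm (convolution h k \<xi>)))\<^sup>2"
      using w0 by (simp add: w2[symmetric] ennreal_power)
    also have "\<dots> \<le> (ennreal c * (P \<xi> + R \<xi>))\<^sup>2" by (intro power_mono pt) auto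
    also have "\<dots> = ennreal (c\<^sup>2) * (P \<xi> + R \<xi>)\<^sup>2" using c by (simp add: power_mult_distrib ennreal_power)
    also have "\<dots> \<le> ennreal (c\<^sup>2) * (2 * ((P \<xi>)\<^sup>2 + (R \<xi>)\<^sup>2))" by (intro mult_left_mono sq) auto
    also have "\<dots> = ennreal (2 * c\<^sup>2) * ((P \<xi>)\<^sup>2 + (R \<xi>)\<^sup>2)"
    proof -
      have "ennreal (2 * c\<^sup>2) = ennreal (c\<^sup>2) * 2" by (simp add: ennreal_mult mult.commute)
      then show ?thesis by (simp only: mult.assoc)
    qed
    finally show "ennreal ((1 + (norm \<xi>)\<^sup>2) powr \<sigma> * (norm (convolution h k \<xi>))\<^sup>2) \<le> ennreal (2 * c\<^sup>2) * ((P \<xi>)\<^sup>2 + (R \<xi>)\<^sup>2)" .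
  qed
  also have "\<dots> = ennreal (2 * c\<^sup>2) * ((\<integral>\<^sup>+\<xi>. (P \<xi>)\<^sup>2 \<partial>lborel) + (\<integral>\<^sup>+\<xi>. (R \<xi>)\<^sup>2 \<partial>lborel))"
    by (subst nn_integral_cmult) (auto simp: nn_integral_add)
  also have "\<dots> \<le> ennreal (2 * c\<^sup>2) * (ennreal ((K * Nk)\<^sup>2 * Nh\<^sup>2) + ennreal ((K * Nh)\<^sup>2 * Nk\<^sup>2))"
  proof (intro mult_left_mono add_mono)
    have "(\<integral>\<^sup>+\<xi>. (P \<xi>)\<^sup>2 \<partial>lborel) \<le> (\<integral>\<^sup>+x. ennreal (b x) \<partial>lborel)\<^sup>2 * (\<integral>\<^sup>+x. ennreal ((A x)\<^sup>2) \<partial>lborel)"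
      unfolding P_def using nn by (intro young_nn_integral) measurable
    also have "\<dots> \<le> (ennreal (K * Nk))\<^sup>2 * ennreal (Nh\<^sup>2)"
      unfolding intA by (intro mult_right_mono power_mono intb) auto
    finally show "(\<integral>\<^sup>+\<xi>. (P \<xi>)\<^sup>2 \<partial>lborel) \<le> ennreal ((K * Nk)\<^sup>2 * Nh\<^sup>2)"
      by (simp only: ennreal_power[OF KN(1)] ennreal_mult'[OF zero_le_power2])
    have "(\<integral>\<^sup>+\<xi>. (R \<xi>)\<^sup>2 \<partial>lborel) \<le> (\<integral>\<^sup>+x. ennreal (a x) \<partial>lborel)\<^sup>2 * (\<integral>\<^sup>+x. ennreal ((B x)\<^sup>2) \<partial>lborel)"
      unfolding R_def using nn by (intro young_nn_integral') measurable
    also have "\<dots> \<le> (ennreal (K * Nh))\<^sup>2 * ennreal (Nk\<^sup>2)"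
      unfolding intB by (intro mult_right_mono power_mono inta) auto
    finally show "(\<integral>\<^sup>+\<xi>. (R \<xi>)\<^sup>2 \<partial>lborel) \<le> ennreal ((K * Nh)\<^sup>2 * Nk\<^sup>2)"
      by (simp only: ennreal_power[OF KN(2)] ennreal_mult'[OF zero_le_power2])
  qed auto
  also have "\<dots> = ennreal ((algebra_constant \<sigma> * Nh * Nk)\<^sup>2)"
  proof -
    have "2 * c\<^sup>2 * ((K * Nk)\<^sup>2 * Nh\<^sup>2 + (K * Nh)\<^sup>2 * Nk\<^sup>2) = (algebra_constant \<sigma> * Nh * Nk)\<^sup>2"
      by (simp add: algebra_constant_def c_def K_def power_mult_distrib algebra_simps)
    then show ?thesis by (simp add: ennreal_mult'[symmetric] ennreal_plus[symmetric] del: ennreal_plus)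
  qed
  finally have main: "(\<integral>\<^sup>+\<xi>. ennreal ((1 + (norm \<xi>)\<^sup>2) powr \<sigma> * (norm (convolution h k \<xi>))\<^sup>2) \<partial>lborel)
    \<le> ennreal ((algebra_constant \<sigma> * Nh * Nk)\<^sup>2)" .
  have "0 \<le> algebra_constant \<sigma> * Nh * Nk"
    using algebra_constant_pos[of \<sigma>] pos by simp
  from sobolev_symbolI[OF convolution_measurable main this]
  show "convolution h k \<in> sobolev_symbol \<sigma>"
    "sobolev_symbol_norm \<sigma> (convolution h k) \<le> algebra_constant \<sigma> * sobolev_symbol_norm \<sigma> h * sobolev_symbol_norm \<sigma> k"
    by (simp_all add: Nh_def Nk_def)
qed

section \<open>Sobolev functions on subsets\<close>

definition extensions :: "real \<Rightarrow> (real^4) set \<Rightarrow> (real^4 \<Rightarrow> complex) \<Rightarrow> (real^4 \<Rightarrow> complex) set" where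
  "extensions \<sigma> V f = {h \<in> sobolev_symbol \<sigma>. \<forall>x\<in>V. f x = fourier h x}"

lemma sobolev_fun_iff: "f \<in> sobolev_fun \<sigma> V \<longleftrightarrow> extensions \<sigma> V f \<noteq> {}"
  by (auto simp: sobolev_fun_def extensions_def)

lemma sobolev_fun_norm_eq: "sobolev_fun_norm \<sigma> V f = Inf (sobolev_symbol_norm \<sigma> ` extensions \<sigma> V f)"
  unfolding sobolev_fun_norm_def extensions_def sobolev_symbol_norm_def
  by (rule arg_cong[where f=Inf]) auto

lemma sobolev_fun_norm_le: "h \<in> extensions \<sigma> V f \<Longrightarrow> sobolev_fun_norm \<sigma> V f \<le> sobolev_symbol_norm \<sigma> h"
  unfolding sobolev_fun_norm_eq
  by (intro cInf_lower imageI) (auto intro!: bdd_belowI2[of _ 0] sobolev_symbol_norm_nonneg)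

lemma sobolev_fun_norm_nonneg:
  assumes "f \<in> sobolev_fun \<sigma> V" shows "0 \<le> sobolev_fun_norm \<sigma> V f"
  using assms unfolding sobolev_fun_norm_eq sobolev_fun_iff
  by (intro cInf_greatest) (auto simp: sobolev_symbol_norm_nonneg)

lemma sobolev_fun_approx:
  assumes "f \<in> sobolev_fun \<sigma> V" "0 < \<epsilon>"
  obtains h where "h \<in> extensions \<sigma> V f" "sobolev_symbol_norm \<sigma> h < sobolev_fun_norm \<sigma> V f + \<epsilon>"
proof -
  have "sobolev_symbol_norm \<sigma> ` extensions \<sigma> V f \<noteq> {}" using assms(1) by (simp add: sobolev_fun_iff)
  then have "\<exists>x\<in>sobolev_symbol_norm \<sigma> ` extensions \<sigma> V f. x < sobolev_fun_norm \<sigma> V f + \<epsilon>"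
    unfolding sobolev_fun_norm_eq using assms(2)
    by (subst cInf_less_iff[symmetric]) (auto intro!: bdd_belowI2[of _ 0] sobolev_symbol_norm_nonneg)
  then show ?thesis using that by blast
qed

lemma sobolev_fun_cong: "(\<And>x. x \<in> V \<Longrightarrow> f x = g x) \<Longrightarrow> f \<in> sobolev_fun \<sigma> V \<longleftrightarrow> g \<in> sobolev_fun \<sigma> V"
  by (auto simp: sobolev_fun_def)

lemma sobolev_fun_add:
  assumes \<sigma>: "2 < \<sigma>" and f: "f \<in> sobolev_fun \<sigma> V" and g: "g \<in> sobolev_fun \<sigma> V"
  shows "(\<lambda>x. f x + g x) \<in> sobolev_fun \<sigma> V"
    "sobolev_fun_norm \<sigma> V (\<lambda>x. f x + g x) \<le> sobolev_fun_norm \<sigma> V f + sobolev_fun_norm \<sigma> V g"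
proof -
  have *: "(\<lambda>\<xi>. h \<xi> + k \<xi>) \<in> extensions \<sigma> V (\<lambda>x. f x + g x)" if "h \<in> extensions \<sigma> V f" "k \<in> extensions \<sigma> V g" for h k
    using that sobolev_symbol_add(1)[of h \<sigma> k] by (auto simp: extensions_def fourier_add[OF \<sigma>])
  show "(\<lambda>x. f x + g x) \<in> sobolev_fun \<sigma> V"
    using f g * unfolding sobolev_fun_iff by blast
  show "sobolev_fun_norm \<sigma> V (\<lambda>x. f x + g x) \<le> sobolev_fun_norm \<sigma> V f + sobolev_fun_norm \<sigma> V g"
  proof (rule field_le_epsilon)
    fix e :: real assume "0 < e"
    then have e: "0 < e / 2" by simp
    obtain h where h: "h \<in> extensions \<sigma> V f" "sobolev_symbol_norm \<sigma> h < sobolev_fun_norm \<sigma> V f + e / 2"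
      by (rule sobolev_fun_approx[OF f e])
    obtain k where k: "k \<in> extensions \<sigma> V g" "sobolev_symbol_norm \<sigma> k < sobolev_fun_norm \<sigma> V g + e / 2"
      by (rule sobolev_fun_approx[OF g e])
    have "sobolev_symbol_norm \<sigma> (\<lambda>\<xi>. h \<xi> + k \<xi>) \<le> sobolev_symbol_norm \<sigma> h + sobolev_symbol_norm \<sigma> k"
      using h k by (intro sobolev_symbol_add) (auto simp: extensions_def)
    then show "sobolev_fun_norm \<sigma> V (\<lambda>x. f x + g x) \<le> sobolev_fun_norm \<sigma> V f + sobolev_fun_norm \<sigma> V g + e"
      using sobolev_fun_norm_le[OF *[OF h(1) k(1)]] h(2) k(2) by linarith
  qed
qed

lemma sobolev_fun_zero: "(\<lambda>_. 0) \<in> sobolev_fun \<sigma> V" "sobolev_fun_norm \<sigma> V (\<lambda>_. 0) = 0"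
proof -
  have *: "(\<lambda>_. 0) \<in> extensions \<sigma> V (\<lambda>_. 0)"
    using sobolev_symbol_zero(1) by (simp add: extensions_def fourier_def)
  then show **: "(\<lambda>_. 0) \<in> sobolev_fun \<sigma> V" by (auto simp: sobolev_fun_iff)
  show "sobolev_fun_norm \<sigma> V (\<lambda>_. 0) = 0"
    using sobolev_fun_norm_le[OF *] sobolev_fun_norm_nonneg[OF **] by (simp add: sobolev_symbol_zero)
qed

lemma sobolev_fun_scale:
  assumes "f \<in> sobolev_fun \<sigma> V"
  shows "(\<lambda>x. r *\<^sub>R f x) \<in> sobolev_fun \<sigma> V" "sobolev_fun_norm \<sigma> V (\<lambda>x. r *\<^sub>R f x) = \<bar>r\<bar> * sobolev_fun_norm \<sigma> V f"
proof -
  have *: "(\<lambda>\<xi>. r *\<^sub>R h \<xi>) \<in> extensions \<sigma> V (\<lambda>x. r *\<^sub>R f x)" if "h \<in> extensions \<sigma> V f" for h r and f :: "real^4 \<Rightarrow> complex"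
    using that sobolev_symbol_scale(1)[of h \<sigma> r] by (simp add: extensions_def fourier_scale)
  have mem: "(\<lambda>x. r *\<^sub>R f x) \<in> sobolev_fun \<sigma> V" if "f \<in> sobolev_fun \<sigma> V" for r and f :: "real^4 \<Rightarrow> complex"
    using that * unfolding sobolev_fun_iff by blast
  then show "(\<lambda>x. r *\<^sub>R f x) \<in> sobolev_fun \<sigma> V" using assms .
  have le: "sobolev_fun_norm \<sigma> V (\<lambda>x. r *\<^sub>R f x) \<le> \<bar>r\<bar> * sobolev_fun_norm \<sigma> V f"
    if f: "f \<in> sobolev_fun \<sigma> V" for r and f :: "real^4 \<Rightarrow> complex"
  proof (rule field_le_epsilon)
    fix e :: real assume e: "0 < e"
    then have "0 < e / (\<bar>r\<bar> + 1)" by simp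
    then obtain h where h: "h \<in> extensions \<sigma> V f" "sobolev_symbol_norm \<sigma> h < sobolev_fun_norm \<sigma> V f + e / (\<bar>r\<bar> + 1)"
      by (rule sobolev_fun_approx[OF f])
    have "sobolev_fun_norm \<sigma> V (\<lambda>x. r *\<^sub>R f x) \<le> \<bar>r\<bar> * sobolev_symbol_norm \<sigma> h"
      using sobolev_fun_norm_le[OF *[OF h(1)], of r] sobolev_symbol_scale(2)[of h \<sigma> r] h(1) by (simp add: extensions_def)
    also have "\<dots> \<le> \<bar>r\<bar> * (sobolev_fun_norm \<sigma> V f + e / (\<bar>r\<bar> + 1))" using h(2) by (intro mult_left_mono) auto
    also have "\<dots> \<le> \<bar>r\<bar> * sobolev_fun_norm \<sigma> V f + e"
      using e by (simp add: field_simps)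
    finally show "sobolev_fun_norm \<sigma> V (\<lambda>x. r *\<^sub>R f x) \<le> \<bar>r\<bar> * sobolev_fun_norm \<sigma> V f + e" .
  qed
  show "sobolev_fun_norm \<sigma> V (\<lambda>x. r *\<^sub>R f x) = \<bar>r\<bar> * sobolev_fun_norm \<sigma> V f"
  proof (cases "r = 0")
    case True
    then show ?thesis using sobolev_fun_zero(2)[of \<sigma> V] by simp
  next
    case False
    \<comment> \<open>The inequality for the factor \<open>1 / r\<close>, applied to the scaled
      function, is the reverse inequality for \<open>r\<close>.\<close>
    have "sobolev_fun_norm \<sigma> V (\<lambda>x. (1 / r) *\<^sub>R (r *\<^sub>R f x)) \<le> \<bar>1 / r\<bar> * sobolev_fun_norm \<sigma> V (\<lambda>x. r *\<^sub>R f x)"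
      by (rule le[OF mem[OF assms]])
    then have "\<bar>r\<bar> * sobolev_fun_norm \<sigma> V f \<le> sobolev_fun_norm \<sigma> V (\<lambda>x. r *\<^sub>R f x)"
      using False by (simp add: field_simps)
    with le[OF assms, of r] show ?thesis by simp
  qed
qed

lemma sobolev_fun_bound:
  assumes \<sigma>: "2 < \<sigma>" and f: "f \<in> sobolev_fun \<sigma> V" and x: "x \<in> V"
  shows "norm (f x) \<le> embedding_constant \<sigma> * sobolev_fun_norm \<sigma> V f"
proof (rule field_le_epsilon)
  fix e :: real assume e: "0 < e"
  note K = embedding_constant_pos[of \<sigma>]
  have "0 < e / embedding_constant \<sigma>" using e K by simp
  then obtain h where h: "h \<in> extensions \<sigma> V f" "sobolev_symbol_norm \<sigma> h < sobolev_fun_norm \<sigma> V f + e / embedding_constant \<sigma>"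
    by (rule sobolev_fun_approx[OF f])
  have "norm (f x) \<le> embedding_constant \<sigma> * sobolev_symbol_norm \<sigma> h"
    using norm_fourier_le[OF \<sigma>, of h x] h(1) x by (simp add: extensions_def)
  also have "\<dots> \<le> embedding_constant \<sigma> * (sobolev_fun_norm \<sigma> V f + e / embedding_constant \<sigma>)"
    using h(2) K by (intro mult_left_mono) auto
  also have "\<dots> = embedding_constant \<sigma> * sobolev_fun_norm \<sigma> V f + e" using K by (simp add: field_simps)
  finally show "norm (f x) \<le> embedding_constant \<sigma> * sobolev_fun_norm \<sigma> V f + e" .
qed

text \<open>The convolution of two symbols extends the product of the functions. The infimum in the
  norm may not be attained, so nearly optimal symbols are used and their excess \<open>e\<close>
  tends to 0.\<close>

lemma sobolev_fun_mult:
  assumes \<sigma>: "2 < \<sigma>" and f: "f \<in> sobolev_fun \<sigma> V" and g: "g \<in> sobolev_fun \<sigma> V"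
  shows "(\<lambda>x. f x * g x) \<in> sobolev_fun \<sigma> V"
    "sobolev_fun_norm \<sigma> V (\<lambda>x. f x * g x) \<le> algebra_constant \<sigma> * sobolev_fun_norm \<sigma> V f * sobolev_fun_norm \<sigma> V g"
proof -
  have *: "convolution h k \<in> extensions \<sigma> V (\<lambda>x. f x * g x)" if "h \<in> extensions \<sigma> V f" "k \<in> extensions \<sigma> V g" for h k
    using that sobolev_symbol_convolution(1)[OF \<sigma>, of h k] by (auto simp: extensions_def fourier_convolution[OF \<sigma>])
  show "(\<lambda>x. f x * g x) \<in> sobolev_fun \<sigma> V"
    using f g * unfolding sobolev_fun_iff by blast
  define a where "a = sobolev_fun_norm \<sigma> V f" define b where "b = sobolev_fun_norm \<sigma> V g"
  define C where "C = algebra_constant \<sigma>"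
  have C: "0 < C" by (simp add: C_def algebra_constant_pos)
  have le: "sobolev_fun_norm \<sigma> V (\<lambda>x. f x * g x) \<le> C * (a + e) * (b + e)" if e: "0 < e" for e
  proof -
    obtain h where h: "h \<in> extensions \<sigma> V f" "sobolev_symbol_norm \<sigma> h < a + e"
      unfolding a_def by (rule sobolev_fun_approx[OF f e])
    obtain k where k: "k \<in> extensions \<sigma> V g" "sobolev_symbol_norm \<sigma> k < b + e"
      unfolding b_def by (rule sobolev_fun_approx[OF g e])
    have "sobolev_fun_norm \<sigma> V (\<lambda>x. f x * g x) \<le> sobolev_symbol_norm \<sigma> (convolution h k)"
      by (rule sobolev_fun_norm_le[OF *[OF h(1) k(1)]])
    also have "\<dots> \<le> C * sobolev_symbol_norm \<sigma> h * sobolev_symbol_norm \<sigma> k"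
      unfolding C_def using h k by (intro sobolev_symbol_convolution(2)[OF \<sigma>]) (auto simp: extensions_def)
    also have "\<dots> \<le> C * (a + e) * (b + e)"
      using h(2) k(2) C sobolev_symbol_norm_nonneg[of \<sigma> h] sobolev_symbol_norm_nonneg[of \<sigma> k]
      by (intro mult_mono mult_left_mono) auto
    finally show ?thesis .
  qed
  have "((\<lambda>e. C * (a + e) * (b + e)) \<longlongrightarrow> C * (a + 0) * (b + 0)) (at_right 0)"
    by (intro tendsto_intros)
  moreover have "eventually (\<lambda>e. sobolev_fun_norm \<sigma> V (\<lambda>x. f x * g x) \<le> C * (a + e) * (b + e)) (at_right 0)"
    using eventually_at_right_less[of "0::real"] by eventually_elim (rule le)
  ultimately have "sobolev_fun_norm \<sigma> V (\<lambda>x. f x * g x) \<le> C * (a + 0) * (b + 0)"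
    by (rule tendsto_lowerbound) simp
  then show "sobolev_fun_norm \<sigma> V (\<lambda>x. f x * g x) \<le> algebra_constant \<sigma> * sobolev_fun_norm \<sigma> V f * sobolev_fun_norm \<sigma> V g"
    by (simp add: C_def a_def b_def)
qed

section \<open>The wedge product of matrix valued forms\<close>

lemma matrix_mul_scaleR_left: "(r *\<^sub>R A) ** B = r *\<^sub>R (A ** (B :: complex^'k^'n))"
  and matrix_mul_scaleR_right: "A ** (r *\<^sub>R B) = r *\<^sub>R (A ** B)" for A :: "complex^'n^'m"
  by (simp_all add: matrix_matrix_mult_def vec_eq_iff scaleR_sum_right)

lemma matrix_mul_zero [simp]: "0 ** (B :: complex^'k^'n) = (0 :: complex^'k^'m)" "(A :: complex^'n^'m) ** (0 :: complex^'k^'n) = 0"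
  by (simp_all add: matrix_matrix_mult_def vec_eq_iff)

lemma matrix_mul_minus: "(- A) ** B = - (A ** (B :: complex^'k^'n))" "A ** (- B) = - (A ** B)" for A :: "complex^'n^'m"
  by (simp_all add: matrix_matrix_mult_def vec_eq_iff sum_negf)

lemma matrix_mul_diff_left: "(A - A') ** B = A ** B - A' ** (B :: complex^'k^'n)"
  and matrix_mul_diff_right: "A ** (B - B') = A ** B - A ** B'" for A :: "complex^'n^'m"
  by (simp_all add: matrix_matrix_mult_def vec_eq_iff sum_subtractf algebra_simps)

lemma matrix_add_rdistrib: "(A + A') ** B = A ** B + A' ** (B :: complex^'k^'n)" for A :: "complex^'n^'m"
  by (simp add: matrix_matrix_mult_def vec_eq_iff sum.distrib algebra_simps)

definition shuffle_sign :: "nat \<Rightarrow> nat set \<Rightarrow> real" where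
  "shuffle_sign n I = (-1) ^ card {(i, j). i \<in> I \<and> j \<in> {..<n} - I \<and> j < i}"

lemma wedge_eq: "(\<alpha> \<and>\<^sub>w \<beta>) c x vs = (\<Sum>I\<in>Pow {..<length vs}. shuffle_sign (length vs) I *\<^sub>R
    (\<alpha> c x (nths vs I) ** \<beta> c x (nths vs (- I))))"
  by (simp add: wedge_def shuffle_sign_def)

lemma wedge_left_linear: "(r *\<^sub>R \<alpha> + \<alpha>') \<and>\<^sub>w \<beta> = r *\<^sub>R (\<alpha> \<and>\<^sub>w \<beta>) + \<alpha>' \<and>\<^sub>w \<beta>"
  by (intro ext) (simp add: wedge_eq scaleR_fun_def matrix_add_rdistrib matrix_mul_scaleR_left
      scaleR_add_right scaleR_sum_right sum.distrib[symmetric] mult.commute)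

lemma wedge_right_linear: "\<alpha> \<and>\<^sub>w (r *\<^sub>R \<beta> + \<beta>') = r *\<^sub>R (\<alpha> \<and>\<^sub>w \<beta>) + \<alpha> \<and>\<^sub>w \<beta>'"
  by (intro ext) (simp add: wedge_eq scaleR_fun_def matrix_add_ldistrib matrix_mul_scaleR_right
      scaleR_add_right scaleR_sum_right sum.distrib[symmetric] mult.commute)

text \<open>Unfolds the sum over subsets of a concrete initial segment, so that wedge products in
  low degree become explicit sums.\<close>

lemma sum_Pow_Suc: "(\<Sum>I\<in>Pow {..<Suc n}. f I) = (\<Sum>I\<in>Pow {..<n}. f I + f (insert n I))"
proof -
  have "Pow {..<Suc n} = Pow {..<n} \<union> insert n ` Pow {..<n}"
    unfolding lessThan_Suc Pow_insert ..
  moreover have "Pow {..<n} \<inter> insert n ` Pow {..<n} = {}" by auto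
  moreover have "inj_on (insert n) (Pow {..<n})"
    by (intro inj_onI) (auto simp: insert_ident)
  ultimately show ?thesis
    by (simp add: sum.union_disjoint sum.reindex sum.distrib)
qed

text \<open>Inversions counted position by position, in a form that simplification can evaluate on
  concrete sets.\<close>

lemma shuffle_sign_eq:
  assumes "I \<subseteq> {..<n}"
  shows "shuffle_sign n I = (-1) ^ (\<Sum>i\<in>I. card ({..<i} - I))"
proof -
  have "{(i, j). i \<in> I \<and> j \<in> {..<n} - I \<and> j < i} = Sigma I (\<lambda>i. {..<i} - I)"
    using assms by auto
  moreover have "finite I" using assms finite_subset by blast
  ultimately show ?thesis by (simp add: shuffle_sign_def card_SigmaI)
qed

lemma wedge_2:
  "(\<alpha> \<and>\<^sub>w \<beta>) c x [u, v] = \<alpha> c x [] ** \<beta> c x [u, v] + \<alpha> c x [u] ** \<beta> c x [v] - \<alpha> c x [v] ** \<beta> c x [u]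
    + \<alpha> c x [u, v] ** \<beta> c x []"
  by (simp only: wedge_eq length_Cons list.size(3) sum_Pow_Suc)
    (simp add: shuffle_sign_eq nths_Cons lessThan_Suc insert_Diff_if)

lemma wedge_3:
  "(\<alpha> \<and>\<^sub>w \<beta>) c x [u, v, w] = \<alpha> c x [] ** \<beta> c x [u, v, w]
    + \<alpha> c x [u] ** \<beta> c x [v, w] - \<alpha> c x [v] ** \<beta> c x [u, w] + \<alpha> c x [w] ** \<beta> c x [u, v]
    + \<alpha> c x [u, v] ** \<beta> c x [w] - \<alpha> c x [u, w] ** \<beta> c x [v] + \<alpha> c x [v, w] ** \<beta> c x [u]
    + \<alpha> c x [u, v, w] ** \<beta> c x []"
  by (simp only: wedge_eq length_Cons list.size(3) sum_Pow_Suc)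
    (simp add: shuffle_sign_eq nths_Cons lessThan_Suc insert_Diff_if)

text \<open>A right factor of degree one leaves four of the sixteen subsets of positions.\<close>

lemma wedge_4_right_one:
  assumes "\<forall>vs. length vs \<noteq> 1 \<longrightarrow> \<beta> c x vs = 0"
  shows "(\<alpha> \<and>\<^sub>w \<beta>) c x [u, v, w, z] = \<alpha> c x [u, v, w] ** \<beta> c x [z] - \<alpha> c x [u, v, z] ** \<beta> c x [w]
    + \<alpha> c x [u, w, z] ** \<beta> c x [v] - \<alpha> c x [v, w, z] ** \<beta> c x [u]"
  by (simp only: wedge_eq length_Cons list.size(3) sum_Pow_Suc)
    (simp add: shuffle_sign_eq nths_Cons lessThan_Suc insert_Diff_if assms)

lemma alt_formD:
  assumes "alt_form r \<eta>"
  shows "length vs \<noteq> r \<Longrightarrow> \<eta> vs = 0" "linear (\<lambda>v. \<eta> (us @ v # ws))" "\<not> distinct vs \<Longrightarrow> \<eta> vs = 0"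
  using assms by (auto simp: alt_form_def)

lemma alt_form_swap:
  assumes "alt_form 2 \<eta>"
  shows "\<eta> [u, v] = - \<eta> [v, u]"
proof -
  have l1: "\<eta> [a + b, z] = \<eta> [a, z] + \<eta> [b, z]" and l2: "\<eta> [z, a + b] = \<eta> [z, a] + \<eta> [z, b]" for a b z
    using linear_add[OF alt_formD(2)[OF assms, of "[]" "[z]"], of a b]
      linear_add[OF alt_formD(2)[OF assms, of "[z]" "[]"], of a b] by simp_all
  have z: "\<eta> [a, a] = 0" for a using alt_formD(3)[OF assms, of "[a, a]"] by simp
  have "\<eta> [u + v, u + v] = \<eta> [u, u] + \<eta> [v, u] + (\<eta> [u, v] + \<eta> [v, v])" by (simp only: l1 l2)
  then have "\<eta> [u, v] + \<eta> [v, u] = 0" by (simp add: z add.commute)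
  then show ?thesis by (simp add: eq_neg_iff_add_eq_0)
qed

lemma wedge_length:
  assumes "alt_form r (\<alpha> c x)" "alt_form s (\<beta> c x)" "length vs \<noteq> r + s"
  shows "(\<alpha> \<and>\<^sub>w \<beta>) c x vs = 0"
  unfolding wedge_eq
proof (rule sum.neutral, rule ballI)
  fix I
  have "length (nths vs I) + length (nths vs (- I)) = length vs"
  proof -
    have "{..<length vs} = {i. i < length vs \<and> i \<in> I} \<union> {i. i < length vs \<and> i \<in> - I}" by auto
    then have "length vs = card ({i. i < length vs \<and> i \<in> I} \<union> {i. i < length vs \<and> i \<in> - I})"
      by (metis card_lessThan)
    also have "\<dots> = card {i. i < length vs \<and> i \<in> I} + card {i. i < length vs \<and> i \<in> - I}"
      by (rule card_Un_disjoint) auto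
    finally show ?thesis by (simp add: length_nths)
  qed
  then have "length (nths vs I) \<noteq> r \<or> length (nths vs (- I)) \<noteq> s" using assms(3) by auto
  then show "shuffle_sign (length vs) I *\<^sub>R (\<alpha> c x (nths vs I) ** \<beta> c x (nths vs (- I))) = 0"
    using alt_formD(1)[OF assms(1)] alt_formD(1)[OF assms(2)] by auto
qed

lemma linear_matrix_mul:
  fixes f :: "'v::real_vector \<Rightarrow> complex^'n^'m"
  assumes "linear f"
  shows "linear (\<lambda>v. f v ** (B :: complex^'k^'n))" "linear (\<lambda>v. (C :: complex^'m^'l) ** f v)"
  by (intro linearI; simp add: linear_add[OF assms] linear_scale[OF assms] matrix_add_ldistrib matrix_add_rdistrib
      matrix_mul_scaleR_left matrix_mul_scaleR_right)+

text \<open>In each summand a given argument position is handed to exactly one of the two factors,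
  and that factor is linear in it.\<close>

lemma wedge_linear:
  assumes "alt_form r (\<alpha> c x)" "alt_form s (\<beta> c x)"
  shows "linear (\<lambda>v. (\<alpha> \<and>\<^sub>w \<beta>) c x (us @ v # ws))"
proof -
  let ?n = "length us"
  have n: "nths (us @ v # ws) I = nths us I @ (if ?n \<in> I then [v] else []) @ nths ws {j. Suc j + ?n \<in> I}" for v I
    by (simp add: nths_append nths_Cons)
  have "linear (\<lambda>v. shuffle_sign (Suc (?n + length ws)) I *\<^sub>R
      (\<alpha> c x (nths (us @ v # ws) I) ** \<beta> c x (nths (us @ v # ws) (- I))))" for I
  proof (cases "?n \<in> I")
    case True
    then show ?thesis
      unfolding n by (auto intro!: linear_compose_scale_right linear_matrix_mul(1) alt_formD(2)[OF assms(1)])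
  next
    case False
    then show ?thesis
      unfolding n by (auto intro!: linear_compose_scale_right linear_matrix_mul(2) alt_formD(2)[OF assms(2)])
  qed
  then show ?thesis
    unfolding wedge_eq by (simp add: linear_compose_sum)
qed

lemma alt_form_wedge_1_1:
  assumes a: "alt_form 1 (\<alpha> c x)" and b: "alt_form 1 (\<beta> c x)"
  shows "alt_form 2 ((\<alpha> \<and>\<^sub>w \<beta>) c x)"
  unfolding alt_form_def
proof (intro conjI allI impI)
  show "(\<alpha> \<and>\<^sub>w \<beta>) c x vs = 0" if "length vs \<noteq> 2" for vs
    using wedge_length[of _ \<alpha> c x _ \<beta>, OF a b] that by simp
  show "linear (\<lambda>v. (\<alpha> \<and>\<^sub>w \<beta>) c x (us @ v # vs))" for us vs
    by (rule wedge_linear[of _ \<alpha> c x _ \<beta>, OF a b])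
  fix vs :: "(real^4) list" assume nd: "\<not> distinct vs"
  show "(\<alpha> \<and>\<^sub>w \<beta>) c x vs = 0"
  proof (cases "length vs = 2")
    case True
    then obtain u v where "vs = [u, v]" by (auto simp: length_Suc_conv numeral_eq_Suc)
    then show ?thesis using nd alt_formD(1)[OF a] alt_formD(1)[OF b] by (auto simp: wedge_2)
  qed (use wedge_length[of _ \<alpha> c x _ \<beta>, OF a b] in simp)
qed

lemma wedge_2_1:
  assumes a: "alt_form 2 (\<alpha> c x)" and b: "alt_form 1 (\<beta> c x)"
  shows "(\<alpha> \<and>\<^sub>w \<beta>) c x [u, v, w] = \<alpha> c x [u, v] ** \<beta> c x [w] - \<alpha> c x [u, w] ** \<beta> c x [v] + \<alpha> c x [v, w] ** \<beta> c x [u]"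
  using alt_formD(1)[OF a] alt_formD(1)[OF b] by (simp add: wedge_3)

lemma wedge_1_2:
  assumes a: "alt_form 1 (\<alpha> c x)" and b: "alt_form 2 (\<beta> c x)"
  shows "(\<alpha> \<and>\<^sub>w \<beta>) c x [u, v, w] = \<alpha> c x [u] ** \<beta> c x [v, w] - \<alpha> c x [v] ** \<beta> c x [u, w] + \<alpha> c x [w] ** \<beta> c x [u, v]"
  using alt_formD(1)[OF a] alt_formD(1)[OF b] by (simp add: wedge_3)

lemma wedge_1_1:
  assumes a: "alt_form 1 (\<alpha> c x)" and b: "alt_form 1 (\<beta> c x)"
  shows "(\<alpha> \<and>\<^sub>w \<beta>) c x [u, v] = \<alpha> c x [u] ** \<beta> c x [v] - \<alpha> c x [v] ** \<beta> c x [u]"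
  using alt_formD(1)[OF a] alt_formD(1)[OF b] by (simp add: wedge_2)

lemma alt_form_wedge_2_1:
  assumes a: "alt_form 2 (\<alpha> c x)" and b: "alt_form 1 (\<beta> c x)"
  shows "alt_form 3 ((\<alpha> \<and>\<^sub>w \<beta>) c x)"
  unfolding alt_form_def
proof (intro conjI allI impI)
  show "(\<alpha> \<and>\<^sub>w \<beta>) c x vs = 0" if "length vs \<noteq> 3" for vs
    using wedge_length[of _ \<alpha> c x _ \<beta>, OF a b] that by simp
  show "linear (\<lambda>v. (\<alpha> \<and>\<^sub>w \<beta>) c x (us @ v # vs))" for us vs
    by (rule wedge_linear[of _ \<alpha> c x _ \<beta>, OF a b])
  fix vs :: "(real^4) list" assume nd: "\<not> distinct vs"
  show "(\<alpha> \<and>\<^sub>w \<beta>) c x vs = 0"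
  proof (cases "length vs = 3")
    case True
    then obtain u v w where vs: "vs = [u, v, w]" by (auto simp: length_Suc_conv numeral_eq_Suc)
    have z: "\<alpha> c x [p, p] = 0" for p using alt_formD(3)[OF a, of "[p, p]"] by simp
    consider "u = v" | "u = w" | "v = w" using nd vs by auto
    then show ?thesis
    proof cases
      \<comment> \<open>With equal outer arguments the middle term vanishes, and the other two
        cancel because \<open>\<alpha>\<close> is antisymmetric in its two arguments.\<close>
      case 2
      then show ?thesis
        unfolding vs wedge_2_1[of \<alpha> c x \<beta>, OF a b] using alt_form_swap[OF a, of v w] by (simp add: z matrix_mul_minus)
    qed (simp_all add: vs wedge_2_1[of \<alpha> c x \<beta>, OF a b] z)
  qed (use wedge_length[of _ \<alpha> c x _ \<beta>, OF a b] in simp)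
qed

lemma wedge_assoc:
  assumes a: "alt_form 1 (\<alpha> c x)" and b: "alt_form 1 (\<beta> c x)" and d: "alt_form 1 (\<delta> c x)"
  shows "(\<alpha> \<and>\<^sub>w \<beta> \<and>\<^sub>w \<delta>) c x = (\<alpha> \<and>\<^sub>w (\<beta> \<and>\<^sub>w \<delta>)) c x"
proof
  fix vs
  note ab = alt_form_wedge_1_1[of \<alpha> c x \<beta>, OF a b] and bd = alt_form_wedge_1_1[of \<beta> c x \<delta>, OF b d]
  show "(\<alpha> \<and>\<^sub>w \<beta> \<and>\<^sub>w \<delta>) c x vs = (\<alpha> \<and>\<^sub>w (\<beta> \<and>\<^sub>w \<delta>)) c x vs"
  proof (cases "length vs = 3")
    case True
    then obtain u v w where vs: "vs = [u, v, w]" by (auto simp: length_Suc_conv numeral_eq_Suc)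
    show ?thesis
      unfolding vs wedge_2_1[of "\<alpha> \<and>\<^sub>w \<beta>" c x \<delta>, OF ab d] wedge_1_2[of \<alpha> c x "\<beta> \<and>\<^sub>w \<delta>", OF a bd] wedge_1_1[of \<alpha> c x \<beta>, OF a b] wedge_1_1[of \<beta> c x \<delta>, OF b d]
      by (simp add: matrix_mul_diff_left matrix_mul_diff_right matrix_mul_assoc)
  next
    case False
    then show ?thesis
      using wedge_length[of 2 "\<alpha> \<and>\<^sub>w \<beta>" c x 1 \<delta> vs] wedge_length[of 1 \<alpha> c x 2 "\<beta> \<and>\<^sub>w \<delta>" vs] ab bd a d by simp
  qed
qed

text \<open>Both sides expand into 24 signed products of matrices, one for each order of the
  arguments. \<open>cyc\<close> rotates each product on the right so that the value of
  \<open>\<alpha>\<close> comes first; the rotation of four arguments is odd, which accounts for the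
  sign.\<close>

lemma trace_wedge_cyclic:
  fixes \<alpha> \<beta> \<delta> \<epsilon> :: "('x, 'n::finite mat) form"
  assumes a: "alt_form 1 (\<alpha> c x)" and b: "alt_form 1 (\<beta> c x)" and d: "alt_form 1 (\<delta> c x)" and e: "alt_form 1 (\<epsilon> c x)"
  shows "trace ((\<alpha> \<and>\<^sub>w \<beta> \<and>\<^sub>w \<delta> \<and>\<^sub>w \<epsilon>) c x [p, q, r, s]) = - trace ((\<beta> \<and>\<^sub>w \<delta> \<and>\<^sub>w \<epsilon> \<and>\<^sub>w \<alpha>) c x [p, q, r, s])"
proof -
  note ab = alt_form_wedge_1_1[of \<alpha> c x \<beta>, OF a b] and bd = alt_form_wedge_1_1[of \<beta> c x \<delta>, OF b d]
  have e1: "\<forall>vs. length vs \<noteq> 1 \<longrightarrow> \<epsilon> c x vs = 0" and a1: "\<forall>vs. length vs \<noteq> 1 \<longrightarrow> \<alpha> c x vs = 0"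
    using a e by (simp_all add: alt_form_def)
  have cyc: "trace (\<beta> c x [i] ** (\<delta> c x [j] ** (\<epsilon> c x [k] ** \<alpha> c x [l])))
      = trace (\<alpha> c x [l] ** (\<beta> c x [i] ** (\<delta> c x [j] ** \<epsilon> c x [k])))" for i j k l
    using trace_mul_sym[of "\<beta> c x [i] ** (\<delta> c x [j] ** \<epsilon> c x [k])" "\<alpha> c x [l]"]
    by (simp add: matrix_mul_assoc)
  show ?thesis
    unfolding wedge_4_right_one[of \<epsilon> c x, OF e1] wedge_4_right_one[of \<alpha> c x, OF a1]
      wedge_2_1[of "\<alpha> \<and>\<^sub>w \<beta>" c x \<delta>, OF ab d] wedge_2_1[of "\<beta> \<and>\<^sub>w \<delta>" c x \<epsilon>, OF bd e] wedge_1_1[of \<alpha> c x \<beta>, OF a b] wedge_1_1[of \<beta> c x \<delta>, OF b d]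
    by (simp add: matrix_mul_diff_left matrix_mul_diff_right matrix_add_ldistrib matrix_add_rdistrib
        trace_add trace_sub cyc matrix_mul_assoc[symmetric] algebra_simps)
qed

section \<open>Sobolev spaces of forms\<close>

lemma alt_form_subspace: "subspace {\<eta>. alt_form r \<eta>}"
  unfolding alt_form_def
  by (intro subspaceI) (auto simp: scaleR_fun_def linear_zero intro!: linear_compose_add linear_compose_scale_right)

text \<open>Arguments are expanded in the basis one after another; \<open>us\<close> holds those
  already replaced by basis vectors.\<close>

lemma alt_form_eq_0:
  fixes \<eta> :: "(real^4) list \<Rightarrow> 'b::real_vector"
  assumes \<eta>: "alt_form r \<eta>" and z: "\<And>vs. vs \<in> frames r \<Longrightarrow> \<eta> vs = 0"
  shows "\<eta> = 0"
proof
  have "set us \<subseteq> Basis \<Longrightarrow> length us + length vs = r \<Longrightarrow> \<eta> (us @ vs) = 0" for us vs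
  proof (induction vs arbitrary: us)
    case Nil
    then show ?case using z[of us] by (simp add: frames_def)
  next
    case (Cons v vs)
    have lin: "linear (\<lambda>v. \<eta> (us @ v # vs))" by (rule alt_formD(2)[OF \<eta>])
    have "\<eta> (us @ b # vs) = 0" if "b \<in> Basis" for b
      using Cons.IH[of "us @ [b]"] Cons.prems that by simp
    then have "\<eta> (us @ (\<Sum>b\<in>Basis. (v \<bullet> b) *\<^sub>R b) # vs) = 0"
      by (simp add: linear_sum[OF lin] linear_scale[OF lin])
    then show ?case by (simp add: euclidean_representation)
  qed
  from this[of "[]"] show "\<eta> vs = 0 vs" for vs
    using alt_formD(1)[OF \<eta>, of vs] by (cases "length vs = r") auto
qed

lemma finite_frames: "finite (frames r)"
  unfolding frames_def using finite_lists_length_eq[of "Basis :: (real^4) set" r] by (simp add: conj_commute)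

lemma forms_subspace:
  assumes "subspace S"
  shows "subspace (forms \<A> r S :: ('x, 'b::real_vector) form set)"
proof (rule subspaceI)
  have alt0: "alt_form r (0 :: (real^4) list \<Rightarrow> 'b)"
    using subspace_0[OF alt_form_subspace] by auto
  have alt_add: "alt_form r (\<eta> + \<eta>')" if "alt_form r \<eta>" "alt_form r \<eta>'" for \<eta> \<eta>' :: "(real^4) list \<Rightarrow> 'b"
    using subspace_add[OF alt_form_subspace] that by auto
  have alt_scale: "alt_form r (a *\<^sub>R \<eta>)" if "alt_form r \<eta>" for a and \<eta> :: "(real^4) list \<Rightarrow> 'b"
    using subspace_scale[OF alt_form_subspace] that by auto
  show "(0 :: ('x, 'b) form) \<in> forms \<A> r S"
    using alt0 subspace_0[OF assms] by (simp add: forms_def)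
  show "\<omega> + \<omega>' \<in> forms \<A> r S" if "\<omega> \<in> forms \<A> r S" "\<omega>' \<in> forms \<A> r S" for \<omega> \<omega>' :: "('x, 'b) form"
    using that subspace_add[OF assms] by (auto simp: forms_def alt_add)
  show "a *\<^sub>R \<omega> \<in> forms \<A> r S" if "\<omega> \<in> forms \<A> r S" for a and \<omega> :: "('x, 'b) form"
  proof -
    have e: "(a *\<^sub>R \<omega>) c x = a *\<^sub>R \<omega> c x" for c x by (simp add: scaleR_fun_def)
    have "(a *\<^sub>R \<omega>) c x vs = a *\<^sub>R \<omega> c x vs" for c x vs by (simp add: scaleR_fun_def)
    then show ?thesis using that subspace_scale[OF assms] unfolding forms_def
      by (auto simp: e alt_scale)
  qed
qed

lemma sobolev_fun_norm_cong:
  "(\<And>x. x \<in> V \<Longrightarrow> f x = g x) \<Longrightarrow> sobolev_fun_norm \<sigma> V f = sobolev_fun_norm \<sigma> V g"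
  by (simp add: sobolev_fun_norm_eq extensions_def)

lemma sobolev_fun_sum:
  assumes "2 < \<sigma>" "\<And>a. a \<in> A \<Longrightarrow> f a \<in> sobolev_fun \<sigma> V"
  shows "(\<lambda>x. \<Sum>a\<in>A. f a x) \<in> sobolev_fun \<sigma> V \<and>
    sobolev_fun_norm \<sigma> V (\<lambda>x. \<Sum>a\<in>A. f a x) \<le> (\<Sum>a\<in>A. sobolev_fun_norm \<sigma> V (f a))"
  using assms(2)
proof (induction A rule: infinite_finite_induct)
  case (insert a A)
  then have IH: "(\<lambda>x. \<Sum>a\<in>A. f a x) \<in> sobolev_fun \<sigma> V"
    "sobolev_fun_norm \<sigma> V (\<lambda>x. \<Sum>a\<in>A. f a x) \<le> (\<Sum>a\<in>A. sobolev_fun_norm \<sigma> V (f a))" by auto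
  have a: "f a \<in> sobolev_fun \<sigma> V" using insert.prems by simp
  show ?case
    using sobolev_fun_add[OF assms(1) a IH(1)] IH(2) insert(1,2) by simp
qed (simp_all add: sobolev_fun_zero)

section \<open>Forms on a compact manifold, controlled by a partition of unity\<close>

locale sobolev_manifold =
  fixes X :: "'x topology" and \<A> :: "'x chart set" and P :: "('x chart \<times> ('x \<Rightarrow> real)) set" and \<sigma> :: real
  assumes manifold: "oriented_manifold4 X \<A>" and compact: "compact_space X"
    and partition: "partition_of_unity X \<A> P" and \<sigma>: "2 < \<sigma>"
begin

lemma atlasD:
  assumes "c \<in> \<A>"
  shows "cdom c \<subseteq> topspace X" "openin (top_of_set half_space) (cimg c)"
    "homeomorphic_map (subtopology X (cdom c)) (top_of_set (cimg c)) (cmap c)"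
  using manifold assms openin_subset[of X "cdom c"] by (auto simp: oriented_manifold4_def)

lemma cinv_cmap: assumes "c \<in> \<A>" "p \<in> cdom c" shows "cinv c (cmap c p) = p"
proof -
  have "inj_on (cmap c) (cdom c)"
    using homeomorphic_imp_injective_map[OF atlasD(3)[OF assms(1)]] atlasD(1)[OF assms(1)]
    by (simp add: Int_absorb1)
  then show ?thesis using assms(2) by (simp add: cinv_def)
qed

lemma finite_P: "finite P"
  using partition by (simp add: partition_of_unity_def)

lemma partitionD:
  assumes "(c, \<rho>) \<in> P"
  shows "c \<in> \<A>" "\<And>p. p \<in> topspace X \<Longrightarrow> 0 \<le> \<rho> p" "X closure_of {p \<in> topspace X. \<rho> p \<noteq> 0} \<subseteq> cdom c"
    "d \<in> \<A> \<Longrightarrow> smooth_along euclid euclid (cimg d) (\<lambda>x. \<rho> (cinv d x))"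
  using partition assms by (auto simp: partition_of_unity_def)

lemma partition_sum: "p \<in> topspace X \<Longrightarrow> (\<Sum>(c, \<rho>)\<in>P. \<rho> p) = 1"
  using partition by (simp add: partition_of_unity_def)

lemma partition_support:
  assumes "(c, \<rho>) \<in> P" "p \<in> topspace X" "\<rho> p \<noteq> 0" shows "p \<in> cdom c"
proof -
  have "{p \<in> topspace X. \<rho> p \<noteq> 0} \<subseteq> X closure_of {p \<in> topspace X. \<rho> p \<noteq> 0}"
    by (rule closure_of_subset) auto
  then show ?thesis using partitionD(3)[OF assms(1)] assms(2,3) by auto
qed

lemma partition_le_1:
  assumes "(c, \<rho>) \<in> P" "p \<in> topspace X" shows "\<rho> p \<le> 1"
proof -
  have "(\<lambda>(c, \<rho>). \<rho> p) (c, \<rho>) \<le> (\<Sum>(c, \<rho>)\<in>P. \<rho> p)"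
    using assms partitionD(2) by (intro member_le_sum finite_P) auto
  then show ?thesis using partition_sum[OF assms(2)] by simp
qed

text \<open>The members of the partition sum to 1, so one of them is nonzero at the given point; the
  point is then seen in the patch of that member, possibly in another chart.\<close>

lemma patch_cover:
  assumes "d \<in> \<A>" "y \<in> cimg d"
  obtains c \<rho> where "(c, \<rho>) \<in> P" "y \<in> overlap d c" "transition d c y \<in> patch c \<rho>"
proof -
  obtain p where p: "p \<in> cdom d" "y = cmap d p" using assms(2) by (auto simp: cimg_def)
  have pX: "p \<in> topspace X" using p(1) atlasD(1)[OF assms(1)] by auto
  have "\<exists>(c, \<rho>)\<in>P. \<rho> p \<noteq> 0"
  proof (rule ccontr)
    assume "\<not> ?thesis"
    then have "(\<Sum>(c, \<rho>)\<in>P. \<rho> p) = 0" by (intro sum.neutral) auto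
    then show False using partition_sum[OF pX] by simp
  qed
  then obtain c \<rho> where c: "(c, \<rho>) \<in> P" "\<rho> p \<noteq> 0" by auto
  have pc: "p \<in> cdom c" by (rule partition_support[OF c(1) pX c(2)])
  show ?thesis
    using that[OF c(1)] p pc c(2) cinv_cmap[OF assms(1) p(1)] by (auto simp: overlap_def transition_def patch_def)
qed

lemma patch_sub: "(c, \<rho>) \<in> P \<Longrightarrow> x \<in> patch c \<rho> \<Longrightarrow> x \<in> cimg c"
  by (auto simp: patch_def cimg_def)

lemma formsD:
  assumes "\<omega> \<in> forms \<A> r S"
  shows "c \<notin> \<A> \<or> x \<notin> cimg c \<Longrightarrow> \<omega> c x = 0" "c \<in> \<A> \<Longrightarrow> x \<in> cimg c \<Longrightarrow> alt_form r (\<omega> c x)"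
    "c \<in> \<A> \<Longrightarrow> x \<in> cimg c \<Longrightarrow> length vs = r \<Longrightarrow> \<omega> c x vs \<in> S"
    "c \<in> \<A> \<Longrightarrow> d \<in> \<A> \<Longrightarrow> x \<in> overlap c d \<Longrightarrow> \<omega> c x vs = \<omega> d (transition c d x) (map (transition_deriv c d x) vs)"
proof -
  note * = assms[unfolded forms_def mem_Collect_eq]
  show "c \<notin> \<A> \<or> x \<notin> cimg c \<Longrightarrow> \<omega> c x = 0" using * by blast
  show "c \<in> \<A> \<Longrightarrow> x \<in> cimg c \<Longrightarrow> alt_form r (\<omega> c x)" using * by blast
  show "c \<in> \<A> \<Longrightarrow> x \<in> cimg c \<Longrightarrow> length vs = r \<Longrightarrow> \<omega> c x vs \<in> S" using * by blast
  show "c \<in> \<A> \<Longrightarrow> d \<in> \<A> \<Longrightarrow> x \<in> overlap c d \<Longrightarrow> \<omega> c x vs = \<omega> d (transition c d x) (map (transition_deriv c d x) vs)"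
    using conjunct2[OF conjunct2[OF *]] by blast
qed

text \<open>The transformation law carries vanishing on the patches to all charts. This makes
  \<open>sobolev_norm\<close> definite, and it lets point evaluations separate forms.\<close>

lemma form_eq_0:
  assumes \<omega>: "\<omega> \<in> forms \<A> r S" and z: "\<And>c \<rho> x vs. (c, \<rho>) \<in> P \<Longrightarrow> x \<in> patch c \<rho> \<Longrightarrow> vs \<in> frames r \<Longrightarrow> \<omega> c x vs = 0"
  shows "\<omega> = 0"
proof (intro ext)
  fix d y vs
  show "\<omega> d y vs = 0 d y vs"
  proof (cases "d \<in> \<A> \<and> y \<in> cimg d")
    case True
    then obtain c \<rho> where c: "(c, \<rho>) \<in> P" "y \<in> overlap d c" "transition d c y \<in> patch c \<rho>"
      by (auto elim: patch_cover)
    have "\<omega> c (transition d c y) = 0"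
      using formsD(2)[OF \<omega> partitionD(1)[OF c(1)] patch_sub[OF c(1,3)]] z[OF c(1,3)] by (rule alt_form_eq_0)
    then show ?thesis
      using formsD(4)[OF \<omega> _ partitionD(1)[OF c(1)] c(2), of vs] True by simp
  next
    case False
    then show ?thesis using formsD(1)[OF \<omega>, of d y] by auto
  qed
qed

text \<open>The components are indexed by a single set, so that the four-fold sum of squares is one
  \<open>L2_set\<close> and its triangle inequality applies.\<close>

definition component_norm :: "('x, 'n::finite mat) form \<Rightarrow> ('x chart \<times> ('x \<Rightarrow> real)) \<times> (real^4) list \<times> 'n \<times> 'n \<Rightarrow> real" where
  "component_norm \<omega> = (\<lambda>((c, \<rho>), vs, i, j). sobolev_fun_norm \<sigma> (patch c \<rho>) (\<lambda>x. \<omega> c x vs $ i $ j))"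

definition component_index :: "nat \<Rightarrow> (('x chart \<times> ('x \<Rightarrow> real)) \<times> (real^4) list \<times> 'n::finite \<times> 'n) set" where
  "component_index r = P \<times> frames r \<times> UNIV \<times> UNIV"

lemma finite_component_index: "finite (component_index r :: (_ \<times> _ \<times> 'n::finite \<times> 'n) set)"
  by (simp add: component_index_def finite_P finite_frames)

lemma sobolev_norm_eq: "sobolev_norm P \<sigma> r \<omega> = L2_set (component_norm \<omega>) (component_index r)"
  unfolding sobolev_norm_def L2_set_def component_index_def component_norm_def
  by (simp add: sum.cartesian_product case_prod_unfold)

text \<open>Stated for lists of every length, because the shuffle sum of a wedge product evaluates
  its factors on sublists of every length; off degree \<open>r\<close> the components vanish on the
  patch.\<close>

lemma component_sobolev_fun:
  assumes "\<omega> \<in> sobolev_forms \<A> P \<sigma> r S" "(c, \<rho>) \<in> P" "set vs \<subseteq> Basis"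
  shows "(\<lambda>x. \<omega> c x vs $ i $ j) \<in> sobolev_fun \<sigma> (patch c \<rho>)"
    "sobolev_fun_norm \<sigma> (patch c \<rho>) (\<lambda>x. \<omega> c x vs $ i $ j) \<le> sobolev_norm P \<sigma> r \<omega>"
proof -
  have \<omega>: "\<omega> \<in> forms \<A> r S" using assms(1) by (simp add: sobolev_forms_def)
  have "(\<lambda>x. \<omega> c x vs $ i $ j) \<in> sobolev_fun \<sigma> (patch c \<rho>) \<and>
    sobolev_fun_norm \<sigma> (patch c \<rho>) (\<lambda>x. \<omega> c x vs $ i $ j) \<le> sobolev_norm P \<sigma> r \<omega>"
  proof (cases "length vs = r")
    case True
    then have vs: "vs \<in> frames r" using assms(3) by (simp add: frames_def)
    have "((c, \<rho>), vs, i, j) \<in> component_index r" using vs assms(2) by (simp add: component_index_def)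
    from member_le_L2_set[OF finite_component_index this, of "component_norm \<omega>"]
    show ?thesis using assms(1,2) vs by (auto simp: sobolev_norm_eq component_norm_def sobolev_forms_def)
  next
    case False
    have "\<omega> c x vs $ i $ j = 0" if "x \<in> patch c \<rho>" for x
      using alt_formD(1)[OF formsD(2)[OF \<omega> partitionD(1)[OF assms(2)] patch_sub[OF assms(2) that]] False] by simp
    then have "(\<lambda>x. \<omega> c x vs $ i $ j) \<in> sobolev_fun \<sigma> (patch c \<rho>) \<longleftrightarrow> (\<lambda>_. 0) \<in> sobolev_fun \<sigma> (patch c \<rho>)"
      "sobolev_fun_norm \<sigma> (patch c \<rho>) (\<lambda>x. \<omega> c x vs $ i $ j) = sobolev_fun_norm \<sigma> (patch c \<rho>) (\<lambda>_. 0)"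
      by (auto intro!: sobolev_fun_cong sobolev_fun_norm_cong)
    then show ?thesis by (simp add: sobolev_fun_zero sobolev_norm_eq L2_set_nonneg)
  qed
  then show "(\<lambda>x. \<omega> c x vs $ i $ j) \<in> sobolev_fun \<sigma> (patch c \<rho>)"
    "sobolev_fun_norm \<sigma> (patch c \<rho>) (\<lambda>x. \<omega> c x vs $ i $ j) \<le> sobolev_norm P \<sigma> r \<omega>" by auto
qed

lemma sobolev_forms_bound:
  assumes "\<omega> \<in> sobolev_forms \<A> P \<sigma> r S" "(c, \<rho>) \<in> P" "set vs \<subseteq> Basis" "x \<in> patch c \<rho>"
  shows "norm (\<omega> c x vs $ i $ j) \<le> embedding_constant \<sigma> * sobolev_norm P \<sigma> r \<omega>"
proof -
  have "norm (\<omega> c x vs $ i $ j) \<le> embedding_constant \<sigma> * sobolev_fun_norm \<sigma> (patch c \<rho>) (\<lambda>x. \<omega> c x vs $ i $ j)"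
    by (rule sobolev_fun_bound[OF \<sigma> component_sobolev_fun(1)[OF assms(1-3)] assms(4)])
  also have "\<dots> \<le> embedding_constant \<sigma> * sobolev_norm P \<sigma> r \<omega>"
    using embedding_constant_pos[of \<sigma>] by (intro mult_left_mono component_sobolev_fun(2)[OF assms(1-3)]) auto
  finally show ?thesis .
qed

lemma component_norm_nonneg:
  "\<omega> \<in> sobolev_forms \<A> P \<sigma> r S \<Longrightarrow> k \<in> component_index r \<Longrightarrow> 0 \<le> component_norm \<omega> k"
  by (auto simp: component_norm_def component_index_def frames_def
      intro!: sobolev_fun_norm_nonneg component_sobolev_fun(1))

lemma nspace_sobolev_space:
  fixes S :: "'n::finite mat set"
  assumes S: "subspace S"
  shows "nspace (sobolev_space \<A> P \<sigma> r S)"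
proof
  let ?F = "sobolev_forms \<A> P \<sigma> r S"
  have fs: "subspace (forms \<A> r S :: ('x, 'n mat) form set)" by (rule forms_subspace[OF S])
  have pts: "pts (sobolev_space \<A> P \<sigma> r S) = ?F" and nrm: "nrm (sobolev_space \<A> P \<sigma> r S) = sobolev_norm P \<sigma> r"
    by (simp_all add: sobolev_space_def)
  have add: "\<omega> + \<omega>' \<in> ?F" if "\<omega> \<in> ?F" "\<omega>' \<in> ?F" for \<omega> \<omega>'
    using that subspace_add[OF fs] by (auto simp: sobolev_forms_def intro!: sobolev_fun_add(1)[OF \<sigma>])
  have scale: "a *\<^sub>R \<omega> \<in> ?F" if "\<omega> \<in> ?F" for a \<omega>
  proof -
    have e: "(a *\<^sub>R \<omega>) c x vs $ i $ j = a *\<^sub>R (\<omega> c x vs $ i $ j)" for c x vs i j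
      by (simp add: scaleR_fun_def)
    show ?thesis
      using that subspace_scale[OF fs] by (auto simp: sobolev_forms_def e intro!: sobolev_fun_scale(1))
  qed
  have zero: "0 \<in> ?F"
    using subspace_0[OF fs] by (auto simp: sobolev_forms_def sobolev_fun_zero)
  show "subspace (pts (sobolev_space \<A> P \<sigma> r S))"
    unfolding pts by (rule subspaceI[OF zero add scale])
  show "nrm (sobolev_space \<A> P \<sigma> r S) (\<omega> + \<omega>') \<le> nrm (sobolev_space \<A> P \<sigma> r S) \<omega> + nrm (sobolev_space \<A> P \<sigma> r S) \<omega>'"
    if w: "\<omega> \<in> pts (sobolev_space \<A> P \<sigma> r S)" "\<omega>' \<in> pts (sobolev_space \<A> P \<sigma> r S)" for \<omega> \<omega>'
  proof -
    note w = w[unfolded pts]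
    have "L2_set (component_norm (\<omega> + \<omega>')) (component_index r)
        \<le> L2_set (\<lambda>k. component_norm \<omega> k + component_norm \<omega>' k) (component_index r)"
    proof (rule L2_set_mono)
      fix k :: "('x chart \<times> ('x \<Rightarrow> real)) \<times> (real^4) list \<times> 'n \<times> 'n" assume k: "k \<in> component_index r"
      then show "component_norm (\<omega> + \<omega>') k \<le> component_norm \<omega> k + component_norm \<omega>' k"
        using w by (auto simp: component_norm_def component_index_def frames_def
            intro!: sobolev_fun_add(2)[OF \<sigma>] component_sobolev_fun(1))
      show "0 \<le> component_norm (\<omega> + \<omega>') k" by (rule component_norm_nonneg[OF add[OF w] k])
    qed
    also have "\<dots> \<le> L2_set (component_norm \<omega>) (component_index r) + L2_set (component_norm \<omega>') (component_index r)"
      by (rule L2_set_triangle_ineq)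
    finally show ?thesis by (simp add: nrm sobolev_norm_eq)
  qed
  show "nrm (sobolev_space \<A> P \<sigma> r S) (a *\<^sub>R \<omega>) = \<bar>a\<bar> * nrm (sobolev_space \<A> P \<sigma> r S) \<omega>"
    if w: "\<omega> \<in> pts (sobolev_space \<A> P \<sigma> r S)" for a \<omega>
  proof -
    note w = w[unfolded pts]
    have "component_norm (a *\<^sub>R \<omega>) k = \<bar>a\<bar> * component_norm \<omega> k"
      if k: "k \<in> (component_index r :: (_ \<times> _ \<times> 'n \<times> 'n) set)" for k
      using k w by (auto simp: component_norm_def component_index_def frames_def scaleR_fun_def
          intro!: sobolev_fun_scale(2) component_sobolev_fun(1))
    then have "L2_set (component_norm (a *\<^sub>R \<omega>)) (component_index r) = L2_set (\<lambda>k. \<bar>a\<bar> * component_norm \<omega> k) (component_index r)"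
      by (intro L2_set_cong) auto
    then show ?thesis by (simp add: nrm sobolev_norm_eq L2_set_right_distrib)
  qed
  show "\<omega> = 0" if w: "\<omega> \<in> pts (sobolev_space \<A> P \<sigma> r S)" and z: "nrm (sobolev_space \<A> P \<sigma> r S) \<omega> = 0" for \<omega>
  proof (rule form_eq_0)
    note w = w[unfolded pts]
    show "\<omega> \<in> forms \<A> r S" using w by (simp add: sobolev_forms_def)
    fix c \<rho> x vs assume c: "(c, \<rho>) \<in> P" "x \<in> patch c \<rho>" and vs: "vs \<in> frames r"
    have "norm (\<omega> c x vs $ i $ j) \<le> 0" for i j
      using sobolev_forms_bound[OF w c(1) _ c(2), of vs i j] z vs by (simp add: nrm frames_def)
    then show "\<omega> c x vs = 0" by (simp add: vec_eq_iff)
  qed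
qed

text \<open>By the Sobolev embedding the real and imaginary parts of components at points of the
  patches are bounded functionals, and these values determine the form.\<close>

lemma separated_sobolev_space:
  fixes S :: "'n::finite mat set"
  shows "separated (sobolev_space \<A> P \<sigma> r S)"
  unfolding separated_def
proof (intro ballI impI)
  let ?E = "sobolev_space \<A> P \<sigma> r S"
  fix \<omega> :: "('x, 'n mat) form" assume w: "\<omega> \<in> pts ?E" and z: "\<forall>l. functional ?E l \<longrightarrow> l \<omega> = 0"
  have w': "\<omega> \<in> sobolev_forms \<A> P \<sigma> r S" using w by (simp add: sobolev_space_def)
  show "\<omega> = 0"
  proof (rule form_eq_0)
    show "\<omega> \<in> forms \<A> r S" using w' by (simp add: sobolev_forms_def)
    fix c \<rho> x vs assume c: "(c, \<rho>) \<in> P" "x \<in> patch c \<rho>" and vs: "vs \<in> frames r"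
    have *: "l (\<omega> c x vs $ i $ j) = 0" if l: "bounded_linear l" "\<And>y. \<bar>l y\<bar> \<le> norm y" for i j and l :: "complex \<Rightarrow> real"
    proof -
      interpret bounded_linear l by (rule l(1))
      have "functional ?E (\<lambda>\<omega>. l (\<omega> c x vs $ i $ j))"
        unfolding functional_def
      proof (intro conjI ballI allI)
        show "\<exists>C. \<forall>\<eta>\<in>pts ?E. \<bar>l (\<eta> c x vs $ i $ j)\<bar> \<le> C * nrm ?E \<eta>"
        proof (intro exI ballI)
          fix \<eta> assume e: "\<eta> \<in> pts ?E"
          show "\<bar>l (\<eta> c x vs $ i $ j)\<bar> \<le> embedding_constant \<sigma> * nrm ?E \<eta>"
            using sobolev_forms_bound[of \<eta> r S c \<rho> vs x i j] l(2)[of "\<eta> c x vs $ i $ j"] e c vs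
            by (simp add: sobolev_space_def frames_def)
        qed
      qed (simp add: scaleR_fun_def add scale)
      then show ?thesis using z by blast
    qed
    have "\<omega> c x vs $ i $ j = 0" for i j
      using *[OF bounded_linear_Re abs_Re_le_cmod] *[OF bounded_linear_Im abs_Im_le_cmod] by (simp add: complex_eq_iff)
    then show "\<omega> c x vs = 0" by (simp add: vec_eq_iff)
  qed
qed

end

section \<open>Products, integrals and the pairing of Sobolev forms\<close>

lemma smooth_along_euclid_continuous_on:
  fixes f :: "'a::real_normed_vector \<Rightarrow> 'b::real_normed_vector"
  assumes "smooth_along euclid euclid S f"
  shows "continuous_on S f"
proof -
  interpret nspace2 "euclid :: 'a nsp" "euclid :: 'b nsp"
    by (intro nspace2.intro nspace_euclid)
  have "continuous (at x within S) f" if x: "x \<in> S" for x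
  proof -
    obtain W g where W: "nopen euclid W" "x \<in> W" "smooth_on euclid euclid W g" "\<forall>y\<in>S \<inter> W. g y = f y"
      using assms x unfolding smooth_along_def by blast
    then obtain D where D: "jet euclid euclid W D" "\<forall>x\<in>W. D [] x = g x"
      unfolding smooth_on_iff_jet by blast
    obtain r where r: "r > 0" "\<And>y. norm (y - x) < r \<Longrightarrow> y \<in> W"
      using W(1,2) unfolding nopen_def by auto
    obtain L where L: "1 \<le> L" "eventually (\<lambda>h. \<forall>hs\<in>lists (pts (euclid :: 'a nsp)). length hs \<le> 0 \<longrightarrow>
        nrm euclid (D hs (x + h) - D hs x) \<le> L * nrm euclid h * npr euclid hs) (near euclid W x)"
      using jet_lipschitz[OF D(1) W(2)] by blast
    then obtain \<delta> where \<delta>: "\<delta> > 0" "\<And>h. norm h < \<delta> \<Longrightarrow> x + h \<in> W \<Longrightarrow> norm (D [] (x + h) - D [] x) \<le> L * norm h"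
      unfolding eventually_near by auto
    show ?thesis
      unfolding continuous_within_eps_delta
    proof (intro allI impI)
      fix e :: real assume e: "0 < e"
      show "\<exists>d>0. \<forall>y\<in>S. dist y x < d \<longrightarrow> dist (f y) (f x) < e"
      proof (intro exI[of _ "min r (min \<delta> (e / L))"] conjI ballI impI)
        show "0 < min r (min \<delta> (e / L))" using r \<delta> e L(1) by simp
        fix y assume y: "y \<in> S" "dist y x < min r (min \<delta> (e / L))"
        then have yW: "y \<in> W" using r(2) by (simp add: dist_norm)
        have "norm (D [] (x + (y - x)) - D [] x) \<le> L * norm (y - x)"
          using y yW by (intro \<delta>(2)) (auto simp: dist_norm)
        then have "dist (f y) (f x) \<le> L * norm (y - x)"
          using D(2) W(2,4) x y(1) yW by (simp add: dist_norm)
        also have "\<dots> < e" using y(2) L(1) by (simp add: dist_norm field_simps)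
        finally show "dist (f y) (f x) < e" .
      qed
    qed
  qed
  then show ?thesis by (simp add: continuous_on_eq_continuous_within)
qed

lemma half_space_borel: "half_space \<in> sets borel"
proof -
  have "closed half_space" unfolding half_space_def by (intro closed_Collect_le continuous_intros)
  then show ?thesis by simp
qed

lemma scaleR_apply: "(r *\<^sub>R f) x = r *\<^sub>R (f x :: 'b::real_vector)"
  by (simp add: scaleR_fun_def)

lemma two_plus_one: "2 + 1 = (3 :: nat)" by simp

context sobolev_manifold
begin

text \<open>An entry of the wedge product is a signed sum over subsets of positions and over the
  intermediate index of the matrix product; the constant is their number times the one of the
  algebra property.\<close>

lemma wedge_component:
  fixes \<alpha> \<beta> :: "('x, 'n::finite mat) form"
  assumes a: "\<alpha> \<in> sobolev_forms \<A> P \<sigma> r S" and b: "\<beta> \<in> sobolev_forms \<A> P \<sigma> s S'"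
    and c: "(c, \<rho>) \<in> P" and vs: "set vs \<subseteq> Basis"
  shows "(\<lambda>x. (\<alpha> \<and>\<^sub>w \<beta>) c x vs $ i $ j) \<in> sobolev_fun \<sigma> (patch c \<rho>) \<and>
    sobolev_fun_norm \<sigma> (patch c \<rho>) (\<lambda>x. (\<alpha> \<and>\<^sub>w \<beta>) c x vs $ i $ j)
      \<le> (2 ^ length vs * CARD('n) * algebra_constant \<sigma>) * sobolev_norm P \<sigma> r \<alpha> * sobolev_norm P \<sigma> s \<beta>"
proof -
  define f where "f q x = shuffle_sign (length vs) (fst q) *\<^sub>R
      (\<alpha> c x (nths vs (fst q)) $ i $ snd q * \<beta> c x (nths vs (- fst q)) $ snd q $ j)" for q :: "nat set \<times> 'n" and x
  define J where "J = Pow {..<length vs} \<times> (UNIV :: 'n set)"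
  define B where "B = algebra_constant \<sigma> * sobolev_norm P \<sigma> r \<alpha> * sobolev_norm P \<sigma> s \<beta>"
  have eq: "(\<alpha> \<and>\<^sub>w \<beta>) c x vs $ i $ j = (\<Sum>q\<in>J. f q x)" for x
    by (simp add: wedge_eq J_def f_def sum_component matrix_matrix_mult_def scaleR_sum_right
        sum.cartesian_product case_prod_unfold)
  have f: "f q \<in> sobolev_fun \<sigma> (patch c \<rho>) \<and> sobolev_fun_norm \<sigma> (patch c \<rho>) (f q) \<le> B" for q
  proof -
    define u where "u x = \<alpha> c x (nths vs (fst q)) $ i $ snd q" for x
    define v where "v x = \<beta> c x (nths vs (- fst q)) $ snd q $ j" for x
    have sub: "set (nths vs I) \<subseteq> Basis" for I using set_nths_subset[of vs I] vs by auto
    have u: "u \<in> sobolev_fun \<sigma> (patch c \<rho>)" "sobolev_fun_norm \<sigma> (patch c \<rho>) u \<le> sobolev_norm P \<sigma> r \<alpha>"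
      unfolding u_def by (rule component_sobolev_fun[OF a c sub])+
    have v: "v \<in> sobolev_fun \<sigma> (patch c \<rho>)" "sobolev_fun_norm \<sigma> (patch c \<rho>) v \<le> sobolev_norm P \<sigma> s \<beta>"
      unfolding v_def by (rule component_sobolev_fun[OF b c sub])+
    have f_eq: "f q = (\<lambda>x. shuffle_sign (length vs) (fst q) *\<^sub>R (u x * v x))"
      by (simp add: f_def u_def v_def fun_eq_iff)
    have "sobolev_fun_norm \<sigma> (patch c \<rho>) (\<lambda>x. u x * v x)
        \<le> algebra_constant \<sigma> * sobolev_fun_norm \<sigma> (patch c \<rho>) u * sobolev_fun_norm \<sigma> (patch c \<rho>) v"
      by (rule sobolev_fun_mult(2)[OF \<sigma> u(1) v(1)])
    also have "\<dots> \<le> B"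
      unfolding B_def using u(2) v(2) algebra_constant_pos[of \<sigma>] sobolev_fun_norm_nonneg[OF u(1)] sobolev_fun_norm_nonneg[OF v(1)]
      by (intro mult_mono mult_left_mono mult_nonneg_nonneg) auto
    finally have "sobolev_fun_norm \<sigma> (patch c \<rho>) (\<lambda>x. u x * v x) \<le> B" .
    moreover have "\<bar>shuffle_sign (length vs) (fst q)\<bar> = 1" by (simp add: shuffle_sign_def power_abs)
    ultimately show ?thesis
      unfolding f_eq using sobolev_fun_scale[OF sobolev_fun_mult(1)[OF \<sigma> u(1) v(1)]] by simp
  qed
  have s: "(\<lambda>x. \<Sum>q\<in>J. f q x) \<in> sobolev_fun \<sigma> (patch c \<rho>) \<and>
      sobolev_fun_norm \<sigma> (patch c \<rho>) (\<lambda>x. \<Sum>q\<in>J. f q x) \<le> (\<Sum>q\<in>J. sobolev_fun_norm \<sigma> (patch c \<rho>) (f q))"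
    using f by (intro sobolev_fun_sum[OF \<sigma>]) auto
  have "(\<Sum>q\<in>J. sobolev_fun_norm \<sigma> (patch c \<rho>) (f q)) \<le> real (card J) * B"
    using f by (intro sum_bounded_above) auto
  also have "real (card J) * B = (2 ^ length vs * CARD('n) * algebra_constant \<sigma>) * sobolev_norm P \<sigma> r \<alpha> * sobolev_norm P \<sigma> s \<beta>"
    by (simp add: J_def B_def card_cartesian_product card_Pow)
  finally show ?thesis using s unfolding eq by auto
qed

lemma wedge_forms:
  fixes \<alpha> \<beta> :: "('x, 'n::finite mat) form"
  assumes a: "\<alpha> \<in> forms \<A> r S" and b: "\<beta> \<in> forms \<A> s S'"
    and alt: "\<And>c x. alt_form r (\<alpha> c x) \<Longrightarrow> alt_form s (\<beta> c x) \<Longrightarrow> alt_form (r + s) ((\<alpha> \<and>\<^sub>w \<beta>) c x)"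
  shows "\<alpha> \<and>\<^sub>w \<beta> \<in> forms \<A> (r + s) UNIV"
proof -
  have "(\<alpha> \<and>\<^sub>w \<beta>) c x = 0" if "c \<notin> \<A> \<or> x \<notin> cimg c" for c x
    using formsD(1)[OF a that] by (intro ext) (simp add: wedge_eq)
  moreover have "(\<alpha> \<and>\<^sub>w \<beta>) c x vs = (\<alpha> \<and>\<^sub>w \<beta>) d (transition c d x) (map (transition_deriv c d x) vs)"
    if "c \<in> \<A>" "d \<in> \<A>" "x \<in> overlap c d" for c d x vs
    using formsD(4)[OF a that] formsD(4)[OF b that] by (simp add: wedge_eq nths_map)
  ultimately show ?thesis
    using alt formsD(2)[OF a] formsD(2)[OF b] by (auto simp: forms_def)
qed

lemma bounded_bil_wedge:
  fixes S S' :: "'n::finite mat set"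
  assumes alt: "\<And>\<alpha> \<beta> :: ('x, 'n mat) form. \<And>c x. alt_form r (\<alpha> c x) \<Longrightarrow> alt_form s (\<beta> c x) \<Longrightarrow> alt_form (r + s) ((\<alpha> \<and>\<^sub>w \<beta>) c x)"
  shows "bounded_bil (sobolev_space \<A> P \<sigma> r S) (sobolev_space \<A> P \<sigma> s S') (sobolev_space \<A> P \<sigma> (r + s) (UNIV :: 'n mat set)) (\<and>\<^sub>w)"
proof -
  have mem: "\<alpha> \<and>\<^sub>w \<beta> \<in> sobolev_forms \<A> P \<sigma> (r + s) UNIV"
    if a: "\<alpha> \<in> sobolev_forms \<A> P \<sigma> r S" and b: "\<beta> \<in> sobolev_forms \<A> P \<sigma> s S'" for \<alpha> \<beta>
  proof -
    have "\<alpha> \<and>\<^sub>w \<beta> \<in> forms \<A> (r + s) UNIV"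
      by (rule wedge_forms[OF _ _ alt]) (use a b in \<open>auto simp: sobolev_forms_def\<close>)
    then show ?thesis
      using wedge_component[OF a b] by (auto simp: sobolev_forms_def frames_def)
  qed
  define C where "C = real (card (component_index (r + s) :: (('x chart \<times> ('x \<Rightarrow> real)) \<times> (real^4) list \<times> 'n \<times> 'n) set))
    * (2 ^ (r + s) * CARD('n) * algebra_constant \<sigma>)"
  have bd: "sobolev_norm P \<sigma> (r + s) (\<alpha> \<and>\<^sub>w \<beta>) \<le> C * sobolev_norm P \<sigma> r \<alpha> * sobolev_norm P \<sigma> s \<beta>"
    if a: "\<alpha> \<in> sobolev_forms \<A> P \<sigma> r S" and b: "\<beta> \<in> sobolev_forms \<A> P \<sigma> s S'" for \<alpha> \<beta>
  proof -
    define B where "B = (2 ^ (r + s) * CARD('n) * algebra_constant \<sigma>) * sobolev_norm P \<sigma> r \<alpha> * sobolev_norm P \<sigma> s \<beta>"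
    let ?I = "component_index (r + s) :: (('x chart \<times> ('x \<Rightarrow> real)) \<times> (real^4) list \<times> 'n \<times> 'n) set"
    have "sobolev_norm P \<sigma> (r + s) (\<alpha> \<and>\<^sub>w \<beta>) \<le> (\<Sum>k\<in>?I. component_norm (\<alpha> \<and>\<^sub>w \<beta>) k)"
      unfolding sobolev_norm_eq by (rule L2_set_le_sum) (rule component_norm_nonneg[OF mem[OF a b]])
    also have "\<dots> \<le> real (card ?I) * B"
    proof (rule sum_bounded_above)
      fix k assume "k \<in> ?I"
      then obtain c \<rho> vs i j where k: "k = ((c, \<rho>), vs, i, j)" "(c, \<rho>) \<in> P" "set vs \<subseteq> Basis" "length vs = r + s"
        by (auto simp: component_index_def frames_def)
      then show "component_norm (\<alpha> \<and>\<^sub>w \<beta>) k \<le> B"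
        using wedge_component[OF a b k(2,3), of i j] by (simp add: component_norm_def B_def)
    qed
    finally show ?thesis by (simp add: C_def B_def mult.assoc)
  qed
  show ?thesis
    unfolding bounded_bil_def sobolev_space_def
    using mem by (auto simp: wedge_left_linear wedge_right_linear intro!: exI[of _ C] bd)
qed

text \<open>In the compact \<open>X\<close> the closed support of \<rho> is compact, and it lies in
  the chart domain; the patch is contained in its image under the chart.\<close>

lemma patch_compact:
  assumes "(c, \<rho>) \<in> P"
  obtains K where "compact K" "patch c \<rho> \<subseteq> K"
proof
  let ?S = "X closure_of {p \<in> topspace X. \<rho> p \<noteq> 0}"
  note c = partitionD(1)[OF assms]
  have sub: "?S \<subseteq> cdom c" by (rule partitionD(3)[OF assms])
  have "compactin X ?S" by (rule closedin_compact_space[OF compact closedin_closure_of])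
  then have "compactin (subtopology X (cdom c)) ?S" using sub by (simp add: compactin_subtopology)
  then have "compactin (top_of_set (cimg c)) (cmap c ` ?S)"
    using atlasD(3)[OF c] by (rule image_compactin[OF _ homeomorphic_imp_continuous_map])
  then show "compact (cmap c ` ?S)" by (simp add: compactin_subtopology)
  show "patch c \<rho> \<subseteq> cmap c ` ?S"
  proof
    fix x assume "x \<in> patch c \<rho>"
    then obtain p where p: "p \<in> cdom c" "\<rho> p \<noteq> 0" "x = cmap c p" by (auto simp: patch_def)
    have "{p \<in> topspace X. \<rho> p \<noteq> 0} \<subseteq> ?S" by (rule closure_of_subset) auto
    then show "x \<in> cmap c ` ?S" using p atlasD(1)[OF c] by auto
  qed
qed

text \<open>A member of \<open>sobolev_fun\<close> is prescribed on the patch only. There it equals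
  a measurable Fourier transform, and on the rest of the chart image the weight is zero; so the
  integrand is measurable, bounded by the Sobolev embedding, and supported in a compact set.\<close>

lemma weighted_integral:
  assumes c: "(c, \<rho>) \<in> P"
  obtains M where "\<And>f. f \<in> sobolev_fun \<sigma> (patch c \<rho>) \<Longrightarrow> set_integrable lborel (cimg c) (\<lambda>x. \<rho> (cinv c x) *\<^sub>R f x)"
    "\<And>f. f \<in> sobolev_fun \<sigma> (patch c \<rho>) \<Longrightarrow>
      norm (LINT x:cimg c|lborel. \<rho> (cinv c x) *\<^sub>R f x) \<le> M * sobolev_fun_norm \<sigma> (patch c \<rho>) f"
proof -
  note cA = partitionD(1)[OF c]
  obtain K where K: "compact K" "patch c \<rho> \<subseteq> K" by (rule patch_compact[OF c])
  have cimg: "cimg c \<in> sets borel"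
  proof -
    obtain T where "open T" "cimg c = half_space \<inter> T"
      using atlasD(2)[OF cA] by (auto simp: openin_open)
    then show ?thesis using half_space_borel by auto
  qed
  define G where "G x = indicator (cimg c) x *\<^sub>R \<rho> (cinv c x)" for x
  have [measurable]: "G \<in> borel_measurable borel"
    unfolding G_def using smooth_along_euclid_continuous_on[OF partitionD(4)[OF c cA]] cimg
    by (intro borel_measurable_continuous_on_indicator) auto
  have p: "\<rho> (cinv c x) = 0 \<or> x \<in> patch c \<rho>" "0 \<le> \<rho> (cinv c x)" "\<rho> (cinv c x) \<le> 1" if x: "x \<in> cimg c" for x
  proof -
    obtain q where q: "q \<in> cdom c" "x = cmap c q" using x by (auto simp: cimg_def)
    have qX: "q \<in> topspace X" using q atlasD(1)[OF cA] by auto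
    show "\<rho> (cinv c x) = 0 \<or> x \<in> patch c \<rho>" "0 \<le> \<rho> (cinv c x)" "\<rho> (cinv c x) \<le> 1"
      using q cinv_cmap[OF cA q(1)] partitionD(2)[OF c qX] partition_le_1[OF c qX] by (auto simp: patch_def)
  qed
  have G: "G x = 0 \<or> x \<in> patch c \<rho>" "\<bar>G x\<bar> \<le> 1" for x
    using p[of x] by (auto simp: G_def indicator_def)
  have Kfin: "emeasure lborel K < \<infinity>" by (rule emeasure_compact_finite[OF K(1)])
  have Kset: "K \<in> sets lborel" using K(1) by (simp add: borel_compact)
  define E where "E = embedding_constant \<sigma>"
  have key: "integrable lborel (\<lambda>x. indicator (cimg c) x *\<^sub>R (\<rho> (cinv c x) *\<^sub>R f x)) \<and>
     norm (LINT x|lborel. indicator (cimg c) x *\<^sub>R (\<rho> (cinv c x) *\<^sub>R f x)) \<le> measure lborel K * E * sobolev_fun_norm \<sigma> (patch c \<rho>) f"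
    if f: "f \<in> sobolev_fun \<sigma> (patch c \<rho>)" for f
  proof -
    obtain h where h: "h \<in> extensions \<sigma> (patch c \<rho>) f" using f by (auto simp: sobolev_fun_iff)
    then have hs: "h \<in> sobolev_symbol \<sigma>" and hf: "\<And>x. x \<in> patch c \<rho> \<Longrightarrow> f x = fourier h x"
      by (auto simp: extensions_def)
    note [measurable] = fourier_measurable[OF hs]
    define B where "B = E * sobolev_fun_norm \<sigma> (patch c \<rho>) f"
    have B: "0 \<le> B" unfolding B_def E_def using embedding_constant_pos[of \<sigma>] sobolev_fun_norm_nonneg[OF f] by simp
    have eq: "indicator (cimg c) x *\<^sub>R (\<rho> (cinv c x) *\<^sub>R f x) = G x *\<^sub>R fourier h x" for x
      using G(1)[of x] hf[of x] by (auto simp: G_def)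
    have le: "norm (G x *\<^sub>R fourier h x) \<le> indicator K x * B" for x
    proof (cases "x \<in> patch c \<rho>")
      case True
      have "\<bar>G x\<bar> * norm (fourier h x) \<le> 1 * B"
        using G(2)[of x] sobolev_fun_bound[OF \<sigma> f True] B hf[OF True] by (intro mult_mono) (auto simp: B_def E_def)
      then show ?thesis using True K(2) by (auto simp: indicator_def)
    next
      case False
      then show ?thesis using G(1)[of x] B by (auto simp: indicator_def)
    qed
    have iK: "integrable lborel (\<lambda>x. indicator K x * B)"
      using Kset Kfin by (intro integrable_mult_left integrable_real_indicator) auto
    have i: "integrable lborel (\<lambda>x. G x *\<^sub>R fourier h x)"
      by (rule Bochner_Integration.integrable_bound[OF iK]) (use le B in \<open>auto intro!: AE_I2 order_trans[OF le abs_ge_self]\<close>)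
    have "norm (LINT x|lborel. G x *\<^sub>R fourier h x) \<le> (LINT x|lborel. indicator K x * B)"
      by (rule Bochner_Integration.integral_norm_bound_integral[OF i iK le])
    also have "\<dots> = measure lborel K * B" using Kset by simp
    finally show ?thesis unfolding eq using i by (simp add: B_def mult.assoc)
  qed
  show ?thesis
  proof (rule that)
    show "set_integrable lborel (cimg c) (\<lambda>x. \<rho> (cinv c x) *\<^sub>R f x)" if "f \<in> sobolev_fun \<sigma> (patch c \<rho>)" for f
      using key[OF that] by (simp add: set_integrable_def)
    show "norm (LINT x:cimg c|lborel. \<rho> (cinv c x) *\<^sub>R f x) \<le> (measure lborel K * E) * sobolev_fun_norm \<sigma> (patch c \<rho>) f"
      if "f \<in> sobolev_fun \<sigma> (patch c \<rho>)" for f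
      using key[OF that] by (simp add: set_lebesgue_integral_def)
  qed
qed

abbreviation top_frame :: "(real^4) list" where
  "top_frame \<equiv> [axis 1 1, axis 2 1, axis 3 1, axis 4 1]"

lemma top_frame_Basis: "set top_frame \<subseteq> Basis"
  by (auto simp: Basis_vec_def)

text \<open>The 16 is the number of subsets of the four positions; one factor
  \<open>CARD('n)\<close> belongs to the matrix product, the other to the diagonal entries summed by
  the trace.\<close>

lemma trace_wedge_component:
  fixes \<alpha> \<beta> :: "('x, 'n::finite mat) form"
  assumes a: "\<alpha> \<in> sobolev_forms \<A> P \<sigma> r S" and b: "\<beta> \<in> sobolev_forms \<A> P \<sigma> s S'" and c: "(c, \<rho>) \<in> P"
  shows "form_trace (\<alpha> \<and>\<^sub>w \<beta>) c x top_frame = (\<Sum>i\<in>UNIV. (\<alpha> \<and>\<^sub>w \<beta>) c x top_frame $ i $ i)"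
    "(\<lambda>x. form_trace (\<alpha> \<and>\<^sub>w \<beta>) c x top_frame) \<in> sobolev_fun \<sigma> (patch c \<rho>)"
    "sobolev_fun_norm \<sigma> (patch c \<rho>) (\<lambda>x. form_trace (\<alpha> \<and>\<^sub>w \<beta>) c x top_frame)
      \<le> (CARD('n) * (16 * CARD('n) * algebra_constant \<sigma>)) * sobolev_norm P \<sigma> r \<alpha> * sobolev_norm P \<sigma> s \<beta>"
proof -
  show eq: "form_trace (\<alpha> \<and>\<^sub>w \<beta>) c x top_frame = (\<Sum>i\<in>UNIV. (\<alpha> \<and>\<^sub>w \<beta>) c x top_frame $ i $ i)" for x
    by (simp add: form_trace_def trace_def)
  note w = wedge_component[OF a b c top_frame_Basis]
  have s: "(\<lambda>x. \<Sum>i\<in>UNIV. (\<alpha> \<and>\<^sub>w \<beta>) c x top_frame $ i $ i) \<in> sobolev_fun \<sigma> (patch c \<rho>) \<and>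
    sobolev_fun_norm \<sigma> (patch c \<rho>) (\<lambda>x. \<Sum>i\<in>UNIV. (\<alpha> \<and>\<^sub>w \<beta>) c x top_frame $ i $ i)
      \<le> (\<Sum>i\<in>UNIV. sobolev_fun_norm \<sigma> (patch c \<rho>) (\<lambda>x. (\<alpha> \<and>\<^sub>w \<beta>) c x top_frame $ i $ i))"
    using w by (intro sobolev_fun_sum[OF \<sigma>]) auto
  then show "(\<lambda>x. form_trace (\<alpha> \<and>\<^sub>w \<beta>) c x top_frame) \<in> sobolev_fun \<sigma> (patch c \<rho>)" unfolding eq ..
  define B where "B = (2 ^ length top_frame * CARD('n) * algebra_constant \<sigma>) * sobolev_norm P \<sigma> r \<alpha> * sobolev_norm P \<sigma> s \<beta>"
  have "(\<Sum>i\<in>(UNIV :: 'n set). sobolev_fun_norm \<sigma> (patch c \<rho>) (\<lambda>x. (\<alpha> \<and>\<^sub>w \<beta>) c x top_frame $ i $ i)) \<le> real CARD('n) * B"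
    using w unfolding B_def by (intro sum_bounded_above) auto
  then show "sobolev_fun_norm \<sigma> (patch c \<rho>) (\<lambda>x. form_trace (\<alpha> \<and>\<^sub>w \<beta>) c x top_frame)
      \<le> (CARD('n) * (16 * CARD('n) * algebra_constant \<sigma>)) * sobolev_norm P \<sigma> r \<alpha> * sobolev_norm P \<sigma> s \<beta>"
    unfolding eq using s by (simp add: B_def mult.assoc)
qed

lemma bounded_bil_pairing:
  fixes S S' :: "'n::finite mat set"
  shows "bounded_bil (sobolev_space \<A> P \<sigma> r S) (sobolev_space \<A> P \<sigma> s S') euclid (pairing P)"
proof -
  define J where "J q f = (LINT x:cimg (fst q)|lborel. snd q (cinv (fst q) x) *\<^sub>R f x)"
    for q :: "'x chart \<times> ('x \<Rightarrow> real)" and f :: "real^4 \<Rightarrow> complex"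
  define T where "T \<alpha> \<beta> q x = form_trace (\<alpha> \<and>\<^sub>w \<beta>) (fst q) x top_frame"
    for \<alpha> \<beta> :: "('x, 'n mat) form" and q :: "'x chart \<times> ('x \<Rightarrow> real)" and x
  have pair: "pairing P \<alpha> \<beta> = (\<Sum>q\<in>P. J q (T \<alpha> \<beta> q)) / complex_of_real (8 * pi ^ 3)" for \<alpha> \<beta> :: "('x, 'n mat) form"
    by (simp add: pairing_def form_integral_def J_def T_def case_prod_unfold)
  have T: "T \<alpha> \<beta> q \<in> sobolev_fun \<sigma> (patch (fst q) (snd q))"
    "sobolev_fun_norm \<sigma> (patch (fst q) (snd q)) (T \<alpha> \<beta> q)
      \<le> (CARD('n) * (16 * CARD('n) * algebra_constant \<sigma>)) * sobolev_norm P \<sigma> r \<alpha> * sobolev_norm P \<sigma> s \<beta>"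
    if "\<alpha> \<in> sobolev_forms \<A> P \<sigma> r S" "\<beta> \<in> sobolev_forms \<A> P \<sigma> s S'" "q \<in> P" for \<alpha> \<beta> q
    unfolding T_def using trace_wedge_component(2,3)[OF that(1,2), of "fst q" "snd q"] that(3) by simp_all
  have "\<forall>q\<in>P. \<exists>M. \<forall>f\<in>sobolev_fun \<sigma> (patch (fst q) (snd q)).
      set_integrable lborel (cimg (fst q)) (\<lambda>x. snd q (cinv (fst q) x) *\<^sub>R f x) \<and>
      norm (J q f) \<le> M * sobolev_fun_norm \<sigma> (patch (fst q) (snd q)) f"
  proof
    fix q assume "q \<in> P"
    then have "(fst q, snd q) \<in> P" by simp
    then show "\<exists>M. \<forall>f\<in>sobolev_fun \<sigma> (patch (fst q) (snd q)).
      set_integrable lborel (cimg (fst q)) (\<lambda>x. snd q (cinv (fst q) x) *\<^sub>R f x) \<and>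
      norm (J q f) \<le> M * sobolev_fun_norm \<sigma> (patch (fst q) (snd q)) f"
    proof (rule weighted_integral)
      fix M
      assume "\<And>f. f \<in> sobolev_fun \<sigma> (patch (fst q) (snd q)) \<Longrightarrow>
          set_integrable lborel (cimg (fst q)) (\<lambda>x. snd q (cinv (fst q) x) *\<^sub>R f x)"
        "\<And>f. f \<in> sobolev_fun \<sigma> (patch (fst q) (snd q)) \<Longrightarrow>
          norm (LINT x:cimg (fst q)|lborel. snd q (cinv (fst q) x) *\<^sub>R f x) \<le> M * sobolev_fun_norm \<sigma> (patch (fst q) (snd q)) f"
      then show ?thesis unfolding J_def by (intro exI[of _ M] ballI conjI)
    qed
  qed
  from bchoice[OF this] obtain M where M: "\<And>q f. q \<in> P \<Longrightarrow> f \<in> sobolev_fun \<sigma> (patch (fst q) (snd q)) \<Longrightarrow>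
      set_integrable lborel (cimg (fst q)) (\<lambda>x. snd q (cinv (fst q) x) *\<^sub>R f x)"
    "\<And>q f. q \<in> P \<Longrightarrow> f \<in> sobolev_fun \<sigma> (patch (fst q) (snd q)) \<Longrightarrow>
      norm (J q f) \<le> M q * sobolev_fun_norm \<sigma> (patch (fst q) (snd q)) f"
    by blast
  have J: "J q (\<lambda>x. a *\<^sub>R f x + g x) = a *\<^sub>R J q f + J q g"
    if "q \<in> P" "f \<in> sobolev_fun \<sigma> (patch (fst q) (snd q))" "g \<in> sobolev_fun \<sigma> (patch (fst q) (snd q))" for q f g a
  proof -
    have "snd q y *\<^sub>R (a *\<^sub>R f x + g x) = a *\<^sub>R (snd q y *\<^sub>R f x) + snd q y *\<^sub>R g x" for x y
      by (simp add: scaleR_add_right)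
    moreover have "set_integrable lborel (cimg (fst q)) (\<lambda>x. a *\<^sub>R (snd q (cinv (fst q) x) *\<^sub>R f x))"
      using M(1)[OF that(1,2)] by (rule set_integrable_scaleR_right)
    ultimately show ?thesis
      unfolding J_def using M(1)[OF that(1,3)]
      by (simp only: set_integral_add set_integral_scaleR_right)
  qed
  \<comment> \<open>One statement for both variables: linearity of the pairing enters only through
    the traced wedge product \<open>T\<close>.\<close>
  have lin: "pairing P \<alpha>'' \<beta>'' = a *\<^sub>R pairing P \<alpha> \<beta> + pairing P \<alpha>' \<beta>'"
    if T'': "\<And>q. T \<alpha>'' \<beta>'' q = (\<lambda>x. a *\<^sub>R T \<alpha> \<beta> q x + T \<alpha>' \<beta>' q x)"
    and "\<alpha> \<in> sobolev_forms \<A> P \<sigma> r S" "\<beta> \<in> sobolev_forms \<A> P \<sigma> s S'"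
      "\<alpha>' \<in> sobolev_forms \<A> P \<sigma> r S" "\<beta>' \<in> sobolev_forms \<A> P \<sigma> s S'" for \<alpha> \<alpha>' \<alpha>'' \<beta> \<beta>' \<beta>'' a
  proof -
    have "(\<Sum>q\<in>P. J q (T \<alpha>'' \<beta>'' q)) = (\<Sum>q\<in>P. a *\<^sub>R J q (T \<alpha> \<beta> q) + J q (T \<alpha>' \<beta>' q))"
      using that(2-) T(1) by (intro sum.cong refl) (simp add: T'' J)
    also have "\<dots> = a *\<^sub>R (\<Sum>q\<in>P. J q (T \<alpha> \<beta> q)) + (\<Sum>q\<in>P. J q (T \<alpha>' \<beta>' q))"
      by (simp add: sum.distrib scaleR_sum_right)
    finally show ?thesis unfolding pair by (simp add: add_divide_distrib scaleR_conv_of_real)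
  qed
  have tr: "trace (a *\<^sub>R A + B) = a *\<^sub>R trace A + trace B" for a and A B :: "'n mat"
    by (simp add: trace_def sum.distrib scaleR_sum_right)
  define C where "C = (\<Sum>q\<in>P. \<bar>M q\<bar> * (CARD('n) * (16 * CARD('n) * algebra_constant \<sigma>)))"
  have bd: "norm (pairing P \<alpha> \<beta>) \<le> (C / (8 * pi ^ 3)) * sobolev_norm P \<sigma> r \<alpha> * sobolev_norm P \<sigma> s \<beta>"
    if ab: "\<alpha> \<in> sobolev_forms \<A> P \<sigma> r S" "\<beta> \<in> sobolev_forms \<A> P \<sigma> s S'" for \<alpha> \<beta>
  proof -
    have "norm (\<Sum>q\<in>P. J q (T \<alpha> \<beta> q)) \<le> (\<Sum>q\<in>P. \<bar>M q\<bar> * ((CARD('n) * (16 * CARD('n) * algebra_constant \<sigma>)) * sobolev_norm P \<sigma> r \<alpha> * sobolev_norm P \<sigma> s \<beta>))"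
    proof (rule sum_norm_le)
      fix q assume q: "q \<in> P"
      have "norm (J q (T \<alpha> \<beta> q)) \<le> M q * sobolev_fun_norm \<sigma> (patch (fst q) (snd q)) (T \<alpha> \<beta> q)"
        by (rule M(2)[OF q T(1)[OF ab q]])
      also have "\<dots> \<le> \<bar>M q\<bar> * sobolev_fun_norm \<sigma> (patch (fst q) (snd q)) (T \<alpha> \<beta> q)"
        using sobolev_fun_norm_nonneg[OF T(1)[OF ab q]] by (intro mult_right_mono) auto
      also have "\<dots> \<le> \<bar>M q\<bar> * ((CARD('n) * (16 * CARD('n) * algebra_constant \<sigma>)) * sobolev_norm P \<sigma> r \<alpha> * sobolev_norm P \<sigma> s \<beta>)"
        by (intro mult_left_mono T(2)[OF ab q]) auto
      finally show "norm (J q (T \<alpha> \<beta> q)) \<le> \<bar>M q\<bar> * ((CARD('n) * (16 * CARD('n) * algebra_constant \<sigma>)) * sobolev_norm P \<sigma> r \<alpha> * sobolev_norm P \<sigma> s \<beta>)" .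
    qed
    also have "\<dots> = C * sobolev_norm P \<sigma> r \<alpha> * sobolev_norm P \<sigma> s \<beta>"
      by (simp add: C_def sum_distrib_right mult.assoc)
    finally have "norm (\<Sum>q\<in>P. J q (T \<alpha> \<beta> q)) / (8 * pi ^ 3) \<le> C * sobolev_norm P \<sigma> r \<alpha> * sobolev_norm P \<sigma> s \<beta> / (8 * pi ^ 3)"
      by (intro divide_right_mono) auto
    then show ?thesis unfolding pair by (simp add: norm_divide norm_mult norm_power)
  qed
  show ?thesis
    unfolding bounded_bil_def sobolev_space_def fst_conv snd_conv pts_euclid nrm_euclid
  proof (intro conjI ballI allI)
    show "pairing P (a *\<^sub>R \<alpha> + \<alpha>') \<beta> = a *\<^sub>R pairing P \<alpha> \<beta> + pairing P \<alpha>' \<beta>"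
      if "\<alpha> \<in> sobolev_forms \<A> P \<sigma> r S" "\<alpha>' \<in> sobolev_forms \<A> P \<sigma> r S" "\<beta> \<in> sobolev_forms \<A> P \<sigma> s S'" for \<alpha> \<alpha>' \<beta> a
      by (rule lin[OF ext that(1,3,2,3)]) (simp add: T_def form_trace_def wedge_left_linear scaleR_apply tr)
    show "pairing P \<alpha> (a *\<^sub>R \<beta> + \<beta>') = a *\<^sub>R pairing P \<alpha> \<beta> + pairing P \<alpha> \<beta>'"
      if "\<alpha> \<in> sobolev_forms \<A> P \<sigma> r S" "\<beta> \<in> sobolev_forms \<A> P \<sigma> s S'" "\<beta>' \<in> sobolev_forms \<A> P \<sigma> s S'" for \<alpha> \<beta> \<beta>' a
      by (rule lin[OF ext that(1,2,1,3)]) (simp add: T_def form_trace_def wedge_right_linear scaleR_apply tr)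
    show "\<exists>C. \<forall>\<alpha>\<in>sobolev_forms \<A> P \<sigma> r S. \<forall>\<beta>\<in>sobolev_forms \<A> P \<sigma> s S'.
        norm (pairing P \<alpha> \<beta>) \<le> C * sobolev_norm P \<sigma> r \<alpha> * sobolev_norm P \<sigma> s \<beta>"
      using bd by blast
  qed auto
qed

lemma pairing_wedge_cyclic:
  fixes \<alpha> \<beta> \<delta> \<epsilon> :: "('x, 'n::finite mat) form"
  assumes "\<alpha> \<in> forms \<A> 1 S" "\<beta> \<in> forms \<A> 1 S" "\<delta> \<in> forms \<A> 1 S" "\<epsilon> \<in> forms \<A> 1 S"
  shows "pairing P (\<alpha> \<and>\<^sub>w \<beta> \<and>\<^sub>w \<delta>) \<epsilon> = - pairing P (\<beta> \<and>\<^sub>w \<delta> \<and>\<^sub>w \<epsilon>) \<alpha>"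
proof -
  have "(LINT x:cimg c|lborel. \<rho> (cinv c x) *\<^sub>R form_trace (\<alpha> \<and>\<^sub>w \<beta> \<and>\<^sub>w \<delta> \<and>\<^sub>w \<epsilon>) c x top_frame)
      = - (LINT x:cimg c|lborel. \<rho> (cinv c x) *\<^sub>R form_trace (\<beta> \<and>\<^sub>w \<delta> \<and>\<^sub>w \<epsilon> \<and>\<^sub>w \<alpha>) c x top_frame)"
    if c: "(c, \<rho>) \<in> P" for c \<rho>
  proof -
    \<comment> \<open>The identity is pointwise on the chart image; elsewhere the indicator makes
      both sides zero.\<close>
    have "indicator (cimg c) x *\<^sub>R (\<rho> (cinv c x) *\<^sub>R form_trace (\<alpha> \<and>\<^sub>w \<beta> \<and>\<^sub>w \<delta> \<and>\<^sub>w \<epsilon>) c x top_frame)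
      = - (indicator (cimg c) x *\<^sub>R (\<rho> (cinv c x) *\<^sub>R form_trace (\<beta> \<and>\<^sub>w \<delta> \<and>\<^sub>w \<epsilon> \<and>\<^sub>w \<alpha>) c x top_frame))" for x
    proof (cases "x \<in> cimg c")
      case True
      note f = formsD(2)[OF _ partitionD(1)[OF c] True]
      show ?thesis
        using trace_wedge_cyclic[of \<alpha> c x \<beta> \<delta> \<epsilon>, OF f[OF assms(1)] f[OF assms(2)] f[OF assms(3)] f[OF assms(4)]]
        by (simp add: form_trace_def)
    qed simp
    then show ?thesis unfolding set_lebesgue_integral_def by simp
  qed
  then have "form_integral P (form_trace (\<alpha> \<and>\<^sub>w \<beta> \<and>\<^sub>w \<delta> \<and>\<^sub>w \<epsilon>)) = - form_integral P (form_trace (\<beta> \<and>\<^sub>w \<delta> \<and>\<^sub>w \<epsilon> \<and>\<^sub>w \<alpha>))"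
    unfolding form_integral_def sum_negf[symmetric] by (intro sum.cong) auto
  then show ?thesis by (simp add: pairing_def)
qed

text \<open>The abstract graph is formed with the left bracketing. Associativity holds where the
  factors are alternating one-forms, that is on the chart images; elsewhere \<open>a\<close> is zero
  and both sides vanish.\<close>

lemma gamma1_eq:
  assumes "A \<in> forms \<A> 1 S" "a \<in> forms \<A> 1 S"
  shows "gamma1 A a = A \<and>\<^sub>w A \<and>\<^sub>w a + a \<and>\<^sub>w A \<and>\<^sub>w (A :: ('x, 'n::finite mat) form)"
proof -
  have "(a \<and>\<^sub>w A \<and>\<^sub>w A) c x = (a \<and>\<^sub>w (A \<and>\<^sub>w A)) c x" for c x
  proof (cases "c \<in> \<A> \<and> x \<in> cimg c")
    case True
    then show ?thesis using formsD(2)[OF assms(1)] formsD(2)[OF assms(2)] by (intro wedge_assoc) auto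
  next
    case False
    then have "a c x = 0" using formsD(1)[OF assms(2)] by blast
    then show ?thesis by (intro ext) (simp add: wedge_eq)
  qed
  then have "a \<and>\<^sub>w A \<and>\<^sub>w A = a \<and>\<^sub>w (A \<and>\<^sub>w A)" by blast
  then show ?thesis by (simp add: gamma1_def)
qed

end

section \<open>Flat connections as an instance of the abstract graph\<close>

lemma subspace_su: "subspace (su :: 'n::finite mat set)"
proof (rule subspaceI)
  show "(0 :: 'n mat) \<in> su" by (simp add: su_def adjoint_mat_def trace_def vec_eq_iff)
  show "A + B \<in> su" if "A \<in> su" "B \<in> su" for A B :: "'n mat"
    using that by (auto simp: su_def adjoint_mat_def trace_def vec_eq_iff sum.distrib)
  show "r *\<^sub>R A \<in> su" if "A \<in> su" for r and A :: "'n mat"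
    using that by (auto simp: su_def adjoint_mat_def trace_def vec_eq_iff scaleR_sum_right[symmetric])
qed

theorem theorem3p12:
  fixes X :: "'x topology" and \<A> :: "'x chart set"
    and g :: "'x chart \<Rightarrow> real^4 \<Rightarrow> real^4 \<Rightarrow> real^4 \<Rightarrow> real"
    and P :: "('x chart \<times> ('x \<Rightarrow> real)) set" and s :: real
  assumes manifold: "oriented_manifold4 X \<A>" "compact_space X" "connected_space X"
    and metric: "riemannian_metric \<A> g"
    and partition: "partition_of_unity X \<A> P"
    and rank: "2 \<le> CARD('n::finite)"
    and exponent: "s > 5 / 2"
    and flat_manifold:
      "submanifold (Omega \<A> P (s - 1/2) 1) (flat_connections \<A> P s :: ('x, 'n mat) form set)"
    and flat_tangent_space:
      "\<And>A :: ('x, 'n mat) form. A \<in> flat_connections \<A> P s \<Longrightarrow>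
         tangent_space (Omega \<A> P (s - 1/2) 1) (flat_connections \<A> P s) A = flat_tangent \<A> P s A"
  shows "dirac_structure (Omega \<A> P (s - 1/2) 1) (Omega_cotangent \<A> P (s - 1/2)) (pairing P)
           (flat_connections \<A> P s) (D_flat \<A> P s :: (('x, 'n mat) form \<times> _) set)"
proof -
  \<comment> \<open>From \<open>s > 5 / 2\<close> the exponent \<open>s - 1/2\<close> exceeds 2,
    half the dimension of \<open>X\<close>.\<close>
  interpret sobolev_manifold X \<A> P "s - 1/2"
    using manifold partition exponent by unfold_locales auto
  let ?E = "Omega \<A> P (s - 1/2) 1 :: ('x, 'n mat) form nsp"
  let ?M = "sobolev_space \<A> P (s - 1/2) 2 UNIV :: ('x, 'n mat) form nsp"
  let ?F = "Omega_cotangent \<A> P (s - 1/2) :: ('x, 'n mat) form nsp"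
  let ?Z = "flat_connections \<A> P s :: ('x, 'n mat) form set"
  have E_forms: "a \<in> forms \<A> 1 su" if "a \<in> pts ?E" for a
    using that by (simp add: Omega_def sobolev_space_def sobolev_forms_def)
  interpret dirac_data ?E ?M ?F "(\<and>\<^sub>w)" "(\<and>\<^sub>w)" "pairing P" ?Z
  proof (intro dirac_data.intro dirac_data_axioms.intro)
    show "nspace ?E" "nspace ?M" "nspace ?F"
      unfolding Omega_def Omega_cotangent_def by (intro nspace_sobolev_space subspace_su subspace_UNIV)+
    show "bounded_bil ?E ?E ?M (\<and>\<^sub>w)"
      using bounded_bil_wedge[where r=1 and s=1 and S=su and S'=su, unfolded one_add_one] alt_form_wedge_1_1
      by (auto simp only: Omega_def)
    show "bounded_bil ?M ?E ?F (\<and>\<^sub>w)"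
      using bounded_bil_wedge[where r=2 and s=1 and S=UNIV and S'=su, unfolded two_plus_one] alt_form_wedge_2_1
      by (auto simp only: Omega_def Omega_cotangent_def)
    show "bounded_bil ?F ?E euclid (pairing P)"
      unfolding Omega_def Omega_cotangent_def by (rule bounded_bil_pairing)
    show "separated ?E"
      unfolding Omega_def by (rule separated_sobolev_space)
    show "submanifold ?E ?Z" by (rule flat_manifold)
    show "pairing P (x \<and>\<^sub>w y \<and>\<^sub>w z) w = - pairing P (y \<and>\<^sub>w z \<and>\<^sub>w w) x"
      if "x \<in> pts ?E" "y \<in> pts ?E" "z \<in> pts ?E" "w \<in> pts ?E" for x y z w
      by (rule pairing_wedge_cyclic[OF that[THEN E_forms]])
  qed
  \<comment> \<open>The two bracketings represent the same covector; with the tangent spaces given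
    by \<open>flat_tangent\<close>, the abstract graph is then \<open>D_flat\<close>.\<close>
  have "\<gamma> A a = gamma1 A a" if "A \<in> ?Z" "a \<in> tangent_space ?E ?Z A" for A a
    using gamma1_eq[OF E_forms E_forms, of A a] that Z_pts tangent_pts by (auto simp: \<gamma>_def)
  then have "graph = (D_flat \<A> P s :: (('x, 'n mat) form \<times> _) set)"
    unfolding graph_def D_flat_def using flat_tangent_space by (intro Sigma_cong refl) auto
  then show ?thesis using dirac_structure_graph by simp
qed

end
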